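(* The Ginzburg–Landau heat flows $u_\lambda$ with data $u_0$ converge, as $\lambda\nearrow\infty$ (modulo a subsequence of $\lambda$), to a weakly harmonic heat flow (WHHF) with data $u_0$ in $L^2(Q(T);\mathbb{R}^{D+1})$.
   Context: $d,D\ge2$ are integers, $T>0$, $\mathbb{B}^d$ is the open unit ball of $\mathbb{R}^d$ centred at $0$, $\mathbb{S}^D\subset\mathbb{R}^{D+1}$ the unit sphere, $Q(T)=(0,T)\times\mathbb{B}^d$. Sphere-valued Sobolev maps are $\mathbb{R}^{D+1}$-valued ones with $|u|=1$ a.e. The data satisfy $u_0\in H^{1,2}(\mathbb{B}^d;\mathbb{S}^D)\cap H^{2,2}(\mathbb{B}^d\setminus B_{1-\delta_0}(0);\mathbb{S}^D)$ with a sufficiently small $\delta_0>0$. $\kappa=\kappa(t)=\arctan(t)/\pi$; $\chi$ is a smooth function with $\chi(t)=t$ for $t<2$, $\chi(t)=3$ for $t\ge4$, $\chi\le3$, and $\dot\chi$ is its derivative. For $\lambda>0$ the Ginzburg–Landau heat flow (GLHF) $u_\lambda\in C^\infty(Q(T);\mathbb{R}^{D+1})$ is the solution of $$\frac{\partial u_\lambda}{\partial t}-\triangle u_\lambda+\lambda^{1-\kappa}\dot\chi\bigl((|u_\lambda|^2-1)^2\bigr)(|u_\lambda|^2-1)u_\lambda=0\quad\text{in }Q(T)$$ with $u_\lambda(t,\cdot)-u_0\in\mathring{H}^{1,2}(\mathbb{B}^d;\mathbb{R}^{D+1})$ for a.e. $t\in(0,T)$ and $\lim_{t\searrow0}\|u_\lambda(t,\cdot)-u_0\|_{L^2(\mathbb{B}^d)}=0$.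 $V(Q(T);\mathbb{S}^D)=L^\infty(0,T;H^{1,2}(\mathbb{B}^d;\mathbb{S}^D))\cap H^{1,2}(0,T;L^2(\mathbb{B}^d;\mathbb{R}^{D+1}))$. A map $u\in V(Q(T);\mathbb{S}^D)$ is a WHHF with data $u_0$ if $\int_{Q(T)}(\langle\partial u/\partial t,\phi\rangle+\langle\nabla u,\nabla\phi\rangle-\langle u,\phi\rangle|\nabla u|^2)\,dz=0$ for all $\phi\in C_0^\infty(Q(T);\mathbb{R}^{D+1})$, $u(t)-u_0\in\mathring{H}^{1,2}(\mathbb{B}^d;\mathbb{R}^{D+1})$ for a.e. $t\in(0,T)$, and $u(t)\to u_0$ in $L^2(\mathbb{B}^d;\mathbb{R}^{D+1})$ as $t\searrow0$.
   Formalization: The Ginzburg–Landau heat flow is taken in the class where u_λ and its spatial gradient lie in L²(Q(T)); without this the stated conditions do not determine the solution, and spurious solutions outside L²(Q(T)) would make the claim false. *)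

theory Defs
  imports "HOL-Analysis.Analysis"
begin

section \<open>Smooth functions and test functions\<close>

definition pderiv_dir :: "'a::euclidean_space \<Rightarrow> ('a \<Rightarrow> 'b::euclidean_space) \<Rightarrow> 'a \<Rightarrow> 'b" where
  "pderiv_dir v f = (\<lambda>x. frechet_derivative f (at x) v)"

(* Meant for open S only: the derivatives are two-sided ones, taken at the points of S. *)
primrec Ck_on :: "nat \<Rightarrow> 'a::euclidean_space set \<Rightarrow> ('a \<Rightarrow> 'b::euclidean_space) \<Rightarrow> bool" where
  "Ck_on 0 S f \<longleftrightarrow> continuous_on S f"
| "Ck_on (Suc k) S f \<longleftrightarrow>
     (\<forall>x\<in>S. f differentiable (at x)) \<and> (\<forall>e\<in>Basis. Ck_on k S (pderiv_dir e f))"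

definition smooth_on :: "'a::euclidean_space set \<Rightarrow> ('a \<Rightarrow> 'b::euclidean_space) \<Rightarrow> bool" where
  "smooth_on S f \<longleftrightarrow> (\<forall>k. Ck_on k S f)"

definition test_functions :: "'a::euclidean_space set \<Rightarrow> ('a \<Rightarrow> 'b::euclidean_space) set" where
  "test_functions S =
     {\<phi>. smooth_on UNIV \<phi> \<and> (\<exists>K. compact K \<and> K \<subseteq> S \<and> (\<forall>x. x \<notin> K \<longrightarrow> \<phi> x = 0))}"

section \<open>Lebesgue and Sobolev spaces\<close>

definition L2 :: "'a::euclidean_space set \<Rightarrow> ('a \<Rightarrow> 'b::euclidean_space) set" where
  "L2 S = {f. f \<in> borel_measurable (lebesgue_on S) \<and>
              integrable (lebesgue_on S) (\<lambda>x. (norm (f x))\<^sup>2)}"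

definition L2_norm :: "'a::euclidean_space set \<Rightarrow> ('a \<Rightarrow> 'b::euclidean_space) \<Rightarrow> real" where
  "L2_norm S f = sqrt (integral\<^sup>L (lebesgue_on S) (\<lambda>x. (norm (f x))\<^sup>2))"

(* Since the Bochner integral of a non-integrable function is 0 by convention,
   membership of the differences in L2 is required explicitly. *)
definition tendsto_L2 ::
  "'a::euclidean_space set \<Rightarrow> ('i \<Rightarrow> 'a \<Rightarrow> 'b::euclidean_space) \<Rightarrow> ('a \<Rightarrow> 'b) \<Rightarrow> 'i filter \<Rightarrow> bool" where
  "tendsto_L2 S f g F \<longleftrightarrow>
     (\<forall>\<^sub>F i in F. (\<lambda>x. f i x - g x) \<in> L2 S) \<and>
     ((\<lambda>i. L2_norm S (\<lambda>x. f i x - g x)) \<longlongrightarrow> 0) F"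

definition locally_integrable_on ::
  "('a::euclidean_space \<Rightarrow> 'b::euclidean_space) \<Rightarrow> 'a set \<Rightarrow> bool" where
  "locally_integrable_on f S \<longleftrightarrow>
     (\<forall>K. compact K \<longrightarrow> K \<subseteq> S \<longrightarrow> integrable (lebesgue_on K) f)"

definition has_weak_deriv ::
  "'a::euclidean_space set \<Rightarrow> 'a \<Rightarrow> ('a \<Rightarrow> 'b::euclidean_space) \<Rightarrow> ('a \<Rightarrow> 'b) \<Rightarrow> bool" where
  "has_weak_deriv S v f g \<longleftrightarrow>
     locally_integrable_on f S \<and> locally_integrable_on g S \<and>
     (\<forall>\<phi> :: 'a \<Rightarrow> real. \<phi> \<in> test_functions S \<longrightarrow>
        integral\<^sup>L (lebesgue_on S) (\<lambda>x. pderiv_dir v \<phi> x *\<^sub>R f x) =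
        - integral\<^sup>L (lebesgue_on S) (\<lambda>x. \<phi> x *\<^sub>R g x))"

(* On an open set the weak derivative is unique up to null sets, so the choice of a
   representative does not affect norms and integrals. *)
definition weak_deriv ::
  "'a::euclidean_space set \<Rightarrow> 'a \<Rightarrow> ('a \<Rightarrow> 'b::euclidean_space) \<Rightarrow> 'a \<Rightarrow> 'b" where
  "weak_deriv S v f = (SOME g. has_weak_deriv S v f g)"

(* The Sobolev space H^{k,2} on the open set S. *)
primrec sobolev :: "nat \<Rightarrow> 'a::euclidean_space set \<Rightarrow> ('a \<Rightarrow> 'b::euclidean_space) set" where
  "sobolev 0 S = L2 S"
| "sobolev (Suc k) S =
     {f. f \<in> L2 S \<and> (\<forall>e\<in>Basis. \<exists>g. has_weak_deriv S e f g \<and> g \<in> sobolev k S)}"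

definition H1_norm :: "'a::euclidean_space set \<Rightarrow> ('a \<Rightarrow> 'b::euclidean_space) \<Rightarrow> real" where
  "H1_norm S f = sqrt ((L2_norm S f)\<^sup>2 + (\<Sum>e\<in>Basis. (L2_norm S (weak_deriv S e f))\<^sup>2))"

(* Closure of the test functions in H^{1,2}. *)
definition sobolev1_0 :: "'a::euclidean_space set \<Rightarrow> ('a \<Rightarrow> 'b::euclidean_space) set" where
  "sobolev1_0 S =
     {f. f \<in> sobolev 1 S \<and>
         (\<exists>\<phi>. (\<forall>n::nat. \<phi> n \<in> test_functions S) \<and>
              (\<lambda>n. H1_norm S (\<lambda>x. \<phi> n x - f x)) \<longlonglongrightarrow> 0)}"

definition sphere_valued :: "'a::euclidean_space set \<Rightarrow> ('a \<Rightarrow> 'b::euclidean_space) \<Rightarrow> bool" where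
  "sphere_valued S f \<longleftrightarrow> (AE x in lebesgue_on S. norm (f x) = 1)"

section \<open>Space-time functions\<close>

abbreviation unit_ball :: "'a::euclidean_space set" where
  "unit_ball \<equiv> ball 0 1"

definition cylinder :: "real \<Rightarrow> (real \<times> 'a::euclidean_space) set" where
  "cylinder T = {0<..<T} \<times> unit_ball"

(* Bochner spaces are rendered through jointly measurable functions on the cylinder:
   L^infinity(0,T; H^{1,2}) by an essential bound on the norms of the time slices,
   and H^{1,2}(0,T; L^2) by a weak time derivative in L^2 of the cylinder. *)
definition V_sphere :: "real \<Rightarrow> (real \<times> 'a::euclidean_space \<Rightarrow> 'b::euclidean_space) set" where
  "V_sphere T =
     {u. u \<in> borel_measurable (lebesgue_on (cylinder T)) \<and>
         (\<exists>C. AE t in lebesgue_on {0<..<T}.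
            (\<lambda>x. u (t, x)) \<in> sobolev 1 unit_ball \<and>
            sphere_valued unit_ball (\<lambda>x. u (t, x)) \<and>
            H1_norm unit_ball (\<lambda>x. u (t, x)) \<le> C) \<and>
         u \<in> L2 (cylinder T) \<and>
         (\<exists>w. has_weak_deriv (cylinder T) (1, 0) u w \<and> w \<in> L2 (cylinder T))}"

definition attains_data ::
  "real \<Rightarrow> ('a::euclidean_space \<Rightarrow> 'b::euclidean_space) \<Rightarrow> (real \<times> 'a \<Rightarrow> 'b) \<Rightarrow> bool" where
  "attains_data T u0 u \<longleftrightarrow>
     (AE t in lebesgue_on {0<..<T}. (\<lambda>x. u (t, x) - u0 x) \<in> sobolev1_0 unit_ball) \<and>
     tendsto_L2 unit_ball (\<lambda>t x. u (t, x)) u0 (at_right 0)"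

section \<open>Ginzburg--Landau heat flow and weakly harmonic heat flow\<close>

definition kappa :: "real \<Rightarrow> real" where
  "kappa t = arctan t / pi"

definition cutoff :: "(real \<Rightarrow> real) \<Rightarrow> bool" where
  "cutoff chi \<longleftrightarrow> smooth_on UNIV chi \<and>
     (\<forall>t<2. chi t = t) \<and> (\<forall>t\<ge>4. chi t = 3) \<and> (\<forall>t. chi t \<le> 3)"

definition laplacian_x ::
  "(real \<times> 'a::euclidean_space \<Rightarrow> 'b::euclidean_space) \<Rightarrow> real \<times> 'a \<Rightarrow> 'b" where
  "laplacian_x u z = (\<Sum>e\<in>Basis. pderiv_dir (0, e) (pderiv_dir (0, e) u) z)"

(* The flow is the solution in the class L^2(0,T; H^{1,2}): this is the content of the
   conditions on u and its spatial derivatives. Without it smooth solutions with these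
   data are not unique, as singular boundary data (for instance a point mass
   in time) may be added without violating the boundary condition for almost every t. *)
definition GLHF ::
  "(real \<Rightarrow> real) \<Rightarrow> real \<Rightarrow> ('a::euclidean_space \<Rightarrow> 'b::euclidean_space) \<Rightarrow> real \<Rightarrow>
   (real \<times> 'a \<Rightarrow> 'b) \<Rightarrow> bool" where
  "GLHF chi T u0 lam u \<longleftrightarrow>
     smooth_on (cylinder T) u \<and>
     u \<in> L2 (cylinder T) \<and> (\<forall>e\<in>Basis. pderiv_dir (0, e) u \<in> L2 (cylinder T)) \<and>
     (\<forall>(t, x)\<in>cylinder T.
        pderiv_dir (1, 0) u (t, x) - laplacian_x u (t, x)
        + (lam powr (1 - kappa t) * deriv chi (((norm (u (t, x)))\<^sup>2 - 1)\<^sup>2)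
           * ((norm (u (t, x)))\<^sup>2 - 1)) *\<^sub>R u (t, x) = 0) \<and>
     attains_data T u0 u"

(* The spatial gradient is taken weakly on the cylinder; for u in V_sphere it agrees
   with the gradients of almost all time slices. *)
definition WHHF ::
  "real \<Rightarrow> ('a::euclidean_space \<Rightarrow> 'b::euclidean_space) \<Rightarrow> (real \<times> 'a \<Rightarrow> 'b) \<Rightarrow> bool" where
  "WHHF T u0 u \<longleftrightarrow>
     u \<in> V_sphere T \<and>
     (\<forall>\<phi>\<in>test_functions (cylinder T).
        integral\<^sup>L (lebesgue_on (cylinder T)) (\<lambda>z.
            weak_deriv (cylinder T) (1, 0) u z \<bullet> \<phi> z
          + (\<Sum>e\<in>Basis. weak_deriv (cylinder T) (0, e) u z \<bullet> pderiv_dir (0, e) \<phi> z)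
          - (u z \<bullet> \<phi> z) * (\<Sum>e\<in>Basis. (norm (weak_deriv (cylinder T) (0, e) u z))\<^sup>2)) = 0) \<and>
     attains_data T u0 u"

end

theory Submission
 imports Defs "HOL-Library.Diagonal_Subsequence"
begin

text \<open>
Testing with a truncation of the part of \<open>u\<close> outside the unit ball gives \<open>|u| \<le> 1\<close>. The energy
inequality, derived from difference quotients in time because \<open>u\<close> need not be regular up to the boundary,
bounds the derivatives of the flows in \<open>L\<^sup>2\<close> uniformly in \<open>lambda\<close> and makes the penalty of order
\<open>lambda^(kappa - 1)\<close>. By Rellich a subsequence converges in \<open>L\<^sup>2\<close> to a map into the sphere, and by
Mazur suitable convex combinations of its derivatives converge strongly. Testing with the field
\<open>(u \<bullet> q) phi - (u \<bullet> phi) q\<close>, which is orthogonal to \<open>u\<close>, removes the penalty and leaves an identity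
linear in the derivatives, so it passes to the convex combinations; as the derivatives of the limit \<open>v\<close> are orthogonal
to \<open>v\<close>, taking \<open>q\<close> close to \<open>v\<close> yields the weak harmonic map heat flow equation.
\<close>

text \<open>The lateral values hold only for almost every time and the data are attained only in
  \<open>L2\<close>, so the time derivative of \<open>u\<close> is not an admissible test function.
  An increment \<open>u (t + h) - u t\<close> is, because the data cancel in it. It is tested
  against the difference of two equations integrated from time 0: the gradient term becomes the time
  derivative of a square, and only an initial layer is left, the norm of the time integral of the
  gradient over \<open>{0..h}\<close>. For suitable \<open>h\<close> tending to 0 it is at most
  \<open>h\<close> times the norm of the gradient of the data, up to a vanishing relative error.
  Such \<open>h\<close> exist because the pairing of \<open>u - u0\<close> with its own time
  primitive is the derivative of half a square that starts at 0. The penalty starts at 0 since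
  \<open>u0\<close> lies on the sphere, and its explicit dependence on time has the good sign since
  \<open>lambda^(1 - kappa)\<close> decreases; \<open>kappa < 1/2\<close> leaves a factor of at
  least \<open>sqrt lambda\<close>. The constants thus depend only on the Dirichlet energy of
  \<open>u0\<close>. In the limit the quadratic term is not a limit of squared gradients of the
  flows: it is created by the derivative falling on \<open>q\<close>.\<close>

hide_fact (open)
  Henstock_Kurzweil_Integration.integrable_add Henstock_Kurzweil_Integration.integrable_bound Henstock_Kurzweil_Integration.integrable_cong
  Henstock_Kurzweil_Integration.integrable_diff Henstock_Kurzweil_Integration.integrable_sum Henstock_Kurzweil_Integration.integral_add
  Henstock_Kurzweil_Integration.integral_cong Henstock_Kurzweil_Integration.integral_diff Henstock_Kurzweil_Integration.integral_nonneg
  Henstock_Kurzweil_Integration.integral_norm_bound_integral Henstock_Kurzweil_Integration.integral_sum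

section \<open>Notation and square-integrable functions: inequalities, Fatou, completeness, convex
  combinations\<close>

type_synonym 'd spacetime = "real \<times> (real, 'd) vec"
abbreviation ind :: "'a set => 'a => 'b::zero_neq_one" where "ind \<equiv> indicator"
notation scaleR (infixr "*R" 75)
notation LIMSEQ ("((_)/ ----> (_))" [60, 60] 60)

text \<open>Over an arbitrary measure, so that the same tools serve \<open>lborel\<close>, where the
  analysis takes place, and \<open>lebesgue_on S\<close>, in which the Sobolev spaces are
  stated.\<close>

definition sq_int :: "'a measure => ('a => 'b::euclidean_space) => bool" where
 "sq_int M f \<longleftrightarrow> f \<in> borel_measurable M \<and> integrable M (%x. (norm (f x))^2)"

definition l2n :: "'a measure => ('a => 'b::euclidean_space) => real" where
 "l2n M f = sqrt (\<integral>x. (norm (f x))^2 \<partial>M)"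

abbreviation sqL :: "('a::euclidean_space => 'b::euclidean_space) => bool" where "sqL \<equiv> sq_int lborel"
abbreviation BM :: "('a::topological_space => 'b::topological_space) set" where "BM \<equiv> borel_measurable borel"
abbreviation intL :: "('a::euclidean_space => 'b::euclidean_space) => bool" where "intL \<equiv> integrable lborel"
abbreviation nrm :: "('a::euclidean_space => 'b::euclidean_space) => real" where "nrm \<equiv> l2n lborel"

lemma sq_int_measurable[measurable_dest]: "sq_int M f ==> f \<in> borel_measurable M"
 by (simp add: sq_int_def)

lemma sq_int_integrable: "sq_int M f ==> integrable M (%x. (norm (f x))^2)"
 by (simp add: sq_int_def)

lemma l2n_nonneg[simp]: "0 \<le> l2n M f"
 by (simp add: l2n_def)

lemma l2n_sq: "(l2n M f)^2 = (\<integral>x. (norm (f x))^2 \<partial>M)"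
 by (simp add: l2n_def)

lemma sq_int_bound:
 assumes "sq_int M f" and [measurable]: "g \<in> borel_measurable M"
  and "AE x in M. norm (g x) \<le> c * norm (f x)"
 shows "sq_int M g"
 unfolding sq_int_def
proof
 show "integrable M (%x. (norm (g x))^2)"
 proof (rule integrable_bound)
  show "integrable M (%x. c^2 * (norm (f x))^2)"
   using assms(1) by (simp add: sq_int_def)
  show "AE x in M. norm ((norm (g x))^2) \<le> norm (c^2 * (norm (f x))^2)"
   using assms(3)
  proof eventually_elim
   case (elim x)
   then have "(norm (g x))^2 \<le> (c * norm (f x))^2" by (intro power_mono) auto
   then show ?case by (simp add: power_mult_distrib)
  qed
 qed measurable
qed fact

lemma sq_int_scaleR: "sq_int M f ==> sq_int M (%x. c *R f x)"
 by (rule sq_int_bound[where f = f and c = "\<bar>c\<bar>"]) (auto intro: borel_measurable_scaleR sq_int_measurable)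

lemma sq_int_zero[simp]: "sq_int M (%x. 0)"
 by (simp add: sq_int_def)

lemma sq_int_add:
 assumes "sq_int M f" "sq_int M g"
 shows "sq_int M (%x. f x + g x)"
 unfolding sq_int_def
proof
 note [measurable] = sq_int_measurable[OF assms(1)] sq_int_measurable[OF assms(2)]
 show "(%x. f x + g x) \<in> borel_measurable M" by measurable
 show "integrable M (%x. (norm (f x + g x))^2)"
 proof (rule integrable_bound)
  show "integrable M (%x. 2 * (norm (f x))^2 + 2 * (norm (g x))^2)"
   using assms by (simp add: sq_int_def)
  show "AE x in M. norm ((norm (f x + g x))^2) \<le> norm (2 * (norm (f x))^2 + 2 * (norm (g x))^2)"
  proof (rule AE_I2)
   fix x
   have "(norm (f x + g x))^2 \<le> (norm (f x) + norm (g x))^2"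
    by (intro power_mono norm_triangle_ineq) auto
   also have "\<dots> \<le> 2 * (norm (f x))^2 + 2 * (norm (g x))^2"
    using sum_squares_bound[of "norm (f x)" "norm (g x)"] by (simp add: power2_sum)
   finally show "norm ((norm (f x + g x))^2) \<le> norm (2 * (norm (f x))^2 + 2 * (norm (g x))^2)" by simp
  qed
 qed measurable
qed

lemma sq_int_minus: "sq_int M f ==> sq_int M (%x. - f x)"
 using sq_int_scaleR[of M f "-1"] by simp

lemma sq_int_diff: "sq_int M f ==> sq_int M g ==> sq_int M (%x. f x - g x)"
 using sq_int_add[of M f "%x. - g x"] sq_int_minus[of M g] by simp

lemma sq_int_sum: "(\<And>i. i \<in> I ==> sq_int M (f i)) ==> sq_int M (%x. \<Sum>i\<in>I. f i x)"
 by (induction I rule: infinite_finite_induct) (auto intro: sq_int_add)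

lemma sq_int_cong_AE:
 assumes "sq_int M f" "g \<in> borel_measurable M" "AE x in M. f x = g x"
 shows "sq_int M g"
 by (rule sq_int_bound[OF assms(1,2), where c = 1]) (use assms(3) in auto)

lemma sq_int_integrable_mult_norm:
 assumes "sq_int M f" "sq_int M g"
 shows "integrable M (%x. norm (f x) * norm (g x))"
proof (rule integrable_bound)
 note [measurable] = sq_int_measurable[OF assms(1)] sq_int_measurable[OF assms(2)]
 show "(%x. norm (f x) * norm (g x)) \<in> borel_measurable M" by measurable
 show "integrable M (%x. (norm (f x))^2 + (norm (g x))^2)"
  using assms by (simp add: sq_int_def)
 show "AE x in M. norm (norm (f x) * norm (g x)) \<le> norm ((norm (f x))^2 + (norm (g x))^2)"
 proof (rule AE_I2)
  fix x
  have "2 * (norm (f x) * norm (g x)) \<le> (norm (f x))^2 + (norm (g x))^2"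
   using sum_squares_bound[of "norm (f x)" "norm (g x)"] by simp
  moreover have "0 \<le> norm (f x) * norm (g x)" by simp
  ultimately show "norm (norm (f x) * norm (g x)) \<le> norm ((norm (f x))^2 + (norm (g x))^2)"
   unfolding real_norm_def by linarith
 qed
qed

lemma sq_int_integrable_inner:
 assumes "sq_int M f" "sq_int M g"
 shows "integrable M (%x. f x \<bullet> g x)"
proof (rule integrable_bound[OF sq_int_integrable_mult_norm[OF assms]])
 note [measurable] = sq_int_measurable[OF assms(1)] sq_int_measurable[OF assms(2)]
 show "(%x. f x \<bullet> g x) \<in> borel_measurable M" by measurable
qed (auto simp: Cauchy_Schwarz_ineq2)

text \<open>The integral of \<open>(t * norm f - norm g)^2\<close> is a nonnegative quadratic
  polynomial in \<open>t\<close>, so its discriminant is not positive. The version with norms is the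
  stronger one; it also controls products other than the inner product.\<close>

lemma l2n_Cauchy_Schwarz_norm:
 assumes "sq_int M f" "sq_int M g"
 shows "(\<integral>x. norm (f x) * norm (g x) \<partial>M) \<le> l2n M f * l2n M g"
proof -
 define A where "A = (\<integral>x. (norm (f x))^2 \<partial>M)"
 define B where "B = (\<integral>x. (norm (g x))^2 \<partial>M)"
 define C where "C = (\<integral>x. norm (f x) * norm (g x) \<partial>M)"
 have C0: "0 \<le> C" "0 \<le> A" "0 \<le> B" by (auto simp: C_def A_def B_def)
 have *: "0 \<le> t^2 * A - 2 * t * C + B" for t
 proof -
  have "0 \<le> (\<integral>x. (t * norm (f x) - norm (g x))^2 \<partial>M)" by simp
  also have "\<dots> = (\<integral>x. t^2 * (norm (f x))^2 - 2 * t * (norm (f x) * norm (g x)) + (norm (g x))^2 \<partial>M)"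
   by (intro integral_cong) (auto simp: power2_eq_square algebra_simps)
  also have "\<dots> = t^2 * A - 2 * t * C + B"
   using sq_int_integrable[OF assms(1)] sq_int_integrable[OF assms(2)] sq_int_integrable_mult_norm[OF assms]
   by (simp add: A_def B_def C_def)
  finally show ?thesis .
 qed
 have "C^2 \<le> A * B"
 proof (cases "A = 0")
  case True
  have "C = 0"
  proof (rule ccontr)
   assume "C \<noteq> 0"
   \<comment> \<open>For \<open>A = 0\<close> the quadratic degenerates to
     \<open>B - 2 * t * C\<close>, and this \<open>t\<close> makes it equal to -1.\<close>
   then show False using *[of "(B + 1) / (2 * C)"] True by simp
  qed
  then show ?thesis using True by simp
 next
  case False
  then have "A > 0" using C0 by simp
  then have "0 \<le> A * ((C / A)^2 * A - 2 * (C / A) * C + B)" using *[of "C / A"] by simp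
  also have "\<dots> = A * B - C^2" using \<open>A > 0\<close> by (simp add: field_simps power2_eq_square)
  finally show ?thesis by simp
 qed
 then have "C \<le> sqrt (A * B)" using C0 real_le_rsqrt by blast
 then show ?thesis by (simp add: A_def B_def C_def l2n_def real_sqrt_mult)
qed

lemma l2n_Cauchy_Schwarz:
 assumes "sq_int M f" "sq_int M g"
 shows "\<bar>\<integral>x. f x \<bullet> g x \<partial>M\<bar> \<le> l2n M f * l2n M g"
proof -
 have "\<bar>\<integral>x. f x \<bullet> g x \<partial>M\<bar> \<le> (\<integral>x. \<bar>f x \<bullet> g x\<bar> \<partial>M)"
  by (rule integral_abs_bound)
 also have "\<dots> \<le> (\<integral>x. norm (f x) * norm (g x) \<partial>M)"
  by (intro integral_mono integrable_abs sq_int_integrable_inner sq_int_integrable_mult_norm assms Cauchy_Schwarz_ineq2)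
 also note l2n_Cauchy_Schwarz_norm[OF assms]
 finally show ?thesis .
qed

lemma l2n_triangle:
 assumes "sq_int M f" "sq_int M g"
 shows "l2n M (%x. f x + g x) \<le> l2n M f + l2n M g"
proof (rule power2_le_imp_le)
 have "(l2n M (%x. f x + g x))^2 = (\<integral>x. (norm (f x))^2 + 2 * (f x \<bullet> g x) + (norm (g x))^2 \<partial>M)"
  unfolding l2n_sq
  by (intro integral_cong) (auto simp: power2_norm_eq_inner inner_simps inner_commute)
 also have "\<dots> = (l2n M f)^2 + 2 * (\<integral>x. f x \<bullet> g x \<partial>M) + (l2n M g)^2"
  using sq_int_integrable[OF assms(1)] sq_int_integrable[OF assms(2)] sq_int_integrable_inner[OF assms]
  by (simp add: l2n_sq)
 also have "\<dots> \<le> (l2n M f + l2n M g)^2"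
  using l2n_Cauchy_Schwarz[OF assms] by (simp add: power2_sum)
 finally show "(l2n M (%x. f x + g x))^2 \<le> (l2n M f + l2n M g)^2" .
qed simp

lemma l2n_scaleR: "l2n M (%x. c *R f x) = \<bar>c\<bar> * l2n M f"
 by (simp add: l2n_def power_mult_distrib real_sqrt_mult)

lemma l2n_minus: "l2n M (%x. - f x) = l2n M f"
 by (simp add: l2n_def)

lemma l2n_diff_commute: "l2n M (%x. f x - g x) = l2n M (%x. g x - f x)"
 by (simp add: l2n_def norm_minus_commute)

lemma l2n_diff_triangle:
 assumes "sq_int M f" "sq_int M g"
 shows "l2n M (%x. f x - g x) \<le> l2n M f + l2n M g"
 using l2n_triangle[OF assms(1) sq_int_minus[OF assms(2)]] by (simp add: l2n_minus)

lemma l2n_triangle3: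
 assumes "sq_int M f" "sq_int M g" "sq_int M h"
 shows "l2n M (%x. f x - h x) \<le> l2n M (%x. f x - g x) + l2n M (%x. g x - h x)"
 using l2n_triangle[OF sq_int_diff[OF assms(1,2)] sq_int_diff[OF assms(2,3)]] by simp

lemma l2n_le_add_diff:
 assumes "sq_int M f" "sq_int M g"
 shows "l2n M f \<le> l2n M g + l2n M (%x. f x - g x)"
 using l2n_triangle[OF assms(2) sq_int_diff[OF assms]] by simp

lemma l2n_sum_le:
 assumes "finite I" "\<And>i. i \<in> I ==> sq_int M (f i)"
 shows "l2n M (%x. \<Sum>i\<in>I. f i x) \<le> (\<Sum>i\<in>I. l2n M (f i))"
 using assms
proof (induction I rule: finite_induct)
 case empty
 then show ?case by (simp add: l2n_def)
next
 case (insert i I)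
 have "l2n M (%x. f i x + (\<Sum>i\<in>I. f i x)) \<le> l2n M (f i) + l2n M (%x. \<Sum>i\<in>I. f i x)"
  by (rule l2n_triangle) (use insert in "auto intro: sq_int_sum")
 then show ?case using insert by force
qed

lemma l2n_mono_AE:
 assumes "sq_int M f" "g \<in> borel_measurable M" "AE x in M. norm (g x) \<le> c * norm (f x)" "0 \<le> c"
 shows "l2n M g \<le> c * l2n M f"
proof -
 have g: "sq_int M g" using assms by (intro sq_int_bound[OF assms(1-3)])
 have "l2n M g \<le> l2n M (%x. c *R f x)"
  unfolding l2n_def real_sqrt_le_iff
 proof (rule integral_mono_AE)
  show "AE x in M. (norm (g x))^2 \<le> (norm (c *R f x))^2"
   using assms(3) by eventually_elim (use assms(4) in "auto intro!: power_mono")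
 qed (use g sq_int_scaleR[OF assms(1)] in "auto simp: sq_int_def")
 then show ?thesis using assms(4) by (simp add: l2n_scaleR)
qed

lemma l2n_cong_AE:
 assumes "f \<in> borel_measurable M" "g \<in> borel_measurable M" "AE x in M. f x = g x"
 shows "l2n M f = l2n M g"
proof -
 have "(\<integral>x. (norm (f x))^2 \<partial>M) = (\<integral>x. (norm (g x))^2 \<partial>M)"
  using assms by (intro integral_cong_AE) auto
 then show ?thesis by (simp add: l2n_def)
qed

text \<open>Fatou's lemma with integrability of the limit as part of the conclusion. The bounds
  \<open>c n\<close> may vary because the energy estimates hold only up to an error that tends to 0
  with the step size.\<close>

lemma nonneg_fatou:
 fixes f :: "nat => 'a => real"
 assumes int: "\<And>n. integrable M (f n)" and nn: "\<And>n. AE x in M. 0 \<le> f n x"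
  and g[measurable]: "g \<in> borel_measurable M"
  and lim: "AE x in M. (%n. f n x) ----> g x"
  and le: "\<And>n. (\<integral>x. f n x \<partial>M) \<le> c n" and c: "c ----> c0"
 shows "integrable M g" "(\<integral>x. g x \<partial>M) \<le> c0"
proof -
 note [measurable] = borel_measurable_integrable[OF int]
 have nnall: "AE x in M. \<forall>n. 0 \<le> f n x" using nn by (simp add: AE_all_countable)
 have c0: "0 \<le> c n" for n using le[of n] integral_nonneg_AE[OF nn[of n]] by linarith
 have c00: "0 \<le> c0" using c0 by (intro LIMSEQ_le_const[OF c]) auto
 have gnn: "AE x in M. 0 \<le> g x"
  using lim nnall by eventually_elim (rule LIMSEQ_le_const, auto)
 have "(\<integral>\<^sup>+x. ennreal (g x) \<partial>M) = (\<integral>\<^sup>+x. liminf (%n. ennreal (f n x)) \<partial>M)"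
  using lim by (intro nn_integral_cong_AE, eventually_elim)
   (metis tendsto_ennrealI lim_imp_Liminf sequentially_bot)
 also have "\<dots> \<le> liminf (%n. \<integral>\<^sup>+x. ennreal (f n x) \<partial>M)"
  by (rule nn_integral_liminf) measurable
 also have "\<dots> \<le> liminf (%n. ennreal (c n))"
  using le by (intro Liminf_mono always_eventually allI) (simp add: nn_integral_eq_integral[OF int nn] ennreal_leI)
 also have "\<dots> = ennreal c0"
  using c by (intro lim_imp_Liminf tendsto_ennrealI) auto
 finally have *: "(\<integral>\<^sup>+x. ennreal (g x) \<partial>M) \<le> ennreal c0" .
 show "integrable M g"
  by (rule integrableI_nonneg[OF g gnn]) (use * in "auto simp: ennreal_less_top le_less_trans")
 then have "ennreal (\<integral>x. g x \<partial>M) \<le> ennreal c0"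
  using * by (simp add: nn_integral_eq_integral gnn)
 then show "(\<integral>x. g x \<partial>M) \<le> c0" using c00 by simp
qed

lemma sq_int_fatou:
 fixes f :: "nat => 'a => 'b::euclidean_space"
 assumes "\<And>n. sq_int M (f n)" "g \<in> borel_measurable M"
  and "AE x in M. (%n. f n x) ----> g x"
  and "\<And>n. (\<integral>x. (norm (f n x))^2 \<partial>M) \<le> c n" "c ----> c0"
 shows "sq_int M g" "(\<integral>x. (norm (g x))^2 \<partial>M) \<le> c0"
proof -
 have m: "(%x. (norm (g x))^2) \<in> borel_measurable M" using assms(2) by measurable
 have l: "AE x in M. (%n. (norm (f n x))^2) ----> (norm (g x))^2"
  using assms(3) by eventually_elim (intro tendsto_intros)
 show "sq_int M g" "(\<integral>x. (norm (g x))^2 \<partial>M) \<le> c0"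
  using nonneg_fatou[OF sq_int_integrable[OF assms(1)] _ m l assms(4,5)] assms(2)
  by (auto simp: sq_int_def)
qed

lemma l2_tendsto_AE_subseq:
 assumes "\<And>n. sq_int M (f n)" "sq_int M g" "(%n. l2n M (%x. f n x - g x)) ----> 0"
 obtains r :: "nat => nat" where "strict_mono r" "AE x in M. (%n. f (r n) x) ----> g x"
proof -
 have "(%n. (l2n M (%x. f n x - g x))^2) ----> 0^2" by (intro tendsto_intros assms(3))
 then have "(%n. \<integral>x. norm ((norm (f n x - g x))^2) \<partial>M) ----> 0" by (simp add: l2n_sq)
 then obtain r :: "nat => nat" where r: "strict_mono r" "AE x in M. (%n. (norm (f (r n) x - g x))^2) ----> 0"
  using tendsto_L1_AE_subseq[of M "%n x. (norm (f n x - g x))^2"] sq_int_integrable[OF sq_int_diff[OF assms(1,2)]] by auto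
 have "AE x in M. (%n. f (r n) x) ----> g x"
  using r(2)
 proof eventually_elim
  case (elim x)
  then have "(%n. sqrt ((norm (f (r n) x - g x))^2)) ----> sqrt 0" by (intro tendsto_intros)
  then show ?case by (simp add: tendsto_norm_zero_iff LIM_zero_iff)
 qed
 then show ?thesis using that r(1) by blast
qed

text \<open>Riesz-Fischer. Along \<open>r\<close> the increments \<open>h k\<close> have norm at
  most 2^(-k), so their squares integrate to at most 4^(-k). With the weight 2^k the sum still has a
  finite integral, and its finiteness at a point gives geometric decay of \<open>h k x\<close>
  there, hence pointwise convergence. Fatou turns this into convergence in norm of the whole
  sequence.\<close>

lemma l2_complete:
 fixes f :: "nat => 'a => 'b::euclidean_space"
 assumes f: "\<And>n. sq_int M (f n)"
  and C: "\<And>e. e > 0 ==> \<exists>N. \<forall>m\<ge>N. \<forall>n\<ge>N. l2n M (%x. f m x - f n x) < e"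
 obtains g where "sq_int M g" "(%n. l2n M (%x. f n x - g x)) ----> 0"
proof -
 note [measurable] = sq_int_measurable[OF f]
 have "\<exists>r. \<forall>k. (\<forall>m\<ge>r k. \<forall>n\<ge>r k. l2n M (%x. f m x - f n x) < (1/2)^k) \<and> r k < r (Suc k)"
 proof (intro dependent_nat_choice, goal_cases)
  case 1
  then show ?case using C[of "(1/2)^0"] by auto
 next
  case (2 r k)
  from C[of "(1/2)^Suc k"] obtain N where N: "\<forall>m\<ge>N. \<forall>n\<ge>N. l2n M (%x. f m x - f n x) < (1/2)^Suc k"
   by auto
  show ?case by (rule exI[of _ "max N (Suc r)"]) (use N in auto)
 qed
 then obtain r where r: "\<And>k m n. m \<ge> r k ==> n \<ge> r k ==> l2n M (%x. f m x - f n x) < (1/2)^k"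
  and rS: "\<And>k. r k < r (Suc k)" by blast
 have mono: "strict_mono r" using rS by (simp add: strict_mono_Suc_iff)
 define h where "h k x = norm (f (r (Suc k)) x - f (r k) x)" for k x
 have hm[measurable]: "h k \<in> borel_measurable M" for k unfolding h_def by measurable
 have hint: "(\<integral>\<^sup>+x. ennreal (2^k * (h k x)^2) \<partial>M) \<le> ennreal ((1/2)^k)" for k
 proof -
  have i: "integrable M (%x. (h k x)^2)" unfolding h_def by (intro sq_int_integrable sq_int_diff f)
  have "(\<integral>x. (h k x)^2 \<partial>M) = (l2n M (%x. f (r (Suc k)) x - f (r k) x))^2"
   by (simp add: l2n_sq h_def)
  also have "\<dots> \<le> ((1/2)^k)^2" using r[of k "r (Suc k)" "r k"] rS[of k]
   by (intro power_mono) (auto intro: less_imp_le)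
  finally have "2^k * (\<integral>x. (h k x)^2 \<partial>M) \<le> 2^k * ((1/2)^k)^2" by simp
  also have "\<dots> = (1/2)^k" by (simp add: power2_eq_square power_divide)
  finally have "(\<integral>x. 2^k * (h k x)^2 \<partial>M) \<le> (1/2)^k" by simp
  then show ?thesis using i by (subst nn_integral_eq_integral) (auto intro: ennreal_leI)
 qed
 have "(\<integral>\<^sup>+x. (\<Sum>k. ennreal (2^k * (h k x)^2)) \<partial>M) = (\<Sum>k. \<integral>\<^sup>+x. ennreal (2^k * (h k x)^2) \<partial>M)"
  by (rule nn_integral_suminf) measurable
 also have "\<dots> \<le> (\<Sum>k. ennreal ((1/2)^k))" by (intro suminf_le hint summableI)
 also have "\<dots> = ennreal (\<Sum>k. (1/2)^k)" by (intro suminf_ennreal2 summable_geometric) auto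
 also have "\<dots> < \<infinity>" by simp
 finally have "AE x in M. (\<Sum>k. ennreal (2^k * (h k x)^2)) \<noteq> \<infinity>"
  by (intro nn_integral_PInf_AE) auto
 then have conv: "AE x in M. convergent (%k. f (r k) x)"
 proof eventually_elim
  case (elim x)
  define S where "S = (\<Sum>k. ennreal (2^k * (h k x)^2))"
  have S: "ennreal (2^k * (h k x)^2) \<le> S" for k
   unfolding S_def by (rule order_trans[OF _ sum_le_suminf[OF summableI, of "{k}"]]) simp_all
  obtain K where K: "K \<ge> 0" "S = ennreal K"
   using elim unfolding S_def[symmetric] by (cases S) auto
  have hb: "h k x \<le> sqrt K * (sqrt (1/2))^k" for k
  proof -
   have "2^k * (h k x)^2 \<le> K" using S[of k] K by simp
   then have "(h k x)^2 \<le> K * (1/2)^k" by (simp add: field_simps power_divide)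
   then have "sqrt ((h k x)^2) \<le> sqrt (K * (1/2)^k)" using real_sqrt_le_iff by blast
   moreover have "h k x \<ge> 0" by (simp add: h_def)
   ultimately show ?thesis by (simp add: real_sqrt_mult real_sqrt_power)
  qed
  have "summable (%k. sqrt K * (sqrt (1/2))^k)"
   by (intro summable_mult summable_geometric) (auto simp: real_sqrt_lt_1_iff)
  then have "summable (%k. f (r (Suc k)) x - f (r k) x)"
   by (rule summable_comparison_test') (use hb in "auto simp: h_def")
  then have "convergent (%n. \<Sum>k<n. f (r (Suc k)) x - f (r k) x)" by (simp add: summable_iff_convergent)
  then have "convergent (%n. (f (r n) x - f (r 0) x) + f (r 0) x)"
   unfolding sum_lessThan_telescope[of "%k. f (r k) x"] by (intro convergent_add convergent_const)
  then show ?case by simp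
 qed
 define g where "g x = lim (%k. f (r k) x)" for x
 have gm[measurable]: "g \<in> borel_measurable M" unfolding g_def by measurable
 have lim: "AE x in M. (%k. f (r k) x) ----> g x"
  using conv by eventually_elim (simp add: g_def convergent_LIMSEQ_iff)
 have key: "sq_int M (%x. f n x - g x) \<and> (\<integral>x. (norm (f n x - g x))^2 \<partial>M) \<le> ((1/2)^j)^2"
  if "n \<ge> r j" for n j
 proof -
  have a: "sq_int M (%x. f n x - f (r (k + j)) x)" for k by (intro sq_int_diff f)
  have b: "(\<integral>x. (norm (f n x - f (r (k + j)) x))^2 \<partial>M) \<le> ((1/2)^j)^2" for k
  proof -
   have "r j \<le> r (k + j)" using mono by (simp add: strict_mono_less_eq)
   then have "l2n M (%x. f n x - f (r (k + j)) x) \<le> (1/2)^j" using r[of j n "r (k + j)"] that by auto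
   then show ?thesis unfolding l2n_sq[symmetric] by (intro power_mono) auto
  qed
  have c: "AE x in M. (%k. f n x - f (r (k + j)) x) ----> f n x - g x"
   using lim
  proof eventually_elim
   case (elim x)
   then have "(%k. f (r (k + j)) x) ----> g x" by (rule LIMSEQ_ignore_initial_segment)
   then show ?case by (intro tendsto_intros)
  qed
  have d: "(%x. f n x - g x) \<in> borel_measurable M" by measurable
  show ?thesis using sq_int_fatou[OF a d c b tendsto_const] by auto
 qed
 have g: "sq_int M g"
  using sq_int_diff[OF f[of "r 0"] conjunct1[OF key[of 0 "r 0"]]] by simp
 have "(%n. l2n M (%x. f n x - g x)) ----> 0"
 proof (rule LIMSEQ_I)
  fix e :: real assume "e > 0"
  then obtain j where j: "(1/2)^j < e" using real_arch_pow_inv[of e "1/2"] by auto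
  have "norm (l2n M (%x. f n x - g x) - 0) < e" if "n \<ge> r j" for n
  proof -
   have "(l2n M (%x. f n x - g x))^2 \<le> ((1/2)^j)^2" using key[OF that] by (simp add: l2n_sq)
   then have "l2n M (%x. f n x - g x) \<le> (1/2)^j" by (rule power2_le_imp_le) simp
   then show ?thesis using j by simp
  qed
  then show "\<exists>N. \<forall>n\<ge>N. norm (l2n M (%x. f n x - g x) - 0) < e" by blast
 qed
 then show ?thesis using that g by blast
qed

lemma l2_inner_tendsto:
 assumes f: "\<And>n. sq_int M (f n)" "sq_int M f0" "(%n. l2n M (%x. f n x - f0 x)) ----> 0"
  and g: "\<And>n. sq_int M (g n)" "sq_int M g0" "(%n. l2n M (%x. g n x - g0 x)) ----> 0"
 shows "(%n. \<integral>x. f n x \<bullet> g n x \<partial>M) ----> (\<integral>x. f0 x \<bullet> g0 x \<partial>M)"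
proof (rule LIM_zero_cancel, rule tendsto_rabs_zero_cancel, rule tendsto_sandwich[OF _ _ tendsto_const])
 let ?b = "%n. l2n M (%x. f n x - f0 x) * (l2n M g0 + l2n M (%x. g n x - g0 x)) + l2n M f0 * l2n M (%x. g n x - g0 x)"
 have "?b ----> 0 * (l2n M g0 + 0) + l2n M f0 * 0" by (intro tendsto_intros f g)
 then show "?b ----> 0" by simp
 show "\<forall>\<^sub>F n in sequentially. 0 \<le> \<bar>(\<integral>x. f n x \<bullet> g n x \<partial>M) - (\<integral>x. f0 x \<bullet> g0 x \<partial>M)\<bar>" by simp
 show "\<forall>\<^sub>F n in sequentially. \<bar>(\<integral>x. f n x \<bullet> g n x \<partial>M) - (\<integral>x. f0 x \<bullet> g0 x \<partial>M)\<bar> \<le> ?b n"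
 proof (rule always_eventually, rule allI)
  fix n
  have "(\<integral>x. f n x \<bullet> g n x \<partial>M) - (\<integral>x. f0 x \<bullet> g0 x \<partial>M)
    = (\<integral>x. (f n x - f0 x) \<bullet> g n x \<partial>M) + (\<integral>x. f0 x \<bullet> (g n x - g0 x) \<partial>M)"
   using f g by (simp add: inner_diff sq_int_integrable_inner)
  also have "\<bar>\<dots>\<bar> \<le> l2n M (%x. f n x - f0 x) * l2n M (g n) + l2n M f0 * l2n M (%x. g n x - g0 x)"
   using l2n_Cauchy_Schwarz[OF sq_int_diff[OF f(1)[of n] f(2)] g(1)[of n]]
    l2n_Cauchy_Schwarz[OF f(2) sq_int_diff[OF g(1)[of n] g(2)]] by linarith
  also have "\<dots> \<le> ?b n"
   using l2n_le_add_diff[OF g(1)[of n] g(2)] by (intro add_right_mono mult_left_mono) auto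
  finally show "\<bar>(\<integral>x. f n x \<bullet> g n x \<partial>M) - (\<integral>x. f0 x \<bullet> g0 x \<partial>M)\<bar> \<le> ?b n" .
 qed
qed

text \<open>A substitute for weak compactness: the almost norm-minimal elements of the convex hulls
 of the tails form a Cauchy sequence by the parallelogram identity.\<close>

lemma l2_convex_tails_convergent:
 fixes g :: "nat => 'a => 'b::euclidean_space"
 assumes g: "\<And>n. sq_int M (g n)" and bd: "\<And>n. l2n M (g n) \<le> C"
 obtains c :: "nat => nat => real" and m :: "nat => nat" and w
 where "\<And>n j. 0 \<le> c n j" "\<And>n. (\<Sum>j=n..<m n. c n j) = 1" "sq_int M w"
  "(%n. l2n M (%x. (\<Sum>j=n..<m n. c n j *R g j x) - w x)) ----> 0"
proof -
 define V where "V n = {f. \<exists>c m. (\<forall>j. (0::real) \<le> c j) \<and> (\<Sum>j=n..<m. c j) = 1 \<and> f = (%x. \<Sum>j=n..<m. c j *R g j x)}" for n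
 have Vsq: "sq_int M f" if "f \<in> V n" for f n
  using that unfolding V_def by (auto intro!: sq_int_sum sq_int_scaleR g)
 have gV: "g n \<in> V n" for n
  unfolding V_def by (auto intro!: exI[of _ "%_. 1"] exI[of _ "Suc n"])
 have ext: "\<exists>c. (\<forall>j. (0::real) \<le> c j) \<and> (\<Sum>j=n..<k. c j) = 1 \<and> f = (%x. \<Sum>j=n..<k. c j *R g j x)"
  if c: "\<forall>j. (0::real) \<le> c j" "(\<Sum>j=i..<m. c j) = 1" "f = (%x. \<Sum>j=i..<m. c j *R g j x)" and "n \<le> i" "m \<le> k" for c i m n k f
 proof (intro exI[of _ "%j. if j \<in> {i..<m} then c j else 0"] conjI allI)
  have s: "{i..<m} \<subseteq> {n..<k}" using that by auto
  show "(\<Sum>j=n..<k. if j \<in> {i..<m} then c j else 0) = 1"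
   unfolding c(2)[symmetric] by (rule sum.mono_neutral_cong_right) (use s in auto)
  show "f = (%x. \<Sum>j=n..<k. (if j \<in> {i..<m} then c j else 0) *R g j x)"
   unfolding c(3) by (rule ext, rule sum.mono_neutral_cong_left) (use s in auto)
 qed (use c in auto)
 have Vmono: "V i \<subseteq> V n" if "n \<le> i" for n i
 proof
  fix f assume "f \<in> V i"
  then obtain c m where "\<forall>j. (0::real) \<le> c j" "(\<Sum>j=i..<m. c j) = 1" "f = (%x. \<Sum>j=i..<m. c j *R g j x)"
   unfolding V_def by auto
  from ext[OF this that order_refl] show "f \<in> V n" unfolding V_def by blast
 qed
 have mid: "(%x. (1/2) *R (f x + h x)) \<in> V n" if "f \<in> V n" "h \<in> V n" for f h n
 proof -
  obtain c1 m1 where 1: "\<forall>j. (0::real) \<le> c1 j" "(\<Sum>j=n..<m1. c1 j) = 1" "f = (%x. \<Sum>j=n..<m1. c1 j *R g j x)"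
   using \<open>f \<in> V n\<close> unfolding V_def by auto
  obtain c2 m2 where 2: "\<forall>j. (0::real) \<le> c2 j" "(\<Sum>j=n..<m2. c2 j) = 1" "h = (%x. \<Sum>j=n..<m2. c2 j *R g j x)"
   using \<open>h \<in> V n\<close> unfolding V_def by auto
  let ?m = "max m1 m2"
  obtain d1 where d1: "\<forall>j. (0::real) \<le> d1 j" "(\<Sum>j=n..<?m. d1 j) = 1" "f = (%x. \<Sum>j=n..<?m. d1 j *R g j x)"
   using ext[OF 1, of n ?m] by auto
  obtain d2 where d2: "\<forall>j. (0::real) \<le> d2 j" "(\<Sum>j=n..<?m. d2 j) = 1" "h = (%x. \<Sum>j=n..<?m. d2 j *R g j x)"
   using ext[OF 2, of n ?m] by auto
  have "(%x. (1/2) *R (f x + h x)) = (%x. \<Sum>j=n..<?m. ((d1 j + d2 j) / 2) *R g j x)"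
   unfolding d1(3) d2(3) sum.distrib[symmetric] scaleR_sum_right
   by (simp add: scaleR_add_left scaleR_add_right add_divide_distrib)
  moreover have "(\<Sum>j=n..<?m. (d1 j + d2 j) / 2) = 1"
   using d1 d2 by (simp add: sum_divide_distrib[symmetric] sum.distrib)
  moreover have "\<forall>j. 0 \<le> (d1 j + d2 j) / 2" using d1 d2 by auto
  ultimately show ?thesis unfolding V_def by (intro CollectI exI[of _ "%j. (d1 j + d2 j) / 2"] exI[of _ ?m]) auto
 qed
 define I where "I n = Inf (l2n M ` V n)" for n
 have bb: "bdd_below (l2n M ` V n)" for n by (rule bdd_belowI[of _ 0]) auto
 have Ile: "I n \<le> l2n M f" if "f \<in> V n" for f n
  unfolding I_def by (rule cInf_lower[OF _ bb]) (use that in auto)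
 have Imono: "I n \<le> I i" if "n \<le> i" for n i
  unfolding I_def by (rule cInf_superset_mono[OF _ bb image_mono[OF Vmono[OF that]]]) (use gV in auto)
 have I0: "0 \<le> I n" for n
  unfolding I_def by (rule cInf_greatest) (use gV in auto)
 have IC: "I n \<le> C" for n using Ile[OF gV[of n]] bd[of n] by linarith
 have "convergent I"
  by (intro Bseq_mono_convergent BseqI'[of _ C]) (use I0 IC Imono in auto)
 then obtain L where L: "I ----> L" by (auto simp: convergent_def)
 have IL: "I n \<le> L" for n using incseq_le[OF _ L] Imono by (simp add: monoI)
 have "\<exists>f\<in>V n. l2n M f < I n + 1 / real (Suc n)" for n
 proof -
  have "Inf (l2n M ` V n) < I n + 1 / real (Suc n)" by (simp add: I_def)
  then show ?thesis using cInf_less_iff[OF _ bb, of n] gV by auto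
 qed
 then obtain f where fV: "\<And>n. f n \<in> V n" and fI: "\<And>n. l2n M (f n) < I n + 1 / real (Suc n)" by metis
 note fsq = Vsq[OF fV]
 \<comment> \<open>The midpoint of \<open>f i\<close> and \<open>f j\<close> lies in
   \<open>V n\<close>, so its norm is at least \<open>I n\<close>; both norms are at most
   \<open>L + 1 / Suc n\<close>. As \<open>I n\<close> tends to \<open>L\<close>, the parallelogram
   identity forces the difference to be small.\<close>
 have est: "(l2n M (%x. f i x - f j x))^2 \<le> 4 * (L + 1 / real (Suc n))^2 - 4 * (I n)^2"
  if "n \<le> i" "n \<le> j" for n i j
 proof -
  have up: "(l2n M (f k))^2 \<le> (L + 1 / real (Suc n))^2" if "n \<le> k" for k
  proof (rule power_mono)
   have "1 / real (Suc k) \<le> 1 / real (Suc n)" using that by (simp add: frac_le)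
   then show "l2n M (f k) \<le> L + 1 / real (Suc n)" using fI[of k] IL[of k] by linarith
  qed simp
  have "(%x. (1/2) *R (f i x + f j x)) \<in> V n"
   using that Vmono fV by (intro mid) blast+
  then have "(I n)^2 \<le> (l2n M (%x. (1/2) *R (f i x + f j x)))^2" using I0 by (intro power_mono Ile) auto
  then have "4 * (I n)^2 \<le> (l2n M (%x. f i x + f j x))^2" by (simp add: l2n_scaleR power_mult_distrib power_divide)
  moreover have "(l2n M (%x. f i x - f j x))^2 + (l2n M (%x. f i x + f j x))^2 = 2 * (l2n M (f i))^2 + 2 * (l2n M (f j))^2"
  proof -
   have "(l2n M (%x. f i x - f j x))^2 + (l2n M (%x. f i x + f j x))^2
    = (\<integral>x. (norm (f i x - f j x))^2 + (norm (f i x + f j x))^2 \<partial>M)"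
    unfolding l2n_sq using fsq by (intro integral_add[symmetric] sq_int_integrable sq_int_add sq_int_diff)
   also have "\<dots> = (\<integral>x. 2 * (norm (f i x))^2 + 2 * (norm (f j x))^2 \<partial>M)"
    by (intro integral_cong) (auto simp: power2_norm_eq_inner inner_simps inner_commute)
   also have "\<dots> = 2 * (l2n M (f i))^2 + 2 * (l2n M (f j))^2"
    unfolding l2n_sq using fsq by (simp add: sq_int_integrable)
   finally show ?thesis .
  qed
  ultimately show ?thesis using up[OF that(1)] up[OF that(2)] by linarith
 qed
 have "(%n. 4 * (L + 1 / real (Suc n))^2 - 4 * (I n)^2) ----> 4 * (L + 0)^2 - 4 * L^2"
  by (intro tendsto_intros L LIMSEQ_Suc[OF lim_1_over_n])
 then have small: "(%n. 4 * (L + 1 / real (Suc n))^2 - 4 * (I n)^2) ----> 0" by simp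
 obtain w where w: "sq_int M w" "(%n. l2n M (%x. f n x - w x)) ----> 0"
 proof (rule l2_complete[OF fsq])
  fix e :: real assume "e > 0"
  then have "e^2 > 0" by simp
  then obtain N where N: "4 * (L + 1 / real (Suc N))^2 - 4 * (I N)^2 < e^2"
   using order_tendstoD(2)[OF small, of "e^2"] by (meson eventually_sequentially order_refl)
  have "l2n M (%x. f i x - f j x) < e" if "i \<ge> N" "j \<ge> N" for i j
   by (rule power2_less_imp_less) (use est[OF that] N \<open>e > 0\<close> in auto)
  then show "\<exists>N. \<forall>m\<ge>N. \<forall>n\<ge>N. l2n M (%x. f m x - f n x) < e" by blast
 qed
 let ?P = "%n c m. (\<forall>j. (0::real) \<le> c j) \<and> (\<Sum>j=n..<m. c j) = 1 \<and> f n = (%x. \<Sum>j=n..<m. c j *R g j x)"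
 have "\<forall>n. \<exists>c m. ?P n c m"
  using fV unfolding V_def by blast
 from choice[OF this] obtain c where "\<forall>n. \<exists>m. ?P n (c n) m" by blast
 from choice[OF this] obtain m where cm: "\<forall>n. ?P n (c n) (m n)" by blast
 show ?thesis
 proof (rule that[of c m w])
  show "(%n. l2n M (%x. (\<Sum>j=n..<m n. c n j *R g j x) - w x)) ----> 0"
  proof -
   have "(%x. (\<Sum>j=n..<m n. c n j *R g j x) - w x) = (%x. f n x - w x)" for n
   proof -
    have e: "f n = (%x. \<Sum>j=n..<m n. c n j *R g j x)" using cm by blast
    show ?thesis by (subst e) (rule refl)
   qed
   then show ?thesis using w(2) by simp
  qed
 qed (use cm w in auto)
qed

section \<open>Functions of class Ck and compactly supported C1 functions\<close>

lemma pderiv_dir_eq: "(f has_derivative f') (at x) ==> pderiv_dir v f x = f' v"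
 unfolding pderiv_dir_def by (metis frechet_derivative_at)

lemma pderiv_dir_has_derivative:
 "f differentiable (at x) ==> (f has_derivative (%v. pderiv_dir v f x)) (at x)"
 unfolding pderiv_dir_def by (simp add: frechet_derivative_works[symmetric])

lemma pderiv_dir_cong_open:
 assumes "open S" "x \<in> S" "\<And>y. y \<in> S ==> f y = g y"
 shows "pderiv_dir v f x = pderiv_dir v g x" and "f differentiable (at x) \<longleftrightarrow> g differentiable (at x)"
proof -
 show *: "f differentiable (at x) \<longleftrightarrow> g differentiable (at x)"
  unfolding differentiable_def using assms by (metis has_derivative_transform_within_open)
 show "pderiv_dir v f x = pderiv_dir v g x"
 proof (cases "f differentiable (at x)")
  case True
  then show ?thesis unfolding pderiv_dir_def
   using frechet_derivative_transform_within_open[OF True assms] by simp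
 next
  case False
  \<comment> \<open>\<open>frechet_derivative\<close> chooses an element from the set of
    derivatives. The two choices agree even when neither function is differentiable, since both sets
    are then the same empty set.\<close>
  have "(%f'. (f has_derivative f') (at x)) = (%f'. (g has_derivative f') (at x))"
   using False * by (auto simp: differentiable_def)
  then show ?thesis unfolding pderiv_dir_def frechet_derivative_def by simp
 qed
qed

lemma pderiv_dir_linear:
 assumes "f differentiable (at x)"
 shows "pderiv_dir v f x = (\<Sum>e\<in>Basis. (v \<bullet> e) *R pderiv_dir e f x)"
proof -
 interpret linear "%v. pderiv_dir v f x"
  using pderiv_dir_has_derivative[OF assms] by (rule has_derivative_linear)
 have "pderiv_dir v f x = pderiv_dir (\<Sum>e\<in>Basis. (v \<bullet> e) *R e) f x"
  by (simp add: euclidean_representation)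
 then show ?thesis by (simp add: sum scale)
qed

lemma Ck_on_cong:
 assumes "open S" "\<And>x. x \<in> S ==> f x = g x"
 shows "Ck_on k S f \<longleftrightarrow> Ck_on k S g"
 using assms(2)
proof (induction k arbitrary: f g)
 case 0
 then show ?case by (simp cong: continuous_on_cong)
next
 case (Suc k)
 have "Ck_on k S (pderiv_dir e f) \<longleftrightarrow> Ck_on k S (pderiv_dir e g)" for e
  by (rule Suc.IH) (rule pderiv_dir_cong_open(1)[OF assms(1)], auto intro: Suc.prems)
 moreover have "f differentiable (at x) \<longleftrightarrow> g differentiable (at x)" if "x \<in> S" for x
  using pderiv_dir_cong_open(2)[OF assms(1) that] Suc.prems by blast
 ultimately show ?case by simp
qed

lemma Ck_on_SucD: "Ck_on (Suc k) S f ==> Ck_on k S f"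
proof (induction k arbitrary: f)
 case 0
 then show ?case by (auto intro!: continuous_at_imp_continuous_on differentiable_imp_continuous_within)
next
 case (Suc k)
 then show ?case by simp
qed

lemma Ck_on_subset: "Ck_on k S f ==> S' \<subseteq> S ==> Ck_on k S' f"
 by (induction k arbitrary: f) (auto intro: continuous_on_subset)

lemma Ck_on_const: "Ck_on k S (%x. c)"
proof (induction k arbitrary: c)
 case (Suc k)
 have "pderiv_dir e (%x. c) = (%x. 0)" for e :: 'a
  by (rule ext, subst pderiv_dir_eq[of _ "%_. 0"]) auto
 then show ?case using Suc by (simp del: Ck_on.simps(1))
qed simp

lemma Ck_on_add:
 assumes "open S" "Ck_on k S f" "Ck_on k S g"
 shows "Ck_on k S (%x. f x + g x)"
 using assms(2,3)
proof (induction k arbitrary: f g)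
 case 0
 then show ?case by (simp add: continuous_on_add)
next
 case (Suc k)
 have "Ck_on k S (pderiv_dir e (%x. f x + g x))" if "e \<in> Basis" for e
 proof (subst Ck_on_cong[OF assms(1)])
  show "Ck_on k S (%x. pderiv_dir e f x + pderiv_dir e g x)"
   using Suc that by simp
  fix x assume "x \<in> S"
  then show "pderiv_dir e (%x. f x + g x) x = pderiv_dir e f x + pderiv_dir e g x"
   using Suc.prems by (intro pderiv_dir_eq has_derivative_add pderiv_dir_has_derivative) auto
 qed
 then show ?case using Suc.prems by (auto simp del: Ck_on.simps(1))
qed

lemma pderiv_dir_bilinear:
 fixes f :: "'d::euclidean_space => 'a::euclidean_space" and g :: "'d => 'b::euclidean_space"
  and prod :: "'a => 'b => 'c::euclidean_space"
 assumes "bounded_bilinear prod" "f differentiable (at x)" "g differentiable (at x)"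
 shows "(%x. prod (f x) (g x)) differentiable (at x)"
  and "pderiv_dir v (%x. prod (f x) (g x)) x = prod (f x) (pderiv_dir v g x) + prod (pderiv_dir v f x) (g x)"
proof -
 note d = bounded_bilinear.FDERIV[OF assms(1) assms(2,3)[THEN pderiv_dir_has_derivative]]
 show "(%x. prod (f x) (g x)) differentiable (at x)" using d by (auto simp: differentiable_def)
 show "pderiv_dir v (%x. prod (f x) (g x)) x = prod (f x) (pderiv_dir v g x) + prod (pderiv_dir v f x) (g x)"
  by (rule pderiv_dir_eq[OF d])
qed

lemma Ck_on_bilinear:
 fixes f :: "'d::euclidean_space => 'a::euclidean_space" and g :: "'d => 'b::euclidean_space"
  and prod :: "'a => 'b => 'c::euclidean_space"
 assumes b: "bounded_bilinear prod" and S: "open S" and "Ck_on k S f" "Ck_on k S g"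
 shows "Ck_on k S (%x. prod (f x) (g x))"
 using assms(3,4)
proof (induction k arbitrary: f g)
 case 0
 then show ?case by (auto intro: bounded_bilinear.continuous_on[OF b])
next
 case (Suc k)
 have "Ck_on k S (pderiv_dir e (%x. prod (f x) (g x)))" if e: "e \<in> Basis" for e
 proof (subst Ck_on_cong[OF S])
  have "Ck_on k S f" "Ck_on k S g" using Suc.prems Ck_on_SucD by blast+
  moreover have "Ck_on k S (pderiv_dir e f)" "Ck_on k S (pderiv_dir e g)" using Suc.prems e by auto
  ultimately show "Ck_on k S (%x. prod (f x) (pderiv_dir e g x) + prod (pderiv_dir e f x) (g x))"
   by (intro Ck_on_add S Suc.IH)
  fix x assume "x \<in> S"
  then show "pderiv_dir e (%x. prod (f x) (g x)) x = prod (f x) (pderiv_dir e g x) + prod (pderiv_dir e f x) (g x)"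
   using Suc.prems pderiv_dir_bilinear(2)[OF b, of f x g e] by auto
 qed
 moreover have "(%x. prod (f x) (g x)) differentiable (at x)" if "x \<in> S" for x
  using Suc.prems that by (auto intro: pderiv_dir_bilinear(1)[OF b, of f x g])
 ultimately show ?case unfolding Ck_on.simps by blast
qed

lemmas Ck_on_scaleR = Ck_on_bilinear[OF bounded_bilinear_scaleR]
lemma Ck_on_cmult: "open S ==> Ck_on k S f ==> Ck_on k S (%x. c *R f x)"
 using Ck_on_scaleR[OF _ Ck_on_const] .

lemma Ck_on_diff:
 assumes "open S" "Ck_on k S f" "Ck_on k S g"
 shows "Ck_on k S (%x. f x - g x)"
 using Ck_on_add[OF assms(1,2) Ck_on_cmult[OF assms(1,3), of "-1"]] by simp

lemma Ck_on_sum: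
 assumes "open S" "\<And>i. i \<in> I ==> Ck_on k S (f i)"
 shows "Ck_on k S (%x. \<Sum>i\<in>I. f i x)"
 using assms(2) by (induction I rule: infinite_finite_induct) (auto intro: Ck_on_const Ck_on_add assms(1))

lemma Ck_on_prod:
 fixes f :: "'i => 'a::euclidean_space => real"
 assumes "open S" "\<And>i. i \<in> I ==> Ck_on k S (f i)"
 shows "Ck_on k S (%x. \<Prod>i\<in>I. f i x)"
 using assms(2) by (induction I rule: infinite_finite_induct)
  (auto intro: Ck_on_const Ck_on_bilinear[OF bounded_bilinear_mult] assms(1))

lemma Ck_on_inner_const: "Ck_on k S (%x. x \<bullet> a)"
proof (cases k)
 case (Suc n)
 have *: "((%x. x \<bullet> a) has_derivative (%v. v \<bullet> a)) (at x)" for x by (auto intro!: derivative_eq_intros)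
 then have "pderiv_dir e (%x. x \<bullet> a) = (%x. e \<bullet> a)" for e by (auto simp: pderiv_dir_eq[OF *])
 moreover have "(%x. x \<bullet> a) differentiable at x" for x using * by (auto simp: differentiable_def)
 ultimately show ?thesis using Suc by (simp add: Ck_on_const del: Ck_on.simps(1))
qed (auto intro: continuous_intros)

lemma pderiv_dir_zero_outside:
 fixes f :: "'a::euclidean_space => 'b::euclidean_space"
 assumes "open S" "x \<in> S" "\<And>y. y \<in> S ==> f y = 0"
 shows "f differentiable (at x)" "pderiv_dir v f x = 0"
 using pderiv_dir_cong_open[OF assms] pderiv_dir_eq[OF has_derivative_const[of "0::'b"], where x = x]
 by simp_all

text \<open>The open sets \<open>S\<close> and \<open>- K\<close> cover the space, and on
  \<open>- K\<close> the function vanishes together with its derivatives.\<close>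

lemma Ck_on_extend:
 assumes "open S" "closed K" "K \<subseteq> S" "Ck_on k S f" "\<And>x. x \<notin> K ==> f x = 0"
 shows "Ck_on k UNIV f"
 using assms(4,5)
proof (induction k arbitrary: f)
 case 0
 have "continuous_on (S \<union> (- K)) f"
  using 0 assms by (intro continuous_on_open_Un continuous_on_eq[OF continuous_on_const[of _ 0], of "- K" f]) auto
 moreover have "S \<union> (- K) = UNIV" using assms by auto
 ultimately show ?case by simp
next
 case (Suc k)
 have z: "f differentiable (at x)" "pderiv_dir v f x = 0" if "x \<notin> K" for x v
  by (rule pderiv_dir_zero_outside[of "- K" x f]; use Suc.prems assms that in auto)+
 have "f differentiable (at x)" for x
  using z(1)[of x] Suc.prems assms by (cases "x \<in> K") auto
 moreover have "Ck_on k UNIV (pderiv_dir e f)" if "e \<in> Basis" for e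
  by (rule Suc.IH) (use Suc.prems z that in auto)
 ultimately show ?case by (simp del: Ck_on.simps(1))
qed

text \<open>Class C1 is enough for integration by parts, and it is all that the truncated fields
  offer: \<open>penG\<close> below has one continuous derivative and no second one on the unit
  sphere. Regularity is required on the whole space so that integrals can be taken over
  \<open>lborel\<close>.\<close>

definition C1c :: "'a::euclidean_space set => ('a => 'b::euclidean_space) set" where
 "C1c S = {phi. Ck_on (Suc 0) UNIV phi \<and> (\<exists>K. compact K \<and> K \<subseteq> S \<and> (\<forall>x. x \<notin> K --> phi x = 0))}"

lemma test_functions_C1c: "phi \<in> test_functions S ==> phi \<in> C1c S"
 by (auto simp: test_functions_def C1c_def smooth_on_def simp del: Ck_on.simps)

lemma C1c_I:
 assumes "open S" "Ck_on (Suc 0) S f" "compact K" "K \<subseteq> S" "\<And>x. x \<notin> K ==> f x = 0"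
 shows "f \<in> C1c S"
 unfolding C1c_def using Ck_on_extend[OF assms(1) compact_imp_closed[OF assms(3)] assms(4,2,5)] assms by blast

lemma C1c_differentiable: "f \<in> C1c S ==> f differentiable (at x)"
 by (auto simp: C1c_def)

lemma C1c_continuous: "f \<in> C1c S ==> continuous_on UNIV f"
 by (auto simp: C1c_def dest!: Ck_on_SucD simp del: Ck_on.simps(2))

lemma C1c_continuous_pderiv:
 assumes "f \<in> C1c S" shows "continuous_on UNIV (pderiv_dir v f)"
proof -
 have "pderiv_dir v f = (%x. \<Sum>e\<in>Basis. (v \<bullet> e) *R pderiv_dir e f x)"
  using pderiv_dir_linear[OF C1c_differentiable[OF assms]] by blast
 moreover have "continuous_on UNIV (%x. \<Sum>e\<in>Basis. (v \<bullet> e) *R pderiv_dir e f x)"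
  using assms by (auto simp: C1c_def intro!: continuous_intros)
 ultimately show ?thesis by simp
qed

lemma C1c_support:
 assumes "f \<in> C1c S"
 obtains K where "compact K" "K \<subseteq> S" "\<And>x. x \<notin> K ==> f x = 0" "\<And>x v. x \<notin> K ==> pderiv_dir v f x = 0"
proof -
 obtain K where K: "compact K" "K \<subseteq> S" "\<And>x. x \<notin> K ==> f x = 0" using assms by (auto simp: C1c_def)
 moreover have "pderiv_dir v f x = 0" if "x \<notin> K" for x v
  by (rule pderiv_dir_zero_outside(2)[of "- K"]) (use K that compact_imp_closed in auto)
 ultimately show ?thesis using that by blast
qed

lemma C1c_bilinear:
 fixes f :: "'d::euclidean_space => 'a::euclidean_space" and g :: "'d => 'b::euclidean_space"
  and prod :: "'a => 'b => 'c::euclidean_space"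
 assumes b: "bounded_bilinear prod" and "open S" "Ck_on (Suc 0) S f" "g \<in> C1c S"
 shows "(%x. prod (f x) (g x)) \<in> C1c S"
proof -
 obtain K where K: "compact K" "K \<subseteq> S" "\<And>x. x \<notin> K ==> g x = 0" using assms(4) by (auto simp: C1c_def)
 show ?thesis
 proof (rule C1c_I[OF assms(2) _ K(1,2)])
  have "Ck_on (Suc 0) S g" using assms(4) Ck_on_subset[OF _ subset_UNIV] unfolding C1c_def by blast
  then show "Ck_on (Suc 0) S (%x. prod (f x) (g x))" by (rule Ck_on_bilinear[OF b assms(2,3)])
 qed (use K(3) in "simp add: bounded_bilinear.zero_right[OF b]")
qed

lemma compact_support_integrable:
 fixes f :: "'a::euclidean_space => 'b::euclidean_space"
 assumes c: "continuous_on UNIV f" and "compact K" "\<And>x. x \<notin> K ==> f x = 0"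
 shows "intL f"
proof -
 have "intL (%x. ind K x *R f x)"
  by (rule borel_integrable_compact[OF assms(2)]) (use c continuous_on_subset in auto)
 moreover have "(%x. ind K x *R f x) = f" using assms(3) by (auto simp: indicator_def)
 ultimately show ?thesis by simp
qed

lemma bounded_of_compact_support:
 fixes f :: "'a::euclidean_space => 'b::euclidean_space"
 assumes c: "continuous_on UNIV f" and "compact K" "\<And>x. x \<notin> K ==> f x = 0"
 obtains L where "L \<ge> 0" "\<And>x. norm (f x) \<le> L"
proof -
 have "bounded (f ` K)" using c assms(2) by (intro compact_imp_bounded compact_continuous_image) (auto intro: continuous_on_subset)
 then obtain L where L: "\<And>x. x \<in> K ==> norm (f x) \<le> L" by (auto simp: bounded_iff)
 show ?thesis
 proof (rule that[of "max L 0"])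
  show "norm (f x) \<le> max L 0" for x using L[of x] assms(3)[of x] by (cases "x \<in> K") auto
 qed simp
qed

lemma C1c_integrable:
 assumes "f \<in> C1c S"
 shows "intL f" "intL (pderiv_dir v f)"
proof -
 obtain K where K: "compact K" "\<And>x. x \<notin> K ==> f x = 0" "\<And>x v. x \<notin> K ==> pderiv_dir v f x = 0"
  using C1c_support[OF assms] by metis
 show "intL f" by (rule compact_support_integrable[OF C1c_continuous[OF assms] K(1,2)])
 show "intL (pderiv_dir v f)"
  by (rule compact_support_integrable[OF C1c_continuous_pderiv[OF assms] K(1,3)])
qed

lemma C1c_sq_int:
 assumes "f \<in> C1c S" shows "sqL f" "sqL (pderiv_dir v f)"
proof -
 obtain K where K: "compact K" "\<And>x. x \<notin> K ==> f x = 0" "\<And>x v. x \<notin> K ==> pderiv_dir v f x = 0"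
  using C1c_support[OF assms] by metis
 show "sqL f" "sqL (pderiv_dir v f)" unfolding sq_int_def
  using C1c_continuous[OF assms] C1c_continuous_pderiv[OF assms, of v] K
  by (auto intro!: compact_support_integrable[of _ K] continuous_intros borel_measurable_continuous_onI)
qed

section \<open>Fubini, the fundamental theorem on intervals, translations and integration by parts
  on \<open>lborel\<close>\<close>

lemma borel_pairD:
 fixes h :: "'t::euclidean_space \<times> 'a::euclidean_space => 'b::euclidean_space"
 shows "h \<in> BM ==> h \<in> borel_measurable (borel \<Otimes>\<^sub>M borel)"
 by (simp add: borel_prod)

lemma borel_measurable_pairI:
 fixes h :: "'t::euclidean_space \<times> 'a::euclidean_space => 'b::euclidean_space"
 assumes "h \<in> BM" "f \<in> borel_measurable M" "g \<in> borel_measurable M"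
 shows "(%x. h (f x, g x)) \<in> borel_measurable M"
proof -
 note [measurable] = borel_pairD[OF assms(1)] assms(2,3)
 show ?thesis by measurable
qed

lemma fubini:
 fixes F :: "'t::euclidean_space \<times> 'a::euclidean_space => 'b::euclidean_space"
 assumes "intL F"
 shows "AE t in lborel. intL (%x. F (t, x))" "AE x in lborel. intL (%t. F (t, x))"
  "intL (%t. LBINT x. F (t, x))" "intL (%x. LBINT t. F (t, x))"
  "(LBINT t. (LBINT x. F (t, x))) = (LBINT z. F z)"
  "(LBINT x. (LBINT t. F (t, x))) = (LBINT z. F z)"
proof -
 have i: "integrable (lborel \<Otimes>\<^sub>M lborel) F" using assms by (simp add: lborel_prod)
 then have i2: "integrable (lborel \<Otimes>\<^sub>M lborel) (%(t, x). F (t, x))" by simp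
 show "AE t in lborel. intL (%x. F (t, x))" by (rule lborel_pair.AE_integrable_fst'[OF i])
 show "intL (%t. LBINT x. F (t, x))" by (rule lborel_pair.integrable_fst'[OF i])
 show "(LBINT t. (LBINT x. F (t, x))) = (LBINT z. F z)"
  using lborel_pair.integral_fst'[OF i] by (simp add: lborel_prod)
 show "AE x in lborel. intL (%t. F (t, x))" by (rule lborel_pair.AE_integrable_snd[OF i2])
 show "intL (%x. LBINT t. F (t, x))" by (rule lborel_pair.integrable_snd[OF i2])
 show "(LBINT x. (LBINT t. F (t, x))) = (LBINT z. F z)"
  using lborel_pair.integral_snd[OF i2] by (simp add: lborel_prod)
qed

lemma integrable_of_iterated:
 fixes F :: "'t::euclidean_space \<times> 'a::euclidean_space => 'b::euclidean_space"
 assumes F: "F \<in> BM"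
  and "AE t in lborel. intL (%x. F (t, x))" "intL (%t. LBINT x. norm (F (t, x)))"
 shows "intL F"
proof -
 have "integrable (lborel \<Otimes>\<^sub>M lborel) F"
  using assms by (intro lborel_pair.Fubini_integrable) (auto simp: lborel_prod)
 then show ?thesis by (simp add: lborel_prod)
qed

lemma interval_lebesgue_eq_integral:
 fixes k :: "real => 'b::euclidean_space"
 assumes "intL (%tau. ind {s..t} tau *R k tau)"
 shows "k integrable_on {s..t}" "(LBINT tau. ind {s..t} tau *R k tau) = integral {s..t} k"
 using set_borel_integral_eq_integral[of "{s..t}" k] assms by (auto simp: set_integrable_def set_lebesgue_integral_def)

text \<open>Differentiability is asked only inside the interval: the time primitives used later are
  merely continuous at time 0, where the flow itself is not defined.\<close>

lemma FTC_interior: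
 fixes F :: "real => 'b::euclidean_space"
 assumes "s \<le> t" "continuous_on {s..t} F" "\<And>tau. s < tau ==> tau < t ==> (F has_vector_derivative k tau) (at tau)"
  and "intL (%tau. ind {s..t} tau *R k tau)"
 shows "(LBINT tau. ind {s..t} tau *R k tau) = F t - F s"
proof -
 have "(k has_integral (F t - F s)) {s..t}"
  by (rule fundamental_theorem_of_calculus_interior) (use assms in auto)
 then show ?thesis using interval_lebesgue_eq_integral(2)[OF assms(4)] by (simp add: integral_unique)
qed

lemma lborel_shift:
 fixes a :: "'a::euclidean_space" and f :: "'a => 'b::euclidean_space"
 shows "sqL f ==> sqL (%z. f (a + z))"
  and "intL f ==> intL (%z. f (a + z))"
  and "f \<in> BM ==> (LBINT z. f (a + z)) = (LBINT z. f z)"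
  and "(AE z in lborel. Q z) ==> (AE z in lborel. Q (a + z))"
proof -
 have m: "(+) a \<in> measurable lborel borel" by simp
 have i: "intL (%z. F (a + z))" if F: "intL F" for F :: "'a => 'c::euclidean_space"
 proof -
  have "integrable (distr lborel borel ((+) a)) F" using F by (simp add: lborel_distr_plus)
  then show ?thesis using F by (subst (asm) integrable_distr_eq[OF m]) auto
 qed
 show "intL f ==> intL (%z. f (a + z))" by (rule i)
 show "sqL f ==> sqL (%z. f (a + z))"
  unfolding sq_int_def using i[of "%z. (norm (f z))^2"] by (auto intro: measurable_compose[rotated])
 show "(LBINT z. f (a + z)) = (LBINT z. f z)" if "f \<in> BM"
 proof -
  have "(LBINT z. f z) = (\<integral>z. f z \<partial>distr lborel borel ((+) a))" by (simp add: lborel_distr_plus)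
  also have "\<dots> = (LBINT z. f (a + z))" by (rule integral_distr[OF m that])
  finally show ?thesis ..
 qed
 show "AE z in lborel. Q (a + z)" if ae: "AE z in lborel. Q z"
 proof -
  obtain N where N: "N \<in> null_sets lborel" "{z. \<not> Q z} \<subseteq> N" using ae by (auto simp: eventually_ae_filter)
  have "N \<in> null_sets (distr lborel borel ((+) a))" using N(1) by (simp add: lborel_distr_plus)
  then have "(+) a -` N \<in> null_sets lborel" by (simp add: null_sets_distr_iff[OF m])
  then show ?thesis using N(2) by (intro AE_I') auto
 qed
qed

text \<open>Integrate the derivative along the shift by \<open>t *R v\<close> and use translation invariance.\<close>

lemma integral_pderiv_dir_C1c:
 fixes h :: "'a::euclidean_space => 'b::euclidean_space"
 assumes h: "h \<in> C1c S"
 shows "(LBINT x. pderiv_dir v h x) = 0"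
proof -
 let ?d = "pderiv_dir v h" and ?I = "ind {0..1::real} :: real => real"
 define F where "F p = ?I (fst p) *R ?d (fst p *R v + snd p)" for p
 have dc: "continuous_on UNIV ?d" by (rule C1c_continuous_pderiv[OF h])
 have di: "intL ?d" by (rule C1c_integrable(2)[OF h])
 have Ii: "intL (%t. ?I t *R c)" for c :: "'c::euclidean_space"
  by (rule integrable_scaleR_left, rule integrable_real_indicator) auto
 note sh = lborel_shift(3)[OF borel_measurable_continuous_onI]
 have Fi: "intL F"
 proof (rule integrable_of_iterated)
  have "(%p. ind ({0..1} \<times> UNIV) p *R ?d (fst p *R v + snd p)) \<in> BM"
   by (intro borel_measurable_scaleR borel_measurable_indicator borel_measurable_continuous_onI continuous_on_compose2[OF dc] continuous_intros)
     (auto intro!: borel_closed closed_Times)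
  moreover have "F = (%p. ind ({0..1} \<times> UNIV) p *R ?d (fst p *R v + snd p))" by (auto simp: F_def indicator_def)
  ultimately show "F \<in> BM" by simp
  show "AE t in lborel. intL (%x. F (t, x))"
   unfolding F_def fst_conv snd_conv by (intro AE_I2 integrable_scaleR_right lborel_shift(2) di)
  have "(LBINT x. norm (F (t, x))) = ?I t *R (LBINT x. norm (?d x))" for t
   using sh[OF continuous_on_norm[OF dc], of "t *R v"] by (simp add: F_def)
  then show "intL (%t. LBINT x. norm (F (t, x)))" using Ii by simp
 qed
 have hd: "(h has_derivative (%v. pderiv_dir v h x)) (at x)" for x
  by (rule pderiv_dir_has_derivative[OF C1c_differentiable[OF h]])
 have "(LBINT x. ?d x) = (LBINT t. ?I t *R (LBINT x. ?d x))" by simp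
 also have "\<dots> = (LBINT t. (LBINT x. F (t, x)))"
  unfolding F_def fst_conv snd_conv by (simp add: sh[OF dc])
 also have "\<dots> = (LBINT x. (LBINT t. F (t, x)))" using fubini(5,6)[OF Fi] by simp
 also have "\<dots> = (LBINT x. h (v + x) - h x)"
 proof (intro integral_cong refl)
  fix x
  have l: "((%s. h (s *R v + x)) has_vector_derivative ?d (s *R v + x)) (at s)" for s
  proof -
   have "((%s. s *R v + x) has_derivative (%d. d *R v)) (at s)" by (auto intro!: derivative_eq_intros)
   from has_derivative_compose[OF this hd] show ?thesis
    unfolding has_vector_derivative_def using linear_cmul[OF has_derivative_linear[OF hd]] by simp
  qed
  have "(LBINT t. ?I t *R ?d (t *R v + x)) = h (1 *R v + x) - h (0 *R v + x)"
  proof (rule FTC_interior[OF _ _ l])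
   show "continuous_on {0..1} (%s. h (s *R v + x))"
    by (intro continuous_at_imp_continuous_on ballI has_vector_derivative_continuous[OF l])
   have "continuous_on {0..1} (%s. ?d (s *R v + x))" by (intro continuous_on_compose2[OF dc] continuous_intros) auto
   then show "intL (%s. ?I s *R ?d (s *R v + x))"
    using borel_integrable_atLeastAtMost' by (force simp: set_integrable_def)
  qed simp
  then show "(LBINT t. F (t, x)) = h (v + x) - h x" by (simp add: F_def)
 qed
 also have "\<dots> = 0"
  using sh[OF C1c_continuous[OF h], of v] lborel_shift(2)[OF C1c_integrable(1)[OF h], of v] C1c_integrable(1)[OF h] by simp
 finally show ?thesis .
qed

section \<open>Smooth bump functions and test functions approximating indicators of boxes\<close>

definition bump :: "real poly => real => real" where
 "bump P t = (if t \<le> 0 then 0 else poly P (1 / t) * exp (- (1 / t)))"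

text \<open>With \<open>s = 1 / t\<close> the derivative in \<open>t\<close> of
  \<open>P s * exp (- s)\<close> is \<open>s^2 * (P s - P' s) * exp (- s)\<close>. Carrying a
  polynomial in \<open>bump\<close> makes the family closed under differentiation, so that
  smoothness becomes an induction with arbitrary \<open>P\<close>.\<close>

definition bump_deriv :: "real poly => real poly" where
 "bump_deriv P = [:0, 0, 1:] * (P - pderiv P)"

lemma poly_exp_minus_tendsto: "((%x. poly P x * exp (- x)) \<longlongrightarrow> (0::real)) at_top"
proof -
 have "((%x. \<Sum>i\<le>degree P. coeff P i * (x ^ i / exp x)) \<longlongrightarrow> (\<Sum>i\<le>degree P. coeff P i * 0)) at_top"
  by (intro tendsto_intros tendsto_power_div_exp_0)
 moreover have "poly P x * exp (- x) = (\<Sum>i\<le>degree P. coeff P i * (x ^ i / exp x))" for x :: real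
  by (simp add: poly_altdef sum_distrib_right exp_minus divide_inverse mult.assoc)
 ultimately show ?thesis by simp
qed

lemma bump_tendsto_0: "(bump P \<longlongrightarrow> 0) (at 0)"
proof (rule filterlim_split_at)
 have "((%t. poly P (inverse t) * exp (- inverse t)) \<longlongrightarrow> 0) (at_right 0)"
  by (rule filterlim_compose[OF poly_exp_minus_tendsto filterlim_inverse_at_top_right])
 moreover have "\<forall>\<^sub>F t in at_right 0. poly P (inverse t) * exp (- inverse t) = bump P t"
  unfolding eventually_at_right_field by (auto simp: bump_def divide_inverse intro!: exI[of _ 1])
 ultimately show "(bump P \<longlongrightarrow> 0) (at_right 0)" by (rule Lim_transform_eventually)
 have "\<forall>\<^sub>F t in at_left 0. 0 = bump P t"
  unfolding eventually_at_left_field by (auto simp: bump_def intro!: exI[of _ "-1"])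
 then show "(bump P \<longlongrightarrow> 0) (at_left 0)" by (rule Lim_transform_eventually[OF tendsto_const])
qed

lemma bump_has_derivative: "(bump P has_real_derivative bump (bump_deriv P) t) (at t)"
proof (cases t "0::real" rule: linorder_cases)
 case less
 have "((%_. 0) has_real_derivative 0) (at t)" by simp
 then have "(bump P has_real_derivative 0) (at t)"
  by (rule has_field_derivative_transform_within_open[of _ _ _ "{..<0}"]) (use less in "auto simp: bump_def")
 then show ?thesis using less by (simp add: bump_def)
next
 case greater
 have r: "((%t. 1 / t) has_real_derivative - (1 / t^2)) (at t)"
  using greater by (auto intro!: derivative_eq_intros simp: power2_eq_square)
 have "((%t. poly P (1 / t) * exp (- (1 / t))) has_real_derivative
   (poly (pderiv P) (1 / t) * (- (1 / t^2))) * exp (- (1 / t))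
   + (exp (- (1 / t)) * (- (- (1 / t^2)))) * poly P (1 / t)) (at t)"
  by (intro DERIV_mult DERIV_chain2[OF poly_DERIV r] DERIV_chain2[OF DERIV_exp DERIV_minus[OF r]])
 also have "(poly (pderiv P) (1 / t) * (- (1 / t^2))) * exp (- (1 / t))
   + (exp (- (1 / t)) * (- (- (1 / t^2)))) * poly P (1 / t) = bump (bump_deriv P) t"
  using greater by (simp add: bump_def bump_deriv_def field_simps power2_eq_square)
 finally have "((%t. poly P (1 / t) * exp (- (1 / t))) has_real_derivative bump (bump_deriv P) t) (at t)" .
 then show ?thesis
  by (rule has_field_derivative_transform_within_open[of _ _ _ "{0<..}"]) (use greater in "auto simp: bump_def")
next
 case equal
 \<comment> \<open>The difference quotient at 0 is again a bump function, its polynomial being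
   multiplied by the variable; so it tends to 0.\<close>
 have "(%h. (bump P (0 + h) - bump P 0) / h) = bump ([:0, 1:] * P)"
  by (auto simp: bump_def fun_eq_iff)
 then show ?thesis using bump_tendsto_0[of "[:0, 1:] * P"] equal
  unfolding DERIV_def by (simp add: bump_def)
qed

lemma Ck_on_bump:
 fixes p :: "'a::euclidean_space => real"
 assumes "open S" and p: "\<And>k. Ck_on k S p"
 shows "Ck_on k S (%x. bump P (p x))"
proof (induction k arbitrary: P)
 case 0
 have "continuous_on UNIV (bump P)"
  by (intro continuous_at_imp_continuous_on ballI DERIV_isCont[OF bump_has_derivative])
 then show ?case using p[of 0] by (auto intro: continuous_on_compose2)
next
 case (Suc k)
 have d: "((%x. bump P (p x)) has_derivative (%v. bump (bump_deriv P) (p x) * pderiv_dir v p x)) (at x)" if "x \<in> S" for x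
 proof -
  have "p differentiable (at x)" using p[of "Suc 0"] that by simp
  from has_derivative_compose[OF pderiv_dir_has_derivative[OF this] bump_has_derivative[of P "p x", unfolded has_field_derivative_def]]
  show ?thesis .
 qed
 have "Ck_on k S (pderiv_dir e (%x. bump P (p x)))" if "e \<in> Basis" for e
 proof (subst Ck_on_cong[OF assms(1) pderiv_dir_eq[OF d]])
  have "Ck_on k S (pderiv_dir e p)" using p[of "Suc k"] that by simp
  then show "Ck_on k S (%x. bump (bump_deriv P) (p x) * pderiv_dir e p x)"
   by (rule Ck_on_bilinear[OF bounded_bilinear_mult assms(1) Suc])
 qed
 moreover have "(%x. bump P (p x)) differentiable (at x)" if "x \<in> S" for x
  using d[OF that] by (auto simp: differentiable_def)
 ultimately show ?case unfolding Ck_on.simps by blast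
qed

text \<open>Each coordinate contributes the factors \<open>exp (- 1 / (Suc n * s))\<close>, where
  \<open>s\<close> is the signed distance to one of the two faces. Outside the box some factor is 0
  for every \<open>n\<close>; inside, all factors tend to 1.\<close>

lemma test_functions_box:
 fixes a b :: "'a::euclidean_space"
 obtains phi :: "nat => 'a => real" where
  "\<And>n. phi n \<in> test_functions UNIV" "\<And>n x. 0 \<le> phi n x" "\<And>n x. phi n x \<le> 1"
  "\<And>n x. x \<notin> cbox a b ==> phi n x = 0" "\<And>n x. x \<in> box a b ==> 0 < phi n x"
  "\<And>x. (%n. phi n x) ----> ind (box a b) x"
proof -
 define eta where "eta n t = bump [:1:] (real (Suc n) * t)" for n t
 have eta0: "eta n t = 0" if "t \<le> 0" for n t using that by (simp add: eta_def bump_def mult_nonneg_nonpos)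
 have eta1: "0 \<le> eta n t" "eta n t \<le> 1" for n t by (auto simp: eta_def bump_def)
 have eta3: "0 < eta n t" if "0 < t" for n t using that by (auto simp: eta_def bump_def not_le)
 have eta2: "(%n. eta n t) ----> 1" if "t > 0" for t
 proof -
  have "(%n. exp (- (inverse (real (Suc n)) * (1 / t)))) ----> exp (- (0 * (1 / t)))"
   by (intro tendsto_intros LIMSEQ_inverse_real_of_nat)
  moreover have "eta n t = exp (- (inverse (real (Suc n)) * (1 / t)))" for n
   using that mult_pos_pos[of "real (Suc n)" t] by (simp add: eta_def bump_def not_le field_simps del: of_nat_Suc)
  ultimately show ?thesis by simp
 qed
 define phi where "phi n x = (\<Prod>e\<in>Basis. eta n (x \<bullet> e - a \<bullet> e) * eta n (b \<bullet> e - x \<bullet> e))" for n x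
 have Ck_eta: "Ck_on k UNIV (%x. eta n (x \<bullet> v + c))" for k n c and v :: 'a
  unfolding eta_def
 proof (rule Ck_on_bump)
  fix k
  have "Ck_on k UNIV (%x::'a. real (Suc n) *R (x \<bullet> v + c))"
   by (intro Ck_on_cmult Ck_on_add Ck_on_inner_const Ck_on_const) auto
  then show "Ck_on k UNIV (%x::'a. real (Suc n) * (x \<bullet> v + c))" by simp
 qed simp
 have sm: "smooth_on UNIV (phi n)" for n
  unfolding smooth_on_def phi_def
 proof (intro allI Ck_on_prod)
  fix k and e :: 'a
  show "Ck_on k UNIV (%x. eta n (x \<bullet> e - a \<bullet> e) * eta n (b \<bullet> e - x \<bullet> e))"
   using Ck_on_bilinear[OF bounded_bilinear_mult open_UNIV Ck_eta[of k n e "- (a \<bullet> e)"] Ck_eta[of k n "- e" "b \<bullet> e"]]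
   by simp
 qed simp
 have z: "phi n x = 0" if "x \<notin> box a b" for n x
 proof -
  from that obtain e where "e \<in> Basis" "x \<bullet> e \<le> a \<bullet> e \<or> b \<bullet> e \<le> x \<bullet> e" by (auto simp: mem_box not_less)
  then show ?thesis unfolding phi_def by (auto simp: eta0 intro!: prod_zero bexI[of _ e])
 qed
 have zc: "phi n x = 0" if "x \<notin> cbox a b" for n x using z[of x n] that box_subset_cbox by blast
 show ?thesis
 proof (rule that[of phi])
  show "phi n \<in> test_functions UNIV" for n
   unfolding test_functions_def using sm zc by (auto intro!: exI[of _ "cbox a b"])
  show "0 \<le> phi n x" for n x unfolding phi_def by (intro prod_nonneg mult_nonneg_nonneg eta1)
  show "phi n x \<le> 1" for n x unfolding phi_def by (intro prod_le_1 conjI mult_nonneg_nonneg mult_le_one eta1)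
  show "0 < phi n x" if "x \<in> box a b" for n x
   unfolding phi_def using that by (intro prod_pos mult_pos_pos eta3) (auto simp: mem_box)
  show "(%n. phi n x) ----> ind (box a b) x" for x
  proof (cases "x \<in> box a b")
   case True
   have "(%n. phi n x) ----> (\<Prod>e\<in>(Basis::'a set). 1 * 1)"
    unfolding phi_def by (intro tendsto_prod tendsto_mult eta2) (use True in "auto simp: mem_box")
   then show ?thesis using True by simp
  qed (simp add: z)
 qed (use zc in auto)
qed

section \<open>The fundamental lemma of the calculus of variations, and the passage between
  \<open>lebesgue_on\<close> and \<open>lborel\<close>\<close>

lemma AE_zero_if_box_integrals_zero:
 fixes F :: "'a::euclidean_space => 'b::euclidean_space"
 assumes F: "intL F" and box: "\<And>a b. (LBINT x. ind (box a b) x *R F x) = 0"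
 shows "AE x in lborel. F x = 0"
proof (rule sigma_finite_measure.density_zero[OF sigma_finite_lborel F])
 have tot: "(LBINT x. F x) = 0"
 proof -
  have m[measurable]: "F \<in> borel_measurable lborel" using F by simp
  have "(%n. LBINT x. ind (box (- real n *R One) (real n *R One)) x *R F x) ----> (LBINT x. F x)"
  proof (rule integral_dominated_convergence[OF m _ integrable_norm[OF F]])
   show "(%x. ind (box (- real n *R One) (real n *R One)) x *R F x) \<in> borel_measurable lborel" for n by measurable
   show "AE x in lborel. (%n. ind (box (- real n *R One) (real n *R One)) x *R F x) ----> F x"
   proof (rule AE_I2)
    fix x :: 'a
    obtain N where N: "norm x < real N" using reals_Archimedean2 by blast
    have "ind (box (- real n *R One) (real n *R One)) x *R F x = F x" if "n \<ge> N" for n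
    proof -
     have "- real n < x \<bullet> e \<and> x \<bullet> e < real n" if "e \<in> Basis" for e
      using Basis_le_norm[OF that, of x] N \<open>n \<ge> N\<close> by linarith
     then have "x \<in> box (- real n *R One) (real n *R One)" by (simp add: mem_box)
     then show ?thesis by simp
    qed
    then show "(%n. ind (box (- real n *R One) (real n *R One)) x *R F x) ----> F x"
     by (intro tendsto_eventually) (auto simp: eventually_sequentially)
   qed
  qed (auto simp: indicator_def)
  then show ?thesis by (simp add: box LIMSEQ_const_iff)
 qed
 fix A :: "'a set" assume "A \<in> sets lborel"
 then have A: "A \<in> sigma_sets UNIV (range (%(a, b). box a b))" by (simp add: borel_eq_box)
 \<comment> \<open>Boxes are an intersection-stable generator of the Borel sets. The sets over which
   \<open>F\<close> integrates to 0 are closed under countable disjoint unions, and under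
   complements because the total integral vanishes as well.\<close>
 have "Int_stable (range (%(a, b). box a b :: 'a set))" by (auto simp: Int_stable_def box_Int_box)
 moreover have "range (%(a, b). box a b :: 'a set) \<subseteq> Pow UNIV" by simp
 ultimately show "set_lebesgue_integral lborel A F = 0"
  using A
 proof (induction rule: sigma_sets_induct_disjoint)
  case (basic A) then show ?case using box by (auto simp: set_lebesgue_integral_def)
 next
  case empty then show ?case by (simp add: set_lebesgue_integral_def)
 next
  case (compl A)
  then have [measurable]: "A \<in> sets borel" by (simp add: borel_eq_box)
  have "set_lebesgue_integral lborel (UNIV - A) F = (LBINT x. F x - ind A x *R F x)"
   unfolding set_lebesgue_integral_def by (intro integral_cong) (auto simp: indicator_def)
  also have "\<dots> = 0" using compl tot F integrable_mult_indicator[OF _ F, of A]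
   by (simp add: set_lebesgue_integral_def)
  finally show ?case .
 next
  case (union A)
  then have [measurable]: "A i \<in> sets borel" for i by (auto simp: borel_eq_box)
  have "set_integrable lborel (\<Union>i. A i) F"
   unfolding set_integrable_def by (intro integrable_mult_indicator F) auto
  then have "set_lebesgue_integral lborel (\<Union>i. A i) F = (\<Sum>i. set_lebesgue_integral lborel (A i) F)"
   by (intro lebesgue_integral_countable_add) (use union in "auto simp: disjoint_family_on_def")
  then show ?case using union by simp
 qed
qed

lemma AE_lebesgue_on_iff:
 assumes "S \<in> sets borel"
 shows "(AE x in lebesgue_on S. P x) \<longleftrightarrow> (AE x in lborel. x \<in> S --> P x)"
 using assms by (subst AE_restrict_space_iff) (auto simp: AE_completion_iff)

text \<open>The bridge between the definitions, which speak of \<open>lebesgue_on S\<close>, and the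
  analysis, which works with Borel functions on \<open>lborel\<close> that vanish off
  \<open>S\<close>; Fubini and translations are applied there.\<close>

lemma lebesgue_on_borel:
 fixes f :: "'a::euclidean_space => 'b::euclidean_space"
 assumes S: "S \<in> sets borel" and f: "f \<in> BM" and z: "\<forall>x. x \<notin> S --> f x = 0"
 shows "f \<in> borel_measurable (lebesgue_on S)"
  and "integrable (lebesgue_on S) f \<longleftrightarrow> intL f"
  and "integral\<^sup>L (lebesgue_on S) f = integral\<^sup>L lborel f"
proof -
 have e: "(%x. ind S x *R f x) = f" using z by (auto simp: indicator_def)
 show "f \<in> borel_measurable (lebesgue_on S)"
  using f by (intro measurable_restrict_space1 measurable_completion) auto
 show "integrable (lebesgue_on S) f \<longleftrightarrow> intL f"
  using S f by (subst integrable_restrict_space) (auto simp: e integrable_completion)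
 show "integral\<^sup>L (lebesgue_on S) f = integral\<^sup>L lborel f"
  using S f by (subst integral_restrict_space) (auto simp: e integral_completion)
qed

lemma sq_int_lebesgue_on_borel:
 fixes f :: "'a::euclidean_space => 'b::euclidean_space"
 assumes S: "S \<in> sets borel" and f: "f \<in> BM" and z: "\<forall>x. x \<notin> S --> f x = 0"
 shows "sq_int (lebesgue_on S) f \<longleftrightarrow> sqL f" "l2n (lebesgue_on S) f = nrm f"
proof -
 have m: "(%x. (norm (f x))^2) \<in> BM" using f by measurable
 show "sq_int (lebesgue_on S) f \<longleftrightarrow> sqL f" "l2n (lebesgue_on S) f = nrm f"
  unfolding sq_int_def l2n_def
  using lebesgue_on_borel[OF S f z] lebesgue_on_borel(2,3)[OF S m] z f by simp_all
qed

lemma lebesgue_borel_rep: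
 fixes f :: "'a::euclidean_space => 'b::euclidean_space"
 assumes "f \<in> borel_measurable lebesgue"
 obtains g where "g \<in> BM" "AE x in lborel. f x = g x"
proof -
 have "\<exists>h\<in>borel_measurable lborel. AE x in lborel. f x \<bullet> b = h x" for b
  by (rule completion_ex_borel_measurable_real) (use assms in measurable)
 then obtain h where h: "\<And>b. h b \<in> borel_measurable lborel" "\<And>b. AE x in lborel. f x \<bullet> b = h b x" by metis
 have "AE x in lborel. \<forall>b\<in>Basis. f x \<bullet> b = h b x" using h(2) by (simp add: AE_ball_countable countable_finite)
 then have "AE x in lborel. f x = (\<Sum>b\<in>Basis. h b x *R b)"
  by eventually_elim (metis (no_types, lifting) euclidean_representation sum.cong)
 moreover have "(%x. \<Sum>b\<in>Basis. h b x *R b) \<in> BM"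
  using h(1) by (intro borel_measurable_sum borel_measurable_scaleR) auto
 ultimately show ?thesis using that by blast
qed

lemma lebesgue_on_borel_rep:
 fixes f :: "'a::euclidean_space => 'b::euclidean_space"
 assumes S[measurable]: "S \<in> sets borel" and f: "f \<in> borel_measurable (lebesgue_on S)"
 obtains g where "g \<in> BM" "\<forall>x. x \<notin> S --> g x = 0" "AE x in lebesgue_on S. f x = g x"
proof -
 have "(%x. if x \<in> S then f x else 0) \<in> borel_measurable lebesgue"
  using f S by (intro borel_measurable_if_I) auto
 then obtain g where g[measurable]: "g \<in> BM" and e: "AE x in lborel. (if x \<in> S then f x else 0) = g x"
  by (rule lebesgue_borel_rep)
 show ?thesis
 proof (rule that[of "%x. ind S x *R g x"])
  show "AE x in lebesgue_on S. f x = ind S x *R g x"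
   unfolding AE_lebesgue_on_iff[OF S] using e by eventually_elim auto
 qed auto
qed

text \<open>Test functions that converge boundedly to the indicator of a box turn the hypothesis
  into vanishing integrals over all boxes whose closure lies in \<open>S\<close>. A Borel
  representative on each such box then vanishes almost everywhere, and countably many closed boxes
  exhaust \<open>S\<close>.\<close>

lemma fundamental_lemma:
 fixes f :: "'a::euclidean_space => 'b::euclidean_space"
 assumes S: "open S" and loc: "locally_integrable_on f S"
  and z: "\<And>phi :: 'a => real. phi \<in> test_functions S ==> (\<integral>x. phi x *R f x \<partial>lebesgue_on S) = 0"
 shows "AE x in lebesgue_on S. f x = 0"
proof -
 have Sb: "S \<in> sets lebesgue" "S \<in> sets borel" using S by auto
 have i: "integrable lebesgue (%x. ind (cbox a b) x *R f x)" if "cbox a b \<subseteq> S" for a b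
  using loc that by (subst integrable_restrict_space[symmetric]) (auto simp: locally_integrable_on_def)
 have on: "integral\<^sup>L (lebesgue_on S) h = integral\<^sup>L lebesgue h" if "\<And>x. x \<notin> S ==> h x = 0" for h :: "'a => 'b"
  by (subst integral_restrict_space) (use Sb that in "auto simp: indicator_def intro!: integral_cong")
 have box: "(\<integral>x. ind (box a b) x *R f x \<partial>lebesgue) = 0" if ab: "cbox a b \<subseteq> S" for a b
 proof -
  let ?F = "%x. ind (cbox a b) x *R f x"
  obtain phi :: "nat => 'a => real" where phi: "\<And>n. phi n \<in> test_functions UNIV" "\<And>n x. 0 \<le> phi n x" "\<And>n x. phi n x \<le> 1"
   "\<And>n x. x \<notin> cbox a b ==> phi n x = 0" and lim: "\<And>x. (%n. phi n x) ----> ind (box a b) x"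
   using test_functions_box[of a b] by metis
  have phiS: "phi n \<in> test_functions S" for n
   using phi(1)[of n] phi(4)[of _ n] ab unfolding test_functions_def by (auto intro!: exI[of _ "cbox a b"])
  have phim: "phi n \<in> borel_measurable lebesgue" for n
   using borel_measurable_continuous_onI[OF C1c_continuous[OF test_functions_C1c[OF phi(1)]]] by (simp add: measurable_completion)
  have phic: "x \<in> cbox a b" if "phi n x \<noteq> 0" for n x using phi(4) that by blast
  note Fm = borel_measurable_integrable[OF i[OF ab]]
  have "(%n. \<integral>x. phi n x *R ?F x \<partial>lebesgue) ----> (\<integral>x. ind (box a b) x *R ?F x \<partial>lebesgue)"
  proof (rule integral_dominated_convergence[OF _ _ integrable_norm[OF i[OF ab]]])
   show "(%x. ind (box a b) x *R ?F x) \<in> borel_measurable lebesgue"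
    by (intro borel_measurable_scaleR Fm borel_measurable_indicator) simp
   show "(%x. phi n x *R ?F x) \<in> borel_measurable lebesgue" for n by (intro borel_measurable_scaleR Fm phim)
   show "AE x in lebesgue. (%n. phi n x *R ?F x) ----> ind (box a b) x *R ?F x"
    by (intro AE_I2 tendsto_scaleR lim tendsto_const)
   show "AE x in lebesgue. norm (phi n x *R ?F x) \<le> norm (?F x)" for n
    using phi(2,3) by (simp add: mult.assoc mult_left_le_one_le)
  qed
  moreover have "(\<integral>x. phi n x *R ?F x \<partial>lebesgue) = (\<integral>x. phi n x *R f x \<partial>lebesgue_on S)" for n
   by (subst on) (use phic ab in "auto simp: indicator_def intro!: integral_cong")
  moreover have "(\<integral>x. ind (box a b) x *R ?F x \<partial>lebesgue) = (\<integral>x. ind (box a b) x *R f x \<partial>lebesgue)"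
   using box_subset_cbox[of a b] by (intro integral_cong) (auto simp: indicator_def)
  ultimately show ?thesis by (simp add: z[OF phiS] LIMSEQ_const_iff)
 qed
 have ae: "AE x in lborel. x \<in> cbox a b --> f x = 0" if ab: "cbox a b \<subseteq> S" for a b
 proof -
  obtain g where g[measurable]: "g \<in> BM" and fg: "AE x in lborel. ind (cbox a b) x *R f x = g x"
   using lebesgue_borel_rep[OF borel_measurable_integrable[OF i[OF ab]]] by blast
  have gi: "intL g"
  proof -
   have "integrable lebesgue g" by (rule integrable_cong_AE_imp[OF i[OF ab]]) (use AE_completion[OF fg] g in "auto elim: eventually_mono intro: measurable_completion")
   then show ?thesis by (simp add: integrable_completion)
  qed
  have "AE x in lborel. ind (box a b) x *R g x = 0"
  proof (rule AE_zero_if_box_integrals_zero)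
   show "intL (%x. ind (box a b) x *R g x)" by (rule integrable_mult_indicator[OF _ gi]) simp
   fix c d :: 'a
   obtain e e' where e: "box a b \<inter> box c d = box e e'" "cbox e e' \<subseteq> cbox a b"
    using box_Int_box[of a b c d] by (auto simp: subset_box mem_box intro!: that)
   have "(LBINT x. ind (box c d) x *R ind (box a b) x *R g x) = (LBINT x. ind (box e e') x *R g x)"
    unfolding e(1)[symmetric] by (intro integral_cong) (auto simp: indicator_def)
   also have "\<dots> = (\<integral>x. ind (box e e') x *R g x \<partial>lebesgue)" by (rule integral_completion[symmetric]) measurable
   also have "\<dots> = (\<integral>x. ind (box e e') x *R f x \<partial>lebesgue)"
   proof (rule integral_cong_AE)
    have s: "box e e' \<subseteq> cbox a b" using e(2) box_subset_cbox by blast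
    have eq: "ind (box e e') x *R f x = ind (box e e') x *R (ind (cbox a b) x *R f x)" for x
     using s by (auto simp: indicator_def)
    show "(%x. ind (box e e') x *R f x) \<in> borel_measurable lebesgue"
     unfolding eq by (intro borel_measurable_scaleR borel_measurable_integrable[OF i[OF ab]] borel_measurable_indicator) simp
    show "AE x in lebesgue. ind (box e e') x *R g x = ind (box e e') x *R f x"
     using AE_completion[OF fg] by eventually_elim (simp only: eq)
   qed (simp add: measurable_completion)
   also have "\<dots> = 0" by (rule box) (use e(2) ab in blast)
   finally show "(LBINT x. ind (box c d) x *R ind (box a b) x *R g x) = 0" .
  qed
  \<comment> \<open>The frontier is a null set, so it is enough to know \<open>g\<close> on the open
    box.\<close>
  moreover have "AE x in lborel. x \<notin> cbox a b - box a b"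
   using negligible_frontier_interval[of a b] by (intro AE_not_in) (simp add: negligible_iff_null_sets null_sets_completion_iff)
  ultimately show ?thesis using fg by eventually_elim (auto simp: indicator_def split: if_splits)
 qed
 obtain \<D> where \<D>: "countable \<D>" "\<D> \<subseteq> Pow S" "\<And>X. X \<in> \<D> ==> \<exists>a b. X = cbox a b" "\<Union>\<D> = S"
  using open_countable_Union_open_cbox[OF S] by metis
 have "AE x in lborel. \<forall>X\<in>\<D>. x \<in> X --> f x = 0"
  unfolding AE_ball_countable[OF \<D>(1)] using \<D>(2,3) ae by (metis PowD subsetD)
 then show ?thesis
  by (subst AE_lebesgue_on_iff[OF Sb(2)]) (use \<D>(4) in "auto elim!: eventually_mono")
qed

section \<open>Weak derivatives and Sobolev functions\<close>

lemma L2_iff: "f \<in> L2 S \<longleftrightarrow> sq_int (lebesgue_on S) f"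
 by (simp add: L2_def sq_int_def)

lemma L2_norm_eq: "L2_norm S f = l2n (lebesgue_on S) f"
 by (simp add: L2_norm_def l2n_def)

lemma C1c_measurable:
 assumes "phi \<in> C1c S"
 shows "phi \<in> BM" "pderiv_dir v phi \<in> BM"
 using C1c_continuous[OF assms] C1c_continuous_pderiv[OF assms] by (auto intro: borel_measurable_continuous_onI)

lemma borel_measurable_lebesgue_on: "f \<in> BM ==> f \<in> borel_measurable (lebesgue_on S)"
 by (intro measurable_restrict_space1 measurable_completion) auto

lemma C1c_sq_int_on:
 assumes "phi \<in> C1c S" "S \<in> sets borel"
 shows "sq_int (lebesgue_on S) phi" "sq_int (lebesgue_on S) (pderiv_dir v phi)"
proof -
 obtain K where K: "K \<subseteq> S" "\<And>x. x \<notin> K ==> phi x = 0" "\<And>x v. x \<notin> K ==> pderiv_dir v phi x = 0"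
  using C1c_support[OF assms(1)] by metis
 then have z: "\<forall>x. x \<notin> S --> phi x = 0" "\<forall>x. x \<notin> S --> pderiv_dir v phi x = 0" by blast+
 show "sq_int (lebesgue_on S) phi" "sq_int (lebesgue_on S) (pderiv_dir v phi)"
  using sq_int_lebesgue_on_borel(1)[OF assms(2) C1c_measurable(1)[OF assms(1)] z(1)]
   sq_int_lebesgue_on_borel(1)[OF assms(2) C1c_measurable(2)[OF assms(1)] z(2)] C1c_sq_int[OF assms(1)] by auto
qed

lemma integrable_scaleR_locally:
 fixes f :: "'a::euclidean_space => 'b::euclidean_space" and h :: "'a => real"
 assumes S: "S \<in> sets borel" and loc: "locally_integrable_on f S"
  and h: "continuous_on UNIV h" "compact K" "K \<subseteq> S" "\<And>x. x \<notin> K ==> h x = 0"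
 shows "integrable (lebesgue_on S) (%x. h x *R f x)"
proof -
 have fi: "integrable (lebesgue_on K) f" using loc h by (auto simp: locally_integrable_on_def)
 have Kb: "K \<in> sets borel" using h by (simp add: borel_compact)
 obtain L where L: "\<And>x. norm (h x) \<le> L" using bounded_of_compact_support[OF h(1,2,4)] by metis
 have hm: "h \<in> borel_measurable (lebesgue_on K)"
  using h(1) by (intro borel_measurable_lebesgue_on borel_measurable_continuous_onI)
 have "integrable (lebesgue_on K) (%x. h x *R f x)"
 proof (rule integrable_bound[OF integrable_mult_right[OF integrable_norm[OF fi], of L]])
  show "(%x. h x *R f x) \<in> borel_measurable (lebesgue_on K)"
   using hm borel_measurable_integrable[OF fi] by (rule borel_measurable_scaleR)
  have "0 \<le> L" using L[of 0] norm_ge_zero by (rule order_trans[rotated])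
  then show "AE x in lebesgue_on K. norm (h x *R f x) \<le> norm (L * norm (f x))"
   using L by (auto simp: abs_mult intro!: mult_right_mono)
 qed
 then have "integrable lebesgue (%x. ind K x *R (h x *R f x))"
  using Kb by (subst (asm) integrable_restrict_space) auto
 also have "(%x. ind K x *R (h x *R f x)) = (%x. ind S x *R (h x *R f x))"
  using h by (auto simp: indicator_def fun_eq_iff)
 finally show ?thesis using S by (subst integrable_restrict_space) auto
qed

lemma test_functions_integrable:
 fixes f :: "'a::euclidean_space => 'b::euclidean_space" and phi :: "'a => real"
 assumes "S \<in> sets borel" "locally_integrable_on f S" "phi \<in> C1c S"
 shows "integrable (lebesgue_on S) (%x. phi x *R f x)" "integrable (lebesgue_on S) (%x. pderiv_dir v phi x *R f x)"
proof -
 obtain K where K: "compact K" "K \<subseteq> S" "\<And>x. x \<notin> K ==> phi x = 0" "\<And>x v. x \<notin> K ==> pderiv_dir v phi x = 0"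
  using C1c_support[OF assms(3)] by metis
 show "integrable (lebesgue_on S) (%x. phi x *R f x)"
  by (rule integrable_scaleR_locally[OF assms(1,2) C1c_continuous[OF assms(3)] K(1-3)])
 show "integrable (lebesgue_on S) (%x. pderiv_dir v phi x *R f x)"
  by (rule integrable_scaleR_locally[OF assms(1,2) C1c_continuous_pderiv[OF assms(3)] K(1,2,4)])
qed

lemma locally_integrable_diff:
 "locally_integrable_on f S ==> locally_integrable_on g S ==> locally_integrable_on (%x. f x - g x) S"
 by (auto simp: locally_integrable_on_def)

lemma has_weak_deriv_diff:
 assumes "open S" "has_weak_deriv S v f f'" "has_weak_deriv S v g g'"
 shows "has_weak_deriv S v (%x. f x - g x) (%x. f' x - g' x)"
 unfolding has_weak_deriv_def
proof (intro conjI allI impI locally_integrable_diff)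
 have S: "S \<in> sets borel" using assms(1) by simp
 fix phi :: "'a => real" assume phi: "phi \<in> test_functions S"
 have l: "locally_integrable_on f S" "locally_integrable_on f' S" "locally_integrable_on g S" "locally_integrable_on g' S"
  and e: "integral\<^sup>L (lebesgue_on S) (%x. pderiv_dir v phi x *R f x) = - integral\<^sup>L (lebesgue_on S) (%x. phi x *R f' x)"
   "integral\<^sup>L (lebesgue_on S) (%x. pderiv_dir v phi x *R g x) = - integral\<^sup>L (lebesgue_on S) (%x. phi x *R g' x)"
  using assms phi by (auto simp: has_weak_deriv_def)
 note i = test_functions_integrable[OF S _ test_functions_C1c[OF phi]]
 show "integral\<^sup>L (lebesgue_on S) (%x. pderiv_dir v phi x *R (f x - g x)) =
     - integral\<^sup>L (lebesgue_on S) (%x. phi x *R (f' x - g' x))"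
  using i[OF l(1)] i[OF l(2)] i[OF l(3)] i[OF l(4)] e by (simp add: scaleR_diff_right)
qed (use assms in "auto simp: has_weak_deriv_def")

lemma has_weak_deriv_unique:
 assumes "open S" "has_weak_deriv S v f g" "has_weak_deriv S v f h"
 shows "AE x in lebesgue_on S. g x = h x"
proof -
 have S: "S \<in> sets borel" using assms(1) by simp
 have l: "locally_integrable_on g S" "locally_integrable_on h S" using assms by (auto simp: has_weak_deriv_def)
 have "AE x in lebesgue_on S. g x - h x = 0"
 proof (rule fundamental_lemma[OF assms(1) locally_integrable_diff[OF l]])
  fix phi :: "'a => real" assume phi: "phi \<in> test_functions S"
  note i = test_functions_integrable(1)[OF S _ test_functions_C1c[OF phi]]
  have "(\<integral>x. phi x *R g x \<partial>lebesgue_on S) = (\<integral>x. phi x *R h x \<partial>lebesgue_on S)"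
   using assms(2,3) phi unfolding has_weak_deriv_def by (metis neg_equal_iff_equal)
  then show "(\<integral>x. phi x *R (g x - h x) \<partial>lebesgue_on S) = 0"
   using i[OF l(1)] i[OF l(2)] by (simp add: scaleR_diff_right)
 qed
 then show ?thesis by simp
qed

lemma weak_deriv_eq_AE:
 assumes "open S" "has_weak_deriv S v f g"
 shows "has_weak_deriv S v f (weak_deriv S v f)" "AE x in lebesgue_on S. weak_deriv S v f x = g x"
proof -
 show *: "has_weak_deriv S v f (weak_deriv S v f)"
  unfolding weak_deriv_def by (rule someI[of "has_weak_deriv S v f", OF assms(2)])
 show "AE x in lebesgue_on S. weak_deriv S v f x = g x" by (rule has_weak_deriv_unique[OF assms(1) * assms(2)])
qed

lemma continuous_locally_integrable:
 fixes f :: "'a::euclidean_space => 'b::euclidean_space"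
 assumes "continuous_on S f" shows "locally_integrable_on f S"
 unfolding locally_integrable_on_def
proof (intro allI impI)
 fix K assume K: "compact K" "K \<subseteq> S"
 let ?g = "%x. ind K x *R f x"
 have c: "continuous_on K f" using assms K continuous_on_subset by blast
 have Kb: "K \<in> sets borel" using K by (simp add: borel_compact)
 have i: "intL ?g" by (rule borel_integrable_compact[OF K(1) c])
 have "integrable lebesgue ?g" using i integrable_completion[of ?g lborel] by simp
 then show "integrable (lebesgue_on K) f" using Kb by (subst integrable_restrict_space) auto
qed

lemma sq_int_locally_integrable:
 fixes f :: "'a::euclidean_space => 'b::euclidean_space"
 assumes S: "S \<in> sets borel" and f: "sq_int (lebesgue_on S) f"
 shows "locally_integrable_on f S"
 unfolding locally_integrable_on_def
proof (intro allI impI)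
 fix K assume K: "compact K" "K \<subseteq> S"
 have Kb: "K \<in> sets borel" using K by (simp add: borel_compact)
 have fm: "f \<in> borel_measurable (lebesgue_on K)"
  using sq_int_measurable[OF f] K(2) by (rule measurable_restrict_mono)
 have "integrable lebesgue (%x. ind S x *R (norm (f x))^2)"
  using sq_int_integrable[OF f] S by (subst (asm) integrable_restrict_space) auto
 then have "integrable lebesgue (%x. ind K x *R (ind S x *R (norm (f x))^2))"
  by (rule integrable_mult_indicator[rotated]) (use Kb in simp)
 also have "(%x. ind K x *R (ind S x *R (norm (f x))^2)) = (%x. ind K x *R (norm (f x))^2)"
  using K by (auto simp: indicator_def fun_eq_iff)
 finally have i: "integrable (lebesgue_on K) (%x. (norm (f x))^2)" using Kb by (subst integrable_restrict_space) auto
 have j: "integrable (lebesgue_on K) (%x. 1 :: real)"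
  by (intro continuous_locally_integrable[unfolded locally_integrable_on_def, rule_format, of UNIV] continuous_on_const K) simp
 show "integrable (lebesgue_on K) f"
 proof (rule integrable_bound[OF integrable_add[OF i j] fm])
  have "norm (f x) \<le> (norm (f x))^2 + 1" for x
   using sum_squares_bound[of "norm (f x)" 1] by (simp, smt (verit) norm_ge_zero)
  then show "AE x in lebesgue_on K. norm (f x) \<le> norm ((norm (f x))^2 + 1)" by auto
 qed
qed

text \<open>The product of \<open>f\<close> with a test function is compactly supported and C1, so
  the integral of its derivative is 0; the product rule splits this integral into the two sides of
  the definition.\<close>

lemma has_weak_deriv_Ck:
 fixes f :: "'a::euclidean_space => 'b::euclidean_space"
 assumes S: "open S" and f: "Ck_on (Suc 0) S f" and e: "e \<in> Basis"
 shows "has_weak_deriv S e f (pderiv_dir e f)"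
 unfolding has_weak_deriv_def
proof (intro conjI allI impI)
 have Sb: "S \<in> sets borel" using S by simp
 show lf: "locally_integrable_on f S" by (rule continuous_locally_integrable) (use Ck_on_SucD[OF f] in simp)
 show ldf: "locally_integrable_on (pderiv_dir e f) S" by (rule continuous_locally_integrable) (use f e in simp)
 fix phi :: "'a => real" assume "phi \<in> test_functions S"
 then have phi: "phi \<in> C1c S" by (rule test_functions_C1c)
 note i = test_functions_integrable[OF Sb _ phi]
 define h where "h x = phi x *R f x" for x
 have b: "bounded_bilinear (%(y::'b) (c::real). c *R y)" by (rule bounded_bilinear.flip[OF bounded_bilinear_scaleR])
 have h: "h \<in> C1c S" unfolding h_def by (rule C1c_bilinear[OF b S f phi])
 obtain K where K: "K \<subseteq> S" "\<And>x v. x \<notin> K ==> pderiv_dir v h x = 0" using C1c_support[OF h] by metis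
 have "(\<integral>x. pderiv_dir e h x \<partial>lebesgue_on S) = (LBINT x. pderiv_dir e h x)"
  using K by (intro lebesgue_on_borel(3) Sb C1c_measurable[OF h]) auto
 also have "\<dots> = 0" by (rule integral_pderiv_dir_C1c[OF h])
 also have "(\<integral>x. pderiv_dir e h x \<partial>lebesgue_on S) = (\<integral>x. phi x *R pderiv_dir e f x + pderiv_dir e phi x *R f x \<partial>lebesgue_on S)"
 proof (rule integral_cong)
  fix x assume "x \<in> space (lebesgue_on S)"
  then show "pderiv_dir e h x = phi x *R pderiv_dir e f x + pderiv_dir e phi x *R f x"
   unfolding h_def using pderiv_dir_bilinear(2)[OF bounded_bilinear_scaleR C1c_differentiable[OF phi], of f x e] f by simp
 qed simp
 also have "\<dots> = (\<integral>x. phi x *R pderiv_dir e f x \<partial>lebesgue_on S) + (\<integral>x. pderiv_dir e phi x *R f x \<partial>lebesgue_on S)"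
  by (intro integral_add i lf ldf)
 finally show "(\<integral>x. pderiv_dir e phi x *R f x \<partial>lebesgue_on S) = - (\<integral>x. phi x *R pderiv_dir e f x \<partial>lebesgue_on S)"
  by (simp add: eq_neg_iff_add_eq_0 add.commute)
qed

lemma l2_scaleR_tendsto:
 fixes h :: "'a => real" and f :: "nat => 'a => 'b::euclidean_space"
 assumes h: "sq_int M h" and f: "\<And>n. sq_int M (f n)" "sq_int M g" "(%n. l2n M (%x. f n x - g x)) ----> 0"
 shows "(%n. \<integral>x. h x *R f n x \<partial>M) ----> (\<integral>x. h x *R g x \<partial>M)"
proof (rule LIM_zero_cancel, rule tendsto_norm_zero_cancel, rule tendsto_sandwich[OF _ _ tendsto_const])
 show "(%n. l2n M h * l2n M (%x. f n x - g x)) ----> 0" using tendsto_mult_left[OF f(3), of "l2n M h"] by simp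
 show "\<forall>\<^sub>F n in sequentially. norm ((\<integral>x. h x *R f n x \<partial>M) - (\<integral>x. h x *R g x \<partial>M)) \<le> l2n M h * l2n M (%x. f n x - g x)"
 proof (intro always_eventually allI)
  fix n
  have i: "integrable M (%x. h x *R k x)" if "sq_int M k" for k :: "'a => 'b"
   by (rule integrable_bound[OF sq_int_integrable_mult_norm[OF h that]])
     (rule borel_measurable_scaleR[OF sq_int_measurable[OF h] sq_int_measurable[OF that]], simp)
  have "(\<integral>x. h x *R f n x \<partial>M) - (\<integral>x. h x *R g x \<partial>M) = (\<integral>x. h x *R (f n x - g x) \<partial>M)"
   using i[OF f(1)] i[OF f(2)] by (simp add: scaleR_diff_right)
  also have "norm \<dots> \<le> (\<integral>x. norm (h x *R (f n x - g x)) \<partial>M)" by (rule integral_norm_bound)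
  also have "\<dots> \<le> l2n M h * l2n M (%x. f n x - g x)"
   using l2n_Cauchy_Schwarz_norm[OF h sq_int_diff[OF f(1)[of n] f(2)]] by simp
  finally show "norm ((\<integral>x. h x *R f n x \<partial>M) - (\<integral>x. h x *R g x \<partial>M)) \<le> l2n M h * l2n M (%x. f n x - g x)" .
 qed
qed simp

text \<open>Both sides of the defining identity are continuous in \<open>L2\<close>, since the test
  function and its derivative are square integrable. The lemma transfers derivatives from convex
  combinations of smooth flows to their limit.\<close>

lemma has_weak_deriv_limit:
 fixes f :: "nat => 'a::euclidean_space => 'b::euclidean_space"
 assumes S: "open S" and w: "\<And>n. has_weak_deriv S v (f n) (g n)"
  and f: "\<And>n. sq_int (lebesgue_on S) (f n)" "sq_int (lebesgue_on S) f0" "(%n. l2n (lebesgue_on S) (%x. f n x - f0 x)) ----> 0"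
  and g: "\<And>n. sq_int (lebesgue_on S) (g n)" "sq_int (lebesgue_on S) g0" "(%n. l2n (lebesgue_on S) (%x. g n x - g0 x)) ----> 0"
 shows "has_weak_deriv S v f0 g0"
 unfolding has_weak_deriv_def
proof (intro conjI allI impI)
 have Sb: "S \<in> sets borel" using S by simp
 show "locally_integrable_on f0 S" "locally_integrable_on g0 S" by (intro sq_int_locally_integrable Sb f g)+
 fix phi :: "'a => real" assume phi: "phi \<in> test_functions S"
 note s = C1c_sq_int_on[OF test_functions_C1c[OF phi] Sb]
 have "(%n. \<integral>x. pderiv_dir v phi x *R f n x \<partial>lebesgue_on S) ----> (\<integral>x. pderiv_dir v phi x *R f0 x \<partial>lebesgue_on S)"
  by (intro l2_scaleR_tendsto s f)
 moreover have "(%n. - (\<integral>x. phi x *R g n x \<partial>lebesgue_on S)) ----> - (\<integral>x. phi x *R g0 x \<partial>lebesgue_on S)"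
  by (intro tendsto_minus l2_scaleR_tendsto s g)
 moreover have "(\<integral>x. pderiv_dir v phi x *R f n x \<partial>lebesgue_on S) = - (\<integral>x. phi x *R g n x \<partial>lebesgue_on S)" for n
  using w phi by (auto simp: has_weak_deriv_def)
 ultimately show "(\<integral>x. pderiv_dir v phi x *R f0 x \<partial>lebesgue_on S) = - (\<integral>x. phi x *R g0 x \<partial>lebesgue_on S)"
  by (simp add: LIMSEQ_unique)
qed

text \<open>This is completeness of the Lebesgue measure. It is what makes \<open>weak_deriv\<close>
  measurable: that function is an unspecified choice, known only almost everywhere.\<close>

lemma lebesgue_on_measurable_AE:
 fixes f :: "'a::euclidean_space => 'b::euclidean_space"
 assumes S: "S \<in> sets borel" and f: "f \<in> borel_measurable (lebesgue_on S)" and ae: "AE x in lebesgue_on S. g x = f x"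
 shows "g \<in> borel_measurable (lebesgue_on S)"
proof -
 have "(%x. if x \<in> S then f x else 0) \<in> borel_measurable lebesgue"
  using f S by (intro borel_measurable_if_I) auto
 moreover have "AE x in lebesgue. (if x \<in> S then f x else 0) = (if x \<in> S then g x else 0)"
  using ae S by (subst (asm) AE_restrict_space_iff) auto
 ultimately have "(%x. if x \<in> S then g x else 0) \<in> borel_measurable lebesgue"
  by (rule borel_measurable_AE)
 then show ?thesis by (rule borel_measurable_if_D)
qed

lemma H1_norm_eq:
 assumes S: "open S" and w: "\<And>e. e \<in> Basis ==> has_weak_deriv S e f (g e)"
  and g: "\<And>e. e \<in> Basis ==> sq_int (lebesgue_on S) (g e)"
 shows "H1_norm S f = sqrt ((l2n (lebesgue_on S) f)^2 + (\<Sum>e\<in>Basis. (l2n (lebesgue_on S) (g e))^2))"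
proof -
 have "l2n (lebesgue_on S) (weak_deriv S e f) = l2n (lebesgue_on S) (g e)" if e: "e \<in> Basis" for e
 proof -
  note a = weak_deriv_eq_AE[OF S w[OF e]]
  have "l2n (lebesgue_on S) (weak_deriv S e f) = l2n (lebesgue_on S) (g e)"
   unfolding l2n_def
  proof (rule arg_cong[where f = sqrt], rule integral_cong_AE)
   show "AE x in lebesgue_on S. (norm (weak_deriv S e f x))^2 = (norm (g e x))^2"
    using a(2) by eventually_elim simp
   have gm: "g e \<in> borel_measurable (lebesgue_on S)" by (rule sq_int_measurable[OF g[OF e]])
   then show "(%x. (norm (g e x))^2) \<in> borel_measurable (lebesgue_on S)" by measurable
   have "weak_deriv S e f \<in> borel_measurable (lebesgue_on S)"
    by (rule lebesgue_on_measurable_AE[OF _ gm]) (use a(2) S in auto)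
   then show "(%x. (norm (weak_deriv S e f x))^2) \<in> borel_measurable (lebesgue_on S)" by measurable
  qed
  then show ?thesis .
 qed
 then show ?thesis by (simp add: H1_norm_def L2_norm_eq)
qed

lemma test_functions_Ck: "phi \<in> test_functions S ==> Ck_on k A phi"
 using Ck_on_subset[OF _ subset_UNIV] by (auto simp: test_functions_def smooth_on_def)

text \<open>Separates closeness in \<open>H1_norm\<close>, which refers to chosen weak derivatives
  of the difference, into \<open>L2\<close> convergence of the functions and of each derivative
  towards a prescribed representative \<open>g\<close>. \<open>sobolev1_0_I\<close> is the way
  back.\<close>

lemma sobolev1_0_D:
 fixes f :: "'a::euclidean_space => 'b::euclidean_space"
 assumes S: "open S" and f: "f \<in> sobolev1_0 S" and w: "\<And>e. e \<in> Basis ==> has_weak_deriv S e f (g e)"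
 shows "sq_int (lebesgue_on S) f" "\<And>e. e \<in> Basis ==> sq_int (lebesgue_on S) (g e)"
  "\<exists>phi. (\<forall>n::nat. phi n \<in> test_functions S) \<and> (%n. l2n (lebesgue_on S) (%x. phi n x - f x)) ----> 0 \<and>
   (\<forall>e\<in>Basis. (%n. l2n (lebesgue_on S) (%x. pderiv_dir e (phi n) x - g e x)) ----> 0)"
proof -
 have Sb: "S \<in> sets borel" using S by simp
 have "f \<in> sobolev (Suc 0) S" using f by (simp add: sobolev1_0_def)
 then have f2: "f \<in> L2 S" "\<And>e. e \<in> Basis ==> \<exists>g. has_weak_deriv S e f g \<and> g \<in> L2 S" by auto
 show fs: "sq_int (lebesgue_on S) f" using f2(1) by (simp add: L2_iff)
 show gs: "sq_int (lebesgue_on S) (g e)" if e: "e \<in> Basis" for e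
 proof -
  obtain g' where g': "has_weak_deriv S e f g'" "sq_int (lebesgue_on S) g'" using f2(2)[OF e] by (auto simp: L2_iff)
  have ae: "AE x in lebesgue_on S. g e x = g' x" by (rule has_weak_deriv_unique[OF S w[OF e] g'(1)])
  have "g e \<in> borel_measurable (lebesgue_on S)" by (rule lebesgue_on_measurable_AE[OF Sb sq_int_measurable[OF g'(2)] ae])
  then show ?thesis by (rule sq_int_cong_AE[OF g'(2)]) (use ae in eventually_elim, simp)
 qed
 obtain phi where phi: "\<And>n::nat. phi n \<in> test_functions S" "(%n. H1_norm S (%x. phi n x - f x)) ----> 0"
  using f by (auto simp: sobolev1_0_def)
 have H: "H1_norm S (%x. phi n x - f x) = sqrt ((l2n (lebesgue_on S) (%x. phi n x - f x))^2
   + (\<Sum>e\<in>Basis. (l2n (lebesgue_on S) (%x. pderiv_dir e (phi n) x - g e x))^2))" for n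
 proof (rule H1_norm_eq[OF S])
  fix e :: 'a assume e: "e \<in> Basis"
  show "has_weak_deriv S e (%x. phi n x - f x) (%x. pderiv_dir e (phi n) x - g e x)"
   by (intro has_weak_deriv_diff has_weak_deriv_Ck S w e test_functions_Ck[OF phi(1)])
  show "sq_int (lebesgue_on S) (%x. pderiv_dir e (phi n) x - g e x)"
   by (intro sq_int_diff gs e C1c_sq_int_on[OF test_functions_C1c[OF phi(1)] Sb])
 qed
 have 1: "l2n (lebesgue_on S) (%x. phi n x - f x) \<le> H1_norm S (%x. phi n x - f x)" for n
  unfolding H by (rule real_le_rsqrt) (auto intro: sum_nonneg)
 have 2: "l2n (lebesgue_on S) (%x. pderiv_dir e (phi n) x - g e x) \<le> H1_norm S (%x. phi n x - f x)" if "e \<in> Basis" for n e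
  unfolding H
 proof (rule real_le_rsqrt)
  have "(l2n (lebesgue_on S) (%x. pderiv_dir e (phi n) x - g e x))^2 \<le> (\<Sum>e\<in>Basis. (l2n (lebesgue_on S) (%x. pderiv_dir e (phi n) x - g e x))^2)"
   by (rule member_le_sum[OF that]) auto
  then show "(l2n (lebesgue_on S) (%x. pderiv_dir e (phi n) x - g e x))^2 \<le> (l2n (lebesgue_on S) (%x. phi n x - f x))^2
   + (\<Sum>e\<in>Basis. (l2n (lebesgue_on S) (%x. pderiv_dir e (phi n) x - g e x))^2)"
   by (rule add_increasing[OF zero_le_power2])
 qed
 have "(%n. l2n (lebesgue_on S) (%x. phi n x - f x)) ----> 0"
  by (rule tendsto_sandwich[OF _ _ tendsto_const phi(2)]) (auto simp: 1)
 moreover have "(%n. l2n (lebesgue_on S) (%x. pderiv_dir e (phi n) x - g e x)) ----> 0" if "e \<in> Basis" for e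
  by (rule tendsto_sandwich[OF _ _ tendsto_const phi(2)]) (auto simp: 2[OF that])
 ultimately show "\<exists>phi. (\<forall>n::nat. phi n \<in> test_functions S) \<and> (%n. l2n (lebesgue_on S) (%x. phi n x - f x)) ----> 0 \<and>
   (\<forall>e\<in>Basis. (%n. l2n (lebesgue_on S) (%x. pderiv_dir e (phi n) x - g e x)) ----> 0)"
  using phi(1) by blast
qed

lemma sobolev1_0_I:
 fixes f :: "'a::euclidean_space => 'b::euclidean_space"
 assumes S: "open S" and w: "\<And>e. e \<in> Basis ==> has_weak_deriv S e f (g e)"
  and fs: "sq_int (lebesgue_on S) f" and gs: "\<And>e. e \<in> Basis ==> sq_int (lebesgue_on S) (g e)"
  and phi: "\<And>n::nat. phi n \<in> test_functions S" and l: "(%n. l2n (lebesgue_on S) (%x. phi n x - f x)) ----> 0"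
   "\<And>e. e \<in> Basis ==> (%n. l2n (lebesgue_on S) (%x. pderiv_dir e (phi n) x - g e x)) ----> 0"
 shows "f \<in> sobolev1_0 S"
proof -
 have Sb: "S \<in> sets borel" using S by simp
 have H: "H1_norm S (%x. phi n x - f x) = sqrt ((l2n (lebesgue_on S) (%x. phi n x - f x))^2
   + (\<Sum>e\<in>Basis. (l2n (lebesgue_on S) (%x. pderiv_dir e (phi n) x - g e x))^2))" for n
 proof (rule H1_norm_eq[OF S])
  fix e :: 'a assume e: "e \<in> Basis"
  show "has_weak_deriv S e (%x. phi n x - f x) (%x. pderiv_dir e (phi n) x - g e x)"
   by (intro has_weak_deriv_diff has_weak_deriv_Ck S w e test_functions_Ck[OF phi])
  show "sq_int (lebesgue_on S) (%x. pderiv_dir e (phi n) x - g e x)"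
   by (intro sq_int_diff gs e C1c_sq_int_on[OF test_functions_C1c[OF phi] Sb])
 qed
 have "(%n. H1_norm S (%x. phi n x - f x)) ----> sqrt (0^2 + (\<Sum>e\<in>(Basis::'a set). 0^2))"
  unfolding H by (intro tendsto_intros l)
 then have "(%n. H1_norm S (%x. phi n x - f x)) ----> 0" by simp
 moreover have "f \<in> sobolev 1 S" using w fs gs by (auto simp: L2_iff)
 ultimately show ?thesis using phi unfolding sobolev1_0_def by blast
qed

section \<open>Time integrals of space-time functions, and identities obtained by integrating in
  time on almost every line\<close>

lemma sq_int_slices:
 fixes h :: "'t::euclidean_space \<times> 'a::euclidean_space => 'b::euclidean_space"
 assumes h: "sqL h"
 shows "AE t in lborel. sqL (%x. h (t, x))" "AE x in lborel. sqL (%t. h (t, x))"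
proof -
 have hm: "h \<in> BM" using sq_int_measurable[OF h] by simp
 have m: "(%x. h (t, x)) \<in> borel_measurable lborel" "(%t. h (t, x)) \<in> borel_measurable lborel" for t x
  by (auto intro: borel_measurable_pairI[OF hm])
 show "AE t in lborel. sqL (%x. h (t, x))"
  using fubini(1)[OF sq_int_integrable[OF h]] by eventually_elim (use m in "auto simp: sq_int_def")
 show "AE x in lborel. sqL (%t. h (t, x))"
  using fubini(2)[OF sq_int_integrable[OF h]] by eventually_elim (use m in "auto simp: sq_int_def")
qed

lemma sq_int_indicator:
 assumes "sq_int M h" "A \<in> sets M"
 shows "sq_int M (%z. ind A z *R h z)"
 by (rule sq_int_bound[OF assms(1), where c = 1])
   (use assms sq_int_measurable[OF assms(1)] in "auto simp: indicator_def")

text \<open>The time primitive at a fixed point of space. On lines where the integrand is not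
  integrable it has the default value 0; for a square-integrable \<open>h\<close> these lines form a
  null set.\<close>

definition TI :: "(real \<times> 'a::euclidean_space => 'b::euclidean_space) => real => real => 'a => 'b" where
 "TI h s t x = (LBINT tau. ind {s..t} tau *R h (tau, x))"

lemma TI_measurable:
 assumes h: "h \<in> BM"
  and [measurable]: "a \<in> borel_measurable M" "b \<in> borel_measurable M" "c \<in> borel_measurable M"
 shows "(%z. TI h (a z) (b z) (c z)) \<in> borel_measurable M"
proof -
 note [measurable] = borel_pairD[OF h]
 have "(%z. LBINT tau. (if a z \<le> tau \<and> tau \<le> b z then h (tau, c z) else 0)) \<in> borel_measurable M" by measurable
 moreover have "(%z. TI h (a z) (b z) (c z)) = (%z. LBINT tau. (if a z \<le> tau \<and> tau \<le> b z then h (tau, c z) else 0))"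
  unfolding TI_def by (intro ext integral_cong) (auto simp: indicator_def)
 ultimately show ?thesis by simp
qed

lemma sq_int_indicator_interval: "sqL (ind {s..t} :: real => real)"
proof -
 have "(%x. (norm (ind {s..t} x :: real))^2) = ind {s..t}" by (auto simp: indicator_def)
 then show ?thesis by (auto simp: sq_int_def emeasure_lborel_Icc_eq intro!: integrable_real_indicator)
qed

lemma l2n_indicator_interval: "s \<le> t ==> nrm (ind {s..t} :: real => real) = sqrt (t - s)"
proof -
 assume "s \<le> t"
 have "(%x. (norm (ind {s..t} x :: real))^2) = ind {s..t}" by (auto simp: indicator_def)
 then show ?thesis using \<open>s \<le> t\<close> by (simp add: l2n_def)
qed

lemma sq_int_interval_integrable:
 fixes k :: "real => 'b::euclidean_space"
 assumes "sqL k"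
 shows "intL (%tau. ind {s..t} tau *R k tau)"
 by (rule integrable_bound[OF sq_int_integrable_mult_norm[OF sq_int_indicator_interval[of s t] assms]])
   (use sq_int_measurable[OF assms] in auto)

lemma interval_integral_sq_bound:
 fixes k :: "real => 'b::euclidean_space"
 assumes k: "sqL k" and st: "s \<le> t"
 shows "(norm (LBINT tau. ind {s..t} tau *R k tau))^2 \<le> (t - s) * (LBINT tau. ind {s..t} tau *R (norm (k tau))^2)"
proof -
 let ?k = "%tau. ind {s..t} tau *R k tau"
 have sk: "sqL ?k" by (rule sq_int_indicator[OF k]) simp
 have "norm (LBINT tau. ?k tau) \<le> (LBINT tau. norm (?k tau))" by (rule integral_norm_bound)
 also have "\<dots> = (LBINT tau. norm (ind {s..t} tau :: real) * norm (?k tau))"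
  by (intro integral_cong) (auto simp: indicator_def)
 also have "\<dots> \<le> nrm (ind {s..t} :: real => real) * nrm ?k"
  by (rule l2n_Cauchy_Schwarz_norm[OF sq_int_indicator_interval sk])
 finally have "norm (LBINT tau. ?k tau) \<le> sqrt (t - s) * nrm ?k" by (simp add: l2n_indicator_interval st)
 then have "(norm (LBINT tau. ?k tau))^2 \<le> (sqrt (t - s) * nrm ?k)^2" by (intro power_mono) auto
 also have "\<dots> = (t - s) * (LBINT tau. (norm (?k tau))^2)" using st by (simp add: power_mult_distrib l2n_sq)
 also have "(LBINT tau. (norm (?k tau))^2) = (LBINT tau. ind {s..t} tau *R (norm (k tau))^2)"
  by (intro integral_cong) (auto simp: indicator_def)
 finally show ?thesis .
qed

lemma indicator_slab_borel [measurable]: "({s..t} \<times> UNIV :: (real \<times> 'a::euclidean_space) set) \<in> sets borel"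
 by (intro borel_closed closed_Times) auto

lemma sq_int_TI:
 fixes h :: "real \<times> 'a::euclidean_space => 'b::euclidean_space"
 assumes h: "sqL h" and st: "s \<le> t"
 shows "sqL (TI h s t)"
  "(LBINT x. (norm (TI h s t x))^2) \<le> (t - s) * (LBINT z. ind ({s..t} \<times> UNIV) z *R (norm (h z))^2)"
proof -
 have hm: "h \<in> BM" using sq_int_measurable[OF h] by simp
 have i: "intL (%z. ind ({s..t} \<times> UNIV) z *R (norm (h z))^2)"
  by (rule integrable_mult_indicator[OF _ sq_int_integrable[OF h]]) simp
 let ?H = "%x. LBINT tau. ind {s..t} tau *R (norm (h (tau, x)))^2"
 have e: "ind ({s..t} \<times> UNIV) (tau, x) *R (norm (h (tau, x)))^2 = ind {s..t} tau *R (norm (h (tau, x)))^2" for tau x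
  by (auto simp: indicator_def)
 have H: "intL ?H" "(LBINT x. ?H x) = (LBINT z. ind ({s..t} \<times> UNIV) z *R (norm (h z))^2)"
  using fubini(4,6)[OF i] unfolding e by auto
 have ae: "AE x in lborel. (norm (TI h s t x))^2 \<le> (t - s) * ?H x"
  using sq_int_slices(2)[OF h] unfolding TI_def by eventually_elim (rule interval_integral_sq_bound[OF _ st])
 have m: "TI h s t \<in> borel_measurable lborel" by (rule TI_measurable[OF hm]) auto
 have ti: "intL (%x. (norm (TI h s t x))^2)"
  by (rule integrable_bound[OF integrable_mult_right[OF H(1), of "t - s"]]) (use m ae in auto)
 show "sqL (TI h s t)" using m ti by (simp add: sq_int_def)
 have "(LBINT x. (norm (TI h s t x))^2) \<le> (LBINT x. (t - s) * ?H x)"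
  by (rule integral_mono_AE[OF ti integrable_mult_right[OF H(1)] ae])
 then show "(LBINT x. (norm (TI h s t x))^2) \<le> (t - s) * (LBINT z. ind ({s..t} \<times> UNIV) z *R (norm (h z))^2)"
  using H(2) by simp
qed

lemma TI_split:
 fixes h :: "real \<times> 'a::euclidean_space => 'b::euclidean_space"
 assumes "sqL (%tau. h (tau, x))" "r \<le> s" "s \<le> t"
 shows "TI h r t x = TI h r s x + TI h s t x"
proof -
 have "TI h r s x + TI h s t x = (LBINT tau. ind {r..s} tau *R h (tau, x) + ind {s..t} tau *R h (tau, x))"
  unfolding TI_def by (rule integral_add[symmetric]; rule sq_int_interval_integrable[OF assms(1)])
 also have "\<dots> = TI h r t x"
  unfolding TI_def
 proof (rule integral_cong_AE)
  have [measurable]: "(%tau. h (tau, x)) \<in> BM" using sq_int_measurable[OF assms(1)] by simp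
  show "(%tau. ind {r..s} tau *R h (tau, x) + ind {s..t} tau *R h (tau, x)) \<in> borel_measurable lborel"
   "(%tau. ind {r..t} tau *R h (tau, x)) \<in> borel_measurable lborel" by measurable
  show "AE tau in lborel. ind {r..s} tau *R h (tau, x) + ind {s..t} tau *R h (tau, x) = ind {r..t} tau *R h (tau, x)"
   using AE_lborel_singleton[of s] by eventually_elim (use assms(2,3) in "auto simp: indicator_def")
 qed
 finally show ?thesis by simp
qed

lemma sq_int_tensor:
 fixes A :: "'a::euclidean_space => 'b::euclidean_space" and s t :: real
 assumes A: "sqL A"
 shows "sqL (%z. ind {s..t} (fst z) *R A (snd z))"
 unfolding sq_int_def
proof
 have Am[measurable]: "A \<in> BM" using sq_int_measurable[OF A] by simp
 have "(%z. ind {s..t} (fst z) *R A (snd z)) \<in> borel_measurable (borel \<Otimes>\<^sub>M borel)" by measurable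
 then show m: "(%z. ind {s..t} (fst z) *R A (snd z)) \<in> borel_measurable lborel" by (simp add: borel_prod)
 have e: "(norm (ind {s..t} (fst (tau, x)) *R A (snd (tau, x))))^2 = ind {s..t} tau *R (norm (A x))^2" for tau :: real and x
  by (auto simp: indicator_def)
 show "intL (%z. (norm (ind {s..t} (fst z) *R A (snd z)))^2)"
 proof (rule integrable_of_iterated)
  show "(%z. (norm (ind {s..t} (fst z) *R A (snd z)))^2) \<in> BM" using m by measurable
  show "AE tau in lborel. intL (%x. (norm (ind {s..t} (fst (tau, x)) *R A (snd (tau, x))))^2)"
   unfolding e using sq_int_integrable[OF A] by auto
  have "(%tau. LBINT x. norm (ind {s..t} tau *R (norm (A x))^2)) = (%tau. ind {s..t} tau * (LBINT x. (norm (A x))^2))"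
   by (auto simp: fun_eq_iff indicator_def)
  then show "intL (%tau. LBINT x. norm ((norm (ind {s..t} (fst (tau, x)) *R A (snd (tau, x))))^2))"
   unfolding e by (auto simp: emeasure_lborel_Icc_eq intro!: integrable_mult_left integrable_real_indicator)
 qed
qed

lemma inner_TI:
 fixes h :: "real \<times> 'a::euclidean_space => 'b::euclidean_space"
 assumes h: "sqL h" and A: "sqL A"
 shows "intL (%tau. ind {s..t} tau *R (LBINT x. A x \<bullet> h (tau, x)))"
  "(LBINT x. A x \<bullet> TI h s t x) = (LBINT tau. ind {s..t} tau *R (LBINT x. A x \<bullet> h (tau, x)))"
proof -
 have i: "intL (%z. (ind {s..t} (fst z) *R A (snd z)) \<bullet> h z)"
  by (rule sq_int_integrable_inner[OF sq_int_tensor[OF A] h])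
 have e: "(LBINT x. (ind {s..t} (fst (tau, x)) *R A (snd (tau, x))) \<bullet> h (tau, x)) = ind {s..t} tau *R (LBINT x. A x \<bullet> h (tau, x))" for tau
  by (auto simp: indicator_def)
 show "intL (%tau. ind {s..t} tau *R (LBINT x. A x \<bullet> h (tau, x)))"
  using fubini(3)[OF i] unfolding e .
 have "(LBINT x. A x \<bullet> TI h s t x) = (LBINT x. (LBINT tau. (ind {s..t} (fst (tau, x)) *R A (snd (tau, x))) \<bullet> h (tau, x)))"
 proof (rule integral_cong_AE)
  have hm: "h \<in> BM" using sq_int_measurable[OF h] by simp
  have "TI h s t \<in> borel_measurable lborel" by (rule TI_measurable[OF hm]) auto
  then show "(%x. A x \<bullet> TI h s t x) \<in> borel_measurable lborel" using sq_int_measurable[OF A] by measurable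
  show "(%x. LBINT tau. (ind {s..t} (fst (tau, x)) *R A (snd (tau, x))) \<bullet> h (tau, x)) \<in> borel_measurable lborel"
   using fubini(4)[OF i] by (rule borel_measurable_integrable)
  show "AE x in lborel. A x \<bullet> TI h s t x = (LBINT tau. (ind {s..t} (fst (tau, x)) *R A (snd (tau, x))) \<bullet> h (tau, x))"
   using sq_int_slices(2)[OF h]
  proof eventually_elim
   case (elim x)
   have "A x \<bullet> TI h s t x = (LBINT tau. A x \<bullet> (ind {s..t} tau *R h (tau, x)))"
    unfolding TI_def using sq_int_interval_integrable[OF elim] by (simp add: integral_inner_right del: inner_scaleR_right)
   then show ?case by simp
  qed
 qed
 also have "\<dots> = (LBINT tau. (LBINT x. (ind {s..t} (fst (tau, x)) *R A (snd (tau, x))) \<bullet> h (tau, x)))"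
  using fubini(5,6)[OF i] by simp
 finally show "(LBINT x. A x \<bullet> TI h s t x) = (LBINT tau. ind {s..t} tau *R (LBINT x. A x \<bullet> h (tau, x)))"
  unfolding e .
qed

lemma indefinite_integral:
 fixes k :: "real => 'b::euclidean_space"
 assumes k: "sqL k"
 shows "continuous_on {a..b} (%s. LBINT tau. ind {a..s} tau *R k tau)"
  "a < s ==> isCont k s ==> ((%s. LBINT tau. ind {a..s} tau *R k tau) has_vector_derivative k s) (at s)"
proof -
 have e: "(%s. LBINT tau. ind {a..s} tau *R k tau) = (%s. integral {a..s} k)"
  by (intro ext interval_lebesgue_eq_integral(2) sq_int_interval_integrable k)
 have i: "k integrable_on {a..c}" for c by (intro interval_lebesgue_eq_integral(1) sq_int_interval_integrable k)
 show "continuous_on {a..b} (%s. LBINT tau. ind {a..s} tau *R k tau)"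
  unfolding e by (rule indefinite_integral_continuous_1[OF i])
 assume "a < s" "isCont k s"
 then have "((%u. integral {a..u} k) has_vector_derivative k s) (at s within ({a..s+1} - {}))"
  by (intro integral_has_vector_derivative_continuous_at i) (auto intro: continuous_at_imp_continuous_at_within)
 moreover have "at s within ({a..s+1} - {}) = at s"
  using \<open>a < s\<close> by (intro at_within_interior) auto
 ultimately show "((%s. LBINT tau. ind {a..s} tau *R k tau) has_vector_derivative k s) (at s)"
  unfolding e by simp
qed

lemma has_vector_derivative_half_norm_sq:
 fixes P :: "real => 'b::euclidean_space"
 assumes "(P has_vector_derivative P') (at s)"
 shows "((%s. (norm (P s))^2 / 2) has_vector_derivative (P s \<bullet> P')) (at s)"
proof -
 have "((%s. P s \<bullet> P s) has_derivative (%h. P s \<bullet> (h *R P') + (h *R P') \<bullet> P s)) (at s)"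
  using assms unfolding has_vector_derivative_def by (intro has_derivative_inner)
 then have "((%s. (P s \<bullet> P s) *R (1/2::real)) has_derivative (%h. (P s \<bullet> (h *R P') + (h *R P') \<bullet> P s) *R (1/2::real))) (at s)"
  by (rule has_derivative_scaleR_left)
 then show ?thesis unfolding has_vector_derivative_def power2_norm_eq_inner
  by (simp add: inner_commute)
qed

text \<open>Fubini reduces the claim to the fundamental theorem on almost every line of constant
  \<open>x\<close>. All energy identities below are obtained in this way, without differentiating
  under an integral sign.\<close>

lemma integral_FTC:
 fixes y R :: "real \<times> 'a::euclidean_space => real"
 assumes st: "s \<le> t" and i: "intL (%z. ind {s..t} (fst z) *R R z)"
  and c: "AE x in lborel. continuous_on {s..t} (%tau. y (tau, x))"
  and d: "AE x in lborel. \<forall>tau. s < tau --> tau < t --> ((%tau. y (tau, x)) has_vector_derivative R (tau, x)) (at tau)"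
  and y: "intL (%x. y (t, x))" "intL (%x. y (s, x))"
 shows "(LBINT tau. ind {s..t} tau *R (LBINT x. R (tau, x))) = (LBINT x. y (t, x)) - (LBINT x. y (s, x))"
proof -
 have "(LBINT tau. ind {s..t} tau *R (LBINT x. R (tau, x))) = (LBINT tau. (LBINT x. ind {s..t} (fst (tau, x)) *R R (tau, x)))"
  by simp
 also have "\<dots> = (LBINT x. (LBINT tau. ind {s..t} (fst (tau, x)) *R R (tau, x)))" using fubini(5,6)[OF i] by simp
 also have "\<dots> = (LBINT x. y (t, x) - y (s, x))"
 proof (rule integral_cong_AE)
  show "(%x. LBINT tau. ind {s..t} (fst (tau, x)) *R R (tau, x)) \<in> borel_measurable lborel"
   using fubini(4)[OF i] by (rule borel_measurable_integrable)
  show "(%x. y (t, x) - y (s, x)) \<in> borel_measurable lborel"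
   using y by (intro borel_measurable_diff borel_measurable_integrable)
  show "AE x in lborel. (LBINT tau. ind {s..t} (fst (tau, x)) *R R (tau, x)) = y (t, x) - y (s, x)"
   using fubini(2)[OF i] c d unfolding fst_conv by eventually_elim (rule FTC_interior[OF st], auto)
 qed
 finally show ?thesis using y by simp
qed

lemma energy_identity:
 fixes P P' :: "real \<times> 'a::euclidean_space => 'b::euclidean_space"
 assumes t: "0 \<le> t"
  and i: "intL (%z. ind {0..t} (fst z) *R (P z \<bullet> P' z))"
  and c: "AE x in lborel. continuous_on {0..t} (%s. P (s, x))"
  and d: "AE x in lborel. \<forall>s. 0 < s --> s < t --> ((%s. P (s, x)) has_vector_derivative P' (s, x)) (at s)"
  and P: "sqL (%x. P (t, x))" "sqL (%x. P (0, x))"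
 shows "(LBINT s. ind {0..t} s *R (LBINT x. P (s, x) \<bullet> P' (s, x)))
  = (LBINT x. (norm (P (t, x)))^2) / 2 - (LBINT x. (norm (P (0, x)))^2) / 2"
proof -
 have "AE x in lborel. continuous_on {0..t} (%s. (norm (P (s, x)))^2 / 2)"
  using c by eventually_elim (intro continuous_intros, auto)
 moreover have "AE x in lborel. \<forall>s. 0 < s --> s < t --> ((%s. (norm (P (s, x)))^2 / 2) has_vector_derivative P (s, x) \<bullet> P' (s, x)) (at s)"
  using d by eventually_elim (intro allI impI has_vector_derivative_half_norm_sq, simp)
 ultimately show ?thesis
  using integral_FTC[OF t i, where y = "%z. (norm (P z))^2 / 2"] sq_int_integrable[OF P(1)] sq_int_integrable[OF P(2)] by simp
qed

section \<open>Gradients and functions with zero boundary values\<close>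

definition grad :: "(real ^ 'd => 'b::euclidean_space) => real ^ 'd => 'b ^ 'd" where
 "grad phi x = (\<chi> i. pderiv_dir (axis i 1) phi x)"

lemma borel_measurable_vec:
 fixes f :: "'i::finite => 'a => 'b::euclidean_space"
 assumes "\<And>i. f i \<in> borel_measurable M"
 shows "(%x. \<chi> i. f i x) \<in> borel_measurable M"
 unfolding borel_measurable_euclidean_space[of "%x. \<chi> i. f i x"]
 using assms by (auto simp: Basis_vec_def inner_axis intro: borel_measurable_inner)

lemma norm_vec_sq: "(norm (a :: 'b::euclidean_space ^ 'i::finite))^2 = (\<Sum>i\<in>UNIV. (norm (a $ i))^2)"
 by (simp add: norm_vec_def L2_set_def sum_nonneg)

lemma sq_int_vec:
 fixes f :: "'i::finite => 'a => 'b::euclidean_space"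
 assumes "\<And>i. sq_int M (f i)"
 shows "sq_int M (%x. \<chi> i. f i x)"
 unfolding sq_int_def using assms
 by (auto simp: norm_vec_sq sq_int_def intro!: borel_measurable_vec)

lemma sq_int_vec_nth:
 fixes f :: "'a => 'b::euclidean_space ^ 'i::finite"
 assumes "sq_int M f" shows "sq_int M (%x. f x $ i)"
proof (rule sq_int_bound[OF assms, where c = 1])
 show "(%x. f x $ i) \<in> borel_measurable M"
  by (rule measurable_compose[OF sq_int_measurable[OF assms] borel_measurable_continuous_onI]) (intro continuous_intros)
qed (simp add: Finite_Cartesian_Product.norm_nth_le)

lemma C1c_grad_sq_int: "phi \<in> C1c S ==> sqL (grad phi)"
 unfolding grad_def[abs_def] by (intro sq_int_vec C1c_sq_int)

text \<open>A pair of a function and its gradient, so that no weak derivative has to be chosen. The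
  approximants need only belong to \<open>C1c\<close>, which admits fields obtained from the flow by
  the C1 map \<open>penG\<close>.\<close>

definition H10 :: "(real ^ 'd => 'b::euclidean_space) => (real ^ 'd => 'b ^ 'd) => bool" where
 "H10 f g \<longleftrightarrow> sqL f \<and> sqL g \<and>
  (\<exists>phi. (\<forall>n::nat. phi n \<in> C1c unit_ball) \<and> (%n. nrm (%x. phi n x - f x)) ----> 0 \<and>
   (%n. nrm (%x. grad (phi n) x - g x)) ----> 0)"

lemma pderiv_dir_diff:
 assumes "f differentiable (at x)" "g differentiable (at x)"
 shows "pderiv_dir v (%x. f x - g x) x = pderiv_dir v f x - pderiv_dir v g x"
 by (rule pderiv_dir_eq[OF has_derivative_diff[OF assms[THEN pderiv_dir_has_derivative]]])

lemma C1c_diff: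
 assumes "f \<in> C1c S" "g \<in> C1c S" shows "(%x. f x - g x) \<in> C1c S"
proof -
 obtain K L where "compact K" "K \<subseteq> S" "\<forall>x. x \<notin> K --> f x = 0" "compact L" "L \<subseteq> S" "\<forall>x. x \<notin> L --> g x = 0"
  using assms unfolding C1c_def by blast
 then have "compact (K \<union> L)" "K \<union> L \<subseteq> S" "\<forall>x. x \<notin> K \<union> L --> f x - g x = 0" by auto
 moreover have "Ck_on (Suc 0) UNIV (%x. f x - g x)"
  using assms unfolding C1c_def by (intro Ck_on_diff) auto
 ultimately show ?thesis unfolding C1c_def by blast
qed

lemma grad_diff:
 assumes "f differentiable (at x)" "g differentiable (at x)"
 shows "grad (%x. f x - g x) x = grad f x - grad g x"
 unfolding grad_def by (simp add: vec_eq_iff pderiv_dir_diff[OF assms])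

lemma l2n_diff_diff_tendsto:
 assumes "\<And>n::nat. sq_int M (a n)" "sq_int M b" "\<And>n. sq_int M (c n)" "sq_int M d"
  and "(%n. l2n M (%x. a n x - b x)) ----> 0" "(%n. l2n M (%x. c n x - d x)) ----> 0"
 shows "(%n. l2n M (%x. (a n x - c n x) - (b x - d x))) ----> 0"
proof (rule tendsto_sandwich[OF _ _ tendsto_const])
 show "(%n. l2n M (%x. a n x - b x) + l2n M (%x. c n x - d x)) ----> 0"
  using tendsto_add[OF assms(5,6)] by simp
 show "\<forall>\<^sub>F n in sequentially. l2n M (%x. (a n x - c n x) - (b x - d x)) \<le> l2n M (%x. a n x - b x) + l2n M (%x. c n x - d x)"
 proof (intro always_eventually allI)
  fix n
  show "l2n M (%x. (a n x - c n x) - (b x - d x)) \<le> l2n M (%x. a n x - b x) + l2n M (%x. c n x - d x)"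
   using l2n_diff_triangle[OF sq_int_diff[OF assms(1)[of n] assms(2)] sq_int_diff[OF assms(3)[of n] assms(4)]]
   by (simp add: algebra_simps)
 qed
qed simp

lemma H10_diff:
 assumes "H10 f g" "H10 f' g'"
 shows "H10 (%x. f x - f' x) (%x. g x - g' x)"
proof -
 obtain phi where phi: "\<And>n::nat. phi n \<in> C1c unit_ball" "(%n. nrm (%x. phi n x - f x)) ----> 0"
   "(%n. nrm (%x. grad (phi n) x - g x)) ----> 0" using assms(1) by (auto simp: H10_def)
 obtain psi where psi: "\<And>n::nat. psi n \<in> C1c unit_ball" "(%n. nrm (%x. psi n x - f' x)) ----> 0"
   "(%n. nrm (%x. grad (psi n) x - g' x)) ----> 0" using assms(2) by (auto simp: H10_def)
 have s: "sqL f" "sqL g" "sqL f'" "sqL g'" using assms by (auto simp: H10_def)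
 have g: "grad (%x. phi n x - psi n x) x = grad (phi n) x - grad (psi n) x" for n x
  by (intro grad_diff C1c_differentiable[OF phi(1)] C1c_differentiable[OF psi(1)])
 show ?thesis unfolding H10_def
 proof (intro conjI exI[of _ "%n x. phi n x - psi n x"] allI sq_int_diff s C1c_diff phi(1) psi(1))
  show "(%n. nrm (%x. phi n x - psi n x - (f x - f' x))) ----> 0"
   by (intro l2n_diff_diff_tendsto s phi(2) psi(2) C1c_sq_int(1)[OF phi(1)] C1c_sq_int(1)[OF psi(1)])
  show "(%n. nrm (%x. grad (%x. phi n x - psi n x) x - (g x - g' x))) ----> 0"
   unfolding g by (intro l2n_diff_diff_tendsto s phi(3) psi(3) C1c_grad_sq_int[OF phi(1)] C1c_grad_sq_int[OF psi(1)])
 qed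
qed

lemma AE_snd_lborel:
 assumes "AE x in (lborel :: 'a::euclidean_space measure). Q x"
 shows "AE z in (lborel :: (real \<times> 'a) measure). Q (snd z)"
proof -
 obtain N where N: "N \<in> null_sets (lborel :: 'a measure)" "{x. \<not> Q x} \<subseteq> N"
  using assms by (auto simp: eventually_ae_filter)
 have "UNIV \<times> N \<in> null_sets ((lborel :: real measure) \<Otimes>\<^sub>M (lborel :: 'a measure))"
  by (rule lborel.times_in_null_sets2[OF _ N(1)]) simp
 then have "UNIV \<times> N \<in> null_sets (lborel :: (real \<times> 'a) measure)" by (simp add: lborel_prod)
 then show ?thesis using N(2) by (intro AE_I') auto
qed

text \<open>Cauchy-Schwarz in time bounds the primitive at \<open>x\<close> by
  \<open>sqrt (t + c) * H x\<close>, where \<open>H x\<close> is the norm of the whole line through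
  \<open>x\<close>; by Fubini \<open>H\<close> is square integrable. The shift \<open>c\<close>
  serves increments of primitives.\<close>

lemma sq_int_TI_joint:
 fixes h :: "real \<times> 'a::euclidean_space => 'b::euclidean_space"
 assumes h: "sqL h" and c: "0 \<le> c" and t: "0 \<le> t"
 shows "sqL (%z. ind {0..t} (fst z) *R TI h 0 (fst z + c) (snd z))"
proof -
 have hm: "h \<in> BM" using sq_int_measurable[OF h] by simp
 define H where "H x = sqrt (LBINT tau. (norm (h (tau, x)))^2)" for x
 have H2: "(H x)^2 = (LBINT tau. (norm (h (tau, x)))^2)" for x by (simp add: H_def)
 have Hs: "sqL H"
  unfolding sq_int_def using fubini(4)[OF sq_int_integrable[OF h]] by (auto simp: H2 H_def[abs_def])
 show ?thesis
 proof (rule sq_int_bound[OF sq_int_tensor[OF Hs, of 0 t], where c = "sqrt (t + c)"])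
  have [measurable]: "(%z. TI h 0 (fst z + c) (snd z)) \<in> borel_measurable (borel \<Otimes>\<^sub>M borel)"
   by (rule TI_measurable[OF hm]) measurable
  have "(%z. ind {0..t} (fst z) *R TI h 0 (fst z + c) (snd z)) \<in> borel_measurable (borel \<Otimes>\<^sub>M borel)"
   by measurable
  then show "(%z. ind {0..t} (fst z) *R TI h 0 (fst z + c) (snd z)) \<in> borel_measurable lborel"
   by (simp add: borel_prod)
  have "AE z in (lborel :: (real \<times> 'a) measure). sqL (%tau. h (tau, snd z))" using AE_snd_lborel[OF sq_int_slices(2)[OF h]] by simp
  then show "AE z in lborel. norm (ind {0..t} (fst z) *R TI h 0 (fst z + c) (snd z)) \<le> sqrt (t + c) * norm (ind {0..t} (fst z) *R H (snd z))"
  proof eventually_elim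
   case (elim z)
   obtain s x where z: "z = (s, x)" by (cases z)
   show ?case
   proof (cases "s \<in> {0..t}")
    case True
    have "(norm (TI h 0 (s + c) x))^2 \<le> (s + c - 0) * (LBINT tau. ind {0..s + c} tau *R (norm (h (tau, x)))^2)"
     unfolding TI_def by (rule interval_integral_sq_bound) (use True c elim z in auto)
    also have "\<dots> \<le> (t + c) * (LBINT tau. (norm (h (tau, x)))^2)"
    proof (intro mult_mono integral_mono)
     have sx: "intL (%tau. (norm (h (tau, x)))^2)" using sq_int_integrable[OF elim] z by simp
     then show "intL (%tau. (norm (h (tau, x)))^2)" .
     show "intL (%tau. ind {0..s + c} tau *R (norm (h (tau, x)))^2)"
      by (rule integrable_mult_indicator[OF _ sx]) simp
    qed (use True c in "auto simp: indicator_def")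
    also have "\<dots> = (sqrt (t + c) * H x)^2" using t c by (simp add: power_mult_distrib H2)
    finally have "norm (TI h 0 (s + c) x) \<le> sqrt (t + c) * H x"
     by (rule power2_le_imp_le) (use t c in "auto simp: H_def")
    then show ?thesis using True z by (simp add: H_def)
   qed (use z in simp)
  qed
 qed
qed

lemma TI_trivial: "TI h s s x = 0"
proof -
 have "(LBINT tau. ind {s..s} tau *R h (tau, x)) = (\<integral>tau. 0 \<partial>(lborel :: real measure))"
 proof (rule integral_cong_AE)
  have "(%tau. ind {s..s} tau *R h (tau, x)) = (%tau. if tau = s then h (s, x) else 0)"
   by (auto simp: fun_eq_iff indicator_def)
  then show "(%tau. ind {s..s} tau *R h (tau, x)) \<in> borel_measurable lborel" by simp
  show "AE tau in lborel. ind {s..s} tau *R h (tau, x) = 0"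
   using AE_lborel_singleton[of s] by eventually_elim (auto simp: indicator_def)
 qed simp
 then show ?thesis by (simp add: TI_def)
qed

section \<open>Weak heat flows with a bounded zero-order term, and their equation integrated from
  time 0\<close>

lemma unit_ball_finite: "emeasure lborel (unit_ball :: 'a::euclidean_space set) < \<infinity>"
 by (rule emeasure_bounded_finite[OF bounded_ball])

lemma cylinder_open: "open (cylinder T)"
 unfolding cylinder_def by (intro open_Times) auto

lemma cylinder_finite: "emeasure lborel (cylinder T :: (real \<times> 'a::euclidean_space) set) < \<infinity>"
proof -
 have "bounded (cylinder T :: (real \<times> 'a) set)"
  unfolding cylinder_def by (intro bounded_Times bounded_ball) (rule bounded_subset[OF bounded_closed_interval[of 0 T]], auto)
 then show ?thesis using emeasure_bounded_finite by (auto simp: less_top)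
qed

text \<open>\<open>p\<close>, \<open>g\<close> and \<open>f\<close> stand for the time derivative,
  the spatial gradient and the nonlinear term of \<open>u\<close>, all extended by 0 outside the
  cylinder; \<open>v0\<close> and \<open>g0\<close> represent the data and their gradient. Here
  \<open>f\<close> is just a bounded continuous function. Square integrability is assumed for
  \<open>u\<close> and \<open>g\<close> only; for \<open>p\<close> it is derived in
  \<open>sq_p\<close>.\<close>

locale heat_flow =
 fixes T Mf :: real and u p f :: "real \<times> (real ^ 'd) => 'b::euclidean_space"
  and g :: "real \<times> (real ^ 'd) => 'b ^ 'd" and v0 :: "real ^ 'd => 'b" and g0 :: "real ^ 'd => 'b ^ 'd"
 assumes T: "0 < T"
  and meas: "u \<in> BM" "p \<in> BM" "f \<in> BM" "g \<in> BM"
  and outside: "z \<notin> cylinder T ==> u z = 0" "z \<notin> cylinder T ==> p z = 0" "z \<notin> cylinder T ==> f z = 0" "z \<notin> cylinder T ==> g z = 0"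
  and cont: "continuous_on (cylinder T) u" "continuous_on (cylinder T) p" "continuous_on (cylinder T) f" "continuous_on (cylinder T) g"
  and der: "(t, x) \<in> cylinder T ==> ((%s. u (s, x)) has_vector_derivative p (t, x)) (at t)"
  and weak: "0 < t ==> t < T ==> psi \<in> C1c unit_ball ==>
   (LBINT x. p (t, x) \<bullet> psi x + g (t, x) \<bullet> grad psi x + f (t, x) \<bullet> psi x) = 0"
  and sq: "sqL u" "sqL g"
  and f_bound: "norm (f z) \<le> Mf"
  and v0: "sqL v0" "sqL g0" "x \<notin> unit_ball ==> v0 x = 0"
  and bdry: "AE t in lborel. 0 < t --> t < T --> H10 (%x. u (t, x) - v0 x) (%x. g (t, x) - g0 x)"
  and init: "((%t. nrm (%x. u (t, x) - v0 x)) \<longlongrightarrow> 0) (at_right 0)"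
   "\<forall>\<^sub>F t in at_right 0. sqL (%x. u (t, x) - v0 x)"
begin

lemma cyl_mem: "(t, x) \<in> cylinder T \<longleftrightarrow> 0 < t \<and> t < T \<and> x \<in> unit_ball"
 by (auto simp: cylinder_def)

lemma cyl_borel [measurable]: "cylinder T \<in> sets (borel :: 'd spacetime measure)"
 using cylinder_open by (rule borel_open)

lemma Mf_nonneg: "0 \<le> Mf"
 using f_bound[of undefined] norm_ge_zero[of "f undefined"] by linarith

lemma slice_meas: "(%x. u (t, x)) \<in> BM" "(%x. p (t, x)) \<in> BM"
 "(%x. f (t, x)) \<in> BM" "(%x. g (t, x)) \<in> BM"
 by (intro borel_measurable_pairI[OF meas(1)] borel_measurable_pairI[OF meas(2)] borel_measurable_pairI[OF meas(3)]
   borel_measurable_pairI[OF meas(4)]; simp)+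

lemma sq_int_const_on:
 fixes A :: "'c::euclidean_space set" and k :: "'c => 'e::euclidean_space"
 assumes "A \<in> sets borel" "emeasure lborel A < \<infinity>" "k \<in> BM" "\<And>z. norm (k z) \<le> C * ind A z"
 shows "sqL k" "(LBINT z. (norm (k z))^2) \<le> C^2 * measure lborel A"
proof -
 have i: "intL (%z. C^2 * ind A z :: real)"
  using assms by (intro integrable_mult_right integrable_real_indicator) auto
 have b: "(norm (k z))^2 \<le> C^2 * ind A z" for z
  using power_mono[OF assms(4)[of z], of 2] by (auto simp: indicator_def)
 have k: "intL (%z. (norm (k z))^2)"
 proof (rule integrable_bound[OF i])
  show "(%z. (norm (k z))^2) \<in> borel_measurable lborel" using assms(3) by measurable
  show "AE z in lborel. norm ((norm (k z))^2) \<le> norm (C^2 * ind A z :: real)"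
   using b by (auto simp: abs_of_nonneg)
 qed
 show "sqL k" using k assms(3) by (simp add: sq_int_def)
 have "(LBINT z. (norm (k z))^2) \<le> (LBINT z. C^2 * ind A z)"
  by (rule integral_mono[OF k i b])
 also have "\<dots> = C^2 * measure lborel A" using assms by simp
 finally show "(LBINT z. (norm (k z))^2) \<le> C^2 * measure lborel A" .
qed

lemma sq_f: "sqL f"
 by (rule sq_int_const_on(1)[OF cyl_borel cylinder_finite meas(3), of Mf])
   (use f_bound outside(3) in "auto simp: indicator_def")

lemma continuous_slice: "x \<in> unit_ball ==> 0 < t ==> t < T ==> continuous_on (cylinder T) (k :: _ => 'c::topological_space) ==> isCont (%s. k (s, x)) t"
proof -
 assume a: "x \<in> unit_ball" "0 < t" "t < T" "continuous_on (cylinder T) k"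
 have "continuous_on {0<..<T} (%s. k (s, x))"
  by (rule continuous_on_compose2[OF a(4)]) (use a in "auto intro!: continuous_intros simp: cyl_mem")
 then show "isCont (%s. k (s, x)) t" using a by (simp add: continuous_on_eq_continuous_at)
qed

text \<open>The supports in time and space keep \<open>{s..t} \<times> K\<close> a compact subset of
  the cylinder, where \<open>p\<close> is bounded by continuity. Integration in time then replaces
  \<open>p\<close> by an increment of \<open>u\<close>.\<close>

lemma weak_interval:
 assumes st: "0 < s" "s < t" "t < T" and psi: "psi \<in> C1c unit_ball"
 shows "(LBINT x. (u (t, x) - u (s, x)) \<bullet> psi x) + (LBINT x. grad psi x \<bullet> TI g s t x) + (LBINT x. psi x \<bullet> TI f s t x) = 0"
proof -
 obtain K where K: "compact K" "K \<subseteq> unit_ball" "\<And>x. x \<notin> K ==> psi x = 0" using C1c_support[OF psi] by metis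
 have sub: "{s..t} \<times> K \<subseteq> cylinder T" using st K by (auto simp: cylinder_def)
 have psic: "continuous_on UNIV psi" by (rule C1c_continuous[OF psi])
 let ?P = "%z. ind ({s..t} \<times> K) z *R (p z \<bullet> psi (snd z))"
 have Pi: "intL ?P"
 proof (rule borel_integrable_compact)
  show "compact ({s..t} \<times> K)" using K by (intro compact_Times) auto
  show "continuous_on ({s..t} \<times> K) (%z. p z \<bullet> psi (snd z))"
   by (intro continuous_intros continuous_on_subset[OF cont(2) sub] continuous_on_compose2[OF psic]) auto
 qed
 have Pe: "?P (tau, x) = ind {s..t} tau *R (p (tau, x) \<bullet> psi x)" for tau x
  using K(3)[of x] by (auto simp: indicator_def)
 have Pf: "?P = (%z. ind {s..t} (fst z) *R (p z \<bullet> psi (snd z)))" using Pe by auto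
 have upsi: "intL (%x. u (tau, x) \<bullet> psi x)" if "0 < tau" "tau < T" for tau
 proof -
  have "intL (%x. ind K x *R (u (tau, x) \<bullet> psi x))"
   by (rule borel_integrable_compact[OF K(1)])
     (use K that in "auto intro!: continuous_intros continuous_on_subset[OF psic] continuous_on_compose2[OF cont(1)] simp: cyl_mem")
  moreover have "(%x. ind K x *R (u (tau, x) \<bullet> psi x)) = (%x. u (tau, x) \<bullet> psi x)" using K(3) by (auto simp: fun_eq_iff indicator_def)
  ultimately show ?thesis by (simp only:)
 qed
 have vd: "((%tau. u (tau, x) \<bullet> psi x) has_vector_derivative p (tau, x) \<bullet> psi x) (at tau)" if "s \<le> tau" "tau \<le> t" for tau x
 proof (cases "x \<in> K")
  case True
  then have "((%tau. u (tau, x)) has_derivative (%h. h *R p (tau, x))) (at tau)"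
   using der[of tau x] K(2) that st by (auto simp: cyl_mem has_vector_derivative_def)
  from has_derivative_inner_left[OF this, of "psi x"] show ?thesis by (simp add: has_vector_derivative_def)
 qed (use K(3) in simp)
 have co: "continuous_on {s..t} (%tau. u (tau, x) \<bullet> psi x)" for x
  by (intro continuous_at_imp_continuous_on ballI has_vector_derivative_continuous[OF vd]) auto
 have 1: "(LBINT x. (u (t, x) - u (s, x)) \<bullet> psi x) = (LBINT tau. ind {s..t} tau *R (LBINT x. p (tau, x) \<bullet> psi x))"
  using integral_FTC[where y = "%z. u z \<bullet> psi (snd z)", OF less_imp_le[OF st(2)] Pi[unfolded Pf]] upsi st vd co
  by (simp add: inner_diff_left)
 have i1: "intL (%tau. ind {s..t} tau *R (LBINT x. p (tau, x) \<bullet> psi x))"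
  using fubini(3)[OF Pi] unfolding Pe by simp
 note 2 = inner_TI[OF sq(2) C1c_grad_sq_int[OF psi], of s t]
 note 3 = inner_TI[OF sq_f C1c_sq_int(1)[OF psi], of s t]
 have ae: "AE tau in lborel. ind {s..t} tau *R (LBINT x. p (tau, x) \<bullet> psi x)
   + ind {s..t} tau *R (LBINT x. grad psi x \<bullet> g (tau, x)) + ind {s..t} tau *R (LBINT x. psi x \<bullet> f (tau, x)) = 0"
  using fubini(1)[OF Pi] sq_int_slices(1)[OF sq(2)] sq_int_slices(1)[OF sq_f]
 proof eventually_elim
  case (elim tau)
  show ?case
  proof (cases "tau \<in> {s..t}")
   case True
   have a: "intL (%x. p (tau, x) \<bullet> psi x)" using elim(1) True unfolding Pe by simp
   have b: "intL (%x. g (tau, x) \<bullet> grad psi x)" "intL (%x. f (tau, x) \<bullet> psi x)"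
    by (intro sq_int_integrable_inner elim C1c_grad_sq_int[OF psi] C1c_sq_int(1)[OF psi])+
   show ?thesis using weak[of tau psi] True st psi a b by (simp add: inner_commute)
  qed simp
 qed
 have "(LBINT tau. ind {s..t} tau *R (LBINT x. p (tau, x) \<bullet> psi x)
   + ind {s..t} tau *R (LBINT x. grad psi x \<bullet> g (tau, x)) + ind {s..t} tau *R (LBINT x. psi x \<bullet> f (tau, x))) = 0"
  using integral_cong_AE[of _ lborel "%_. 0", OF _ _ ae] i1 2(1) 3(1) by simp
 then show ?thesis using i1 2 3 1 by simp
qed

text \<open>The times at which the boundary values are attained, almost all of the interval.
  Increments of \<open>u\<close> between two good times are admissible test functions, as the data
  cancel.\<close>

definition good :: "real => bool" where
 "good t \<longleftrightarrow> 0 < t \<and> t < T \<and> H10 (%x. u (t, x) - v0 x) (%x. g (t, x) - g0 x)"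

lemma AE_good: "AE t in lborel. 0 < t --> t < T --> good t"
 using bdry by eventually_elim (simp add: good_def)

lemma good_sq: "good t ==> sqL (%x. u (t, x) - v0 x)" "good t ==> sqL (%x. g (t, x) - g0 x)"
 "good t ==> sqL (%x. u (t, x))" "good t ==> sqL (%x. g (t, x))"
proof -
 assume "good t"
 then show a: "sqL (%x. u (t, x) - v0 x)" and b: "sqL (%x. g (t, x) - g0 x)"
  by (auto simp: good_def H10_def)
 show "sqL (%x. u (t, x))" using sq_int_add[OF a v0(1)] by simp
 show "sqL (%x. g (t, x))" using sq_int_add[OF b v0(2)] by simp
qed

abbreviation dev :: "real => real" where "dev t \<equiv> nrm (%x. u (t, x) - v0 x)"

lemma dev_small:
 assumes "0 < e" obtains b where "0 < b" "\<And>t. 0 < t ==> t < b ==> dev t < e"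
 using order_tendstoD(2)[OF init(1) assms] unfolding eventually_at_right_field by auto

lemma u_has_derivative:
 assumes "0 < t" "t < T"
 shows "((%s. u (s, x)) has_vector_derivative p (t, x)) (at t)"
proof (cases "x \<in> unit_ball")
 case True
 then show ?thesis using assms by (intro der) (simp add: cyl_mem)
next
 case False
 then have "(%s. u (s, x)) = (%_. 0)" "p (t, x) = 0" using outside by (auto simp: cylinder_def)
 then show ?thesis by simp
qed

lemma TI_0_tendsto:
 fixes h :: "'d spacetime => 'c::euclidean_space"
 assumes h: "sqL h" and s: "s ----> 0" "\<And>n. 0 < s n"
 shows "(%n. nrm (TI h 0 (s n))) ----> 0"
proof (rule tendsto_sandwich[OF _ _ tendsto_const])
 have "(%n. sqrt (s n * (nrm h)^2)) ----> sqrt (0 * (nrm h)^2)" by (intro tendsto_intros s)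
 then show "(%n. sqrt (s n * (nrm h)^2)) ----> 0" by simp
 show "\<forall>\<^sub>F n in sequentially. nrm (TI h 0 (s n)) \<le> sqrt (s n * (nrm h)^2)"
 proof (intro always_eventually allI real_le_rsqrt)
  fix n
  have "(nrm (TI h 0 (s n)))^2 \<le> (s n - 0) * (LBINT z. ind ({0..s n} \<times> UNIV) z *R (norm (h z))^2)"
   unfolding l2n_sq using s(2)[of n] by (intro sq_int_TI(2) h) auto
  also have "\<dots> \<le> s n * (nrm h)^2"
   unfolding l2n_sq using s(2)[of n] integrable_mult_indicator[OF _ sq_int_integrable[OF h], of "{0..s n} \<times> UNIV"] sq_int_integrable[OF h]
   by (intro mult_mono integral_mono) (auto simp: indicator_def)
  finally show "(nrm (TI h 0 (s n)))^2 \<le> s n * (nrm h)^2" .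
 qed
qed simp

text \<open>Let the lower limit in \<open>weak_interval\<close> tend to 0: \<open>u s\<close> tends
  to the data in \<open>L2\<close>, and the primitives over \<open>{0..s}\<close> tend to 0 since
  \<open>g\<close> and \<open>f\<close> are square integrable on space-time.\<close>

lemma weak_initial_C1c:
 assumes t: "good t" and psi: "psi \<in> C1c unit_ball"
 shows "(LBINT x. (u (t, x) - v0 x) \<bullet> psi x) + (LBINT x. TI g 0 t x \<bullet> grad psi x) + (LBINT x. TI f 0 t x \<bullet> psi x) = 0"
proof -
 have t0: "0 < t" "t < T" using t by (auto simp: good_def)
 \<comment> \<open>The summand 2 keeps \<open>s n\<close> strictly below \<open>t\<close> also for
   \<open>n = 0\<close>.\<close>
 define s where "s n = t / real (n + 2)" for n
 have s: "0 < s n" "s n < t" for n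
 proof -
  show "0 < s n" using t0 by (simp add: s_def)
  have "t * 1 < t * real (n + 2)" using t0 by (intro mult_strict_left_mono) auto
  then show "s n < t" by (simp add: s_def divide_less_eq)
 qed
 have s_lim: "s ----> 0" unfolding s_def
  by (rule LIMSEQ_ignore_initial_segment) (rule tendsto_divide_0[OF tendsto_const tendsto_of_nat])
 have sf: "filterlim s (at_right 0) sequentially"
 proof -
  have "s n \<noteq> 0" for n using s(1)[of n] by simp
  then show ?thesis unfolding filterlim_at using s_lim s(1) by (auto intro!: always_eventually)
 qed
 note psis = C1c_sq_int(1)[OF psi] and gs = C1c_grad_sq_int[OF psi]
 have ev: "\<forall>\<^sub>F n in sequentially. sqL (%x. u (s n, x) - v0 x)"
  using filterlim_iff[THEN iffD1, OF sf] init(2) by blast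
 have l0: "(%n. dev (s n)) ----> 0" by (rule filterlim_compose[OF init(1) sf])
 define X where "X = (LBINT x. (u (t, x) - v0 x) \<bullet> psi x)"
 define Y where "Y = (LBINT x. TI g 0 t x \<bullet> grad psi x)"
 define Z where "Z = (LBINT x. TI f 0 t x \<bullet> psi x)"
 have spl: "(LBINT x. k x \<bullet> TI h (s n) t x) = (LBINT x. TI h 0 t x \<bullet> k x) - (LBINT x. TI h 0 (s n) x \<bullet> k x)"
  if h: "sqL h" and k: "sqL k" for h :: "'d spacetime => 'c::euclidean_space" and k n
 proof -
  have "(LBINT x. k x \<bullet> TI h (s n) t x) = (LBINT x. TI h 0 t x \<bullet> k x - TI h 0 (s n) x \<bullet> k x)"
  proof (rule integral_cong_AE)
   have [measurable]: "TI h a b \<in> borel_measurable lborel" for a b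
    by (rule TI_measurable) (use sq_int_measurable[OF h] in auto)
   have [measurable]: "k \<in> borel_measurable lborel" using sq_int_measurable[OF k] .
   show "(%x. k x \<bullet> TI h (s n) t x) \<in> borel_measurable lborel"
    "(%x. TI h 0 t x \<bullet> k x - TI h 0 (s n) x \<bullet> k x) \<in> borel_measurable lborel" by measurable
   show "AE x in lborel. k x \<bullet> TI h (s n) t x = TI h 0 t x \<bullet> k x - TI h 0 (s n) x \<bullet> k x"
    using sq_int_slices(2)[OF h]
    by eventually_elim (use TI_split[of h _ 0 "s n" t] s[of n] in "simp add: inner_simps inner_commute")
  qed
  also have "\<dots> = (LBINT x. TI h 0 t x \<bullet> k x) - (LBINT x. TI h 0 (s n) x \<bullet> k x)"
   by (intro integral_diff sq_int_integrable_inner k sq_int_TI(1) h) (use s[of n] t0 in auto)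
  finally show ?thesis .
 qed
 let ?e = "%n. dev (s n) * nrm psi + nrm (TI g 0 (s n)) * nrm (grad psi)
  + nrm (TI f 0 (s n)) * nrm psi"
 have "?e ----> 0 * nrm psi + 0 * nrm (grad psi) + 0 * nrm psi"
  by (intro tendsto_intros l0 TI_0_tendsto sq(2) sq_f s_lim s(1))
 then have e0: "?e ----> 0" by simp
 have "\<forall>\<^sub>F n in sequentially. \<bar>X + Y + Z\<bar> \<le> ?e n"
  using ev
 proof eventually_elim
  case (elim n)
  have "(LBINT x. (u (t, x) - u (s n, x)) \<bullet> psi x) = (LBINT x. (u (t, x) - v0 x) \<bullet> psi x - (u (s n, x) - v0 x) \<bullet> psi x)"
   by (simp add: inner_diff_left)
  also have "\<dots> = X - (LBINT x. (u (s n, x) - v0 x) \<bullet> psi x)"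
   unfolding X_def by (intro integral_diff sq_int_integrable_inner elim good_sq(1)[OF t] psis)
  finally have "X + Y + Z = (LBINT x. (u (s n, x) - v0 x) \<bullet> psi x) + (LBINT x. TI g 0 (s n) x \<bullet> grad psi x)
   + (LBINT x. TI f 0 (s n) x \<bullet> psi x)"
   using weak_interval[OF s(1)[of n] s(2)[of n] t0(2) psi] spl[OF sq(2) gs, of n] spl[OF sq_f psis, of n]
   unfolding Y_def Z_def by linarith
  moreover have "\<bar>LBINT x. (u (s n, x) - v0 x) \<bullet> psi x\<bar> \<le> dev (s n) * nrm psi"
   by (rule l2n_Cauchy_Schwarz[OF elim psis])
  moreover have "\<bar>LBINT x. TI g 0 (s n) x \<bullet> grad psi x\<bar> \<le> nrm (TI g 0 (s n)) * nrm (grad psi)"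
   by (rule l2n_Cauchy_Schwarz[OF _ gs]) (rule sq_int_TI(1)[OF sq(2)], use s(1)[of n] in simp)
  moreover have "\<bar>LBINT x. TI f 0 (s n) x \<bullet> psi x\<bar> \<le> nrm (TI f 0 (s n)) * nrm psi"
   by (rule l2n_Cauchy_Schwarz[OF _ psis]) (rule sq_int_TI(1)[OF sq_f], use s(1)[of n] in simp)
  ultimately show ?case by linarith
 qed
 then have "\<bar>X + Y + Z\<bar> \<le> 0" by (intro tendsto_lowerbound[OF e0]) auto
 then show ?thesis unfolding X_def Y_def Z_def by simp
qed

text \<open>By density the integrated equation accepts every test function with zero boundary
  values. It contains no time derivative, so behaviour of \<open>p\<close> near the boundary does
  not enter.\<close>

lemma weak_initial:
 assumes t: "good t" and psi: "H10 psi \<Psi>"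
 shows "(LBINT x. (u (t, x) - v0 x) \<bullet> psi x) + (LBINT x. TI g 0 t x \<bullet> \<Psi> x) + (LBINT x. TI f 0 t x \<bullet> psi x) = 0"
proof -
 have t0: "0 \<le> t" using t by (auto simp: good_def)
 obtain phi where phi: "\<And>n::nat. phi n \<in> C1c unit_ball" "(%n. nrm (%x. phi n x - psi x)) ----> 0"
   "(%n. nrm (%x. grad (phi n) x - \<Psi> x)) ----> 0" and s: "sqL psi" "sqL \<Psi>"
  using psi by (auto simp: H10_def)
 have lim: "(%n. LBINT x. k x \<bullet> a n x) ----> (LBINT x. k x \<bullet> b x)"
  if "sqL k" "\<And>n. sqL (a n)" "sqL b" "(%n. nrm (%x. a n x - b x)) ----> 0"
  for k b :: "real ^ 'd => 'c::euclidean_space" and a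
  by (rule l2_inner_tendsto[OF that(1,1) _ that(2-4)]) (simp add: l2n_def)
 have "(%n. (LBINT x. (u (t, x) - v0 x) \<bullet> phi n x) + (LBINT x. TI g 0 t x \<bullet> grad (phi n) x) + (LBINT x. TI f 0 t x \<bullet> phi n x))
  ----> (LBINT x. (u (t, x) - v0 x) \<bullet> psi x) + (LBINT x. TI g 0 t x \<bullet> \<Psi> x) + (LBINT x. TI f 0 t x \<bullet> psi x)"
  by (intro tendsto_add lim good_sq(1)[OF t] sq_int_TI(1) sq(2) sq_f t0 s phi(2,3) C1c_sq_int(1)[OF phi(1)] C1c_grad_sq_int[OF phi(1)])
 then show ?thesis by (simp add: weak_initial_C1c[OF t phi(1)] LIMSEQ_const_iff)
qed

text \<open>The deviation from the data, cut off in time so that it is square integrable on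
  space-time.\<close>

definition w :: "'d spacetime => 'b" where
 "w z = u z - ind {0..T} (fst z) *R v0 (snd z)"

lemma w_eq: "0 < t ==> t < T ==> w (t, x) = u (t, x) - v0 x"
 by (simp add: w_def)

lemma sq_w: "sqL w"
 unfolding w_def[abs_def] by (intro sq_int_diff sq sq_int_tensor v0)

lemma w_zero: "x \<notin> unit_ball ==> w (t, x) = 0"
 using outside(1)[of "(t, x)"] v0(3)[of x] by (simp add: w_def cylinder_def)

lemma w_cont: "0 < t ==> t < T ==> isCont (%s. w (s, x)) t"
proof (cases "x \<in> unit_ball")
 case True
 assume t: "0 < t" "t < T"
 have "isCont (%s. u (s, x) - v0 x) t" using continuous_slice[OF True t cont(1)] by (intro continuous_intros)
 moreover have "\<forall>\<^sub>F s in nhds t. u (s, x) - v0 x = w (s, x)"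
  by (rule eventually_nhds_in_open[of "{0<..<T}" t, THEN eventually_mono]) (use t in "auto simp: w_eq")
 ultimately show ?thesis using isCont_cong[of "%s. u (s, x) - v0 x" "%s. w (s, x)" t] by simp
qed (simp add: w_zero)

lemma AE_not_null_interval: "0 < delta ==> AE h in lborel. 0 < h --> h < delta --> Q h ==> \<exists>h. 0 < h \<and> h < (delta::real) \<and> Q h"
proof (rule ccontr)
 assume d: "0 < delta" and ae: "AE h in lborel. 0 < h --> h < delta --> Q h" and n: "\<not> (\<exists>h. 0 < h \<and> h < delta \<and> Q h)"
 have "AE h in lborel. h \<notin> {0<..<delta}" using ae by eventually_elim (use n in auto)
 then have "emeasure lborel {0<..<delta} = 0" by (subst (asm) AE_iff_measurable[of "{0<..<delta}"]) auto
 then show False using d by simp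
qed

text \<open>The pairing of \<open>w s\<close> with its primitive \<open>TI w 0 s\<close> is the time
  derivative of half the squared norm of that primitive, which starts at 0. Its integral over
  \<open>{0..delta}\<close> is therefore nonnegative, so the pairing cannot be negative at almost
  every time.\<close>

lemma ex_nonneg_increment:
 assumes delta: "0 < delta" "delta < T"
 shows "\<exists>h. good h \<and> h < delta \<and> 0 \<le> (LBINT x. w (h, x) \<bullet> TI w 0 h x)"
proof (rule ccontr)
 assume n: "\<not> ?thesis"
 define c where "c s = (LBINT x. TI w 0 s x \<bullet> w (s, x))" for s
 have i: "intL (%z. ind {0..delta} (fst z) *R (TI w 0 (fst z) (snd z) \<bullet> w z))"
  using sq_int_integrable_inner[OF sq_int_TI_joint[OF sq_w, of 0 delta] sq_w] delta by simp
 have id: "(LBINT s. ind {0..delta} s *R (LBINT x. TI w 0 (fst (s, x)) (snd (s, x)) \<bullet> w (s, x)))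
  = (LBINT x. (norm (TI w 0 (fst (delta, x)) (snd (delta, x))))^2) / 2
   - (LBINT x. (norm (TI w 0 (fst (0::real, x)) (snd (0::real, x))))^2) / 2"
 proof (rule energy_identity[where P = "%z. TI w 0 (fst z) (snd z)"])
  show "AE x in lborel. continuous_on {0..delta} (%s. TI w 0 (fst (s, x)) (snd (s, x)))"
   using sq_int_slices(2)[OF sq_w] unfolding TI_def fst_conv snd_conv
   by eventually_elim (rule indefinite_integral(1))
  show "AE x in lborel. \<forall>s. 0 < s --> s < delta --> ((%s. TI w 0 (fst (s, x)) (snd (s, x))) has_vector_derivative w (s, x)) (at s)"
   using sq_int_slices(2)[OF sq_w] unfolding TI_def fst_conv snd_conv
   by eventually_elim (intro allI impI indefinite_integral(2) w_cont, use delta in auto)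
  have "sqL (TI w 0 delta)" by (rule sq_int_TI(1)[OF sq_w]) (use delta in simp)
  then show "sqL (%x. TI w 0 (fst (delta, x)) (snd (delta, x)))" by simp
 qed (use delta i in "auto simp: TI_trivial")
 have pos: "0 \<le> (LBINT s. ind {0..delta} s *R c s)"
  unfolding c_def id[unfolded fst_conv snd_conv TI_trivial] by simp
 have ci: "intL (%s. ind {0..delta} s *R c s)"
  using fubini(3)[OF i] unfolding fst_conv snd_conv by (simp add: c_def)
 have neg: "AE h in lborel. 0 < h --> h < delta --> c h < 0"
  using AE_good
 proof eventually_elim
  case (elim h)
  show ?case
  proof (intro impI)
   assume "0 < h" "h < delta"
   then have "good h" using elim delta by simp
   then have "\<not> 0 \<le> (LBINT x. w (h, x) \<bullet> TI w 0 h x)" using n \<open>h < delta\<close> by blast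
   then show "c h < 0" by (simp add: c_def inner_commute)
  qed
 qed
 have nn: "AE s in lborel. 0 \<le> - (ind {0..delta} s *R c s)"
  using neg AE_lborel_singleton[of 0] AE_lborel_singleton[of delta]
  by eventually_elim (auto simp: indicator_def)
 have "(LBINT s. - (ind {0..delta} s *R c s)) = 0"
  using pos integral_nonneg_AE[OF nn] by (simp add: antisym)
 then have "AE s in lborel. - (ind {0..delta} s *R c s) = 0"
  using integral_nonneg_eq_0_iff_AE[OF integrable_minus[OF ci] nn] by blast
 then have "AE s in lborel. 0 < s --> s < delta --> False"
  using neg by eventually_elim (auto simp: indicator_def)
 then show False using AE_not_null_interval[OF delta(1), of "%_. False"] by blast
qed

lemma TI_f_bound: "0 \<le> h ==> norm (TI f s (s + h) x) \<le> h * Mf * ind unit_ball x"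
proof (cases "x \<in> unit_ball")
 case True
 assume h: "0 \<le> h"
 have m: "(%tau. f (tau, x)) \<in> BM" by (rule borel_measurable_pairI[OF meas(3)]) auto
 have i: "intL (%tau. Mf * ind {s..s + h} tau :: real)" by (auto simp: emeasure_lborel_Icc_eq)
 have "norm (TI f s (s + h) x) \<le> (LBINT tau. norm (ind {s..s + h} tau *R f (tau, x)))"
  unfolding TI_def by (rule integral_norm_bound)
 also have "\<dots> \<le> (LBINT tau. Mf * ind {s..s + h} tau)"
 proof (rule integral_mono[OF _ i])
  show "intL (%tau. norm (ind {s..s + h} tau *R f (tau, x)))"
   by (rule integrable_bound[OF i]) (use m f_bound Mf_nonneg in "auto simp: indicator_def")
 qed (use f_bound in "auto simp: indicator_def")
 also have "\<dots> = h * Mf" using h by simp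
 finally show ?thesis using True by simp
next
 case False
 assume "0 \<le> h"
 have "TI f s (s + h) x = 0" unfolding TI_def using False outside(3) by (simp add: cylinder_def)
 then show ?thesis using False by simp
qed

definition cB :: real where "cB = measure lborel (unit_ball :: (real ^ 'd) set)"

lemma TI_f_sq: "0 \<le> h ==> (LBINT x. (norm (TI f s (s + h) x))^2) \<le> (h * Mf)^2 * cB"
 unfolding cB_def by (rule sq_int_const_on(2)[OF _ unit_ball_finite]) (auto intro!: TI_f_bound TI_measurable meas)

text \<open>The equation integrated up to \<open>h\<close> is tested with \<open>w tau\<close> and
  then integrated over \<open>tau\<close> in \<open>{0..h}\<close>. The gradient term becomes the
  squared norm of \<open>TI g 0 h\<close> minus \<open>h\<close> times its pairing with
  \<open>g0\<close>; the term in \<open>w\<close> is nonnegative by \<open>pos\<close> and is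
  dropped; the term in \<open>f\<close> is at most \<open>h^2\<close> times
  \<open>Mf * sqrt cB * S\<close>. Half of the squared norm is absorbed by Young's inequality. So
  the time average of the gradient is asymptotically no larger than the gradient of the
  data.\<close>

lemma avg_grad_estimate:
 assumes h: "good h" "h < delta" and S: "\<And>tau. 0 < tau ==> tau < delta ==> dev tau \<le> S"
  and pos: "0 \<le> (LBINT x. w (h, x) \<bullet> TI w 0 h x)"
 shows "(nrm (TI g 0 h))^2 \<le> h^2 * ((nrm g0)^2 + 2 * (Mf * sqrt cB) * S)"
proof -
 have h0: "0 < h" "h < T" using h by (auto simp: good_def)
 have wh: "sqL (%x. w (h, x))" using good_sq(1)[OF h(1)] by (simp add: w_eq h0)
 have sG: "sqL (TI g 0 h)" and sF: "sqL (TI f 0 h)" and sW: "sqL (TI w 0 h)"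
  using h0 by (auto intro!: sq_int_TI(1) sq sq_f sq_w)
 have S0: "0 \<le> S" using S[of h] h h0 l2n_nonneg by (meson order_trans)
 note 1 = inner_TI[OF sq_w wh, of 0 h] and 2 = inner_TI[OF sq(2) sG, of 0 h] and 3 = inner_TI[OF sq_w sF, of 0 h]
 let ?q = "LBINT x. TI g 0 h x \<bullet> g0 x"
 have i0: "intL (%tau. ind {0..h} tau *R ?q)"
  by (auto simp: emeasure_lborel_Icc_eq intro!: integrable_mult_left)
 have ae: "AE tau in lborel. ind {0..h} tau *R (LBINT x. w (h, x) \<bullet> w (tau, x))
   + (ind {0..h} tau *R (LBINT x. TI g 0 h x \<bullet> g (tau, x)) - ind {0..h} tau *R ?q)
   + ind {0..h} tau *R (LBINT x. TI f 0 h x \<bullet> w (tau, x)) = 0"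
  using AE_good AE_lborel_singleton[of 0]
 proof eventually_elim
  case (elim tau)
  show ?case
  proof (cases "tau \<in> {0..h}")
   case True
   then have tau: "0 < tau" "tau < T" "good tau" using elim h0 by auto
   then have "H10 (%x. u (tau, x) - v0 x) (%x. g (tau, x) - g0 x)" by (simp add: good_def)
   from weak_initial[OF h(1) this] have "(LBINT x. w (h, x) \<bullet> w (tau, x)) + (LBINT x. TI g 0 h x \<bullet> (g (tau, x) - g0 x))
     + (LBINT x. TI f 0 h x \<bullet> w (tau, x)) = 0"
    by (simp add: w_eq h0 tau)
   moreover have "(LBINT x. TI g 0 h x \<bullet> (g (tau, x) - g0 x)) = (LBINT x. TI g 0 h x \<bullet> g (tau, x)) - ?q"
    unfolding inner_diff_right by (intro integral_diff sq_int_integrable_inner sG v0 good_sq(4)[OF tau(3)])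
   ultimately show ?thesis using True by simp
  qed simp
 qed
 have "(LBINT tau. ind {0..h} tau *R (LBINT x. w (h, x) \<bullet> w (tau, x))
   + (ind {0..h} tau *R (LBINT x. TI g 0 h x \<bullet> g (tau, x)) - ind {0..h} tau *R ?q)
   + ind {0..h} tau *R (LBINT x. TI f 0 h x \<bullet> w (tau, x))) = 0"
  using integral_cong_AE[of _ lborel "%_. 0", OF _ _ ae] 1(1) 2(1) 3(1) i0 by simp
 then have "(LBINT x. w (h, x) \<bullet> TI w 0 h x) + ((LBINT x. TI g 0 h x \<bullet> TI g 0 h x) - h * ?q) + (LBINT x. TI f 0 h x \<bullet> TI w 0 h x) = 0"
  using 1 2 3 i0 h0 by simp
 moreover have "(LBINT x. TI g 0 h x \<bullet> TI g 0 h x) = (nrm (TI g 0 h))^2" by (simp add: l2n_sq power2_norm_eq_inner)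
 ultimately have "(nrm (TI g 0 h))^2 \<le> h * ?q - (LBINT x. TI f 0 h x \<bullet> TI w 0 h x)" using pos by linarith
 moreover have "h * ?q \<le> (nrm (TI g 0 h))^2 / 2 + h^2 * (nrm g0)^2 / 2"
 proof -
  have "?q \<le> nrm (TI g 0 h) * nrm g0" using l2n_Cauchy_Schwarz[OF sG v0(2)] by linarith
  then have "h * ?q \<le> h * (nrm (TI g 0 h) * nrm g0)" using h0 by (intro mult_left_mono) auto
  also have "\<dots> \<le> (nrm (TI g 0 h))^2 / 2 + h^2 * (nrm g0)^2 / 2"
   using sum_squares_bound[of "nrm (TI g 0 h)" "h * nrm g0"] by (simp add: power_mult_distrib algebra_simps)
  finally show ?thesis .
 qed
 moreover have "\<bar>LBINT x. TI f 0 h x \<bullet> TI w 0 h x\<bar> \<le> (h * (Mf * sqrt cB)) * (h * S)"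
 proof -
  have F: "nrm (TI f 0 h) \<le> h * (Mf * sqrt cB)"
   unfolding l2n_def
  proof (rule real_le_lsqrt)
   show "(LBINT x. (norm (TI f 0 h x))^2) \<le> (h * (Mf * sqrt cB))^2"
    using TI_f_sq[of h 0] h0 by (simp add: power_mult_distrib cB_def)
  qed (use h0 Mf_nonneg in "auto simp: cB_def")
  have W: "nrm (TI w 0 h) \<le> h * S"
   unfolding l2n_def
  proof (rule real_le_lsqrt)
   have iw: "intL (%z. ind ({0..h} \<times> UNIV) z *R (norm (w z))^2)"
    by (rule integrable_mult_indicator[OF _ sq_int_integrable[OF sq_w]]) simp
   have e: "ind ({0..h} \<times> UNIV) (tau, x) *R (norm (w (tau, x)))^2 = ind {0..h} tau *R (norm (w (tau, x)))^2" for tau x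
    by (auto simp: indicator_def)
   have iS: "intL (%tau. ind {0..h} tau * S^2 :: real)"
    by (auto simp: emeasure_lborel_Icc_eq intro!: integrable_mult_left)
   have "(LBINT z. ind ({0..h} \<times> UNIV) z *R (norm (w z))^2) = (LBINT tau. (LBINT x. ind {0..h} tau *R (norm (w (tau, x)))^2))"
    using fubini(5)[OF iw] unfolding e by simp
   also have "\<dots> \<le> (LBINT tau. ind {0..h} tau * S^2)"
   proof (rule integral_mono_AE[OF _ iS])
    show "intL (%tau. LBINT x. ind {0..h} tau *R (norm (w (tau, x)))^2)" using fubini(3)[OF iw] unfolding e .
    show "AE tau in lborel. (LBINT x. ind {0..h} tau *R (norm (w (tau, x)))^2) \<le> ind {0..h} tau * S^2"
     using AE_lborel_singleton[of 0]
    proof eventually_elim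
     case (elim tau)
     show ?case
     proof (cases "tau \<in> {0..h}")
      case True
      then have tau: "0 < tau" "tau < delta" "tau < T" using elim h h0 by auto
      have "(LBINT x. (norm (w (tau, x)))^2) = (dev tau)^2" by (simp add: l2n_sq w_eq tau)
      also have "\<dots> \<le> S^2" using S[OF tau(1,2)] by (intro power_mono) auto
      finally show ?thesis using True by simp
     qed simp
    qed
   qed
   also have "\<dots> = h * S^2" using h0 by simp
   finally have "(LBINT x. (norm (TI w 0 h x))^2) \<le> (h - 0) * (h * S^2)"
    using sq_int_TI(2)[OF sq_w, of 0 h] h0 by (meson diff_ge_0_iff_ge less_imp_le mult_left_mono order_trans)
   then show "(LBINT x. (norm (TI w 0 h x))^2) \<le> (h * S)^2" by (simp add: power2_eq_square algebra_simps)
  qed (use h0 S0 in auto)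
  have "\<bar>LBINT x. TI f 0 h x \<bullet> TI w 0 h x\<bar> \<le> nrm (TI f 0 h) * nrm (TI w 0 h)" by (rule l2n_Cauchy_Schwarz[OF sF sW])
  also have "\<dots> \<le> (h * (Mf * sqrt cB)) * (h * S)"
   by (rule mult_mono[OF F W]) (use h0 Mf_nonneg in "auto simp: cB_def")
  finally show ?thesis .
 qed
 ultimately have "(nrm (TI g 0 h))^2 \<le> h^2 * (nrm g0)^2 + 2 * ((h * (Mf * sqrt cB)) * (h * S))" by linarith
 then show ?thesis by (simp add: power2_eq_square algebra_simps)
qed

text \<open>Step sizes for the later difference quotients. Each is taken below a
  \<open>delta\<close> on which the deviation from the data is less than \<open>1 / Suc j\<close>,
  which makes the error in \<open>avg_grad_estimate\<close> vanish.\<close>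

lemma avg_grad_sequence:
 assumes r: "0 < r" "r \<le> T"
 obtains h eps :: "nat => real" where "\<And>j. 0 < h j" "\<And>j. h j < r" "h ----> 0" "eps ----> 0"
  "\<And>j. (nrm (TI g 0 (h j)))^2 \<le> (h j)^2 * ((nrm g0)^2 + eps j)"
proof -
 have "\<exists>h. good h \<and> h < r \<and> h < 1 / real (Suc j) \<and> (nrm (TI g 0 h))^2 \<le> h^2 * ((nrm g0)^2 + 2 * (Mf * sqrt cB) * (1 / real (Suc j)))" for j
 proof -
  obtain b where b: "b > 0" "\<And>t. 0 < t ==> t < b ==> dev t < 1 / real (Suc j)"
   using dev_small[of "1 / real (Suc j)"] by auto
  define delta where "delta = min b (min (r / 2) (1 / real (Suc j)))"
  have delta: "0 < delta" "delta < r" "delta < T" "delta \<le> b" "delta \<le> 1 / real (Suc j)" using b r by (auto simp: delta_def)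
  obtain h where h: "good h" "h < delta" "0 \<le> (LBINT x. w (h, x) \<bullet> TI w 0 h x)"
   using ex_nonneg_increment[OF delta(1,3)] by blast
  have "(nrm (TI g 0 h))^2 \<le> h^2 * ((nrm g0)^2 + 2 * (Mf * sqrt cB) * (1 / real (Suc j)))"
  proof (rule avg_grad_estimate[OF h(1,2) _ h(3)])
   fix tau assume "0 < tau" "tau < delta"
   then show "dev tau \<le> 1 / real (Suc j)" using b(2)[of tau] delta(4) by simp
  qed
  then show ?thesis using h(1,2) delta(2,5) by (intro exI[of _ h]) auto
 qed
 then obtain h where h: "\<And>j. good (h j)" "\<And>j. h j < r" "\<And>j. h j < 1 / real (Suc j)"
   "\<And>j. (nrm (TI g 0 (h j)))^2 \<le> (h j)^2 * ((nrm g0)^2 + 2 * (Mf * sqrt cB) * (1 / real (Suc j)))" by metis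
 have l: "(%j. 1 / real (Suc j)) ----> 0" by (rule LIMSEQ_Suc[OF lim_1_over_n])
 show ?thesis
 proof (rule that[of h "%j. 2 * (Mf * sqrt cB) * (1 / real (Suc j))"])
  show hj: "0 < h j" "h j < r" for j using h(1,2)[of j] by (auto simp: good_def)
  show "h ----> 0"
  proof (rule tendsto_sandwich[OF _ _ tendsto_const l])
   show "\<forall>\<^sub>F j in sequentially. 0 \<le> h j" using hj(1) by (intro always_eventually allI less_imp_le)
   show "\<forall>\<^sub>F j in sequentially. h j \<le> 1 / real (Suc j)" using h(3) by (intro always_eventually allI less_imp_le)
  qed
  show "(%j. 2 * (Mf * sqrt cB) * (1 / real (Suc j))) ----> 0" using tendsto_mult_left[OF l, of "2 * (Mf * sqrt cB)"] by simp
 qed (use h in auto)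
qed

end

section \<open>Increments in time and square integrability of the time derivative\<close>

lemma has_vector_derivative_quotient_tendsto:
 fixes f :: "real => 'a::real_normed_vector"
 assumes "(f has_vector_derivative D) (at s)" and h: "h ----> 0" "\<And>n. h n \<noteq> 0"
 shows "(%n. (1 / h n) *R (f (s + h n) - f s)) ----> D"
proof -
 have "((%d. norm (f (s + d) - f s - d *R D) / norm d) \<longlongrightarrow> 0) (at 0)"
  using assms(1) unfolding has_vector_derivative_def has_derivative_at by blast
 moreover have "filterlim h (at 0) sequentially" using h by (simp add: filterlim_at)
 ultimately have "(%n. norm (f (s + h n) - f s - h n *R D) / norm (h n)) ----> 0"
  by (rule filterlim_compose)
 moreover have "norm (f (s + h n) - f s - h n *R D) / norm (h n) = norm ((1 / h n) *R (f (s + h n) - f s) - D)" for n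
 proof -
  have "(1 / h n) *R (f (s + h n) - f s) - D = (1 / h n) *R (f (s + h n) - f s - h n *R D)"
   using h(2)[of n] by (simp add: scaleR_diff_right)
  then show ?thesis by simp
 qed
 ultimately show ?thesis by (simp add: LIM_zero_iff tendsto_norm_zero_iff)
qed

context heat_flow
begin

text \<open>Increments over time \<open>h\<close> of \<open>u\<close> and \<open>g\<close>, and of
  the primitives of \<open>g\<close> and \<open>f\<close>. The point of the pair \<open>DG\<close>,
  \<open>Dg\<close> is that \<open>Dg\<close> is the time derivative of \<open>DG\<close>.\<close>

definition Du :: "real => 'd spacetime => 'b" where "Du h z = u ((h, 0) + z) - u z"
definition Dg :: "real => 'd spacetime => 'b ^ 'd" where "Dg h z = g ((h, 0) + z) - g z"
definition DG :: "real => 'd spacetime => 'b ^ 'd" where "DG h z = TI g 0 (fst z + h) (snd z) - TI g 0 (fst z) (snd z)"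
definition DF :: "real => 'd spacetime => 'b" where "DF h z = TI f 0 (fst z + h) (snd z) - TI f 0 (fst z) (snd z)"

lemma Du_simp: "Du h (s, x) = u (s + h, x) - u (s, x)" and Dg_simp: "Dg h (s, x) = g (s + h, x) - g (s, x)"
 by (simp_all add: Du_def Dg_def add.commute)

lemma sq_Du: "sqL (Du h)" and sq_Dg: "sqL (Dg h)"
 unfolding Du_def[abs_def] Dg_def[abs_def] by (intro sq_int_diff lborel_shift(1) sq)+

lemma sq_DG: "0 \<le> h ==> 0 \<le> t ==> sqL (%z. ind {0..t} (fst z) *R DG h z)"
 and sq_DF: "0 \<le> h ==> 0 \<le> t ==> sqL (%z. ind {0..t} (fst z) *R DF h z)"
 using sq_int_diff[OF sq_int_TI_joint[OF sq(2), of h t] sq_int_TI_joint[OF sq(2), of 0 t]]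
  sq_int_diff[OF sq_int_TI_joint[OF sq_f, of h t] sq_int_TI_joint[OF sq_f, of 0 t]]
 by (simp_all add: DG_def DF_def scaleR_diff_right)

lemma g_cont: "0 < t ==> t < T ==> isCont (%s. g (s, x)) t"
proof (cases "x \<in> unit_ball")
 case False
 then have "(%s. g (s, x)) = (%s. 0)" using outside(4) by (auto simp: cylinder_def)
 then show ?thesis by simp
qed (rule continuous_slice[OF _ _ _ cont(4)])

text \<open>Subtract the equations integrated up to \<open>s + h\<close> and up to \<open>s\<close>,
  both tested with the increment \<open>Du\<close>, which has zero boundary values.\<close>

lemma weak_increment:
 assumes "good s" "good (s + h)" "0 < h"
 shows "(LBINT x. (norm (Du h (s, x)))^2) + (LBINT x. DG h (s, x) \<bullet> Dg h (s, x)) + (LBINT x. DF h (s, x) \<bullet> Du h (s, x)) = 0"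
proof -
 have s0: "0 \<le> s" using assms by (auto simp: good_def)
 have H: "H10 (%x. Du h (s, x)) (%x. Dg h (s, x))"
  using H10_diff[of "%x. u (s + h, x) - v0 x" "%x. g (s + h, x) - g0 x" "%x. u (s, x) - v0 x" "%x. g (s, x) - g0 x"] assms
  by (simp add: good_def Du_simp Dg_simp)
 then have hs: "sqL (%x. Du h (s, x))" "sqL (%x. Dg h (s, x))" by (auto simp: H10_def)
 have ti: "sqL (TI g 0 s)" "sqL (TI g 0 (s + h))" "sqL (TI f 0 s)" "sqL (TI f 0 (s + h))"
  using s0 assms(3) by (auto intro!: sq_int_TI(1) sq sq_f)
 have "(LBINT x. (norm (Du h (s, x)))^2) = (LBINT x. (u (s + h, x) - v0 x) \<bullet> Du h (s, x) - (u (s, x) - v0 x) \<bullet> Du h (s, x))"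
  by (intro integral_cong) (auto simp: power2_norm_eq_inner Du_simp inner_simps)
 also have "\<dots> = (LBINT x. (u (s + h, x) - v0 x) \<bullet> Du h (s, x)) - (LBINT x. (u (s, x) - v0 x) \<bullet> Du h (s, x))"
  by (intro integral_diff sq_int_integrable_inner hs good_sq(1) assms)
 finally have 1: "(LBINT x. (norm (Du h (s, x)))^2) = (LBINT x. (u (s + h, x) - v0 x) \<bullet> Du h (s, x)) - (LBINT x. (u (s, x) - v0 x) \<bullet> Du h (s, x))" .
 have 2: "(LBINT x. DG h (s, x) \<bullet> Dg h (s, x)) = (LBINT x. TI g 0 (s + h) x \<bullet> Dg h (s, x)) - (LBINT x. TI g 0 s x \<bullet> Dg h (s, x))"
  unfolding DG_def fst_conv snd_conv inner_diff_left by (intro integral_diff sq_int_integrable_inner hs ti)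
 have 3: "(LBINT x. DF h (s, x) \<bullet> Du h (s, x)) = (LBINT x. TI f 0 (s + h) x \<bullet> Du h (s, x)) - (LBINT x. TI f 0 s x \<bullet> Du h (s, x))"
  unfolding DF_def fst_conv snd_conv inner_diff_left by (intro integral_diff sq_int_integrable_inner hs ti)
 show ?thesis using 1 2 3 weak_initial[OF assms(1) H] weak_initial[OF assms(2) H] by linarith
qed

text \<open>Integration of \<open>weak_increment\<close> over \<open>s\<close> in
  \<open>{0..t}\<close>. The middle term integrates to half the increment of the squared norm of
  \<open>DG\<close>, and at \<open>s = 0\<close> this \<open>DG\<close> is \<open>TI g 0 h\<close>:
  the whole contribution of the data sits in the initial layer.\<close>

lemma increment_energy:
 assumes h: "0 < h" and t: "0 < t" "t + h < T"
 shows "(LBINT z. (norm (ind {0..t} (fst z) *R Du h z))^2) + (LBINT x. (norm (DG h (t, x)))^2) / 2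
  + (LBINT z. (ind {0..t} (fst z) *R DF h z) \<bullet> Du h z) = (nrm (TI g 0 h))^2 / 2"
proof -
 have iD: "intL (%z. ind {0..t} (fst z) *R (norm (Du h z))^2)"
 proof -
  have "intL (%z. ind ({0..t} \<times> UNIV) z *R (norm (Du h z))^2)"
   by (rule integrable_mult_indicator[OF _ sq_int_integrable[OF sq_Du]]) simp
  then show ?thesis by (simp add: indicator_def mem_Times_iff)
 qed
 have iG: "intL (%z. ind {0..t} (fst z) *R (DG h z \<bullet> Dg h z))"
  using sq_int_integrable_inner[OF sq_DG[of h t] sq_Dg[of h]] h t by simp
 have iF: "intL (%z. ind {0..t} (fst z) *R (DF h z \<bullet> Du h z))"
  using sq_int_integrable_inner[OF sq_DF[of h t] sq_Du[of h]] h t by simp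
 have fb: "intL (%s. ind {0..t} s *R (LBINT x. k (s, x)))"
   "(LBINT s. ind {0..t} s *R (LBINT x. k (s, x))) = (LBINT z. ind {0..t} (fst z) *R k z)"
  if "intL (%z. ind {0..t} (fst z) *R k z)" for k :: "'d spacetime => real"
  using fubini(3,5)[OF that] by simp_all
 have ae: "AE s in lborel. ind {0..t} s *R (LBINT x. (norm (Du h (s, x)))^2)
   + ind {0..t} s *R (LBINT x. DG h (s, x) \<bullet> Dg h (s, x)) + ind {0..t} s *R (LBINT x. DF h (s, x) \<bullet> Du h (s, x)) = 0"
  using AE_good lborel_shift(4)[OF AE_good, of h] AE_lborel_singleton[of 0]
 proof eventually_elim
  case (elim s)
  show ?case
  proof (cases "s \<in> {0..t}")
   case True
   then have "good s" "good (s + h)" using elim h t by (auto simp: add.commute)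
   from weak_increment[OF this h] True show ?thesis by simp
  qed simp
 qed
 have "(LBINT s. ind {0..t} s *R (LBINT x. (norm (Du h (s, x)))^2)
   + ind {0..t} s *R (LBINT x. DG h (s, x) \<bullet> Dg h (s, x)) + ind {0..t} s *R (LBINT x. DF h (s, x) \<bullet> Du h (s, x))) = 0"
  using integral_cong_AE[of _ lborel "%_. 0", OF _ _ ae] fb(1)[OF iD] fb(1)[OF iG] fb(1)[OF iF] by simp
 then have sum: "(LBINT z. ind {0..t} (fst z) *R (norm (Du h z))^2) + (LBINT s. ind {0..t} s *R (LBINT x. DG h (s, x) \<bullet> Dg h (s, x)))
   + (LBINT z. ind {0..t} (fst z) *R (DF h z \<bullet> Du h z)) = 0"
  using fb(1)[OF iD] fb(1)[OF iG] fb(1)[OF iF] fb(2)[OF iD] fb(2)[OF iF] by simp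
 have "(LBINT s. ind {0..t} s *R (LBINT x. DG h (s, x) \<bullet> Dg h (s, x)))
  = (LBINT x. (norm (DG h (t, x)))^2) / 2 - (LBINT x. (norm (DG h (0, x)))^2) / 2"
 proof (rule energy_identity[OF _ iG])
  show "AE x in lborel. continuous_on {0..t} (%s. DG h (s, x))"
   using sq_int_slices(2)[OF sq(2)]
  proof eventually_elim
   case (elim x)
   have "continuous_on {0..t + h} (%s. TI g 0 s x)" unfolding TI_def by (rule indefinite_integral(1)[OF elim])
   then show ?case unfolding DG_def fst_conv snd_conv
    by (intro continuous_on_diff continuous_on_compose2[of "{0..t + h}" "%s. TI g 0 s x" _ "%s. s + h"]
      continuous_on_subset[of "{0..t + h}" "%s. TI g 0 s x" "{0..t}"]) (use h in "auto intro!: continuous_intros")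
  qed
  show "AE x in lborel. \<forall>s. 0 < s --> s < t --> ((%s. DG h (s, x)) has_vector_derivative Dg h (s, x)) (at s)"
   using sq_int_slices(2)[OF sq(2)]
  proof eventually_elim
   case (elim x)
   have d: "((%s. TI g 0 s x) has_vector_derivative g (s, x)) (at s)" if "0 < s" "s < T" for s
    unfolding TI_def by (rule indefinite_integral(2)[OF elim that(1) g_cont[OF that]])
   show ?case
   proof (intro allI impI)
    fix s assume s: "0 < s" "s < t"
    have "((%s. TI g 0 (s + h) x) has_vector_derivative g (s + h, x)) (at s)"
    proof -
     have "((%s. TI g 0 s x) has_derivative (%d. d *R g (s + h, x))) (at (s + h))"
      using d[of "s + h"] s h t by (simp add: has_vector_derivative_def)
     from has_derivative_compose[of "%s. s + h" "%d. d" s UNIV, OF _ this] show ?thesis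
      unfolding has_vector_derivative_def by (simp add: has_derivative_add_const)
    qed
    then show "((%s. DG h (s, x)) has_vector_derivative Dg h (s, x)) (at s)"
     unfolding DG_def Dg_simp fst_conv snd_conv using d[of s] s h t by (intro has_vector_derivative_diff) auto
   qed
  qed
  have "sqL (%x. TI g 0 (s + h) x - TI g 0 s x)" if "0 \<le> s" for s
   using that h by (intro sq_int_diff sq_int_TI(1) sq) auto
  from this[of t] this[of 0] show "sqL (%x. DG h (t, x))" "sqL (%x. DG h (0, x))"
   using t by (simp_all add: DG_def)
 qed (use t in simp)
 moreover have "(LBINT x. (norm (DG h (0, x)))^2) = (nrm (TI g 0 h))^2" by (simp add: DG_def TI_trivial l2n_sq)
 moreover have "(LBINT z. (norm (ind {0..t} (fst z) *R Du h z))^2) = (LBINT z. ind {0..t} (fst z) *R (norm (Du h z))^2)"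
  by (intro integral_cong) (auto simp: indicator_def)
 ultimately show ?thesis using sum by simp
qed

definition cQ :: real where "cQ = measure lborel ({0..T} \<times> cball 0 1 :: 'd spacetime set)"

lemma DF_eq: "AE z in lborel. 0 \<le> fst z --> 0 \<le> h --> DF h z = TI f (fst z) (fst z + h) (snd z)"
proof -
 have "AE z in (lborel :: 'd spacetime measure). sqL (%tau. f (tau, snd z))"
  using AE_snd_lborel[OF sq_int_slices(2)[OF sq_f]] by simp
 then show ?thesis
 proof eventually_elim
  case (elim z)
  show ?case using TI_split[of f "snd z" 0 "fst z" "fst z + h", OF elim] by (simp add: DF_def)
 qed
qed

lemma sq_int_DF_bound:
 assumes h: "0 \<le> h" and t: "0 \<le> t" "t \<le> T"
 shows "(LBINT z. (norm (ind {0..t} (fst z) *R DF h z))^2) \<le> h^2 * (Mf^2 * cQ)"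
proof -
 let ?k = "%z. ind {0..t} (fst z) *R TI f (fst z) (fst z + h) (snd z)"
 have [measurable]: "(%z. TI f (fst z) (fst z + h) (snd z)) \<in> borel_measurable (borel \<Otimes>\<^sub>M borel)"
  by (rule TI_measurable[OF meas(3)]) measurable
 have "?k \<in> borel_measurable (borel \<Otimes>\<^sub>M borel)" by measurable
 then have km: "?k \<in> BM" by (simp add: borel_prod)
 have "(LBINT z. (norm (ind {0..t} (fst z) *R DF h z))^2) = (LBINT z. (norm (?k z))^2)"
 proof (rule integral_cong_AE)
  show "(%z. (norm (ind {0..t} (fst z) *R DF h z))^2) \<in> borel_measurable lborel"
   using sq_int_integrable[OF sq_DF[OF h t(1)]] by (rule borel_measurable_integrable)
  show "(%z. (norm (?k z))^2) \<in> borel_measurable lborel" using km by measurable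
  show "AE z in lborel. (norm (ind {0..t} (fst z) *R DF h z))^2 = (norm (?k z))^2"
   using DF_eq[of h] by eventually_elim (use h in "auto simp: indicator_def")
 qed
 also have "\<dots> \<le> (h * Mf)^2 * measure lborel ({0..T} \<times> cball 0 1 :: 'd spacetime set)"
 proof (rule sq_int_const_on(2)[OF _ _ km])
  show "{0..T} \<times> cball 0 1 \<in> sets (borel :: 'd spacetime measure)" by (intro borel_closed closed_Times) auto
  show "emeasure lborel ({0..T} \<times> cball 0 1 :: 'd spacetime set) < \<infinity>"
   by (intro emeasure_bounded_finite bounded_Times) auto
  show "norm (?k z) \<le> h * Mf * ind ({0..T} \<times> cball 0 1) z" for z
  proof (cases "fst z \<in> {0..t}")
   case True
   have "norm (?k z) \<le> h * Mf * ind unit_ball (snd z)" using TI_f_bound[OF h, of "fst z" "snd z"] True by simp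
   also have "\<dots> \<le> h * Mf * ind ({0..T} \<times> cball 0 1) z"
    using True t h Mf_nonneg by (intro mult_left_mono) (auto simp: indicator_def mem_Times_iff)
   finally show ?thesis .
  qed (use h Mf_nonneg in simp)
 qed
 finally show ?thesis by (simp add: cQ_def power_mult_distrib mult.assoc)
qed

lemma Du_quotient_tendsto:
 assumes h: "h ----> 0" "\<And>n. h n \<noteq> 0" and z: "0 < fst z" "fst z < T"
 shows "(%n. (1 / h n) *R Du (h n) z) ----> p z"
 using has_vector_derivative_quotient_tendsto[OF u_has_derivative[OF z, of "snd z"] h] Du_simp[of _ "fst z" "snd z"] by simp

lemma indicator_fst_measurable [measurable]:
 "(%z. ind {s..t} (fst z) :: real) \<in> borel_measurable (borel :: 'd spacetime measure)"
proof -
 have "(%z. ind {s..t} (fst z) :: real) \<in> borel_measurable (borel \<Otimes>\<^sub>M (borel :: (real ^ 'd) measure))" by measurable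
 then show ?thesis by (simp add: borel_prod)
qed

lemma sq_indicator_fst:
 assumes "sqL k"
 shows "sqL (%z :: 'd spacetime. ind {s..t} (fst z) *R k z)"
 by (rule sq_int_bound[OF assms, where c = 1])
   (use indicator_fst_measurable sq_int_measurable[OF assms] in "auto simp: indicator_def intro!: borel_measurable_scaleR")

text \<open>A crude bound: the nonlinear term is absorbed by Young's inequality, so the constant
  involves \<open>Mf\<close> and with it the size of the nonlinearity. It makes \<open>p\<close>
  square integrable and controls the error terms of the sharp estimate.\<close>

lemma Du_sq_bound:
 assumes h: "0 < h" and t: "0 < t" "t + h < T" and G: "(nrm (TI g 0 h))^2 \<le> h^2 * ((nrm g0)^2 + eps)"
 shows "(LBINT z. (norm (ind {0..t} (fst z) *R Du h z))^2) \<le> h^2 * ((nrm g0)^2 + Mf^2 * cQ + eps)"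
proof -
 let ?X = "LBINT z. (norm (ind {0..t} (fst z) *R Du h z))^2"
 let ?I = "%z. ind {0..t} (fst z) *R Du h z"
 let ?K = "%z. ind {0..t} (fst z) *R DF h z"
 have Is: "sqL ?I" by (rule sq_indicator_fst[OF sq_Du])
 have Ks: "sqL ?K" using h t by (intro sq_DF) auto
 have "(LBINT z. ?K z \<bullet> Du h z) = (LBINT z. ?K z \<bullet> ?I z)"
  by (intro integral_cong) (auto simp: indicator_def)
 then have "- (LBINT z. ?K z \<bullet> Du h z) \<le> nrm ?K * nrm ?I"
  using l2n_Cauchy_Schwarz[OF Ks Is] by linarith
 also have "\<dots> \<le> (nrm ?K)^2 / 2 + (nrm ?I)^2 / 2"
  using sum_squares_bound[of "nrm ?K" "nrm ?I"] by simp
 also have "(nrm ?K)^2 \<le> h^2 * (Mf^2 * cQ)" unfolding l2n_sq using h t by (intro sq_int_DF_bound) auto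
 finally have "- (LBINT z. ?K z \<bullet> Du h z) \<le> h^2 * (Mf^2 * cQ) / 2 + ?X / 2" by (simp add: l2n_sq)
 moreover have "0 \<le> (LBINT x. (norm (DG h (t, x)))^2)" by simp
 ultimately have "?X \<le> h^2 * (Mf^2 * cQ) + (nrm (TI g 0 h))^2"
  using increment_energy[OF h t] by linarith
 then show ?thesis using G by (simp add: algebra_simps)
qed

lemma AE_fst_neq: "AE z in (lborel :: 'd spacetime measure). fst z \<noteq> c"
proof -
 have "{c} \<times> (UNIV :: (real ^ 'd) set) \<in> null_sets (lborel \<Otimes>\<^sub>M lborel)"
  by (rule lborel.times_in_null_sets1) auto
 then have "{c} \<times> (UNIV :: (real ^ 'd) set) \<in> null_sets lborel" by (simp add: lborel_prod)
 then show ?thesis by (rule AE_I') (auto simp: mem_Times_iff)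
qed

text \<open>The quotients \<open>Du (h j) / h j\<close> converge to \<open>p\<close> pointwise at
  positive times below \<open>T\<close>; Fatou transfers the bound.\<close>

lemma p_part:
 assumes t: "0 < t" "t < T" and h: "h ----> 0" "\<And>j. 0 < h j" and R: "R ----> C"
  and b: "\<And>j. (LBINT z. (norm (ind {0..t} (fst z) *R Du (h j) z))^2) \<le> (h j)^2 * R j"
 shows "sqL (%z. ind {0..t} (fst z) *R p z)" "(LBINT z. (norm (ind {0..t} (fst z) *R p z))^2) \<le> C"
proof -
 let ?q = "%j z. ind {0..t} (fst z) *R Du (h j) z"
 have hne: "h j \<noteq> 0" for j using h(2)[of j] by simp
 have qs: "sqL (%z. (1 / h j) *R ?q j z)" for j by (intro sq_int_scaleR sq_indicator_fst sq_Du)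
 have qb: "(LBINT z. (norm ((1 / h j) *R ?q j z))^2) \<le> R j" for j
 proof -
  have "(LBINT z. (norm ((1 / h j) *R ?q j z))^2) = (LBINT z. (1 / (h j)^2) * (norm (?q j z))^2)"
   by (intro integral_cong) (auto simp: power_mult_distrib power_divide)
  also have "\<dots> = (LBINT z. (norm (?q j z))^2) / (h j)^2" by simp
  also have "\<dots> \<le> R j" using b[of j] h(2)[of j] by (simp add: pos_divide_le_eq mult.commute)
  finally show ?thesis .
 qed
 have lim: "AE z in lborel. (%j. (1 / h j) *R ?q j z) ----> ind {0..t} (fst z) *R p z"
  using AE_fst_neq[of 0]
 proof eventually_elim
  case (elim z)
  show ?case
  proof (cases "fst z \<in> {0..t}")
   case True
   then show ?thesis using Du_quotient_tendsto[OF h(1) hne, of z] elim t by simp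
  qed simp
 qed
 have "(%z. ind {0..t} (fst z) *R p z) \<in> borel_measurable lborel"
  using indicator_fst_measurable[of 0 t] meas(2) by (auto intro: borel_measurable_scaleR)
 from sq_int_fatou[OF qs this lim qb R]
 show "sqL (%z. ind {0..t} (fst z) *R p z)" "(LBINT z. (norm (ind {0..t} (fst z) *R p z))^2) \<le> C" .
qed

text \<open>The times \<open>s n\<close> increase to \<open>T\<close> from inside the interval, so
  bounds on \<open>{0..t}\<close> with a common constant reach the whole cylinder by Fatou.\<close>

lemma p_exhaust:
 assumes sq: "\<And>t. 0 < t ==> t < T ==> sqL (%z. ind {0..t} (fst z) *R p z)"
  and le: "\<And>t. 0 < t ==> t < T ==> (LBINT z. (norm (ind {0..t} (fst z) *R p z))^2) \<le> C"
 shows "sqL p" "(LBINT z. (norm (p z))^2) \<le> C"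
proof -
 define s where "s n = T - T / real (n + 2)" for n
 have s: "0 < s n" "s n < T" for n
 proof -
  have "T / real (n + 2) \<le> T / 2" using T by (intro divide_left_mono) auto
  moreover have "0 < T / real (n + 2)" using T by simp
  ultimately show "0 < s n" "s n < T" unfolding s_def using T by linarith+
 qed
 have slim: "s ----> T"
 proof -
  have "(%n. T / real (n + 2)) ----> 0"
   by (rule LIMSEQ_ignore_initial_segment) (rule tendsto_divide_0[OF tendsto_const tendsto_of_nat])
  from tendsto_diff[OF tendsto_const this, of T] show ?thesis by (simp add: s_def[abs_def])
 qed
 have lim: "AE z in lborel. (%n. ind {0..s n} (fst z) *R p z) ----> p z"
 proof (rule AE_I2)
  fix z :: "'d spacetime"
  show "(%n. ind {0..s n} (fst z) *R p z) ----> p z"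
  proof (cases "z \<in> cylinder T")
   case True
   then have "0 < fst z" "fst z < T" by (auto simp: cylinder_def)
   then have "\<forall>\<^sub>F n in sequentially. fst z < s n" using order_tendstoD(1)[OF slim] by blast
   then have "\<forall>\<^sub>F n in sequentially. ind {0..s n} (fst z) *R p z = p z"
    by eventually_elim (use \<open>0 < fst z\<close> in auto)
   then show ?thesis by (rule tendsto_eventually)
  qed (simp add: outside)
 qed
 from sq_int_fatou[OF sq[OF s] _ lim le[OF s] tendsto_const] meas
 show "sqL p" "(LBINT z. (norm (p z))^2) \<le> C" by auto
qed

lemma sq_p: "sqL p"
proof (rule p_exhaust(1))
 fix t assume t: "0 < t" "t < T"
 obtain h eps :: "nat => real" where h: "\<And>j. 0 < h j" "\<And>j. h j < T - t" "h ----> 0" and eps: "eps ----> 0"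
  and G: "\<And>j. (nrm (TI g 0 (h j)))^2 \<le> (h j)^2 * ((nrm g0)^2 + eps j)"
  using avg_grad_sequence[of "T - t"] t by auto
 have k: "t + h j < T" for j using h(2)[of j] by simp
 note p = p_part[OF t h(3,1) tendsto_add[OF tendsto_const eps] Du_sq_bound[OF h(1) t(1) k G]]
 show "sqL (%z. ind {0..t} (fst z) *R p z)" by (rule p(1))
 show "(LBINT z. (norm (ind {0..t} (fst z) *R p z))^2) \<le> (nrm g0)^2 + Mf^2 * cQ + 0" by (rule p(2))
qed

end

section \<open>A penalty for leaving the unit ball\<close>

definition exc :: "real => real" where "exc S = max 0 (S - 1)"
text \<open>For \<open>S > 1\<close> this is \<open>(S - 1)^3 / S^2\<close>. The cube makes it twice
  continuously differentiable across \<open>S = 1\<close>; the denominator makes it grow linearly in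
  \<open>S = (norm y)^2\<close>, so that its gradient in \<open>y\<close> is globally Lipschitz. The
  expression \<open>1 + exc S\<close> is \<open>max 1 S\<close>, which avoids a division by
  0.\<close>

definition pen :: "real => real" where "pen S = exc S ^ 3 / (1 + exc S)^2"
definition pen' :: "real => real" where "pen' S = (3 * exc S ^ 2 + exc S ^ 3) / (1 + exc S) ^ 3"
definition pen'' :: "real => real" where "pen'' S = 6 * exc S / (1 + exc S) ^ 4"

lemma exc_nonneg [simp]: "0 \<le> exc S" by (simp add: exc_def)
lemma exc_zero: "S \<le> 1 ==> exc S = 0" by (simp add: exc_def)
lemma exc_eq: "1 \<le> S ==> exc S = S - 1" by (simp add: exc_def)

text \<open>From the second power on the kink at 1 disappears: the difference quotient there is at
  most \<open>abs h ^ Suc n\<close>.\<close>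

lemma exc_power_deriv: "((%S. exc S ^ Suc (Suc n)) has_real_derivative real (Suc (Suc n)) * exc S ^ Suc n) (at S)"
proof (cases S "1::real" rule: linorder_cases)
 case less
 have "((%S. 0) has_real_derivative 0) (at S)" by simp
 then have "((%S. exc S ^ Suc (Suc n)) has_real_derivative 0) (at S)"
  by (rule has_field_derivative_transform_within_open[of _ _ _ "{..<1}"]) (use less in "auto simp: exc_def")
 then show ?thesis using less by (simp add: exc_def)
next
 case greater
 have "((%S. S - 1) has_real_derivative 1) (at S)" by (auto intro!: derivative_eq_intros)
 from DERIV_power[OF this, of "Suc (Suc n)"]
 have "((%S. (S - 1) ^ Suc (Suc n)) has_real_derivative real (Suc (Suc n)) * (S - 1) ^ Suc n) (at S)" by simp
 then have "((%S. exc S ^ Suc (Suc n)) has_real_derivative real (Suc (Suc n)) * (S - 1) ^ Suc n) (at S)"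
  by (rule has_field_derivative_transform_within_open[of _ _ _ "{1<..}"]) (use greater in "auto simp: exc_def")
 then show ?thesis using greater by (simp add: exc_def)
next
 case equal
 have "((%h. exc (1 + h) ^ Suc (Suc n) / h) \<longlongrightarrow> 0) (at 0)"
 proof (rule tendsto_rabs_zero_cancel, rule tendsto_sandwich[OF _ _ tendsto_const])
  show "((%h. \<bar>h\<bar> ^ Suc n) \<longlongrightarrow> 0) (at (0::real))"
   using tendsto_power[OF tendsto_rabs[OF tendsto_ident_at[of "0::real" UNIV]], of "Suc n"] by simp
  show "\<forall>\<^sub>F h in at (0::real). \<bar>exc (1 + h) ^ Suc (Suc n) / h\<bar> \<le> \<bar>h\<bar> ^ Suc n"
  proof (rule eventually_at_topological[THEN iffD2], intro exI[of _ UNIV] conjI ballI impI open_UNIV UNIV_I)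
   fix h :: real assume "h \<noteq> 0"
   have "\<bar>exc (1 + h) ^ Suc (Suc n)\<bar> \<le> \<bar>h\<bar> ^ Suc (Suc n)"
    unfolding power_abs by (rule power_mono) (auto simp: exc_def)
   then show "\<bar>exc (1 + h) ^ Suc (Suc n) / h\<bar> \<le> \<bar>h\<bar> ^ Suc n"
    using \<open>h \<noteq> 0\<close> by (simp add: abs_divide divide_le_eq mult.commute)
  qed
 qed simp
 then show ?thesis using equal by (simp add: DERIV_def exc_zero)
qed

lemma pen_deriv: "(pen has_real_derivative pen' S) (at S)"
 and pen'_deriv: "(pen' has_real_derivative pen'' S) (at S)"
proof -
 note d2 = exc_power_deriv[of 0 S, simplified] and d3 = exc_power_deriv[of 1 S, simplified]
 show "(pen has_real_derivative pen' S) (at S)"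
 proof (cases "S < 1")
  case True
  have "((%S. 0) has_real_derivative 0) (at S)" by simp
  then have "(pen has_real_derivative 0) (at S)"
   by (rule has_field_derivative_transform_within_open[of _ _ _ "{..<1}"]) (use True in "auto simp: pen_def exc_def")
  then show ?thesis using True by (simp add: pen'_def exc_zero)
 next
  case False
  have e: "exc r ^ 3 / r^2 = pen r" if "r > 0" for r
   using that by (cases "r \<le> 1") (auto simp: pen_def exc_zero exc_eq)
  have "((%S. exc S ^ 3 / S^2) has_real_derivative pen' S) (at S)"
  proof -
   have "((%S. exc S ^ 3 / S^2) has_real_derivative ((3 * (exc S)^2) * S^2 - exc S ^ 3 * (2 * S)) / (S^2 * S^2)) (at S)"
    using False by (intro DERIV_divide) (use d3 in "auto simp: numeral_3_eq_3 numeral_2_eq_2 intro!: derivative_eq_intros")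
   moreover have "((3 * (exc S)^2) * S^2 - exc S ^ 3 * (2 * S)) / (S^2 * S^2) = pen' S"
    using False by (simp add: pen'_def exc_eq field_simps power2_eq_square power3_eq_cube)
   ultimately show ?thesis by simp
  qed
  then show ?thesis
   by (rule has_field_derivative_transform_within_open[of _ _ _ "{0<..}"]) (use False e in auto)
 qed
 show "(pen' has_real_derivative pen'' S) (at S)"
 proof (cases "S < 1")
  case True
  have "((%S. 0) has_real_derivative 0) (at S)" by simp
  then have "(pen' has_real_derivative 0) (at S)"
   by (rule has_field_derivative_transform_within_open[of _ _ _ "{..<1}"]) (use True in "auto simp: pen'_def exc_def")
  then show ?thesis using True by (simp add: pen''_def exc_zero)
 next
  case False
  have e: "(3 * (exc r)^2 + exc r ^ 3) / r ^ 3 = pen' r" if "r > 0" for r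
   using that by (cases "r \<le> 1") (auto simp: pen'_def exc_zero exc_eq)
  have "((%S. (3 * (exc S)^2 + exc S ^ 3) / S ^ 3) has_real_derivative pen'' S) (at S)"
  proof -
   have "((%S. (3 * (exc S)^2 + exc S ^ 3) / S ^ 3) has_real_derivative
     ((3 * (2 * exc S) + 3 * (exc S)^2) * S ^ 3 - (3 * (exc S)^2 + exc S ^ 3) * (3 * S^2)) / (S ^ 3 * S ^ 3)) (at S)"
    using False by (intro DERIV_divide DERIV_add DERIV_cmult)
     (use d2 d3 in "auto simp: numeral_3_eq_3 numeral_2_eq_2 intro!: derivative_eq_intros")
   moreover have "((3 * (2 * exc S) + 3 * (exc S)^2) * S ^ 3 - (3 * (exc S)^2 + exc S ^ 3) * (3 * S^2)) / (S ^ 3 * S ^ 3) = pen'' S"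
    using False by (simp add: pen''_def exc_eq field_simps) algebra
   ultimately show ?thesis by simp
  qed
  then show ?thesis
   by (rule has_field_derivative_transform_within_open[of _ _ _ "{0<..}"]) (use False e in auto)
 qed
qed

lemma pen_bounds: "0 \<le> pen S" "0 \<le> pen' S" "pen' S \<le> 3" "0 \<le> pen'' S" "0 \<le> S ==> pen'' S * S \<le> 6" "0 \<le> S ==> pen S \<le> S"
proof -
 let ?m = "exc S"
 have m: "0 \<le> ?m" by simp
 show "0 \<le> pen S" "0 \<le> pen' S" "0 \<le> pen'' S" by (simp_all add: pen_def pen'_def pen''_def)
 have "3 * ?m ^ 2 + ?m ^ 3 \<le> 3 * (1 + ?m) ^ 3"
 proof -
  have "3 * (1 + ?m) ^ 3 - (3 * ?m ^ 2 + ?m ^ 3) = 3 + 9 * ?m + 6 * ?m^2 + 2 * ?m ^ 3" by algebra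
  moreover have "0 \<le> 3 + 9 * ?m + 6 * ?m^2 + 2 * ?m ^ 3" using m by (intro add_nonneg_nonneg) auto
  ultimately show ?thesis by linarith
 qed
 moreover have "0 < (1 + ?m) ^ 3" using m by (intro zero_less_power) linarith
 ultimately show "pen' S \<le> 3" unfolding pen'_def by (simp add: pos_divide_le_eq)
 assume S: "0 \<le> S"
 show "pen'' S * S \<le> 6"
 proof (cases "S \<le> 1")
  case False
  then have e: "pen'' S * S = 6 * (S - 1) / S ^ 3" by (simp add: pen''_def exc_eq power4_eq_xxxx power3_eq_cube)
  have "S - 1 \<le> S ^ 3" using self_le_power[of S 3] False by simp
  then have "6 * (S - 1) \<le> 6 * S ^ 3" by simp
  then show ?thesis unfolding e using False by (subst divide_le_eq) auto
 qed (simp add: pen''_def exc_zero)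
 show "pen S \<le> S"
 proof (cases "S \<le> 1")
  case False
  then have e: "pen S = (S - 1) ^ 3 / S^2" by (simp add: pen_def exc_eq)
  have "(S - 1) ^ 3 \<le> S ^ 3" using False by (intro power_mono) auto
  then have "(S - 1) ^ 3 \<le> S * S^2" by (simp add: power2_eq_square power3_eq_cube mult.assoc)
  then show ?thesis unfolding e using False by (subst divide_le_eq) auto
 qed (use S in "simp add: pen_def exc_zero")
qed

lemma pen_pos: "1 < S ==> 0 < pen S"
 by (simp add: pen_def exc_eq)

lemma pen_ge_quarter: "2 \<le> S ==> 1 / 4 \<le> pen S"
proof -
 assume S: "2 \<le> S"
 have "S^2 \<le> 4 * (S - 1) ^ 3"
 proof -
  have "S^2 \<le> (2 * (S - 1))^2" using S by (intro power_mono) auto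
  also have "\<dots> = 4 * (S - 1)^2" by algebra
  finally have "S^2 \<le> 4 * (S - 1)^2" .
  moreover have "4 * (S - 1)^2 * 1 \<le> 4 * (S - 1)^2 * (S - 1)" using S by (intro mult_left_mono) auto
  ultimately show ?thesis by (simp add: power2_eq_square power3_eq_cube)
 qed
 then show ?thesis using S by (simp add: pen_def exc_eq field_simps)
qed

text \<open>For \<open>r = norm y > 1\<close> one has
  \<open>(r^2 - 1)^3 <= (r^2 - 1)^2 * r^2\<close> and \<open>(r + 1)^2 <= (2 * r)^2\<close>, which
  together give \<open>4 * (r - 1)^2\<close>; and \<open>r - 1\<close> is at most the distance to
  the unit vector \<open>z\<close>. With \<open>z\<close> the initial value this shows that the
  penalty starts at 0.\<close>

lemma pen_le_dist: "norm z = 1 ==> pen ((norm y)^2) \<le> 4 * (norm (y - z))^2"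
proof (cases "norm y \<le> 1")
 case True
 then have "(norm y)^2 \<le> 1" using power_mono[of "norm y" 1 2] by simp
 then show ?thesis by (simp add: pen_def exc_zero)
next
 case False
 assume z: "norm z = 1"
 let ?r = "norm y"
 have r: "1 < ?r^2" using False power_strict_mono[of 1 ?r 2] by simp
 have e: "pen (?r^2) = (?r^2 - 1) ^ 3 / (?r^2)^2" using r by (simp add: pen_def exc_eq)
 have "(?r^2 - 1) ^ 3 \<le> (?r^2 - 1)^2 * ?r^2" using r by (simp add: power3_eq_cube power2_eq_square mult_left_mono)
 also have "(?r^2 - 1)^2 = (?r - 1)^2 * (?r + 1)^2" by algebra
 also have "\<dots> \<le> (?r - 1)^2 * (2 * ?r)^2" using False by (intro mult_left_mono power_mono) auto
 finally have "(?r^2 - 1) ^ 3 \<le> (?r - 1)^2 * (2 * ?r)^2 * ?r^2" using r by (simp add: mult_right_mono)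
 also have "(?r - 1)^2 * (2 * ?r)^2 * ?r^2 = 4 * (?r - 1)^2 * (?r^2)^2" by algebra
 finally have "(?r^2 - 1) ^ 3 \<le> 4 * (?r - 1)^2 * (?r^2)^2" .
 moreover have "0 < (?r^2)^2" by (meson r zero_less_power less_trans zero_less_one)
 ultimately have "pen (?r^2) \<le> 4 * (?r - 1)^2" unfolding e by (simp add: pos_divide_le_eq)
 also have "\<dots> \<le> 4 * (norm (y - z))^2"
  using norm_triangle_ineq2[of y z] z False by (intro mult_left_mono power_mono) auto
 finally show ?thesis .
qed

text \<open>The gradient of \<open>pen ((norm y)^2)\<close> in \<open>y\<close>;
  \<open>penDG\<close> is the derivative of this gradient, that is, the Hessian applied to
  \<open>k\<close>.\<close>

definition penG :: "'b::euclidean_space => 'b" where "penG y = (2 * pen' ((norm y)^2)) *R y"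
definition penDG :: "'b::euclidean_space => 'b => 'b" where
 "penDG y k = (2 * pen' ((norm y)^2)) *R k + (4 * pen'' ((norm y)^2) * (y \<bullet> k)) *R y"

lemma norm_sq_has_derivative: "((%y::'b::euclidean_space. (norm y)^2) has_derivative (%k. 2 * (y \<bullet> k))) (at y)"
 unfolding power2_norm_eq_inner by (auto intro!: derivative_eq_intros simp: inner_commute)

lemma pen_norm_has_derivative: "((%y::'b::euclidean_space. pen ((norm y)^2)) has_derivative (%k. penG y \<bullet> k)) (at y)"
 using has_derivative_compose[OF norm_sq_has_derivative[of y] pen_deriv[unfolded has_field_derivative_def]]
 by (simp add: penG_def mult.assoc mult.left_commute)

lemma penG_has_derivative: "((penG :: 'b::euclidean_space => 'b) has_derivative penDG y) (at y)"
proof -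
 have "((%y::'b. pen' ((norm y)^2)) has_derivative (%k. pen'' ((norm y)^2) * (2 * (y \<bullet> k)))) (at y)"
  by (rule has_derivative_compose[OF norm_sq_has_derivative[of y] pen'_deriv[unfolded has_field_derivative_def]])
 then have "((%y::'b. (2 * pen' ((norm y)^2)) *R y) has_derivative
   (%k. (2 * pen' ((norm y)^2)) *R k + (2 * (pen'' ((norm y)^2) * (2 * (y \<bullet> k)))) *R y)) (at y)"
  by (auto intro!: derivative_eq_intros)
 then show ?thesis unfolding penG_def[abs_def] penDG_def[abs_def] by (simp add: mult.assoc mult.left_commute)
qed

lemma continuous_pen'': "continuous_on UNIV pen''" and continuous_pen': "continuous_on UNIV pen'"
 and continuous_pen: "continuous_on UNIV pen"
proof -
 have e: "continuous_on UNIV exc" unfolding exc_def by (intro continuous_intros)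
 have p: "1 + exc S \<noteq> 0" for S using exc_nonneg[of S] by linarith
 show "continuous_on UNIV pen''" unfolding pen''_def by (intro continuous_intros e) (use p in auto)
 show "continuous_on UNIV pen'" unfolding pen'_def by (intro continuous_intros e) (use p in auto)
 show "continuous_on UNIV pen" unfolding pen_def by (intro continuous_intros e) (use p in auto)
qed

lemma continuous_penDG:
 fixes y k :: "'a::topological_space => 'b::euclidean_space"
 assumes "continuous_on S y" "continuous_on S k"
 shows "continuous_on S (%x. penDG (y x) (k x))"
 unfolding penDG_def using assms
 by (intro continuous_intros continuous_on_compose2[OF continuous_pen''] continuous_on_compose2[OF continuous_pen']) auto

lemma continuous_penG: "continuous_on S (penG :: 'b::euclidean_space => 'b)"
 by (intro continuous_at_imp_continuous_on ballI has_derivative_continuous[OF penG_has_derivative])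

text \<open>The constant is \<open>2 * 3 + 4 * 6\<close>, from \<open>pen' S <= 3\<close> and
  \<open>pen'' S * S <= 6\<close>.\<close>

lemma penDG_bound: "norm (penDG y k) \<le> 30 * norm k"
proof -
 have "norm (penDG y k) \<le> norm ((2 * pen' ((norm y)^2)) *R k) + norm ((4 * pen'' ((norm y)^2) * (y \<bullet> k)) *R y)"
  unfolding penDG_def by (rule norm_triangle_ineq)
 also have "norm ((2 * pen' ((norm y)^2)) *R k) = 2 * pen' ((norm y)^2) * norm k"
  using pen_bounds(2)[of "(norm y)^2"] by simp
 also have "\<dots> \<le> 6 * norm k" using pen_bounds(3)[of "(norm y)^2"] by (intro mult_right_mono) auto
 also have "norm ((4 * pen'' ((norm y)^2) * (y \<bullet> k)) *R y) = 4 * pen'' ((norm y)^2) * (\<bar>y \<bullet> k\<bar> * norm y)"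
  using pen_bounds(4)[of "(norm y)^2"] by (simp add: abs_mult)
 also have "\<dots> \<le> 4 * pen'' ((norm y)^2) * ((norm y * norm k) * norm y)"
  using pen_bounds(4)[of "(norm y)^2"] by (intro mult_left_mono mult_right_mono Cauchy_Schwarz_ineq2) auto
 also have "\<dots> = 4 * (pen'' ((norm y)^2) * (norm y)^2) * norm k" by (simp add: power2_eq_square)
 also have "\<dots> \<le> 4 * 6 * norm k" using pen_bounds(5)[of "(norm y)^2"] by (intro mult_right_mono mult_left_mono) auto
 finally show ?thesis by simp
qed

lemma penG_lipschitz: "norm (penG y - penG z) \<le> 30 * norm (y - z)"
 by (rule differentiable_bound[of UNIV penG penDG])
   (auto intro: penG_has_derivative onorm_le penDG_bound)

lemma pen_measurable: "k \<in> borel_measurable M ==> (%x. pen ((norm (k x))^2)) \<in> borel_measurable M"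
 by (rule measurable_compose[OF _ borel_measurable_continuous_onI[OF continuous_pen]]) measurable

lemma pen_integrable: "sq_int M k ==> integrable M (%x. pen ((norm (k x))^2))"
 by (rule integrable_bound[OF sq_int_integrable pen_measurable[OF sq_int_measurable]]) (auto simp: pen_bounds)

lemma penG_zero: "norm y \<le> 1 ==> penG y = 0" "norm y \<le> 1 ==> penDG y k = 0"
 using power_mono[of "norm y" 1 2] by (auto simp: penG_def penDG_def pen'_def pen''_def exc_zero)

lemma penG_bound: "norm (penG y) \<le> 6 * norm y"
proof -
 have "norm (penG y) = 2 * pen' ((norm y)^2) * norm y" using pen_bounds(2)[of "(norm y)^2"] by (simp add: penG_def)
 also have "\<dots> \<le> 6 * norm y" using pen_bounds(3)[of "(norm y)^2"] by (intro mult_right_mono) auto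
 finally show ?thesis .
qed

lemma penDG_linear: "penDG y (k + l) = penDG y k + penDG y l" "penDG y (k - l) = penDG y k - penDG y l"
 by (simp_all add: penDG_def inner_simps algebra_simps)

text \<open>Since \<open>pen'\<close> and \<open>pen''\<close> are nonnegative, the Hessian of the
  penalty is positive semidefinite. This gives the gradient term the good sign when the flow is
  tested with \<open>penG u\<close>.\<close>

lemma penDG_nonneg: "0 \<le> k \<bullet> penDG y k"
proof -
 have "k \<bullet> penDG y k = 2 * pen' ((norm y)^2) * (k \<bullet> k) + 4 * pen'' ((norm y)^2) * (y \<bullet> k)^2"
  by (simp add: penDG_def inner_simps inner_commute power2_eq_square)
 then show ?thesis using pen_bounds(2,4)[of "(norm y)^2"] by simp
qed

lemma Ck_on_penG:
 fixes v :: "'a::euclidean_space => 'b::euclidean_space"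
 assumes v: "Ck_on (Suc 0) S v" and S: "open S"
 shows "Ck_on (Suc 0) S (%x. penG (v x))" "x \<in> S ==> pderiv_dir e (%x. penG (v x)) x = penDG (v x) (pderiv_dir e v x)"
proof -
 have d: "((%x. penG (v x)) has_derivative (%k. penDG (v x) (pderiv_dir k v x))) (at x)" if "x \<in> S" for x
  by (rule has_derivative_compose[OF pderiv_dir_has_derivative penG_has_derivative]) (use v that in simp)
 have c: "Ck_on 0 S v" using Ck_on_SucD[OF v] .
 have "Ck_on 0 S (pderiv_dir e (%x. penG (v x)))" if "e \<in> Basis" for e
  by (subst Ck_on_cong[OF S pderiv_dir_eq[OF d]]) (use v c that in "auto intro!: continuous_penDG")
 moreover have "(%x. penG (v x)) differentiable (at x)" if "x \<in> S" for x
  using d[OF that] by (auto simp: differentiable_def)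
 ultimately show "Ck_on (Suc 0) S (%x. penG (v x))" unfolding Ck_on.simps(2) by blast
 show "x \<in> S ==> pderiv_dir e (%x. penG (v x)) x = penDG (v x) (pderiv_dir e v x)"
  by (rule pderiv_dir_eq[OF d])
qed

definition vDG :: "'b::euclidean_space => 'b ^ 'd => 'b ^ 'd" where
 "vDG y k = (\<chi> i. penDG y (k $ i))"

lemma vDG_bound: "norm (vDG y k) \<le> 30 * norm k"
proof (rule power2_le_imp_le)
 have i: "(norm (penDG y (k $ i)))^2 \<le> (30 * norm (k $ i))^2" for i by (rule power_mono[OF penDG_bound]) simp
 have "(norm (vDG y k))^2 \<le> (\<Sum>i\<in>UNIV. (30 * norm (k $ i))^2)"
  unfolding norm_vec_sq vDG_def vec_lambda_beta by (intro sum_mono i)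
 also have "\<dots> = (30 * norm k)^2" by (simp add: power_mult_distrib norm_vec_sq sum_distrib_left)
 finally show "(norm (vDG y k))^2 \<le> (30 * norm k)^2" .
qed simp

lemma vDG_add: "vDG y (k + l) = vDG y k + vDG y l" and vDG_diff: "vDG y (k - l) = vDG y k - vDG y l"
 by (simp_all add: vDG_def vec_eq_iff penDG_linear)

lemma vDG_nonneg: "0 \<le> k \<bullet> vDG y k"
 unfolding inner_vec_def vDG_def by (intro sum_nonneg) (simp add: penDG_nonneg)

lemma vDG_measurable:
 fixes y :: "'a => 'b::euclidean_space" and k :: "'a => 'b ^ 'd"
 assumes "y \<in> borel_measurable M" "k \<in> borel_measurable M"
 shows "(%x. vDG (y x) (k x)) \<in> borel_measurable M"
proof -
 have "continuous_on UNIV (%z :: 'b \<times> ('b ^ 'd). vDG (fst z) (snd z))"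
  unfolding vDG_def by (intro continuous_intros continuous_penDG)
 then have "(%z :: 'b \<times> ('b ^ 'd). vDG (fst z) (snd z)) \<in> BM" by (rule borel_measurable_continuous_onI)
 moreover have "(%x. (y x, k x)) \<in> M \<rightarrow>\<^sub>M borel" using assms by (rule borel_measurable_Pair)
 ultimately show ?thesis
  using measurable_compose[of "%x. (y x, k x)" M borel "%z :: 'b \<times> ('b ^ 'd). vDG (fst z) (snd z)" borel] by simp
qed

lemma vDG_tendsto:
 fixes k :: "'b::euclidean_space ^ 'd"
 assumes "y ----> y0"
 shows "(%n. vDG (y n) k) ----> vDG y0 k"
proof -
 have "continuous_on UNIV (%y :: 'b. vDG y k)" unfolding vDG_def by (intro continuous_intros continuous_penDG)
 then have "isCont (%y :: 'b. vDG y k) y0" by (simp add: continuous_on_eq_continuous_at)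
 then show ?thesis using assms by (rule isCont_tendsto_compose)
qed

section \<open>The Ginzburg-Landau nonlinearity and the bound of the flow by 1\<close>

lemma cutoff_deriv_small: assumes chi: "cutoff chi" shows "s < 2 ==> deriv chi s = 1"
proof -
 assume "s < 2"
 have "((%s. s) has_real_derivative 1) (at s)" by simp
 then have "(chi has_real_derivative 1) (at s)"
  by (rule has_field_derivative_transform_within_open[of _ _ _ "{..<2}"]) (use \<open>s < 2\<close> chi in "auto simp: cutoff_def")
 then show ?thesis by (rule DERIV_imp_deriv)
qed

lemma cutoff_deriv_large: assumes chi: "cutoff chi" shows "4 < s ==> deriv chi s = 0"
proof -
 assume "4 < s"
 have "((%s. 3) has_real_derivative 0) (at s)" by simp
 then have "(chi has_real_derivative 0) (at s)"
  by (rule has_field_derivative_transform_within_open[of _ _ _ "{4<..}"]) (use \<open>4 < s\<close> chi in "auto simp: cutoff_def")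
 then show ?thesis by (rule DERIV_imp_deriv)
qed

lemma cutoff_deriv_bound: assumes chi: "cutoff chi" obtains K where "0 \<le> K" "\<And>s. 0 \<le> s ==> \<bar>deriv chi s\<bar> \<le> K"
proof -
 have C: "Ck_on (Suc 0) UNIV chi" using chi by (simp add: cutoff_def smooth_on_def del: Ck_on.simps)
 have d: "deriv chi s = pderiv_dir 1 chi s" for s
 proof -
  have "chi differentiable (at s)" using C unfolding Ck_on.simps by blast
  then have dd: "(chi has_derivative (%v. pderiv_dir v chi s)) (at s)" by (rule pderiv_dir_has_derivative)
  have "pderiv_dir v chi s = pderiv_dir 1 chi s * v" for v
   using linear_cmul[OF has_derivative_linear[OF dd], of v 1] by (simp add: mult.commute)
  then have "(%v. pderiv_dir v chi s) = (*) (pderiv_dir 1 chi s)" by (rule ext)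
  then have "(chi has_real_derivative pderiv_dir 1 chi s) (at s)" using dd unfolding has_field_derivative_def by metis
  then show ?thesis by (rule DERIV_imp_deriv)
 qed
 have "continuous_on UNIV (pderiv_dir 1 chi)" using C by simp
 then have "bounded (pderiv_dir 1 chi ` {0..4})"
  by (intro compact_imp_bounded compact_continuous_image) (auto intro: continuous_on_subset)
 then obtain K where "\<forall>y\<in>pderiv_dir 1 chi ` {0..4}. norm y \<le> K" unfolding bounded_iff by blast
 then have K: "\<bar>pderiv_dir 1 chi s\<bar> \<le> K" if "s \<in> {0..4}" for s using that by auto
 have "\<bar>deriv chi s\<bar> \<le> max K 0" if "0 \<le> s" for s
  using K[of s] cutoff_deriv_large[OF chi, of s] that by (cases "s \<le> 4") (auto simp: d)
 then show ?thesis by (intro that[of "max K 0"]) auto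
qed

text \<open>Adds the form of the nonlinearity. The coefficient \<open>a\<close> will be
  \<open>lam powr (1 - kappa t)\<close>; it enters through being nonnegative, bounded by
  \<open>A\<close> and nonincreasing in time. The assumptions \<open>slice\<close> permit the chain
  rule in space at a fixed time.\<close>

locale gl_flow = heat_flow T Mf u p f g v0 g0
 for T Mf :: real and u p f :: "real \<times> (real ^ 'd) => 'b::euclidean_space"
  and g :: "real \<times> (real ^ 'd) => 'b ^ 'd" and v0 :: "real ^ 'd => 'b" and g0 :: "real ^ 'd => 'b ^ 'd" +
 fixes chi a :: "real => real" and A :: real
 assumes chi: "cutoff chi"
  and a_cont: "continuous_on {0<..<T} a"
  and a: "0 < t ==> t < T ==> 0 \<le> a t" "0 < t ==> t < T ==> a t \<le> A" "0 < s ==> s \<le> t ==> t < T ==> a t \<le> a s"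
  and f_eq: "z \<in> cylinder T ==> f z = (a (fst z) * deriv chi (((norm (u z))^2 - 1)^2) * ((norm (u z))^2 - 1)) *R u z"
  and sphere: "AE x in lborel. x \<in> unit_ball --> norm (v0 x) = 1"
  and slice: "0 < t ==> t < T ==> Ck_on (Suc 0) unit_ball (%x. u (t, x))"
   "0 < t ==> t < T ==> x \<in> unit_ball ==> grad (%x. u (t, x)) x = g (t, x)"
begin

lemmas chi_small = cutoff_deriv_small[OF chi]
lemmas chi_large = cutoff_deriv_large[OF chi]
lemmas chi_bound = cutoff_deriv_bound[OF chi]

lemma A_nonneg: "0 \<le> A"
 using a(1,2)[of "T / 2"] T by auto

text \<open>With \<open>S = (norm u)^2\<close>, the derivative of \<open>chi\<close> has no known
  sign when \<open>(S - 1)^2\<close> is between 2 and 4. For \<open>S > 1\<close> this means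
  \<open>2 <= S <= 3\<close>, where \<open>pen S\<close> is at least 1/4 and a bounded product can
  be absorbed. Elsewhere the pairing is nonnegative or 0: below 2 the derivative is 1, beyond 4 it
  is 0, and for \<open>S <= 1\<close> the field \<open>penG\<close> vanishes.\<close>

lemma f_penG_bound: obtains C where "0 \<le> C" "\<And>z. - (f z \<bullet> penG (u z)) \<le> C * pen ((norm (u z))^2)"
proof -
 obtain K where K: "0 \<le> K" "\<And>s. 0 \<le> s ==> \<bar>deriv chi s\<bar> \<le> K" by (rule chi_bound) blast
 \<comment> \<open>In the third case below the product is at most \<open>A * K * 2 * 18\<close>,
   which has to be \<open>C * (1 / 4)\<close>.\<close>
 define C where "C = 144 * (A * K)"
 have C0: "0 \<le> C" using K A_nonneg by (simp add: C_def)
 have "- (f z \<bullet> penG (u z)) \<le> C * pen ((norm (u z))^2)" for z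
 proof (cases "z \<in> cylinder T")
  case True
  define S where "S = (norm (u z))^2"
  have S0: "0 \<le> S" by (simp add: S_def)
  have az: "0 \<le> a (fst z)" "a (fst z) \<le> A" using a(1,2)[of "fst z"] True by (auto simp: cylinder_def)
  have e: "f z \<bullet> penG (u z) = a (fst z) * deriv chi ((S - 1)^2) * (S - 1) * (2 * pen' S * S)"
   unfolding f_eq[OF True] penG_def S_def by (simp add: power2_norm_eq_inner)
  consider "S \<le> 1" | "1 < S" "(S - 1)^2 < 2" | "1 < S" "2 \<le> (S - 1)^2" "(S - 1)^2 \<le> 4" | "4 < (S - 1)^2" by linarith
  then show ?thesis
  proof cases
   case 1
   then show ?thesis unfolding S_def[symmetric] e using pen_bounds(1)[of S] C0 by (simp add: pen'_def exc_zero)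
  next
   case 2
   then have "0 \<le> f z \<bullet> penG (u z)" unfolding e using az pen_bounds(2)[of S] S0 chi_small[of "(S - 1)^2"] by simp
   moreover have "0 \<le> C * pen S" by (intro mult_nonneg_nonneg C0 pen_bounds)
   ultimately show ?thesis unfolding S_def by linarith
  next
   case 3
   have S2: "2 \<le> S"
   proof (rule ccontr)
    assume "\<not> 2 \<le> S"
    then have "(S - 1)^2 \<le> 1^2" using 3 by (intro power_mono) auto
    then show False using 3 by simp
   qed
   have S3: "S \<le> 3" using 3 power2_le_imp_le[of "S - 1" 2] by simp
   have "\<bar>f z \<bullet> penG (u z)\<bar> = a (fst z) * \<bar>deriv chi ((S - 1)^2)\<bar> * (S - 1) * (2 * pen' S * S)"
    unfolding e using az 3 S0 pen_bounds(2)[of S] by (simp add: abs_mult)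
   also have "\<dots> \<le> A * K * 2 * (2 * 3 * 3)"
    using az 3 S0 S3 pen_bounds(2,3)[of S] K by (intro mult_mono) auto
   also have "\<dots> = C * (1 / 4)" by (simp add: C_def)
   also have "\<dots> \<le> C * pen S" using pen_ge_quarter[OF S2] C0 by (intro mult_left_mono)
   finally show ?thesis unfolding S_def by linarith
  next
   case 4
   then show ?thesis unfolding S_def[symmetric] e using pen_bounds(1)[of S] C0 chi_large[of "(S - 1)^2"] by simp
  qed
 qed (use outside C0 pen_bounds(1) in simp)
 then show ?thesis using that C0 by blast
qed

text \<open>The equation at a single time, with test functions from the closure. By
  \<open>sq_p\<close> its hypotheses on the slices are met at almost every time, so the bound by 1
  can be proved without increments.\<close>

lemma weak_at:
 assumes t: "0 < t" "t < T" and s: "sqL (%x. p (t, x))" "sqL (%x. g (t, x))" "sqL (%x. f (t, x))"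
  and psi: "H10 psi \<Psi>"
 shows "(LBINT x. p (t, x) \<bullet> psi x) + (LBINT x. g (t, x) \<bullet> \<Psi> x) + (LBINT x. f (t, x) \<bullet> psi x) = 0"
proof -
 obtain phi where phi: "\<And>n::nat. phi n \<in> C1c unit_ball" "(%n. nrm (%x. phi n x - psi x)) ----> 0"
   "(%n. nrm (%x. grad (phi n) x - \<Psi> x)) ----> 0" and h: "sqL psi" "sqL \<Psi>"
  using psi by (auto simp: H10_def)
 note c = C1c_sq_int(1)[OF phi(1)] C1c_grad_sq_int[OF phi(1)]
 have lim: "(%n. LBINT x. k x \<bullet> a n x) ----> (LBINT x. k x \<bullet> b x)"
  if "sqL k" "\<And>n. sqL (a n)" "sqL b" "(%n. nrm (%x. a n x - b x)) ----> 0"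
  for k b :: "real ^ 'd => 'c::euclidean_space" and a
  by (rule l2_inner_tendsto[OF that(1,1) _ that(2-4)]) (simp add: l2n_def)
 have "(LBINT x. p (t, x) \<bullet> phi n x) + (LBINT x. g (t, x) \<bullet> grad (phi n) x) + (LBINT x. f (t, x) \<bullet> phi n x) = 0" for n
  using weak[OF t phi(1)[of n]] sq_int_integrable_inner[OF s(1) c(1)[of n]] sq_int_integrable_inner[OF s(2) c(2)[of n]]
   sq_int_integrable_inner[OF s(3) c(1)[of n]] by simp
 moreover have "(%n. (LBINT x. p (t, x) \<bullet> phi n x) + (LBINT x. g (t, x) \<bullet> grad (phi n) x) + (LBINT x. f (t, x) \<bullet> phi n x))
   ----> (LBINT x. p (t, x) \<bullet> psi x) + (LBINT x. g (t, x) \<bullet> \<Psi> x) + (LBINT x. f (t, x) \<bullet> psi x)"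
  by (intro tendsto_add lim s h phi(2,3) c)
 ultimately show ?thesis by (simp add: LIMSEQ_const_iff)
qed

text \<open>\<open>penG (u t)\<close> is approximated by \<open>penG (u t) - penG (u t - phi n)\<close>, which has compact
 support; the second term tends to \<open>penG (v0) = 0\<close>.\<close>

lemma H10_penG:
 assumes t: "good t"
 shows "H10 (%x. penG (u (t, x))) (%x. vDG (u (t, x)) (g (t, x)))"
proof -
 have t0: "0 < t" "t < T" and H: "H10 (%x. u (t, x) - v0 x) (%x. g (t, x) - g0 x)" using t by (auto simp: good_def)
 note s = good_sq[OF t]
 obtain phi' where phi': "\<And>n::nat. phi' n \<in> C1c unit_ball" "(%n. nrm (%x. phi' n x - (u (t, x) - v0 x))) ----> 0"
   "(%n. nrm (%x. grad (phi' n) x - (g (t, x) - g0 x))) ----> 0" using H by (auto simp: H10_def)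
 obtain r :: "nat => nat" where r: "strict_mono r" "AE x in lborel. (%n. phi' (r n) x) ----> u (t, x) - v0 x"
  using l2_tendsto_AE_subseq[OF C1c_sq_int(1)[OF phi'(1)] s(1) phi'(2)] by blast
 define phi where "phi n = phi' (r n)" for n
 have phi: "\<And>n. phi n \<in> C1c unit_ball" "AE x in lborel. (%n. phi n x) ----> u (t, x) - v0 x"
  and phil: "(%n. nrm (%x. phi n x - (u (t, x) - v0 x))) ----> 0"
   "(%n. nrm (%x. grad (phi n) x - (g (t, x) - g0 x))) ----> 0"
  using phi'(1) r(2) LIMSEQ_subseq_LIMSEQ[OF phi'(2) r(1)] LIMSEQ_subseq_LIMSEQ[OF phi'(3) r(1)]
  by (simp_all add: phi_def o_def)
 note ps = C1c_sq_int(1)[OF phi(1)] and gs = C1c_grad_sq_int[OF phi(1)]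
 have um: "(%x. u (t, x)) \<in> borel_measurable lborel" using sq_int_measurable[OF s(3)] .
 have gm: "(%x. g (t, x)) \<in> borel_measurable lborel" using sq_int_measurable[OF s(4)] .
 have Gm: "(%x. penG (k x)) \<in> borel_measurable M" if "k \<in> borel_measurable M" for k :: "real ^ 'd => 'b" and M
  by (rule measurable_compose[OF that borel_measurable_continuous_onI[OF continuous_penG]])
 have v1: "AE x in lborel. norm (v0 x) \<le> 1" using sphere by eventually_elim (use v0(3) in fastforce)
 have sG: "sqL (%x. penG (u (t, x)))"
  by (rule sq_int_bound[OF s(3) Gm[OF um], where c = 6]) (simp add: penG_bound)
 have sV: "sqL (%x. vDG (u (t, x)) (g (t, x)))"
  by (rule sq_int_bound[OF s(4) vDG_measurable[OF um gm], where c = 30]) (simp add: vDG_bound)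
 define psi where "psi n x = penG (u (t, x)) - penG (u (t, x) - phi n x)" for n x
 have B: "open (unit_ball :: (real ^ 'd) set)" by simp
 have Cphi: "Ck_on (Suc 0) unit_ball (phi n)" for n
  using phi(1)[of n] Ck_on_subset[OF _ subset_UNIV] unfolding C1c_def by blast
 have Cd: "Ck_on (Suc 0) unit_ball (%x. u (t, x) - phi n x)" for n by (rule Ck_on_diff[OF B slice(1)[OF t0] Cphi])
 have psiC: "psi n \<in> C1c unit_ball" for n
 proof -
  obtain K where K: "compact K" "K \<subseteq> unit_ball" "\<And>x. x \<notin> K ==> phi n x = 0" using C1c_support[OF phi(1)] by metis
  show ?thesis
  proof (rule C1c_I[OF B _ K(1,2)])
   show "Ck_on (Suc 0) unit_ball (psi n)" unfolding psi_def
    by (intro Ck_on_diff[OF B] Ck_on_penG(1)[OF _ B] slice(1)[OF t0] Cd)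
  qed (simp add: psi_def K)
 qed
 have psig: "grad (psi n) x = vDG (u (t, x)) (g (t, x)) - vDG (u (t, x) - phi n x) (g (t, x) - grad (phi n) x)" for n x
 proof (cases "x \<in> unit_ball")
  case True
  have d: "(%x. penG (u (t, x))) differentiable (at x)" "(%x. penG (u (t, x) - phi n x)) differentiable (at x)"
   "(%x. u (t, x)) differentiable (at x)" "phi n differentiable (at x)"
   using Ck_on_penG(1)[OF slice(1)[OF t0] B] Ck_on_penG(1)[OF Cd B] slice(1)[OF t0] Cphi True by auto
  have "grad (%x. u (t, x)) x = g (t, x)" by (rule slice(2)[OF t0 True])
  then have gi: "pderiv_dir (axis i 1) (%x. u (t, x)) x = g (t, x) $ i" for i by (auto simp: grad_def vec_eq_iff)
  show ?thesis
   unfolding psi_def grad_def vDG_def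
   by (simp add: vec_eq_iff pderiv_dir_diff[OF d(1,2)] Ck_on_penG(2)[OF slice(1)[OF t0] B True] Ck_on_penG(2)[OF Cd B True]
     pderiv_dir_diff[OF d(3,4)] gi)
 next
  case False
  obtain K where K: "compact K" "K \<subseteq> unit_ball" "\<And>x. x \<notin> K ==> phi n x = 0" "\<And>x v. x \<notin> K ==> pderiv_dir v (phi n) x = 0"
   using C1c_support[OF phi(1)] by metis
  have "x \<notin> K" using False K by blast
  obtain L where L: "L \<subseteq> unit_ball" "\<And>x v. x \<notin> L ==> pderiv_dir v (psi n) x = 0"
   using C1c_support[OF psiC] by metis
  have "x \<notin> L" using False L by blast
  have "grad (phi n) x = 0" "grad (psi n) x = 0" "phi n x = 0"
   using K(3,4)[OF \<open>x \<notin> K\<close>] L(2)[OF \<open>x \<notin> L\<close>] by (auto simp: grad_def vec_eq_iff)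
  then show ?thesis by simp
 qed
 have phim: "phi n \<in> borel_measurable lborel" "grad (phi n) \<in> borel_measurable lborel" for n
  using sq_int_measurable[OF ps] sq_int_measurable[OF gs] by auto
 have l1: "(%n. nrm (%x. psi n x - penG (u (t, x)))) ----> 0"
 proof (rule tendsto_sandwich[OF _ _ tendsto_const])
  show "(%n. 30 * nrm (%x. phi n x - (u (t, x) - v0 x))) ----> 0" using tendsto_mult_left[OF phil(1), of 30] by simp
  show "\<forall>\<^sub>F n in sequentially. nrm (%x. psi n x - penG (u (t, x))) \<le> 30 * nrm (%x. phi n x - (u (t, x) - v0 x))"
  proof (rule always_eventually, rule allI, rule l2n_mono_AE)
   fix n
   show "sqL (%x. phi n x - (u (t, x) - v0 x))" by (intro sq_int_diff ps s)
   show "(%x. psi n x - penG (u (t, x))) \<in> borel_measurable lborel"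
    unfolding psi_def using Gm um phim by (intro borel_measurable_diff Gm) auto
   show "AE x in lborel. norm (psi n x - penG (u (t, x))) \<le> 30 * norm (phi n x - (u (t, x) - v0 x))"
    using v1
   proof eventually_elim
    case (elim x)
    have "norm (penG (u (t, x) - phi n x) - penG (v0 x)) \<le> 30 * norm (u (t, x) - phi n x - v0 x)" by (rule penG_lipschitz)
    then show ?case using penG_zero(1)[OF elim] norm_minus_commute[of "phi n x" "u (t, x) - v0 x"]
     by (simp add: psi_def algebra_simps)
   qed
  qed simp
 qed simp
 \<comment> \<open>The factor \<open>g0\<close> is only square integrable, so a Lipschitz bound in
   the first argument would not suffice. Dominated convergence is used along the almost everywhere
   convergent subsequence chosen above; the limit \<open>vDG (v0 x) (g0 x)\<close> vanishes because
   \<open>norm (v0 x) <= 1\<close>.\<close>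
 have l2a: "(%n. nrm (%x. vDG (u (t, x) - phi n x) (g0 x))) ----> 0"
 proof -
  have m: "(%x. (norm (vDG (u (t, x) - phi n x) (g0 x)))^2) \<in> borel_measurable lborel" for n
  proof -
   have "(%x. vDG (u (t, x) - phi n x) (g0 x)) \<in> borel_measurable lborel"
    using um phim sq_int_measurable[OF v0(2)] by (intro vDG_measurable borel_measurable_diff) auto
   then show ?thesis by measurable
  qed
  have "(%n. LBINT x. (norm (vDG (u (t, x) - phi n x) (g0 x)))^2) ----> (\<integral>x. 0 \<partial>(lborel :: (real ^ 'd) measure))"
  proof (rule integral_dominated_convergence)
   show "intL (%x. 900 * (norm (g0 x))^2)" using sq_int_integrable[OF v0(2)] by simp
   show "AE x in lborel. norm ((norm (vDG (u (t, x) - phi n x) (g0 x)))^2) \<le> 900 * (norm (g0 x))^2" for n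
    using power_mono[OF vDG_bound, of "u (t, _) - phi n _" "g0 _" 2] by (auto simp: power_mult_distrib)
   show "AE x in lborel. (%n. (norm (vDG (u (t, x) - phi n x) (g0 x)))^2) ----> 0"
    using v1 phi(2)
   proof eventually_elim
    case (elim x)
    have "(%n. u (t, x) - phi n x) ----> u (t, x) - (u (t, x) - v0 x)" by (intro tendsto_intros elim(2))
    then have "(%n. vDG (u (t, x) - phi n x) (g0 x)) ----> vDG (v0 x) (g0 x)" by (intro vDG_tendsto) simp
    also have "vDG (v0 x) (g0 x) = 0" using penG_zero(2)[OF elim(1)] by (simp add: vDG_def vec_eq_iff)
    finally have "(%n. (norm (vDG (u (t, x) - phi n x) (g0 x)))^2) ----> (norm (0 :: 'b ^ 'd))^2" by (intro tendsto_intros)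
    then show ?case by simp
   qed
  qed (use m in auto)
  then have "(%n. sqrt (LBINT x. (norm (vDG (u (t, x) - phi n x) (g0 x)))^2)) ----> sqrt 0" by (intro tendsto_intros) simp
  then show ?thesis by (simp add: l2n_def)
 qed
 have l2: "(%n. nrm (%x. grad (psi n) x - vDG (u (t, x)) (g (t, x)))) ----> 0"
 proof (rule tendsto_sandwich[OF _ _ tendsto_const])
  let ?e = "%n. 30 * nrm (%x. grad (phi n) x - (g (t, x) - g0 x)) + nrm (%x. vDG (u (t, x) - phi n x) (g0 x))"
  show "?e ----> 0" using tendsto_add[OF tendsto_mult_left[OF phil(2), of 30] l2a] by simp
  show "\<forall>\<^sub>F n in sequentially. nrm (%x. grad (psi n) x - vDG (u (t, x)) (g (t, x))) \<le> ?e n"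
  proof (intro always_eventually allI)
   fix n
   let ?k = "%x. grad (phi n) x - (g (t, x) - g0 x)"
   have ks: "sqL ?k" by (intro sq_int_diff gs s)
   have um': "(%x. u (t, x) - phi n x) \<in> borel_measurable lborel" using um phim by (intro borel_measurable_diff) auto
   have m1: "(%x. vDG (u (t, x) - phi n x) (?k x)) \<in> borel_measurable lborel" by (rule vDG_measurable[OF um' sq_int_measurable[OF ks]])
   have m2: "(%x. vDG (u (t, x) - phi n x) (g0 x)) \<in> borel_measurable lborel" by (rule vDG_measurable[OF um' sq_int_measurable[OF v0(2)]])
   have s1: "sqL (%x. vDG (u (t, x) - phi n x) (?k x))" by (rule sq_int_bound[OF ks m1, where c = 30]) (simp add: vDG_bound)
   have s2: "sqL (%x. vDG (u (t, x) - phi n x) (g0 x))" by (rule sq_int_bound[OF v0(2) m2, where c = 30]) (simp add: vDG_bound)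
   have e: "grad (psi n) x - vDG (u (t, x)) (g (t, x)) = vDG (u (t, x) - phi n x) (?k x) - vDG (u (t, x) - phi n x) (g0 x)" for x
    unfolding psig by (simp add: vDG_diff)
   have "nrm (%x. grad (psi n) x - vDG (u (t, x)) (g (t, x))) \<le> nrm (%x. vDG (u (t, x) - phi n x) (?k x)) + nrm (%x. vDG (u (t, x) - phi n x) (g0 x))"
    unfolding e by (rule l2n_diff_triangle[OF s1 s2])
   moreover have "nrm (%x. vDG (u (t, x) - phi n x) (?k x)) \<le> 30 * nrm ?k"
    by (rule l2n_mono_AE[OF ks m1]) (simp_all add: vDG_bound)
   ultimately show "nrm (%x. grad (psi n) x - vDG (u (t, x)) (g (t, x))) \<le> ?e n" by linarith
  qed
 qed simp
 show ?thesis unfolding H10_def using sG sV psiC l1 l2 by blast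
qed

end

lemma pos_on_open_imp_all:
 fixes f :: "'a::euclidean_space => 'b::euclidean_space"
 assumes S: "open S" and c: "continuous_on S f" and C: "closed C" and ae: "AE z in lborel. z \<in> S --> f z \<in> C"
  and z: "z \<in> S"
 shows "f z \<in> C"
proof (rule ccontr)
 assume n: "f z \<notin> C"
 define U where "U = S \<inter> f -` (- C)"
 have U: "open U" unfolding U_def using c S C by (intro continuous_open_preimage) auto
 have "AE z in lborel. z \<notin> U" using ae by eventually_elim (auto simp: U_def)
 then have "U \<in> null_sets lborel" using U by (subst (asm) AE_iff_null_sets[symmetric]) auto
 then have "negligible U" by (simp add: negligible_iff_null_sets null_sets_completionI)
 then show False using open_not_negligible[OF U] z n by (auto simp: U_def)
qed

context gl_flow
begin

text \<open>Gronwall's inequality in integrated form: \<open>exp (- C * t)\<close> times the penalty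
  does not increase. At almost every time the equation is tested with \<open>penG u\<close>; the
  gradient term is dropped by its sign and the nonlinear term is bounded by
  \<open>f_penG_bound\<close>.\<close>

lemma penalty_decay:
 obtains C where "\<And>s t. good s ==> good t ==> s < t ==>
  (LBINT x. pen ((norm (u (t, x)))^2)) \<le> exp (C * (t - s)) * (LBINT x. pen ((norm (u (s, x)))^2))"
proof -
 obtain C where C: "0 \<le> C" "\<And>z. - (f z \<bullet> penG (u z)) \<le> C * pen ((norm (u z))^2)" using f_penG_bound by blast
 have "(LBINT x. pen ((norm (u (t, x)))^2)) \<le> exp (C * (t - s)) * (LBINT x. pen ((norm (u (s, x)))^2))"
  if st: "good s" "good t" "s < t" for s t
 proof -
  have s0: "0 < s" "t < T" using st by (auto simp: good_def)
  define R where "R z = exp (- C * fst z) * (penG (u z) \<bullet> p z - C * pen ((norm (u z))^2))" for z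
  have um: "u \<in> borel_measurable lborel" using sq_int_measurable[OF sq(1)] .
  have sGz: "sqL (%z. penG (u z))"
   by (rule sq_int_bound[OF sq(1) measurable_compose[OF um borel_measurable_continuous_onI[OF continuous_penG]], where c = 6]) (simp add: penG_bound)
  note iP = pen_integrable
  have i0: "intL (%z. penG (u z) \<bullet> p z - C * pen ((norm (u z))^2))"
   by (intro integrable_diff integrable_mult_right sq_int_integrable_inner sGz sq_p iP sq)
  have iR: "intL (%z. ind {s..t} (fst z) *R R z)"
  proof (rule integrable_bound[OF i0])
   have "(%z :: 'd spacetime. exp (- C * fst z)) \<in> BM"
    by (intro borel_measurable_continuous_onI continuous_intros)
   then have "R \<in> borel_measurable lborel" unfolding R_def using borel_measurable_integrable[OF i0] by (intro borel_measurable_times) auto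
   then show "(%z. ind {s..t} (fst z) *R R z) \<in> borel_measurable lborel"
    using indicator_fst_measurable[of s t] by (intro borel_measurable_scaleR) auto
   have "\<bar>exp (- C * r) * b\<bar> \<le> \<bar>b\<bar>" if "0 \<le> r" for r b :: real
    using that C(1) by (simp add: abs_mult mult_left_le_one_le)
   then show "AE z in lborel. norm (ind {s..t} (fst z) *R R z) \<le> norm (penG (u z) \<bullet> p z - C * pen ((norm (u z))^2))"
    using s0 by (intro AE_I2) (auto simp: indicator_def R_def)
  qed
  have neg: "AE tau in lborel. ind {s..t} tau *R (LBINT x. R (tau, x)) \<le> 0"
   using AE_good sq_int_slices(1)[OF sq_p] sq_int_slices(1)[OF sq_f]
  proof eventually_elim
   case (elim tau)
   show ?case
   proof (cases "tau \<in> {s..t}")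
    case True
    then have g: "good tau" "0 < tau" "tau < T" using elim s0 by auto
    note H = H10_penG[OF g(1)]
    then have hs: "sqL (%x. penG (u (tau, x)))" "sqL (%x. vDG (u (tau, x)) (g (tau, x)))" by (auto simp: H10_def)
    note w = weak_at[OF g(2,3) elim(2) good_sq(4)[OF g(1)] elim(3) H]
    have 1: "0 \<le> (LBINT x. g (tau, x) \<bullet> vDG (u (tau, x)) (g (tau, x)))" by (intro integral_nonneg_AE) (simp add: vDG_nonneg)
    have 2: "- (LBINT x. f (tau, x) \<bullet> penG (u (tau, x))) \<le> C * (LBINT x. pen ((norm (u (tau, x)))^2))"
    proof -
     have "(LBINT x. - (f (tau, x) \<bullet> penG (u (tau, x)))) \<le> (LBINT x. C * pen ((norm (u (tau, x)))^2))"
      by (intro integral_mono integrable_minus integrable_mult_right sq_int_integrable_inner elim(3) hs iP good_sq(3)[OF g(1)] C(2))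
     then show ?thesis by simp
    qed
    have "(LBINT x. R (tau, x)) = exp (- C * tau) * ((LBINT x. p (tau, x) \<bullet> penG (u (tau, x))) - C * (LBINT x. pen ((norm (u (tau, x)))^2)))"
     using sq_int_integrable_inner[OF elim(2) hs(1)] iP[OF good_sq(3)[OF g(1)]] by (simp add: R_def inner_commute)
    also have "\<dots> \<le> 0" using w 1 2 by (intro mult_nonneg_nonpos) auto
    finally show ?thesis using True by simp
   qed simp
  qed
  let ?y = "%z. exp (- C * fst z) * pen ((norm (u z))^2)"
  have d: "((%tau. ?y (tau, x)) has_vector_derivative R (tau, x)) (at tau)" if "0 < tau" "tau < T" for tau x
  proof -
   have "((%tau. pen ((norm (u (tau, x)))^2)) has_derivative (%h. penG (u (tau, x)) \<bullet> (h *R p (tau, x)))) (at tau)"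
    by (rule has_derivative_compose[OF u_has_derivative[OF that, unfolded has_vector_derivative_def] pen_norm_has_derivative])
   then have d2: "((%tau. pen ((norm (u (tau, x)))^2)) has_real_derivative (penG (u (tau, x)) \<bullet> p (tau, x))) (at tau)"
    by (rule has_derivative_imp_has_field_derivative) (simp add: mult.commute)
   have d3: "((%tau. exp (- C * tau)) has_real_derivative (exp (- C * tau) * (- C))) (at tau)"
    by (auto intro!: derivative_eq_intros)
   from DERIV_mult[OF d3 d2] show ?thesis by (simp add: has_real_derivative_iff_has_vector_derivative R_def algebra_simps)
  qed
  have "(LBINT tau. ind {s..t} tau *R (LBINT x. R (tau, x))) = (LBINT x. ?y (t, x)) - (LBINT x. ?y (s, x))"
  proof (rule integral_FTC[OF _ iR])
   show "AE x in lborel. continuous_on {s..t} (%tau. ?y (tau, x))"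
    by (intro AE_I2 continuous_at_imp_continuous_on ballI has_vector_derivative_continuous[OF d]) (use s0 in auto)
  qed (use d st s0 iP[OF good_sq(3)] in auto)
  moreover have "0 \<le> (LBINT tau. - (ind {s..t} tau *R (LBINT x. R (tau, x))))"
   by (rule integral_nonneg_AE) (use neg in eventually_elim, simp)
  ultimately have "exp (- C * t) * (LBINT x. pen ((norm (u (t, x)))^2)) \<le> exp (- C * s) * (LBINT x. pen ((norm (u (s, x)))^2))" by simp
  then have "exp (C * t) * (exp (- C * t) * (LBINT x. pen ((norm (u (t, x)))^2))) \<le> exp (C * t) * (exp (- C * s) * (LBINT x. pen ((norm (u (s, x)))^2)))"
   by (intro mult_left_mono) auto
  then show ?thesis by (simp add: mult.assoc[symmetric] exp_add[symmetric] algebra_simps)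
 qed
 then show ?thesis using that by blast
qed

lemma ex_good_near_0:
 assumes "0 < delta" "delta \<le> T" shows "\<exists>s. good s \<and> s < delta"
proof -
 have "AE h in lborel. 0 < h --> h < delta --> good h" using AE_good by eventually_elim (use assms in auto)
 then show ?thesis using AE_not_null_interval[OF assms(1), of good] by blast
qed

text \<open>As \<open>s\<close> tends to 0 the penalty at \<open>s\<close> is at most four times the
  squared deviation from the data, so by \<open>penalty_decay\<close> the penalty vanishes at every
  good time. Continuity removes the exceptional sets, in space at good times and then in time at a
  fixed point of space.\<close>

lemma norm_u_le_1: "norm (u z) \<le> 1"
proof (cases "z \<in> cylinder T")
 case True
 obtain C where C: "\<And>s t. good s ==> good t ==> s < t ==>
  (LBINT x. pen ((norm (u (t, x)))^2)) \<le> exp (C * (t - s)) * (LBINT x. pen ((norm (u (s, x)))^2))"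
  using penalty_decay by blast
 note iP = pen_integrable[OF good_sq(3)]
 have small: "(LBINT x. pen ((norm (u (s, x)))^2)) \<le> 4 * (dev s)^2" if s: "good s" for s
 proof -
  have "(LBINT x. pen ((norm (u (s, x)))^2)) \<le> (LBINT x. 4 * (norm (u (s, x) - v0 x))^2)"
  proof (rule integral_mono_AE[OF iP[OF s]])
   show "intL (%x. 4 * (norm (u (s, x) - v0 x))^2)" using sq_int_integrable[OF good_sq(1)[OF s]] by simp
   show "AE x in lborel. pen ((norm (u (s, x)))^2) \<le> 4 * (norm (u (s, x) - v0 x))^2"
    using sphere
   proof eventually_elim
    case (elim x)
    show ?case
    proof (cases "x \<in> unit_ball")
     case True then show ?thesis using elim by (intro pen_le_dist) blast
    next
     case False
     then have "u (s, x) = 0" using outside(1) by (auto simp: cylinder_def)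
     then show ?thesis by (simp add: pen_def exc_zero)
    qed
   qed
  qed
  then show ?thesis by (simp add: l2n_sq)
 qed
 have zero: "AE x in lborel. norm (u (t, x)) \<le> 1" if t: "good t" for t
 proof -
  have t0: "0 < t" "t < T" using t by (auto simp: good_def)
  have "(LBINT x. pen ((norm (u (t, x)))^2)) \<le> e" if e: "e > 0" for e
  proof -
   \<comment> \<open>A bound for the growth factor times the 4 of \<open>small\<close>, so that a
     squared deviation of at most \<open>e / M\<close> yields exactly \<open>e\<close>. The absolute
     value spares the sign of \<open>C\<close>.\<close>
   define M where "M = exp (\<bar>C\<bar> * T) * 4"
   have M: "M > 0" by (simp add: M_def)
   obtain b where b: "b > 0" "\<And>s. 0 < s ==> s < b ==> dev s < sqrt (e / M)"
    by (rule dev_small[of "sqrt (e / M)"]) (use e M in auto)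
   have "0 < min b t" "min b t \<le> T" using b t0 by auto
   from ex_good_near_0[OF this] obtain s where s: "good s" "s < min b t" by blast
   then have s0: "0 < s" "s < b" "s < t" by (auto simp: good_def)
   have "(dev s)^2 \<le> (sqrt (e / M))^2" using b(2)[OF s0(1,2)] by (intro power_mono) auto
   then have l: "(dev s)^2 \<le> e / M" using that M by simp
   have "(LBINT x. pen ((norm (u (t, x)))^2)) \<le> exp (C * (t - s)) * (LBINT x. pen ((norm (u (s, x)))^2))"
    by (rule C[OF s(1) t s0(3)])
   also have "\<dots> \<le> exp (\<bar>C\<bar> * T) * (4 * (e / M))"
   proof (intro mult_mono)
    have "C * (t - s) \<le> \<bar>C\<bar> * (t - s)" using s0 by (intro mult_right_mono) auto
    also have "\<dots> \<le> \<bar>C\<bar> * T" using s0 t0 by (intro mult_left_mono) auto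
    finally show "exp (C * (t - s)) \<le> exp (\<bar>C\<bar> * T)" by simp
    show "(LBINT x. pen ((norm (u (s, x)))^2)) \<le> 4 * (e / M)" using small[OF s(1)] l by linarith
    show "0 \<le> (LBINT x. pen ((norm (u (s, x)))^2))" by (rule integral_nonneg_AE) (simp add: pen_bounds)
   qed simp
   also have "\<dots> = e" using M by (simp add: M_def)
   finally show ?thesis .
  qed
  note eps = this
  have "(LBINT x. pen ((norm (u (t, x)))^2)) \<le> 0"
  proof (rule ccontr)
   assume "\<not> ?thesis"
   then show False using eps[of "(LBINT x. pen ((norm (u (t, x)))^2)) / 2"] by linarith
  qed
  moreover have "0 \<le> (LBINT x. pen ((norm (u (t, x)))^2))" by (rule integral_nonneg_AE) (simp add: pen_bounds)
  ultimately have "(LBINT x. pen ((norm (u (t, x)))^2)) = 0" by (rule antisym)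
  then have "AE x in lborel. pen ((norm (u (t, x)))^2) = 0"
   using integral_nonneg_eq_0_iff_AE[OF iP[OF t]] by (simp add: pen_bounds)
  then show ?thesis
  proof eventually_elim
   case (elim x)
   then have "(norm (u (t, x)))^2 \<le> 1" using pen_pos[of "(norm (u (t, x)))^2"] by linarith
   then show ?case using power2_le_imp_le[of "norm (u (t, x))" 1] by simp
  qed
 qed
 obtain t0 x0 where z: "z = (t0, x0)" by (cases z)
 have tx: "0 < t0" "t0 < T" "x0 \<in> unit_ball" using True z by (auto simp: cyl_mem)
 have all: "norm (u (t, x)) \<le> 1" if "good t" "x \<in> unit_ball" for t x
 proof -
  have t: "0 < t" "t < T" using that by (auto simp: good_def)
  have "continuous_on unit_ball (%x. u (t, x))" using Ck_on_SucD[OF slice(1)[OF t]] by simp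
  then have "u (t, x) \<in> cball 0 1"
   by (rule pos_on_open_imp_all[of unit_ball, rotated]) (use zero[OF that(1)] that in "auto elim!: eventually_mono")
  then show ?thesis by simp
 qed
 have "continuous_on {0<..<T} (%t. u (t, x0))"
  by (rule continuous_on_compose2[OF cont(1)]) (use tx in "auto intro!: continuous_intros simp: cyl_mem")
 then have "u (t0, x0) \<in> cball 0 1"
  by (rule pos_on_open_imp_all[of "{0<..<T}", rotated]) (use AE_good all tx in "auto elim!: eventually_mono")
 then show ?thesis using z by simp
qed (simp add: outside)

end

section \<open>The double-well potential and the energy inequality\<close>

definition well :: "'b::euclidean_space => real" where "well y = ((norm y)^2 - 1)^2 / 4"

lemma well_nonneg: "0 \<le> well y" by (simp add: well_def)

text \<open>The left side is the derivative of \<open>well\<close> at \<open>y\<close> towards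
  \<open>z\<close>. On the unit ball the Hessian \<open>((norm y)^2 - 1) I + 2 y y^T\<close> is at
  most 2, which explains the error \<open>(norm (z - y))^2\<close>. It is an upper Taylor bound for
  \<open>well z\<close>; convexity, which fails inside the ball, plays no part in it.\<close>

lemma well_taylor:
 assumes y: "norm y \<le> 1" "norm z \<le> 1"
 shows "((norm y)^2 - 1) * (y \<bullet> (z - y)) \<ge> well z - well y - (norm (z - y))^2"
proof -
 define B delta q where "B = (norm y)^2 - 1" and "delta = (norm z)^2 - (norm y)^2" and "q = (norm (z - y))^2"
 have B: "B \<le> 0" using y power_mono[of "norm y" 1 2] by (simp add: B_def)
 have yz: "y \<bullet> (z - y) = (delta - q) / 2"
  by (simp add: delta_def q_def power2_norm_eq_inner inner_simps inner_commute)
 have w: "well z - well y = B * delta / 2 + delta^2 / 4"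
  by (simp add: well_def B_def delta_def power2_eq_square field_simps)
 have "\<bar>delta\<bar> = \<bar>norm z - norm y\<bar> * (norm z + norm y)"
  by (simp add: delta_def power2_eq_square square_diff_square_factored abs_mult mult.commute)
 also have "\<dots> \<le> norm (z - y) * 2" using y by (intro mult_mono norm_triangle_ineq3) auto
 finally have "\<bar>delta\<bar>^2 \<le> (norm (z - y) * 2)^2" by (intro power_mono) auto
 then have "delta^2 / 4 \<le> q" by (simp add: q_def power_mult_distrib)
 moreover have "B * q \<le> 0" using B by (intro mult_nonpos_nonneg) (simp_all add: q_def)
 moreover have "B * ((delta - q) / 2) = B * delta / 2 - B * q / 2" by (simp add: field_simps)
 ultimately show ?thesis unfolding B_def[symmetric] yz w q_def[symmetric] by linarith
qed

lemma well_le_dist: "norm z = 1 ==> norm y \<le> 1 ==> well y \<le> (norm (y - z))^2"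
 using well_taylor[of z y] by (simp add: well_def)

lemma well_le: "norm y \<le> 1 ==> well y \<le> 1 / 4"
 using power_mono[of "norm y" 1 2] power_mono[of "1 - (norm y)^2" 1 2] by (simp add: well_def power2_commute)

context gl_flow
begin

text \<open>By \<open>norm_u_le_1\<close> the argument of \<open>deriv chi\<close> is at most 1,
  below the threshold 2, so from here on the cutoff is inactive and the nonlinearity is a times the
  gradient of \<open>well\<close>.\<close>

lemma f_simp: "z \<in> cylinder T ==> f z = (a (fst z) * ((norm (u z))^2 - 1)) *R u z"
proof -
 assume z: "z \<in> cylinder T"
 have "(norm (u z))^2 \<le> 1" using power_mono[OF norm_u_le_1[of z], of 2] by simp
 then have "(1 - (norm (u z))^2)^2 \<le> 1^2" by (intro power_mono) auto
 then have "((norm (u z))^2 - 1)^2 < 2" by (simp add: power2_commute)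
 then show ?thesis using f_eq[OF z] by (simp add: chi_small)
qed

definition wd :: "'d spacetime => real" where
 "wd z = (if z \<in> cylinder T then a (fst z) * well (u z) else 0)"

lemma wd_nonneg: "0 \<le> wd z"
 using a(1)[of "fst z"] by (auto simp: wd_def cylinder_def well_nonneg)

lemma wd_measurable: "wd \<in> BM"
proof -
 have "continuous_on (cylinder T) (%z. a (fst z) * well (u z))"
  unfolding well_def by (intro continuous_intros cont continuous_on_compose2[OF a_cont]) (auto simp: cylinder_def)
 then have "(%z. ind (cylinder T) z *R (a (fst z) * well (u z))) \<in> BM"
  by (rule borel_measurable_continuous_on_indicator[rotated]) (rule cyl_borel)
 moreover have "wd = (%z. ind (cylinder T) z *R (a (fst z) * well (u z)))" by (auto simp: wd_def)
 ultimately show ?thesis by simp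
qed

lemma wd_le: "wd z \<le> A * ind (cylinder T) z"
proof (cases "z \<in> cylinder T")
 case True
 have "a (fst z) * well (u z) \<le> A * 1" using a(1,2)[of "fst z"] True well_le[OF norm_u_le_1[of z]] A_nonneg
  by (intro mult_mono) (auto simp: cylinder_def well_nonneg)
 then show ?thesis using True by (simp add: wd_def)
qed (simp add: wd_def)

lemma wd_integrable: "intL wd"
proof (rule integrable_bound)
 show "intL (%z :: 'd spacetime. A * ind (cylinder T) z)"
  by (intro integrable_mult_right integrable_real_indicator cylinder_finite) (simp add: cyl_borel)
 show "AE z in lborel. norm (wd z) \<le> norm (A * ind (cylinder T) z :: real)"
  using wd_le wd_nonneg A_nonneg by (auto simp: indicator_def intro!: AE_I2)
qed (use wd_measurable in simp)

abbreviation wI :: "real => real => real" where "wI s t \<equiv> (LBINT z. ind ({s..t} \<times> UNIV) z *R wd z)"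

lemma wd_TI: "0 \<le> s ==> s \<le> t ==> wI s t = (LBINT x. TI wd s t x)"
 "AE x in lborel. intL (%tau. wd (tau, x))"
 "intL (TI wd s t)"
proof -
 have i: "intL (%z. ind ({s..t} \<times> UNIV) z *R wd z)"
  by (rule integrable_mult_indicator[OF _ wd_integrable]) simp
 have e: "ind ({s..t} \<times> UNIV) (tau, x) *R wd (tau, x) = ind {s..t} tau *R wd (tau, x)" for tau x by (simp add: indicator_def)
 show "wI s t = (LBINT x. TI wd s t x)"
  using fubini(6)[OF i] unfolding e TI_def by simp
 show "intL (TI wd s t)" using fubini(4)[OF i] unfolding e TI_def[abs_def] .
 show "AE x in lborel. intL (%tau. wd (tau, x))" by (rule fubini(2)[OF wd_integrable])
qed

text \<open>\<open>well_taylor\<close> multiplied by \<open>a >= 0\<close>. Since \<open>a\<close>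
  does not increase in time, the later value of the potential, weighted with the earlier
  coefficient, is at least the later value of \<open>wd\<close>. This is where the monotonicity of
  the coefficient enters.\<close>

lemma nonlinear_increment:
 assumes h: "0 < h" and t: "0 < t" "t + h < T" and z: "0 < fst z" "fst z \<le> t"
 shows "f z \<bullet> Du h z \<ge> wd ((h, 0) + z) - wd z - A * (norm (Du h z))^2"
proof (cases "snd z \<in> unit_ball")
 case True
 then have c: "z \<in> cylinder T" "(h, 0) + z \<in> cylinder T" using h t z by (auto simp: cylinder_def mem_Times_iff)
 let ?z = "(h, 0) + z"
 have az: "0 \<le> a (fst z)" "a (fst z) \<le> A" "a (h + fst z) \<le> a (fst z)" using a(1)[of "fst z"] a(2)[of "fst z"] a(3)[of "fst z" "h + fst z"] h t z by auto
 have "f z \<bullet> Du h z = a (fst z) * (((norm (u z))^2 - 1) * (u z \<bullet> (u ?z - u z)))" unfolding f_simp[OF c(1)] Du_def by simp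
 moreover have "a (fst z) * (((norm (u z))^2 - 1) * (u z \<bullet> (u ?z - u z))) \<ge> a (fst z) * (well (u ?z) - well (u z) - (norm (u ?z - u z))^2)"
  by (intro mult_left_mono well_taylor norm_u_le_1 az)
 moreover have "a (h + fst z) * well (u ?z) \<le> a (fst z) * well (u ?z)" by (intro mult_right_mono az well_nonneg)
 moreover have "a (fst z) * (norm (u ?z - u z))^2 \<le> A * (norm (u ?z - u z))^2" by (intro mult_right_mono az) simp
 ultimately show ?thesis using c by (simp add: wd_def Du_def algebra_simps)
next
 case False
 then have c: "z \<notin> cylinder T" "(h, 0) + z \<notin> cylinder T" by (auto simp: cylinder_def mem_Times_iff)
 then show ?thesis using outside A_nonneg by (simp add: wd_def Du_def)
qed

text \<open>The error made when the time average of \<open>f\<close> over a step is replaced by its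
  value at the beginning of the step.\<close>

definition fdev :: "real => real => real" where
 "fdev t h = nrm (%z. ind {0..t} (fst z) *R ((1 / h) *R DF h z - f z))"

lemma sq_fdev: "0 < h ==> 0 \<le> t ==> sqL (%z. ind {0..t} (fst z) *R ((1 / h) *R DF h z - f z))"
 using sq_int_diff[OF sq_int_scaleR[OF sq_DF[of h t], of "1 / h"] sq_indicator_fst[OF sq_f, of 0 t]]
 by (simp add: scaleR_diff_right mult.commute)

lemma fdev_tendsto:
 assumes h: "h ----> 0" "\<And>n. 0 < h n" and t: "0 < t" "\<And>n. t + h n < T"
 shows "(%n. fdev t (h n)) ----> 0"
proof -
 let ?k = "%n z. ind {0..t} (fst z) *R ((1 / h n) *R DF (h n) z - f z)"
 let ?B = "{0..t} \<times> cball 0 1 :: 'd spacetime set"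
 have Bs: "?B \<in> sets borel" by (intro borel_closed closed_Times) auto
 have hne: "h n \<noteq> 0" for n using h(2)[of n] by simp
 have sf: "AE z in (lborel :: 'd spacetime measure). sqL (%tau. f (tau, snd z))"
  using AE_snd_lborel[OF sq_int_slices(2)[OF sq_f]] by simp
 have "(%n. LBINT z. (norm (?k n z))^2) ----> (\<integral>z. 0 \<partial>(lborel :: 'd spacetime measure))"
 proof (rule integral_dominated_convergence)
  show "intL (%z. (2 * Mf)^2 * ind ?B z :: real)"
   by (intro integrable_mult_right integrable_real_indicator emeasure_bounded_finite bounded_Times) (use Bs in auto)
  show "(%z. (norm (?k n z))^2) \<in> borel_measurable lborel" for n
   using sq_int_integrable[OF sq_fdev[of "h n" t]] h(2)[of n] t(1) by (auto dest: borel_measurable_integrable)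
  show "AE z in lborel. norm ((norm (?k n z))^2) \<le> (2 * Mf)^2 * ind ?B z" for n
   using DF_eq[of "h n"]
  proof eventually_elim
   case (elim z)
   show ?case
   proof (cases "fst z \<in> {0..t}")
    case True
    have D: "norm (DF (h n) z) \<le> h n * Mf * ind unit_ball (snd z)"
     using elim True h(2)[of n] TI_f_bound[of "h n" "fst z" "snd z"] by simp
    have "norm ((1 / h n) *R DF (h n) z) = (1 / h n) * norm (DF (h n) z)" using h(2)[of n] by simp
    also have "\<dots> \<le> (1 / h n) * (h n * Mf * ind unit_ball (snd z))" using D h(2)[of n] by (intro mult_left_mono) auto
    also have "\<dots> = Mf * ind unit_ball (snd z)" using h(2)[of n] by simp
    finally have 1: "norm ((1 / h n) *R DF (h n) z) \<le> Mf * ind unit_ball (snd z)" .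
    have 2: "norm (f z) \<le> Mf * ind unit_ball (snd z)"
     using f_bound[of z] outside(3)[of z] by (cases "snd z \<in> unit_ball") (auto simp: cylinder_def mem_Times_iff)
    have "norm ((1 / h n) *R DF (h n) z - f z) \<le> 2 * Mf * ind unit_ball (snd z)"
     using norm_triangle_ineq4[of "(1 / h n) *R DF (h n) z" "f z"] 1 2 by linarith
    also have "\<dots> \<le> 2 * Mf * ind ?B z" using True Mf_nonneg
     by (intro mult_left_mono) (auto simp: indicator_def mem_Times_iff)
    finally have "(norm ((1 / h n) *R DF (h n) z - f z))^2 \<le> (2 * Mf * ind ?B z)^2" by (intro power_mono) auto
    moreover have "(2 * Mf * ind ?B z)^2 = (2 * Mf)^2 * ind ?B z" by (simp add: indicator_def)
    ultimately show ?thesis using True by simp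
   qed (use Mf_nonneg in "auto simp: indicator_def")
  qed
  show "AE z in lborel. (%n. (norm (?k n z))^2) ----> 0"
   using sf AE_fst_neq[of 0]
  proof eventually_elim
   case (elim z)
   show ?case
   proof (cases "fst z \<in> {0..t}")
    case True
    then have z: "0 < fst z" "fst z < T" using elim(2) t(2)[of 0] h(2)[of 0] by auto
    have c: "isCont (%tau. f (tau, snd z)) (fst z)"
    proof (cases "snd z \<in> unit_ball")
     case True then show ?thesis by (rule continuous_slice[OF _ z cont(3)])
    next
     case False
     then have "(%tau. f (tau, snd z)) = (%_. 0)" using outside(3) by (auto simp: cylinder_def)
     then show ?thesis by simp
    qed
    have "((%s. TI f 0 s (snd z)) has_vector_derivative f (fst z, snd z)) (at (fst z))"
     unfolding TI_def by (rule indefinite_integral(2)[OF elim(1) z(1) c])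
    from has_vector_derivative_quotient_tendsto[OF this h(1) hne]
    have "(%n. (1 / h n) *R DF (h n) z) ----> f z" by (simp add: DF_def)
    then have "(%n. (norm ((1 / h n) *R DF (h n) z - f z))^2) ----> (norm (f z - f z))^2" by (intro tendsto_intros)
    then show ?thesis using True by simp
   qed simp
  qed
 qed auto
 then have "(%n. sqrt (LBINT z. (norm (?k n z))^2)) ----> sqrt 0" by (intro tendsto_intros) simp
 then show ?thesis by (simp add: fdev_def l2n_def)
qed

text \<open>As the data lie on the sphere, \<open>well u\<close> is at most the squared deviation
  from the data: the penalty energy starts at 0.\<close>

lemma wd_initial:
 assumes h: "0 < h" "h < delta" "delta \<le> T" and S: "\<And>tau. 0 < tau ==> tau < delta ==> dev tau \<le> S"
 shows "wI 0 h \<le> h * (A * S^2)"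
proof -
 have i: "intL (%z. ind ({0..h} \<times> UNIV) z *R wd z)"
  by (rule integrable_mult_indicator[OF _ wd_integrable]) simp
 have e: "ind ({0..h} \<times> UNIV) (tau, x) *R wd (tau, x) = ind {0..h} tau *R wd (tau, x)" for tau x by (simp add: indicator_def)
 have iS: "intL (%tau. ind {0..h} tau * (A * S^2) :: real)"
  by (intro integrable_mult_left integrable_real_indicator) (auto simp: emeasure_lborel_Icc_eq)
 have "wI 0 h = (LBINT tau. (LBINT x. ind {0..h} tau *R wd (tau, x)))"
  using fubini(5)[OF i] unfolding e by simp
 also have "\<dots> \<le> (LBINT tau. ind {0..h} tau * (A * S^2))"
 proof (rule integral_mono_AE[OF _ iS])
  show "intL (%tau. LBINT x. ind {0..h} tau *R wd (tau, x))" using fubini(3)[OF i] unfolding e .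
  show "AE tau in lborel. (LBINT x. ind {0..h} tau *R wd (tau, x)) \<le> ind {0..h} tau * (A * S^2)"
   using AE_good AE_lborel_singleton[of 0] fubini(1)[OF wd_integrable]
  proof eventually_elim
   case (elim tau)
   show ?case
   proof (cases "tau \<in> {0..h}")
    case True
    then have tau: "0 < tau" "tau < delta" "tau < T" "good tau" using elim h by auto
    have "(LBINT x. wd (tau, x)) \<le> (LBINT x. A * (norm (u (tau, x) - v0 x))^2)"
    proof (rule integral_mono_AE[OF elim(3)])
     show "intL (%x. A * (norm (u (tau, x) - v0 x))^2)" using sq_int_integrable[OF good_sq(1)[OF tau(4)]] by simp
     show "AE x in lborel. wd (tau, x) \<le> A * (norm (u (tau, x) - v0 x))^2"
      using sphere
     proof eventually_elim
      case (elim x)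
      show ?case
      proof (cases "x \<in> unit_ball")
       case True
       then have "well (u (tau, x)) \<le> (norm (u (tau, x) - v0 x))^2" using elim by (intro well_le_dist norm_u_le_1) blast
       then have "a tau * well (u (tau, x)) \<le> A * (norm (u (tau, x) - v0 x))^2"
        using a(1,2)[of tau] tau A_nonneg by (intro mult_mono) (auto simp: well_nonneg)
       then show ?thesis using True tau by (simp add: wd_def cyl_mem)
      qed (use A_nonneg in "simp add: wd_def cylinder_def")
     qed
    qed
    also have "\<dots> = A * (dev tau)^2" by (simp add: l2n_sq)
    also have "\<dots> \<le> A * S^2" using S[OF tau(1,2)] A_nonneg by (intro mult_left_mono power_mono) auto
    finally show ?thesis using True by simp
   qed simp
  qed
 qed
 also have "\<dots> = h * (A * S^2)" using h by simp
 finally show ?thesis .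
qed

text \<open>\<open>increment_energy\<close> divided by \<open>h^2\<close>. Up to \<open>fdev\<close>
  the primitive \<open>DF\<close> is \<open>h * f\<close>, and the pairing of \<open>f\<close> with
  \<open>Du\<close> is bounded below by increments of \<open>wd\<close>; integrated over
  \<open>{0..t}\<close> these leave the integral over \<open>{t..t + h}\<close> minus that over
  \<open>{0..h}\<close>. The remaining terms carry a factor that vanishes with
  \<open>h\<close>.\<close>

lemma increment_energy_estimate:
 assumes h: "0 < h" and t: "0 < t" "t + h < T"
  and G: "(nrm (TI g 0 h))^2 \<le> h^2 * ((nrm g0)^2 + eps)"
  and I: "wI 0 h \<le> h * eta"
  and X: "(LBINT z. (norm (ind {0..t} (fst z) *R Du h z))^2) \<le> h^2 * C" and C: "0 \<le> C"
 shows "(LBINT z. (norm (ind {0..t} (fst z) *R Du h z))^2) / h^2 + (LBINT x. (norm (DG h (t, x)))^2) / (2 * h^2)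
  + (LBINT x. TI wd t (t + h) x) / h \<le> ((nrm g0)^2 + eps) / 2 + eta + h * (A * C) + fdev t h * sqrt C"
proof -
 let ?X = "LBINT z. (norm (ind {0..t} (fst z) *R Du h z))^2"
 let ?Y = "LBINT x. (norm (DG h (t, x)))^2"
 let ?I = "%z. ind {0..t} (fst z) *R Du h z"
 let ?k = "%z. ind {0..t} (fst z) *R ((1 / h) *R DF h z - f z)"
 let ?P = "LBINT x. TI wd t (t + h) x"
 have Is: "sqL ?I" by (rule sq_indicator_fst[OF sq_Du])
 have ks: "sqL ?k" using h t by (intro sq_fdev) auto
 have fI: "intL (%z. f z \<bullet> ?I z)" by (rule sq_int_integrable_inner[OF sq_f Is])
 have iw: "intL (%z. ind ({r..s} \<times> UNIV) z *R wd z)" for r s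
  by (rule integrable_mult_indicator[OF _ wd_integrable]) simp
 have iw2: "intL (%z. ind ({h..t + h} \<times> UNIV) z *R wd z)" by (rule iw)
 have shift: "(LBINT z. ind ({0..t} \<times> UNIV) z *R wd ((h, 0) + z)) = wI h (t + h)"
  "intL (%z. ind ({0..t} \<times> UNIV) z *R wd ((h, 0) + z))"
 proof -
  have e: "(%z. ind ({h..t + h} \<times> UNIV) ((h, 0) + z) *R wd ((h, 0) + z)) = (%z. ind ({0..t} \<times> UNIV) z *R wd ((h, 0) + z))"
   by (auto simp: fun_eq_iff indicator_def)
  show "(LBINT z. ind ({0..t} \<times> UNIV) z *R wd ((h, 0) + z)) = wI h (t + h)"
   using lborel_shift(3)[of "%z. ind ({h..t + h} \<times> UNIV) z *R wd z" "(h, 0)"] borel_measurable_integrable[OF iw2] unfolding e by simp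
  show "intL (%z. ind ({0..t} \<times> UNIV) z *R wd ((h, 0) + z))"
   using lborel_shift(2)[OF iw2, of "(h, 0)"] unfolding e .
 qed
 \<comment> \<open>\<open>{h..t + h}\<close> together with \<open>{0..h}\<close> covers the same
   times as \<open>{0..t}\<close> together with \<open>{t..t + h}\<close>, the overlaps being null
   sets.\<close>
 have split: "wI h (t + h) - wI 0 t
  = ?P - wI 0 h"
 proof -
  have 1: "intL (%z. ind ({0..t} \<times> UNIV) z *R wd z)" "intL (%z. ind ({0..h} \<times> UNIV) z *R wd z)"
   "intL (%z. ind ({t..t + h} \<times> UNIV) z *R wd z)" by (rule iw)+
  have "(LBINT z. ind ({h..t + h} \<times> UNIV) z *R wd z + ind ({0..h} \<times> UNIV) z *R wd z)
   = (LBINT z. ind ({0..t} \<times> UNIV) z *R wd z + ind ({t..t + h} \<times> UNIV) z *R wd z)"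
  proof (rule integral_cong_AE)
   show "AE z in lborel. ind ({h..t + h} \<times> UNIV) z *R wd z + ind ({0..h} \<times> UNIV) z *R wd z
    = ind ({0..t} \<times> UNIV) z *R wd z + ind ({t..t + h} \<times> UNIV) z *R wd z"
    using AE_fst_neq[of h] AE_fst_neq[of t]
    by eventually_elim (use h t in "auto simp: indicator_def mem_Times_iff")
  qed (use iw2 1 in "auto intro!: borel_measurable_add dest!: borel_measurable_integrable")
  then have "wI h (t + h) + wI 0 h
   = wI 0 t + wI t (t + h)"
   using iw2 1 by simp
  then show ?thesis using wd_TI(1)[of t "t + h"] h t by simp
 qed
 have low: "?P - h * eta - A * (h^2 * C) \<le> (LBINT z. f z \<bullet> ?I z)"
 proof -
  have i1: "intL (%z. ind ({0..t} \<times> UNIV) z *R wd z)" by (rule iw)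
  have i2: "intL (%z. A * (norm (?I z))^2)" using sq_int_integrable[OF Is] by simp
  have "(LBINT z. ind ({0..t} \<times> UNIV) z *R wd ((h, 0) + z) - ind ({0..t} \<times> UNIV) z *R wd z - A * (norm (?I z))^2)
   \<le> (LBINT z. f z \<bullet> ?I z)"
  proof (rule integral_mono_AE)
   show "intL (%z. ind ({0..t} \<times> UNIV) z *R wd ((h, 0) + z) - ind ({0..t} \<times> UNIV) z *R wd z - A * (norm (?I z))^2)"
    by (intro integrable_diff shift i1 i2)
   show "AE z in lborel. ind ({0..t} \<times> UNIV) z *R wd ((h, 0) + z) - ind ({0..t} \<times> UNIV) z *R wd z - A * (norm (?I z))^2 \<le> f z \<bullet> ?I z"
    using AE_fst_neq[of 0]
   proof eventually_elim
    case (elim z)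
    show ?case
    proof (cases "fst z \<in> {0..t}")
     case True
     then show ?thesis using nonlinear_increment[OF h t, of z] elim by (simp add: indicator_def mem_Times_iff)
    qed (auto simp: indicator_def mem_Times_iff)
   qed
  qed (rule fI)
  then have "(LBINT z. ind ({0..t} \<times> UNIV) z *R wd ((h, 0) + z)) - wI 0 t - A * ?X
   \<le> (LBINT z. f z \<bullet> ?I z)"
   using shift(2) i1 sq_int_integrable[OF Is] by simp
  moreover have "A * ?X \<le> A * (h^2 * C)" using X A_nonneg by (rule mult_left_mono)
  ultimately show ?thesis using shift(1) split I by linarith
 qed
 have "(LBINT z. (ind {0..t} (fst z) *R DF h z) \<bullet> Du h z) = (LBINT z. h * (?k z \<bullet> ?I z) + h * (f z \<bullet> ?I z))"
  using h by (intro integral_cong) (auto simp: indicator_def inner_simps field_simps)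
 also have "\<dots> = h * (LBINT z. ?k z \<bullet> ?I z) + h * (LBINT z. f z \<bullet> ?I z)"
  using sq_int_integrable_inner[OF ks Is] fI by simp
 finally have K: "(LBINT z. (ind {0..t} (fst z) *R DF h z) \<bullet> Du h z) = h * (LBINT z. ?k z \<bullet> ?I z) + h * (LBINT z. f z \<bullet> ?I z)" .
 have "\<bar>LBINT z. ?k z \<bullet> ?I z\<bar> \<le> fdev t h * nrm ?I" unfolding fdev_def by (rule l2n_Cauchy_Schwarz[OF ks Is])
 also have "\<dots> \<le> fdev t h * (h * sqrt C)"
 proof (intro mult_left_mono)
  have "(nrm ?I)^2 \<le> (h * sqrt C)^2" using X C by (simp add: l2n_sq power_mult_distrib)
  then show "nrm ?I \<le> h * sqrt C" by (rule power2_le_imp_le) (use h C in simp)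
 qed (simp add: fdev_def)
 finally have kb: "- (fdev t h * (h * sqrt C)) \<le> (LBINT z. ?k z \<bullet> ?I z)" by linarith
 have hk: "h * (- (fdev t h * (h * sqrt C))) \<le> h * (LBINT z. ?k z \<bullet> ?I z)"
  by (rule mult_left_mono[OF kb]) (use h in simp)
 have hl: "h * (?P - h * eta - A * (h^2 * C)) \<le> h * (LBINT z. f z \<bullet> ?I z)"
  by (rule mult_left_mono[OF low]) (use h in simp)
 have "h^2 * ((nrm g0)^2 + eps) / 2 \<ge> (nrm (TI g 0 h))^2 / 2" using G by simp
 then have "?X + ?Y / 2 + h * ?P \<le> h^2 * ((nrm g0)^2 + eps) / 2 + h * (h * eta) + h * (A * (h^2 * C)) + h * (fdev t h * (h * sqrt C))"
  using increment_energy[OF h t] hk[unfolded mult_minus_right] hl[unfolded right_diff_distrib] unfolding K by linarith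
 then have "(?X + ?Y / 2 + h * ?P) / h^2 \<le> (h^2 * ((nrm g0)^2 + eps) / 2 + h * (h * eta) + h * (A * (h^2 * C)) + h * (fdev t h * (h * sqrt C))) / h^2"
  by (rule divide_right_mono) simp
 also have "\<dots> = ((nrm g0)^2 + eps) / 2 + eta + h * (A * C) + fdev t h * sqrt C"
  using h by (simp add: field_simps power2_eq_square)
 also have "(?X + ?Y / 2 + h * ?P) / h^2 = ?X / h^2 + ?Y / (2 * h^2) + ?P / h" using h by (simp add: field_simps power2_eq_square)
 finally show ?thesis .
qed

end

context gl_flow
begin

abbreviation E0 :: real where "E0 \<equiv> (nrm g0)^2"

text \<open>With the step sizes from \<open>avg_grad_sequence\<close> every error term of the
  previous estimate tends to 0, and what remains is half the Dirichlet energy of the data.\<close>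

lemma energy_sequence:
 assumes t: "0 < t" "t < T"
 obtains h R :: "nat => real" where "\<And>j. 0 < h j" "\<And>j. t + h j < T" "h ----> 0" "R ----> E0 / 2"
  "\<And>j. (LBINT z. (norm (ind {0..t} (fst z) *R Du (h j) z))^2) / (h j)^2 + (LBINT x. (norm (DG (h j) (t, x)))^2) / (2 * (h j)^2)
   + (LBINT x. TI wd t (t + h j) x) / h j \<le> R j"
proof -
 obtain h eps :: "nat => real" where h': "\<And>j. 0 < h j" "\<And>j. h j < T - t" and h0: "h ----> 0" and e0: "eps ----> 0"
  and G: "\<And>j. (nrm (TI g 0 (h j)))^2 \<le> (h j)^2 * (E0 + eps j)"
  using avg_grad_sequence[of "T - t"] t by auto
 have h: "0 < h j" "t + h j < T" for j using h'[of j] by auto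
 define eta where "eta j = wI 0 (h j) / h j" for j
 have eta_nonneg: "0 \<le> eta j" for j
  unfolding eta_def using h(1)[of j] by (intro divide_nonneg_pos integral_nonneg_AE AE_I2) (auto simp: wd_nonneg)
 have eta0: "eta ----> 0"
 proof (rule LIMSEQ_I)
  fix r :: real assume r: "0 < r"
  \<comment> \<open>Chosen so that \<open>A * S^2 < r\<close>; the summand 1 covers
    \<open>A = 0\<close>.\<close>
  define S where "S = sqrt (r / (2 * (A + 1)))"
  have "A * S^2 = r * (A / (2 * (A + 1)))" using r A_nonneg by (simp add: S_def)
  also have "\<dots> < r * 1" using r A_nonneg by (intro mult_strict_left_mono) (auto simp: divide_less_eq)
  finally have AS: "A * S^2 < r" by simp
  have "0 < S" using r A_nonneg by (simp add: S_def)
  then obtain b where b: "b > 0" "\<And>t. 0 < t ==> t < b ==> dev t < S" by (metis dev_small)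
  have "\<forall>\<^sub>F j in sequentially. h j < min b T" by (rule order_tendstoD(2)[OF h0]) (use b T in simp)
  then obtain M where M: "\<And>j. j \<ge> M ==> h j < min b T" by (auto simp: eventually_sequentially)
  have "norm (eta j - 0) < r" if "j \<ge> M" for j
  proof -
   have "wI 0 (h j) \<le> h j * (A * S^2)"
   proof (rule wd_initial[OF h(1) M[OF that]])
    fix tau assume "0 < tau" "tau < min b T"
    then show "dev tau \<le> S" using b(2)[of tau] by simp
   qed simp
   then have "eta j \<le> A * S^2" using h(1)[of j] by (simp add: eta_def pos_divide_le_eq mult.commute)
   then show ?thesis using AS eta_nonneg[of j] by simp
  qed
  then show "\<exists>no. \<forall>n\<ge>no. norm (eta n - 0) < r" by blast
 qed
 obtain M where M: "\<And>j. \<bar>eps j\<bar> \<le> M" using convergent_imp_Bseq[OF convergentI[OF e0]] by (auto simp: Bseq_def)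
 have M0: "0 \<le> M" using M[of 0] by simp
 define C where "C = E0 + Mf^2 * cQ + M"
 have C: "0 \<le> C" using M0 by (simp add: C_def cQ_def)
 have X: "(LBINT z. (norm (ind {0..t} (fst z) *R Du (h j) z))^2) \<le> (h j)^2 * C" for j
 proof -
  have "(LBINT z. (norm (ind {0..t} (fst z) *R Du (h j) z))^2) \<le> (h j)^2 * (E0 + Mf^2 * cQ + eps j)"
   by (rule Du_sq_bound[OF h(1) t(1) h(2) G])
  also have "\<dots> \<le> (h j)^2 * C" using M[of j] by (intro mult_left_mono) (auto simp: C_def)
  finally show ?thesis .
 qed
 define R where "R j = (E0 + eps j) / 2 + eta j + h j * (A * C) + fdev t (h j) * sqrt C" for j
 have "R ----> (E0 + 0) / 2 + 0 + 0 * (A * C) + 0 * sqrt C"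
  unfolding R_def by (intro tendsto_intros e0 eta0 h0 fdev_tendsto h t) simp
 then have R0: "R ----> E0 / 2" by simp
 show ?thesis
 proof (rule that[of h R, OF h h0 R0])
  fix j
  show "(LBINT z. (norm (ind {0..t} (fst z) *R Du (h j) z))^2) / (h j)^2 + (LBINT x. (norm (DG (h j) (t, x)))^2) / (2 * (h j)^2)
   + (LBINT x. TI wd t (t + h j) x) / h j \<le> R j"
   unfolding R_def by (rule increment_energy_estimate[OF h(1) t(1) h(2) G _ X C]) (use h(1)[of j] in "simp add: eta_def")
 qed
qed

text \<open>The three terms of \<open>energy_sequence\<close> are nonnegative, so each alone is
  bounded by \<open>R j\<close>, and Fatou lets the step size tend to 0. The statements about slices
  hold at every time, because the quotients of primitives converge by continuity in time. The
  constants contain neither \<open>A\<close> nor \<open>Mf\<close>.\<close>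

lemma energy_parts:
 assumes t: "0 < t" "t < T"
 shows "(LBINT z. (norm (ind {0..t} (fst z) *R p z))^2) \<le> E0 / 2"
  "sqL (%x. g (t, x))" "(LBINT x. (norm (g (t, x)))^2) \<le> E0"
  "intL (%x. wd (t, x))" "(LBINT x. wd (t, x)) \<le> E0 / 2"
proof -
 obtain h R :: "nat => real" where h: "\<And>j. 0 < h j" "\<And>j. t + h j < T" "h ----> 0" and R: "R ----> E0 / 2"
  and est: "\<And>j. (LBINT z. (norm (ind {0..t} (fst z) *R Du (h j) z))^2) / (h j)^2 + (LBINT x. (norm (DG (h j) (t, x)))^2) / (2 * (h j)^2)
   + (LBINT x. TI wd t (t + h j) x) / h j \<le> R j"
  by (rule energy_sequence[OF t], rule that)
 have hne: "h j \<noteq> 0" for j using h(1)[of j] by simp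
 have n1: "0 \<le> (LBINT z. (norm (ind {0..t} (fst z) *R Du (h j) z))^2) / (h j)^2" for j by simp
 have n2: "0 \<le> (LBINT x. (norm (DG (h j) (t, x)))^2) / (2 * (h j)^2)" for j by simp
 have TIn: "0 \<le> TI wd t (t + h j) x" for j x unfolding TI_def by (intro integral_nonneg_AE AE_I2) (simp add: wd_nonneg)
 have n3: "0 \<le> (LBINT x. TI wd t (t + h j) x) / h j" for j
  by (rule divide_nonneg_pos[OF integral_nonneg_AE[OF AE_I2[OF TIn]] h(1)])
 show "(LBINT z. (norm (ind {0..t} (fst z) *R p z))^2) \<le> E0 / 2"
 proof (rule p_part(2)[OF t h(3,1) R])
  fix j
  have "(LBINT z. (norm (ind {0..t} (fst z) *R Du (h j) z))^2) / (h j)^2 \<le> R j" using est[of j] n2[of j] n3[of j] by linarith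
  then show "(LBINT z. (norm (ind {0..t} (fst z) *R Du (h j) z))^2) \<le> (h j)^2 * R j"
   using h(1)[of j] by (simp add: pos_divide_le_eq mult.commute)
 qed
 have gl: "(%j. (1 / h j) *R DG (h j) (t, x)) ----> g (t, x)" if "sqL (%tau. g (tau, x))" for x
 proof -
  have "((%s. TI g 0 s x) has_vector_derivative g (t, x)) (at t)"
   unfolding TI_def by (rule indefinite_integral(2)[OF that t(1) g_cont[OF t]])
  from has_vector_derivative_quotient_tendsto[OF this h(3) hne] show ?thesis by (simp add: DG_def)
 qed
 have gq: "sqL (%x. (1 / h j) *R DG (h j) (t, x))" for j
 proof -
  have "0 \<le> t + h j" using t h(1)[of j] by simp
  then show ?thesis unfolding DG_def fst_conv snd_conv using t by (intro sq_int_scaleR sq_int_diff sq_int_TI(1) sq) auto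
 qed
 have gb: "(LBINT x. (norm ((1 / h j) *R DG (h j) (t, x)))^2) \<le> 2 * R j" for j
 proof -
  have "(LBINT x. (norm ((1 / h j) *R DG (h j) (t, x)))^2) = (LBINT x. (1 / (h j)^2) * (norm (DG (h j) (t, x)))^2)"
   by (intro integral_cong) (auto simp: power_mult_distrib power_divide)
  also have "\<dots> = 2 * ((LBINT x. (norm (DG (h j) (t, x)))^2) / (2 * (h j)^2))" by simp
  finally show ?thesis using est[of j] n1[of j] n3[of j] by linarith
 qed
 have R2: "(%j. 2 * R j) ----> E0" using tendsto_mult_left[OF R, of 2] by simp
 have gae: "AE x in lborel. (%j. (1 / h j) *R DG (h j) (t, x)) ----> g (t, x)"
  using sq_int_slices(2)[OF sq(2)] by eventually_elim (rule gl)
 have gm: "(%x. g (t, x)) \<in> borel_measurable lborel" using slice_meas(4) by simp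
 show "sqL (%x. g (t, x))" "(LBINT x. (norm (g (t, x)))^2) \<le> E0"
  using sq_int_fatou[OF gq gm gae gb R2] by auto
 have wm: "(%x. wd (t, x)) \<in> borel_measurable lborel" by (rule borel_measurable_pairI[OF wd_measurable]) auto
 have wae: "AE x in lborel. (%j. TI wd t (t + h j) x / h j) ----> wd (t, x)"
 proof (rule AE_I2)
  fix x :: "real ^ 'd"
  have sx: "sqL (%tau. wd (tau, x))"
  proof (rule sq_int_const_on(1)[of "{0..T}" _ A])
   show "(%tau. wd (tau, x)) \<in> BM" by (rule borel_measurable_pairI[OF wd_measurable]) auto
   show "norm (wd (tau, x)) \<le> A * ind {0..T} tau" for tau
   proof -
    have "A * ind (cylinder T) (tau, x) \<le> A * ind {0..T} tau"
     by (intro mult_left_mono A_nonneg) (auto simp: indicator_def cylinder_def)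
    then show ?thesis using wd_le[of "(tau, x)"] wd_nonneg[of "(tau, x)"] by simp
   qed
  qed (auto simp: emeasure_lborel_Icc_eq)
  have c: "isCont (%tau. wd (tau, x)) t"
  proof (cases "x \<in> unit_ball")
   case True
   have "continuous_on {0<..<T} (%tau. a tau * well (u (tau, x)))"
    unfolding well_def
    by (intro continuous_intros a_cont continuous_on_compose2[OF cont(1)]) (use True in "auto simp: cyl_mem")
   then have "isCont (%tau. a tau * well (u (tau, x))) t" using t by (simp add: continuous_on_eq_continuous_at)
   moreover have "\<forall>\<^sub>F tau in nhds t. a tau * well (u (tau, x)) = wd (tau, x)"
    by (rule eventually_nhds_in_open[of "{0<..<T}" t, THEN eventually_mono]) (use t True in "auto simp: wd_def cyl_mem")
   ultimately show ?thesis using isCont_cong[of "%tau. a tau * well (u (tau, x))" "%tau. wd (tau, x)" t] by simp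
  next
   case False
   then have "(%tau. wd (tau, x)) = (%_. 0)" by (auto simp: wd_def cylinder_def)
   then show ?thesis by simp
  qed
  have d: "((%s. TI wd 0 s x) has_vector_derivative wd (t, x)) (at t)"
   unfolding TI_def by (rule indefinite_integral(2)[OF sx t(1) c])
  have "TI wd 0 (t + h j) x - TI wd 0 t x = TI wd t (t + h j) x" for j
   using TI_split[OF sx, of 0 t "t + h j"] t h(1)[of j] by simp
  with has_vector_derivative_quotient_tendsto[OF d h(3) hne]
  show "(%j. TI wd t (t + h j) x / h j) ----> wd (t, x)" by simp
 qed
 have wi: "intL (%x. TI wd t (t + h j) x / h j)" for j using wd_TI(3)[of t "t + h j"] by simp
 have wn: "AE x in lborel. 0 \<le> TI wd t (t + h j) x / h j" for j
  by (rule AE_I2) (rule divide_nonneg_pos[OF TIn h(1)])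
 have wb: "(LBINT x. TI wd t (t + h j) x / h j) \<le> R j" for j
 proof -
  have "(LBINT x. TI wd t (t + h j) x / h j) = (LBINT x. TI wd t (t + h j) x) / h j" by simp
  then show ?thesis using est[of j] n1[of j] n2[of j] by linarith
 qed
 show "intL (%x. wd (t, x))" "(LBINT x. wd (t, x)) \<le> E0 / 2"
  using nonneg_fatou[OF wi wn wm wae wb R] by auto
qed

lemma p_bound: "(LBINT z. (norm (p z))^2) \<le> E0 / 2"
 by (rule p_exhaust(2)[OF sq_indicator_fst[OF sq_p] energy_parts(1)])

lemma sq_u_slice: "sqL (%x. u (t, x))"
 by (rule sq_int_const_on(1)[where A = unit_ball and C = 1])
   (use norm_u_le_1 outside(1) slice_meas(1) unit_ball_finite in "auto simp: indicator_def cylinder_def")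

lemma u_increment:
 assumes st: "0 < s" "s \<le> t" "t < T"
 shows "nrm (%x. u (t, x) - u (s, x)) \<le> sqrt (t * E0)"
proof (rule real_le_rsqrt)
 have "(nrm (%x. u (t, x) - u (s, x)))^2 = (LBINT x. (norm (u (t, x) - u (s, x)))^2)" by (rule l2n_sq)
 also have "\<dots> = (LBINT x. (norm (TI p s t x))^2)"
 proof (rule integral_cong_AE)
  show "(%x. (norm (u (t, x) - u (s, x)))^2) \<in> borel_measurable lborel" using slice_meas(1) by measurable
  have "TI p s t \<in> borel_measurable lborel" by (rule TI_measurable[OF meas(2)]) auto
  then show "(%x. (norm (TI p s t x))^2) \<in> borel_measurable lborel" by measurable
  show "AE x in lborel. (norm (u (t, x) - u (s, x)))^2 = (norm (TI p s t x))^2"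
   using sq_int_slices(2)[OF sq_p]
  proof eventually_elim
   case (elim x)
   note d = u_has_derivative[of _ x]
   have "TI p s t x = u (t, x) - u (s, x)"
    unfolding TI_def
   proof (rule FTC_interior)
    show "continuous_on {s..t} (%tau. u (tau, x))"
     by (intro continuous_at_imp_continuous_on ballI has_vector_derivative_continuous[OF d]) (use st in auto)
   qed (use st d sq_int_interval_integrable[OF elim] in auto)
   then show ?case by simp
  qed
 qed
 also have "\<dots> \<le> (t - s) * (LBINT z. ind ({s..t} \<times> UNIV) z *R (norm (p z))^2)" by (rule sq_int_TI(2)[OF sq_p st(2)])
 also have "\<dots> \<le> t * (LBINT z. (norm (p z))^2)"
  using st integrable_mult_indicator[OF _ sq_int_integrable[OF sq_p], of "{s..t} \<times> UNIV"] sq_int_integrable[OF sq_p]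
  by (intro mult_mono integral_mono) (auto simp: indicator_def)
 also have "\<dots> \<le> t * E0"
 proof (rule mult_left_mono)
  have "E0 / 2 \<le> E0" by simp
  then show "(LBINT z. (norm (p z))^2) \<le> E0" using p_bound by linarith
 qed (use st in simp)
 finally show "(nrm (%x. u (t, x) - u (s, x)))^2 \<le> t * E0" .
qed

text \<open>A rate at which the data are attained that does not depend on \<open>lambda\<close>. It
  survives the limit and provides the initial condition there. The triangle inequality is used with
  an intermediate time near 0.\<close>

lemma u_initial_bound:
 assumes t: "0 < t" "t < T"
 shows "dev t \<le> sqrt (t * E0)"
proof (rule field_le_epsilon)
 fix e :: real assume "0 < e"
 then obtain b where b: "b > 0" "\<And>s. 0 < s ==> s < b ==> dev s < e" by (metis dev_small)
 define s where "s = min b t / 2"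
 have s: "0 < s" "s < b" "s \<le> t" using b t by (auto simp: s_def min_def)
 have "dev t \<le> nrm (%x. u (t, x) - u (s, x)) + dev s"
  by (rule l2n_triangle3) (intro sq_u_slice v0)+
 then show "dev t \<le> sqrt (t * E0) + e"
  using u_increment[OF s(1,3) t(2)] b(2)[OF s(1,2)] by linarith
qed

end

section \<open>Rellich compactness by averages over balls\<close>

lemma nn_integral_shift:
 fixes a :: "'a::euclidean_space"
 assumes "f \<in> BM"
 shows "(\<integral>\<^sup>+z. f (a + z) \<partial>lborel) = (\<integral>\<^sup>+z. f z \<partial>lborel)"
proof -
 have "(\<integral>\<^sup>+z. f z \<partial>lborel) = (\<integral>\<^sup>+z. f z \<partial>distr lborel borel ((+) a))" by (simp add: lborel_distr_plus)
 also have "\<dots> = (\<integral>\<^sup>+z. f (a + z) \<partial>lborel)" by (rule nn_integral_distr) (use assms in auto)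
 finally show ?thesis by simp
qed

lemma segment_sq_bound:
 fixes u :: "'a::euclidean_space => 'b::euclidean_space"
 assumes S: "convex S" and der: "\<And>z. z \<in> S ==> (u has_derivative u' z) (at z)"
  and cont: "\<And>v. continuous_on S (%z. u' z v)"
  and bd: "\<And>z v. z \<in> S ==> norm (u' z v) \<le> D z * norm v"
  and z: "z \<in> S" "w + z \<in> S"
 shows "ennreal ((norm (u (w + z) - u z))^2)
  \<le> (\<integral>\<^sup>+tau. ind {0..1} tau * ennreal ((norm w)^2 * (D (tau *R w + z))^2) \<partial>lborel)"
proof -
 have seg: "tau *R w + z \<in> S" if "tau \<in> {0..1}" for tau :: real
 proof -
  have "(1 - tau) *R z + tau *R (w + z) \<in> S" using S z that by (auto simp: convex_alt)
  then show ?thesis by (simp add: algebra_simps)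
 qed
 define k where "k tau = u' (tau *R w + z) w" for tau
 have kc: "continuous_on {0..1} k" unfolding k_def
  by (rule continuous_on_compose2[OF cont]) (use seg in "auto intro!: continuous_intros")
 define k0 where "k0 tau = ind {0..1::real} tau *R k tau" for tau
 have k0m: "k0 \<in> borel_measurable lborel" unfolding k0_def
  using borel_integrable_atLeastAtMost'[OF kc] by (simp add: set_integrable_def borel_measurable_integrable)
 have k0i: "intL (%tau. ind {0..1} tau *R (norm (k tau))^2)"
  using borel_integrable_atLeastAtMost'[OF continuous_on_power[OF continuous_on_norm[OF kc], of 2]]
  by (simp add: set_integrable_def)
 have k0n: "(norm (k0 tau))^2 = ind {0..1} tau *R (norm (k tau))^2" for tau
  by (auto simp: k0_def indicator_def)
 have k0: "sqL k0" using k0m k0i by (simp add: sq_int_def k0n)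
 have uv: "((%tau. u (tau *R w + z)) has_vector_derivative k tau) (at tau)" if "tau \<in> {0..1}" for tau
 proof -
  have "((%tau. u (tau *R w + z)) has_derivative (%h. u' (tau *R w + z) (h *R w))) (at tau)"
   by (rule has_derivative_compose[where f = "%tau. tau *R w + z", OF _ der[OF seg[OF that]]]) (auto intro!: derivative_eq_intros)
  moreover have "u' (tau *R w + z) (h *R w) = h *R k tau" for h
   unfolding k_def using der[OF seg[OF that]] has_derivative_bounded_linear linear_cmul bounded_linear.linear by blast
  ultimately show ?thesis by (simp add: has_vector_derivative_def)
 qed
 have "(LBINT tau. ind {0..1} tau *R k0 tau) = u (1 *R w + z) - u (0 *R w + z)"
 proof (rule FTC_interior[where F = "%tau. u (tau *R w + z)"])
  show "continuous_on {0..1} (%tau. u (tau *R w + z))"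
   by (intro continuous_at_imp_continuous_on ballI) (use uv has_vector_derivative_continuous in blast)
  show "((%tau. u (tau *R w + z)) has_vector_derivative k0 tau) (at tau)" if "0 < tau" "tau < 1" for tau
   using uv[of tau] that by (simp add: k0_def)
  show "intL (%tau. ind {0..1} tau *R k0 tau)" by (rule sq_int_interval_integrable[OF k0])
 qed simp
 then have "(norm (u (w + z) - u z))^2 \<le> (LBINT tau. ind {0..1} tau *R (norm (k0 tau))^2)"
  using interval_integral_sq_bound[OF k0, of 0 1] by simp
 also have "\<dots> = (LBINT tau. ind {0..1} tau *R (norm (k tau))^2)"
  by (intro integral_cong) (auto simp: k0n indicator_def)
 finally have "ennreal ((norm (u (w + z) - u z))^2) \<le> ennreal (LBINT tau. ind {0..1} tau *R (norm (k tau))^2)"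
  by (rule ennreal_leI)
 also have "\<dots> = (\<integral>\<^sup>+tau. ennreal (ind {0..1} tau *R (norm (k tau))^2) \<partial>lborel)"
  by (rule nn_integral_eq_integral[symmetric, OF k0i]) auto
 also have "\<dots> \<le> (\<integral>\<^sup>+tau. ind {0..1} tau * ennreal ((norm w)^2 * (D (tau *R w + z))^2) \<partial>lborel)"
 proof (rule nn_integral_mono)
  fix tau :: real
  have "(norm (k tau))^2 \<le> (norm w)^2 * (D (tau *R w + z))^2" if "tau \<in> {0..1}"
   using power_mono[OF bd[OF seg[OF that], of w], of 2] by (simp add: k_def power_mult_distrib mult.commute)
  then show "ennreal (ind {0..1} tau *R (norm (k tau))^2) \<le> ind {0..1} tau * ennreal ((norm w)^2 * (D (tau *R w + z))^2)"
   by (auto simp: indicator_def intro: ennreal_leI)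
 qed
 finally show ?thesis .
qed

text \<open>The fundamental theorem along the segment from \<open>z\<close> to \<open>w + z\<close>,
  followed by Fubini and translation invariance. Nonnegative integrals are used throughout, so that
  the derivative bound \<open>D\<close> needs no separate treatment of integrability at each
  shift.\<close>

lemma translation_sq_bound:
 fixes u :: "'a::euclidean_space => 'b::euclidean_space"
 assumes S: "convex S" and der: "\<And>z. z \<in> S ==> (u has_derivative u' z) (at z)"
  and cont: "\<And>v. continuous_on S (%z. u' z v)"
  and bd: "\<And>z v. z \<in> S ==> norm (u' z v) \<le> D z * norm v"
  and D: "D \<in> BM" "(\<integral>\<^sup>+z. ennreal ((D z)^2) \<partial>lborel) \<le> ennreal C"
  and A: "\<And>z. z \<in> A ==> z \<in> S \<and> w + z \<in> S"
 shows "(\<integral>\<^sup>+z. ind A z * ennreal ((norm (u (w + z) - u z))^2) \<partial>lborel) \<le> ennreal ((norm w)^2 * C)"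
proof -
 note [measurable] = D(1)
 let ?F = "%tau z. ind {0..1::real} tau * ennreal ((norm w)^2 * (D (tau *R w + z))^2)"
 have "(\<integral>\<^sup>+z. ind A z * ennreal ((norm (u (w + z) - u z))^2) \<partial>lborel)
  \<le> (\<integral>\<^sup>+z. (\<integral>\<^sup>+tau. ?F tau z \<partial>lborel) \<partial>lborel)"
  using segment_sq_bound[OF S der cont bd] A by (intro nn_integral_mono) (auto simp: indicator_def)
 also have "\<dots> = (\<integral>\<^sup>+tau. (\<integral>\<^sup>+z. ?F tau z \<partial>lborel) \<partial>lborel)"
  by (rule lborel_pair.Fubini') measurable
 also have "\<dots> \<le> (\<integral>\<^sup>+tau. ind {0..1::real} tau * ennreal ((norm w)^2 * C) \<partial>lborel)"
 proof (rule nn_integral_mono)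
  fix tau :: real
  have "(\<integral>\<^sup>+z. ?F tau z \<partial>lborel) = ind {0..1} tau * (\<integral>\<^sup>+z. ennreal ((norm w)^2 * (D (tau *R w + z))^2) \<partial>lborel)"
   by (rule nn_integral_cmult) measurable
  also have "(\<integral>\<^sup>+z. ennreal ((norm w)^2 * (D (tau *R w + z))^2) \<partial>lborel) = (\<integral>\<^sup>+z. ennreal ((norm w)^2 * (D z)^2) \<partial>lborel)"
   by (rule nn_integral_shift[of "%z. ennreal ((norm w)^2 * (D z)^2)"]) measurable
  also have "\<dots> = ennreal ((norm w)^2) * (\<integral>\<^sup>+z. ennreal ((D z)^2) \<partial>lborel)"
   by (subst nn_integral_cmult[symmetric]) (auto simp: ennreal_mult)
  also have "\<dots> \<le> ennreal ((norm w)^2) * ennreal C" by (intro mult_left_mono D(2)) auto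
  also have "\<dots> = ennreal ((norm w)^2 * C)" by (simp add: ennreal_mult')
  finally show "(\<integral>\<^sup>+z. ?F tau z \<partial>lborel) \<le> ind {0..1} tau * ennreal ((norm w)^2 * C)"
   by (auto simp: mult_left_mono)
 qed
 also have "\<dots> = ennreal ((norm w)^2 * C)"
  by (subst nn_integral_multc) auto
 finally show ?thesis .
qed

lemma set_integral_sq_bound:
 fixes f :: "'a => 'b::euclidean_space"
 assumes f[measurable]: "f \<in> borel_measurable M" and B: "\<And>x. norm (f x) \<le> B"
  and K[measurable]: "K \<in> sets M" and fin: "emeasure M K < \<infinity>"
 shows "ennreal ((norm (\<integral>x. ind K x *R f x \<partial>M))^2)
  \<le> ennreal (measure M K) * (\<integral>\<^sup>+x. ind K x * ennreal ((norm (f x))^2) \<partial>M)"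
proof -
 let ?k = "%x. ind K x *R f x" and ?i = "ind K :: 'a => real"
 have isq: "(norm (?i x))^2 = ?i x" for x by (auto simp: indicator_def)
 have i: "sq_int M ?i" unfolding sq_int_def isq using fin by (auto intro: integrable_real_indicator)
 have k: "sq_int M ?k"
  by (rule sq_int_bound[OF i, where c = B]) (use B in "auto simp: indicator_def")
 have "norm (\<integral>x. ?k x \<partial>M) \<le> (\<integral>x. norm (?k x) \<partial>M)" by (rule integral_norm_bound)
 also have "\<dots> = (\<integral>x. norm (?i x) * norm (?k x) \<partial>M)"
  by (intro integral_cong) (auto simp: indicator_def)
 also have "\<dots> \<le> l2n M ?i * l2n M ?k" by (rule l2n_Cauchy_Schwarz_norm[OF i k])
 finally have "(norm (\<integral>x. ?k x \<partial>M))^2 \<le> (l2n M ?i * l2n M ?k)^2" by (intro power_mono) auto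
 also have "\<dots> = measure M K * (\<integral>x. (norm (?k x))^2 \<partial>M)"
  unfolding power_mult_distrib l2n_sq isq by simp
 finally have "ennreal ((norm (\<integral>x. ?k x \<partial>M))^2) \<le> ennreal (measure M K) * ennreal (\<integral>x. (norm (?k x))^2 \<partial>M)"
  by (simp add: ennreal_leI flip: ennreal_mult)
 also have "ennreal (\<integral>x. (norm (?k x))^2 \<partial>M) = (\<integral>\<^sup>+x. ennreal ((norm (?k x))^2) \<partial>M)"
  by (rule nn_integral_eq_integral[symmetric, OF sq_int_integrable[OF k]]) auto
 also have "\<dots> = (\<integral>\<^sup>+x. ind K x * ennreal ((norm (f x))^2) \<partial>M)"
  by (intro nn_integral_cong) (auto simp: indicator_def)
 finally show ?thesis .
qed

lemma bounded_convergent_subsequence: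
 fixes f :: "nat => 'i => 'b::euclidean_space"
 assumes I: "countable I" and bd: "\<And>k i. norm (f k i) \<le> B"
 obtains r :: "nat => nat" where "strict_mono r" "\<And>i. i \<in> I ==> convergent (%k. f (r k) i)"
proof -
 define P where "P n r = convergent (%k. f (r k) (from_nat_into I n))" for n :: nat and r :: "nat => nat"
 interpret subseqs P
 proof
  fix n and s :: "nat => nat"
  have "bounded (range (%k. f (s k) (from_nat_into I n)))" using bd by (auto simp: bounded_iff)
  then obtain l r where "strict_mono r" "((%k. f (s k) (from_nat_into I n)) \<circ> r) ----> l"
   using bounded_imp_convergent_subsequence by blast
  then show "\<exists>r'. strict_mono r' \<and> P n (s \<circ> r')" by (auto simp: P_def o_def convergent_def)
 qed
 have "convergent (%k. f (diagseq k) i)" if i: "i \<in> I" for i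
 proof -
  have "P (to_nat_on I i) (diagseq \<circ> ((+) (Suc (to_nat_on I i))))"
   by (rule diagseq_holds) (use convergent_subseq_convergent in "auto simp: P_def o_def")
  then have "convergent (%k. f (diagseq (k + Suc (to_nat_on I i))) i)"
   using I i by (simp add: P_def o_def add.commute)
  then show ?thesis by (subst (asm) convergent_ignore_initial_segment)
 qed
 then show thesis using that[OF subseq_diagseq] by blast
qed

text \<open>Plain averages take the place of smooth mollifiers: only their equicontinuity and the
  size of the error in \<open>L2\<close> matter.\<close>

definition avg :: "real => ('a::euclidean_space => 'b::euclidean_space) => 'a => 'b" where
 "avg delta u z = (1 / measure lborel (cball (0::'a) delta)) *R (LBINT y. ind (cball 0 delta) y *R u (z + y))"

lemma cball_lborel: "emeasure lborel (cball (z::'a::euclidean_space) delta) < \<infinity>"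
 by (rule emeasure_bounded_finite) simp

lemma cball_integrable:
 fixes f :: "'a::euclidean_space => 'b::euclidean_space"
 assumes [measurable]: "f \<in> BM" and B: "\<And>z. norm (f z) \<le> B"
 shows "intL (%y. ind (cball z delta) y *R f y)"
proof -
 have "intL (%y. ind (cball z delta) y *R B)"
  using cball_lborel[of z delta] by (intro integrable_scaleR_left) (auto intro: integrable_real_indicator)
 then show ?thesis
  by (rule integrable_bound) (use order_trans[OF B abs_ge_self] in "auto simp: indicator_def")
qed

text \<open>Jensen's inequality for the square, obtained from Cauchy-Schwarz against the indicator
  of the ball.\<close>

lemma avg_sq_bound:
 fixes f :: "'a::euclidean_space => 'b::euclidean_space"
 assumes delta: "delta > 0" and f: "f \<in> BM" "\<And>z. norm (f z) \<le> B"
 defines "c \<equiv> measure lborel (cball (0::'a) delta)"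
 shows "ennreal ((norm ((1 / c) *R (LBINT y. ind (cball 0 delta) y *R f y)))^2)
  \<le> ennreal (1 / c) * (\<integral>\<^sup>+y. ind (cball 0 delta) y * ennreal ((norm (f y))^2) \<partial>lborel)"
proof -
 have c: "c > 0" unfolding c_def using content_cball_pos[OF delta, of "0::'a"] by simp
 let ?I = "LBINT y. ind (cball 0 delta) y *R f y"
 let ?N = "\<integral>\<^sup>+y. ind (cball 0 delta) y * ennreal ((norm (f y))^2) \<partial>lborel"
 have "ennreal ((norm ((1 / c) *R ?I))^2) = ennreal ((1 / c)^2) * ennreal ((norm ?I)^2)"
  using c by (simp add: power_mult_distrib flip: ennreal_mult) (simp add: power_divide)
 also have "\<dots> \<le> ennreal ((1 / c)^2) * (ennreal c * ?N)"
  unfolding c_def by (intro mult_left_mono set_integral_sq_bound[where B = B]) (use f cball_lborel in auto)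
 also have "\<dots> = ennreal ((1 / c)^2 * c) * ?N" using c by (simp add: ennreal_mult mult.assoc)
 also have "(1 / c)^2 * c = 1 / c" using c by (simp add: power2_eq_square)
 finally show ?thesis .
qed

lemma avg_norm_le:
 fixes u :: "'a::euclidean_space => 'b::euclidean_space"
 assumes delta: "delta > 0" and u: "u \<in> BM" "\<And>z. norm (u z) \<le> 1"
 shows "norm (avg delta u z) \<le> 1"
proof -
 have c: "measure lborel (cball (0::'a) delta) > 0" using content_cball_pos[OF delta, of "0::'a"] by simp
 have m: "(%y. u (z + y)) \<in> BM" using u(1) by measurable
 have "norm (LBINT y. ind (cball 0 delta) y *R u (z + y)) \<le> (LBINT y. ind (cball (0::'a) delta) y)"
 proof (rule integral_norm_bound_integral)
  show "intL (%y. ind (cball 0 delta) y *R u (z + y))" by (rule cball_integrable[OF m u(2)])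
  show "intL (ind (cball 0 delta) :: 'a => real)"
   by (rule integrable_real_indicator) (use cball_lborel in auto)
 qed (use u(2) in "auto simp: indicator_def")
 then show ?thesis using c by (simp add: avg_def)
qed

lemma avg_measurable:
 fixes u :: "'a::euclidean_space => 'b::euclidean_space"
 assumes u[measurable]: "u \<in> BM"
 shows "avg delta u \<in> BM"
proof -
 have [measurable]: "(%p. u (fst p + snd p)) \<in> borel_measurable (borel \<Otimes>\<^sub>M lborel)"
  by (rule measurable_compose[OF _ u]) measurable
 have [measurable]: "cball (0::'a) delta \<in> sets borel" by simp
 have "(%z. LBINT y. ind (cball 0 delta) y *R u (z + y)) \<in> BM" by measurable
 then have "(%z. avg delta u z) \<in> BM" unfolding avg_def by measurable
 then show ?thesis by simp
qed

text \<open>Describes one function, with its constant \<open>C\<close> as a parameter; compactness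
  is about families that share \<open>C\<close>.\<close>

locale equi_diff =
 fixes S :: "'a::euclidean_space set" and u :: "'a => 'b::euclidean_space" and u' D C
 assumes S: "convex S" and der: "\<And>z. z \<in> S ==> (u has_derivative u' z) (at z)"
  and cont: "\<And>v. continuous_on S (%z. u' z v)"
  and bd: "\<And>z v. z \<in> S ==> norm (u' z v) \<le> D z * norm v"
  and D: "D \<in> BM" "(\<integral>\<^sup>+z. ennreal ((D z)^2) \<partial>lborel) \<le> ennreal C"
  and C: "0 \<le> C"
  and u: "u \<in> BM" "\<And>z. norm (u z) \<le> 1"
begin

text \<open>For a fixed radius the averages are Lipschitz with a constant that depends only on
  \<open>C\<close> and the volume of the ball, since the translation estimate may be integrated over
  the ball around \<open>z\<close>.\<close>

lemma avg_increment:
 assumes delta: "delta > 0" and z: "cball z delta \<subseteq> S" "cball (w + z) delta \<subseteq> S"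
 shows "(norm (avg delta u (w + z) - avg delta u z))^2 \<le> (norm w)^2 * C / measure lborel (cball (0::'a) delta)"
proof -
 define c where "c = measure lborel (cball (0::'a) delta)"
 have c: "c > 0" unfolding c_def using content_cball_pos[OF delta, of "0::'a"] by simp
 note [measurable] = u(1)
 have [measurable]: "cball z delta \<in> sets borel" by simp
 have i: "intL (%y. ind (cball 0 delta) y *R u (x + y))" for x
  by (rule cball_integrable[where B = 1]) (use u(2) in auto)
 have d: "norm (u (w + z + y) - u (z + y)) \<le> 2" for y
  using norm_triangle_ineq4[of "u (w + z + y)" "u (z + y)"] u(2)[of "w + z + y"] u(2)[of "z + y"] by linarith
 have "avg delta u (w + z) - avg delta u z
  = (1 / c) *R (LBINT y. ind (cball 0 delta) y *R (u (w + z + y) - u (z + y)))"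
  using integral_diff[OF i[of "w + z"] i[of z]]
  by (simp add: avg_def c_def scaleR_diff_right)
 then have "ennreal ((norm (avg delta u (w + z) - avg delta u z))^2)
  \<le> ennreal (1 / c) * (\<integral>\<^sup>+y. ind (cball 0 delta) y * ennreal ((norm (u (w + z + y) - u (z + y)))^2) \<partial>lborel)"
  unfolding c_def using avg_sq_bound[OF delta, of "%y. u (w + z + y) - u (z + y)" 2] d by simp
 also have "(\<integral>\<^sup>+y. ind (cball 0 delta) y * ennreal ((norm (u (w + z + y) - u (z + y)))^2) \<partial>lborel)
  = (\<integral>\<^sup>+y. ind (cball z delta) (z + y) * ennreal ((norm (u (w + (z + y)) - u (z + y)))^2) \<partial>lborel)"
  by (intro nn_integral_cong) (auto simp: indicator_def dist_norm add.assoc)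
 also have "\<dots> = (\<integral>\<^sup>+y. ind (cball z delta) y * ennreal ((norm (u (w + y) - u y))^2) \<partial>lborel)"
  by (rule nn_integral_shift[of "%y. ind (cball z delta) y * ennreal ((norm (u (w + y) - u y))^2)"]) measurable
 also have "\<dots> \<le> ennreal ((norm w)^2 * C)"
 proof (rule translation_sq_bound[OF S der cont bd D])
  show "y \<in> S \<and> w + y \<in> S" if "y \<in> cball z delta" for y
  proof -
   have "w + y \<in> cball (w + z) delta" using that by (auto simp: dist_norm)
   then show ?thesis using that z by auto
  qed
 qed
 finally have "ennreal ((norm (avg delta u (w + z) - avg delta u z))^2) \<le> ennreal (1 / c) * ennreal ((norm w)^2 * C)"
  by (simp add: mult_left_mono)
 also have "\<dots> = ennreal ((norm w)^2 * C / c)" using c C by (simp flip: ennreal_mult)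
 finally show ?thesis using c C by (simp add: c_def)
qed

text \<open>The error is an average of the translates by \<open>y\<close> with
  \<open>norm y <= delta\<close>, each of which costs at most \<open>delta^2 * C\<close> by
  \<open>translation_sq_bound\<close>; Fubini exchanges the two integrals.\<close>

lemma avg_error:
 assumes delta: "delta > 0" and A: "A \<in> sets borel" "\<And>z. z \<in> A ==> cball z delta \<subseteq> S"
 shows "(\<integral>\<^sup>+z. ind A z * ennreal ((norm (u z - avg delta u z))^2) \<partial>lborel) \<le> ennreal (delta^2 * C)"
proof -
 define c where "c = measure lborel (cball (0::'a) delta)"
 have c: "c > 0" unfolding c_def using content_cball_pos[OF delta, of "0::'a"] by simp
 note [measurable] = u(1) A(1)
 have [measurable]: "cball (0::'a) delta \<in> sets borel" by simp
 let ?F = "%y z. ennreal (1 / c) * (ind (cball 0 delta) y * (ind A z * ennreal ((norm (u (y + z) - u z))^2)))"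
 have e: "ind A z * ennreal ((norm (u z - avg delta u z))^2) \<le> (\<integral>\<^sup>+y. ?F y z \<partial>lborel)" for z
 proof -
  have i: "intL (%y. ind (cball 0 delta) y *R u (z + y))"
   by (rule cball_integrable[where B = 1]) (use u(2) in auto)
  have i2: "intL (%y. ind (cball 0 delta) y *R u z)"
   by (rule cball_integrable[where B = 1]) (use u(2) in auto)
  have d: "norm (u z - u (z + y)) \<le> 2" for y
   using norm_triangle_ineq4[of "u z" "u (z + y)"] u(2)[of z] u(2)[of "z + y"] by linarith
  have "(LBINT y. ind (cball (0::'a) delta) y *R u z) = (LBINT y. ind (cball (0::'a) delta) y) *R u z"
   by (rule integral_scaleR_left, rule integrable_real_indicator) (use cball_lborel in auto)
  also have "(LBINT y. ind (cball (0::'a) delta) y) = c" by (simp add: c_def)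
  finally have "u z = (1 / c) *R (LBINT y. ind (cball (0::'a) delta) y *R u z)"
   using c by simp
  then have "u z - avg delta u z
   = (1 / c) *R (LBINT y. ind (cball 0 delta) y *R (u z - u (z + y)))"
   using integral_diff[OF i2 i] by (simp add: avg_def c_def scaleR_diff_right)
  then have "ennreal ((norm (u z - avg delta u z))^2)
   \<le> ennreal (1 / c) * (\<integral>\<^sup>+y. ind (cball 0 delta) y * ennreal ((norm (u z - u (z + y)))^2) \<partial>lborel)"
   unfolding c_def using avg_sq_bound[OF delta, of "%y. u z - u (z + y)" 2] d by simp
  also have "\<dots> = (\<integral>\<^sup>+y. ennreal (1 / c) * (ind (cball 0 delta) y * ennreal ((norm (u (y + z) - u z))^2)) \<partial>lborel)"
   by (subst nn_integral_cmult[symmetric], measurable) (simp add: norm_minus_commute add.commute)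
  finally show ?thesis by (cases "z \<in> A") auto
 qed
 have "(\<integral>\<^sup>+z. ind A z * ennreal ((norm (u z - avg delta u z))^2) \<partial>lborel) \<le> (\<integral>\<^sup>+z. (\<integral>\<^sup>+y. ?F y z \<partial>lborel) \<partial>lborel)"
  by (intro nn_integral_mono e)
 also have "\<dots> = (\<integral>\<^sup>+y. (\<integral>\<^sup>+z. ?F y z \<partial>lborel) \<partial>lborel)"
  by (rule lborel_pair.Fubini') measurable
 also have "\<dots> \<le> (\<integral>\<^sup>+y. ennreal (delta^2 * C / c) * ind (cball (0::'a) delta) y \<partial>lborel)"
 proof (rule nn_integral_mono)
  fix y :: 'a
  have *: "(\<integral>\<^sup>+z. ind A z * ennreal ((norm (u (y + z) - u z))^2) \<partial>lborel) \<le> ennreal (delta^2 * C)" if y: "y \<in> cball 0 delta"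
  proof -
   have "(\<integral>\<^sup>+z. ind A z * ennreal ((norm (u (y + z) - u z))^2) \<partial>lborel) \<le> ennreal ((norm y)^2 * C)"
   proof (rule translation_sq_bound[OF S der cont bd D])
    show "z \<in> S \<and> y + z \<in> S" if "z \<in> A" for z
     using A(2)[OF that] y delta by (auto simp: subset_iff dist_norm)
   qed
   also have "\<dots> \<le> ennreal (delta^2 * C)" using y C by (intro ennreal_leI mult_right_mono power_mono) auto
   finally show ?thesis .
  qed
  have F: "(\<integral>\<^sup>+z. ?F y z \<partial>lborel)
   = ennreal (1 / c) * (ind (cball 0 delta) y * (\<integral>\<^sup>+z. ind A z * ennreal ((norm (u (y + z) - u z))^2) \<partial>lborel))"
   by (subst nn_integral_cmult, measurable) (subst nn_integral_cmult, measurable)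
  show "(\<integral>\<^sup>+z. ?F y z \<partial>lborel) \<le> ennreal (delta^2 * C / c) * ind (cball (0::'a) delta) y"
  proof (cases "y \<in> cball 0 delta")
   case True
   then have "(\<integral>\<^sup>+z. ?F y z \<partial>lborel) \<le> ennreal (1 / c) * ennreal (delta^2 * C)"
    unfolding F using mult_left_mono[OF *[OF True], of "ennreal (1 / c)"] by simp
   also have "\<dots> = ennreal (delta^2 * C / c)" using c C by (simp flip: ennreal_mult)
   finally show ?thesis using True by simp
  qed (simp add: F)
 qed
 also have "\<dots> = ennreal (delta^2 * C / c) * ennreal c"
  unfolding c_def using cball_lborel[of "0::'a" delta]
  by (subst nn_integral_cmult_indicator) (auto simp: emeasure_eq_ennreal_measure)
 also have "\<dots> = ennreal (delta^2 * C)" using c C by (simp flip: ennreal_mult)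
 finally show ?thesis .
qed

end

text \<open>At each scale \<open>delta m\<close> the averages are bounded and equi-Lipschitz, so
  convergence on a countable dense set, obtained for all scales at once by a diagonal subsequence,
  spreads to all of \<open>A m\<close>. The functions themselves are within \<open>eps m\<close> of
  these averages uniformly in \<open>k\<close>, hence the subsequence is Cauchy. Regularity of the
  boundary of \<open>S\<close> is replaced by the bound 1 on the functions and the small measure of
  the layer \<open>S - A m\<close>.\<close>

lemma rellich:
 fixes S :: "'a::euclidean_space set" and u :: "nat => 'a => 'b::euclidean_space"
 assumes S: "open S" "bounded S" and ed: "\<And>k. equi_diff S (u k) (u' k) (D k) C"
  and outside: "\<And>k z. z \<notin> S ==> u k z = 0"
 obtains r :: "nat => nat" and v where "strict_mono r" "sqL v"
  "(%k. nrm (%z. u (r k) z - v z)) ----> 0"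
proof -
 have C: "0 \<le> C" using equi_diff.C[OF ed] .
 note u = equi_diff.u[OF ed]
 have Sfin: "emeasure lborel S < \<infinity>" by (rule emeasure_bounded_finite[OF S(2)])
 have Sne: "- S \<noteq> {}" using S(2) not_bounded_UNIV by (metis Compl_empty_eq double_complement)
 have [measurable]: "S \<in> sets borel" using S(1) by simp
 define delta where "delta m = 1 / (real m + 1)" for m :: nat
 have delta: "delta m > 0" for m by (simp add: delta_def)
 have delta0: "delta ----> 0" unfolding delta_def using LIMSEQ_Suc[OF lim_1_over_n] by (simp add: add.commute)
 define A where "A m = {z. delta m < infdist z (- S)}" for m
 have Aop: "open (A m)" for m
  unfolding A_def by (intro open_Collect_less continuous_intros)
 then have [measurable]: "A m \<in> sets borel" for m by simp
 have Acb: "cball z (delta m) \<subseteq> S" if "z \<in> A m" for z m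
 proof
  fix y assume y: "y \<in> cball z (delta m)"
  show "y \<in> S"
  proof (rule ccontr)
   assume "y \<notin> S"
   then have "infdist z (- S) \<le> dist z y" by (intro infdist_le) auto
   then show False using that y by (simp add: A_def)
  qed
 qed
 have AS: "A m \<subseteq> S" for m using Acb[of _ m] delta[of m] by force
 define V where "V m k = avg (delta m) (u k)" for m k
 have Vle: "norm (V m k z) \<le> 1" for m k z unfolding V_def by (rule avg_norm_le[OF delta u])
 have [measurable]: "V m k \<in> BM" for m k unfolding V_def by (rule avg_measurable[OF u(1)])
 have "\<forall>m. \<exists>T. countable T \<and> T \<subseteq> A m \<and> A m \<subseteq> closure T" using separable by metis
 then obtain T where T: "\<And>m. countable (T m)" "\<And>m. T m \<subseteq> A m" "\<And>m. A m \<subseteq> closure (T m)" by metis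
 have cI: "countable (Sigma UNIV T)" by (intro countable_SIGMA) (use T(1) in auto)
 obtain r :: "nat => nat" where r: "strict_mono r"
  and r2: "\<And>i. i \<in> Sigma UNIV T ==> convergent (%k. (%k (m, z). V m k z) (r k) i)"
  by (rule bounded_convergent_subsequence[OF cI, of "%k (m, z). V m k z" 1]) (use Vle in auto)
 have convT: "convergent (%k. V m (r k) z)" if "z \<in> T m" for m z
  using r2[of "(m, z)"] that by simp
 have conv: "convergent (%k. V m (r k) z)" if z: "z \<in> A m" for m z
 proof -
  define K where "K = sqrt (C / measure lborel (cball (0::'a) (delta m)))"
  have K: "0 \<le> K" using C by (simp add: K_def)
  have lip: "norm (V m k z' - V m k z) \<le> dist z' z * K" if z': "z' \<in> A m" for z' k
  proof -
   have "(norm (V m k ((z' - z) + z) - V m k z))^2 \<le> (norm (z' - z))^2 * C / measure lborel (cball (0::'a) (delta m))"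
    unfolding V_def by (rule equi_diff.avg_increment[OF ed delta]) (use Acb[OF z] Acb[OF z'] in auto)
   then have "(norm (V m k z' - V m k z))^2 \<le> (dist z' z * K)^2"
    using C by (simp add: power_mult_distrib K_def dist_norm)
   then show ?thesis by (rule power2_le_imp_le) (use K in simp)
  qed
  have "Cauchy (%k. V m (r k) z)"
  proof (rule metric_CauchyI)
   fix e :: real assume e: "e > 0"
   \<comment> \<open>\<open>K + 1\<close> instead of \<open>K\<close>, because the Lipschitz
     constant \<open>K\<close> may be 0.\<close>
   have "e / (3 * (K + 1)) > 0" using e K by simp
   then obtain z' where z': "z' \<in> T m" "dist z' z < e / (3 * (K + 1))"
    using T(3) z closure_approachable by blast
   have zA: "z' \<in> A m" using z'(1) T(2) by blast
   have "dist z' z * K \<le> dist z' z * (K + 1)" by (intro mult_left_mono) auto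
   also have "\<dots> < e / (3 * (K + 1)) * (K + 1)" using z'(2) K by (intro mult_strict_right_mono) auto
   also have "\<dots> = e / 3" using K by (simp add: divide_simps)
   finally have s: "dist (V m k z') (V m k z) < e / 3" for k using lip[OF zA, of k] by (simp add: dist_norm)
   obtain M where M: "\<And>i j. i \<ge> M ==> j \<ge> M ==> dist (V m (r i) z') (V m (r j) z') < e / 3"
    using metric_CauchyD[OF convergent_Cauchy[OF convT[OF z'(1)]], of "e / 3"] e by auto
   have "dist (V m (r i) z) (V m (r j) z) < e" if "i \<ge> M" "j \<ge> M" for i j
   proof -
    have "dist (V m (r i) z) (V m (r j) z) \<le> dist (V m (r i) z) (V m (r i) z') + dist (V m (r i) z') (V m (r j) z)"
     by (rule dist_triangle)
    also have "dist (V m (r i) z') (V m (r j) z) \<le> dist (V m (r i) z') (V m (r j) z') + dist (V m (r j) z') (V m (r j) z)"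
     by (rule dist_triangle)
    finally show ?thesis using s[of "r i"] s[of "r j"] M[OF that] by (simp add: dist_commute)
   qed
   then show "\<exists>M. \<forall>i\<ge>M. \<forall>j\<ge>M. dist (V m (r i) z) (V m (r j) z) < e" by blast
  qed
  then show ?thesis by (rule Cauchy_convergent)
 qed
 define W where "W m k z = ind (A m) z *R V m (r k) z" for m k z
 define L where "L m z = lim (%k. W m k z)" for m z
 have WL: "(%k. W m k z) ----> L m z" for m z
 proof -
  have "convergent (%k. W m k z)"
   by (cases "z \<in> A m") (use conv in "auto simp: W_def convergent_const")
  then show ?thesis by (simp add: L_def convergent_LIMSEQ_iff)
 qed
 have Wm[measurable]: "W m k \<in> BM" for m k
  unfolding W_def[abs_def] by measurable
 have Lm[measurable]: "L m \<in> BM" for m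
  by (rule borel_measurable_LIMSEQ_metric[OF Wm WL])
 have W1: "norm (W m k z) \<le> ind S z" for m k z
  using Vle AS[of m] by (auto simp: W_def indicator_def)
 have L1: "norm (L m z) \<le> ind S z" for m z
  by (rule LIMSEQ_le_const2[OF tendsto_norm[OF WL]]) (use W1 in auto)
 have Si: "intL (%z. ind S z *R (c::real))" for c
  by (rule integrable_scaleR_left, rule integrable_real_indicator) (use Sfin in auto)
 have sqS: "sqL f" if f: "f \<in> BM" "\<And>z. norm (f z) \<le> ind S z" for f :: "'a => 'b"
  unfolding sq_int_def
 proof
  show "intL (%z. (norm (f z))^2)"
  proof (rule integrable_bound[OF Si[of 1]])
   have "(norm (f z))^2 \<le> ind S z" for z
    using f(2)[of z] by (auto simp: indicator_def power_le_one split: if_splits)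
   then show "AE z in lborel. norm ((norm (f z))^2) \<le> norm (ind S z *R (1::real))" by simp
  qed (use f in simp)
 qed (use f in simp)
 note Wsq = sqS[OF Wm W1] and Lsq = sqS[OF Lm L1]
 have usq: "sqL (u k)" for k
  by (rule sqS[OF u(1)]) (use u(2) outside in "auto simp: indicator_def")
 have lim: "(%k. nrm (%z. W m k z - L m z)) ----> 0" for m
 proof -
  have "(%k. LBINT z. (norm (W m k z - L m z))^2) ----> (\<integral>z. 0 \<partial>(lborel::'a measure))"
  proof (rule integral_dominated_convergence[where w = "%z. ind S z *R (4::real)"])
   show "AE z in lborel. (%k. (norm (W m k z - L m z))^2) ----> 0"
    by (intro AE_I2) (auto intro!: tendsto_eq_intros WL)
   show "AE z in lborel. norm ((norm (W m k z - L m z))^2) \<le> ind S z *R (4::real)" for k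
   proof (rule AE_I2)
    fix z
    have "norm (W m k z - L m z) \<le> 2 * ind S z"
     using norm_triangle_ineq4[of "W m k z" "L m z"] W1[of m k z] L1[of m z] by linarith
    then have "(norm (W m k z - L m z))^2 \<le> (2 * ind S z)^2" by (intro power_mono) auto
    then show "norm ((norm (W m k z - L m z))^2) \<le> ind S z *R (4::real)"
     by (auto simp: indicator_def split: if_splits)
   qed
  qed (use Si in auto)
  then have "(%k. sqrt (LBINT z. (norm (W m k z - L m z))^2)) ----> sqrt 0"
   by (intro tendsto_real_sqrt) simp
  then show ?thesis by (simp add: l2n_def)
 qed
 \<comment> \<open>The first summand is the averaging error on \<open>A m\<close>, the second the
   boundary layer, where the average is replaced by 0.\<close>
 define eps where "eps m = sqrt ((delta m)^2 * C + measure lborel (S - A m))" for m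
 have SAfin: "emeasure lborel (S - A m) < \<infinity>" for m
  by (rule emeasure_bounded_finite) (use S(2) bounded_diff in blast)
 have err: "nrm (%z. u (r k) z - W m k z) \<le> eps m" for m k
 proof -
  note [measurable] = u(1)
  have "(\<integral>\<^sup>+z. ennreal ((norm (u (r k) z - W m k z))^2) \<partial>lborel)
   \<le> (\<integral>\<^sup>+z. ind (A m) z * ennreal ((norm (u (r k) z - V m (r k) z))^2) + ind (S - A m) z \<partial>lborel)"
  proof (rule nn_integral_mono)
   fix z
   have "ennreal ((norm (u (r k) z))^2) \<le> 1" using u(2)[of "r k" z] by (simp add: power_le_one)
   then show "ennreal ((norm (u (r k) z - W m k z))^2)
     \<le> ind (A m) z * ennreal ((norm (u (r k) z - V m (r k) z))^2) + ind (S - A m) z"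
    using outside[of z "r k"] AS[of m] by (cases "z \<in> A m"; cases "z \<in> S") (auto simp: W_def)
  qed
  also have "\<dots> = (\<integral>\<^sup>+z. ind (A m) z * ennreal ((norm (u (r k) z - V m (r k) z))^2) \<partial>lborel) + emeasure lborel (S - A m)"
   by (subst nn_integral_add) auto
  also have "\<dots> \<le> ennreal ((delta m)^2 * C) + ennreal (measure lborel (S - A m))"
  proof (rule add_mono)
   show "(\<integral>\<^sup>+z. ind (A m) z * ennreal ((norm (u (r k) z - V m (r k) z))^2) \<partial>lborel) \<le> ennreal ((delta m)^2 * C)"
    unfolding V_def by (rule equi_diff.avg_error[OF ed delta]) (use Acb in auto)
   show "emeasure lborel (S - A m) \<le> ennreal (measure lborel (S - A m))"
    using SAfin[of m] by (simp add: emeasure_eq_ennreal_measure)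
  qed
  also have "\<dots> = ennreal ((delta m)^2 * C + measure lborel (S - A m))" using C by simp
  finally have "(LBINT z. (norm (u (r k) z - W m k z))^2) \<le> (delta m)^2 * C + measure lborel (S - A m)"
   by (intro integral_real_bounded) (use C in auto)
  then show ?thesis unfolding l2n_def eps_def by (rule real_sqrt_le_mono)
 qed
 have "eps ----> sqrt (0^2 * C + measure lborel (\<Inter>m. S - A m))"
  unfolding eps_def
 proof (intro tendsto_intros delta0 Lim_measure_decseq)
  have "delta n \<le> delta m" if "m \<le> n" for m n using that by (simp add: delta_def divide_simps)
  then show "decseq (%m. S - A m)" unfolding decseq_def A_def using order_le_less_trans by fastforce
 qed (use SAfin in "auto simp: less_top")
 moreover have "(\<Inter>m. S - A m) = {}"
 proof -
  have "\<exists>m. z \<in> A m" if "z \<in> S" for z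
  proof -
   have "infdist z (- S) > 0"
    using in_closed_iff_infdist_zero[of "- S" z] S(1) Sne that infdist_nonneg[of z "- S"] by (auto simp: less_le)
   then have "\<forall>\<^sub>F m in sequentially. delta m < infdist z (- S)" by (rule order_tendstoD(2)[OF delta0])
   then show ?thesis unfolding A_def using eventually_happens' by fastforce
  qed
  then show ?thesis by blast
 qed
 ultimately have eps0: "eps ----> 0" by (simp del: INT_simps)
 obtain v where "sqL v" "(%k. nrm (%z. u (r k) z - v z)) ----> 0"
 proof (rule l2_complete[of lborel "%k. u (r k)"])
  show "sqL (u (r k))" for k by (rule usq)
  fix e :: real assume e: "e > 0"
  then obtain m where m: "eps m < e / 4"
   using eventually_happens'[OF sequentially_bot order_tendstoD(2)[OF eps0, of "e / 4"]] by auto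
  obtain N where N: "\<And>k. k \<ge> N ==> nrm (%z. W m k z - L m z) < e / 4"
   using order_tendstoD(2)[OF lim[of m], of "e / 4"] e by (auto simp: eventually_sequentially)
  have h: "nrm (%z. u (r k) z - L m z) < e / 2" if "k \<ge> N" for k
   using l2n_triangle3[OF usq[of "r k"] Wsq[of m k] Lsq[of m]] N[OF that] err[of k m] m by linarith
  have "nrm (%z. u (r i) z - u (r j) z) < e" if "i \<ge> N" "j \<ge> N" for i j
   using l2n_triangle3[OF usq[of "r i"] Lsq[of m] usq[of "r j"]] h[OF that(1)] h[OF that(2)]
    l2n_diff_commute[of lborel "u (r j)" "L m"] by linarith
  then show "\<exists>N. \<forall>i\<ge>N. \<forall>j\<ge>N. nrm (%z. u (r i) z - u (r j) z) < e" by blast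
 qed (rule that)
 then show thesis by (rule that[OF r])
qed

section \<open>Slices in space, test fields orthogonal to a map, and the equation on the
  cylinder\<close>

lemma Basis_snd: "e \<in> Basis ==> (0, e) \<in> Basis"
 by (simp add: Basis_prod_def)

lemma slice_has_derivative:
 assumes "f differentiable (at (t, x))"
 shows "((%x. f (t, x)) has_derivative (%h. pderiv_dir (0, h) f (t, x))) (at x)"
proof -
 have "(Pair t has_derivative Pair 0) (at x)" by (auto intro!: derivative_eq_intros)
 then show ?thesis by (rule has_derivative_compose) (rule pderiv_dir_has_derivative[OF assms])
qed

lemma Ck_on_slice:
 assumes f: "Ck_on (Suc 0) (I \<times> S) f" and t: "t \<in> I" and S: "open S"
 shows "Ck_on (Suc 0) S (%x. f (t, x))"
  and "x \<in> S ==> pderiv_dir v (%x. f (t, x)) x = pderiv_dir (0, v) f (t, x)"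
proof -
 have d: "((%x. f (t, x)) has_derivative (%h. pderiv_dir (0, h) f (t, x))) (at x)" if "x \<in> S" for x
  by (rule slice_has_derivative) (use f t that in auto)
 have "Ck_on 0 S (pderiv_dir e (%x. f (t, x)))" if e: "e \<in> Basis" for e
 proof (subst Ck_on_cong[OF S pderiv_dir_eq[OF d]])
  have "continuous_on (I \<times> S) (pderiv_dir (0, e) f)" using f Basis_snd[OF e] unfolding Ck_on.simps by blast
  then show "Ck_on 0 S (%x. pderiv_dir (0, e) f (t, x))" unfolding Ck_on.simps
   by (rule continuous_on_compose2) (use t in "auto intro!: continuous_intros")
 qed
 moreover have "(%x. f (t, x)) differentiable (at x)" if "x \<in> S" for x
  using d[OF that] by (auto simp: differentiable_def)
 ultimately show "Ck_on (Suc 0) S (%x. f (t, x))" unfolding Ck_on.simps(2) by blast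
 show "x \<in> S ==> pderiv_dir v (%x. f (t, x)) x = pderiv_dir (0, v) f (t, x)" by (rule pderiv_dir_eq[OF d])
qed

lemma C1c_slice:
 fixes \<Psi> :: "real \<times> (real ^ 'd) => 'b::euclidean_space"
 assumes "\<Psi> \<in> C1c (cylinder T)"
 shows "(%x. \<Psi> (t, x)) \<in> C1c unit_ball" "grad (%x. \<Psi> (t, x)) x $ i = pderiv_dir (0, axis i 1) \<Psi> (t, x)"
proof -
 have \<Psi>: "Ck_on (Suc 0) (UNIV \<times> UNIV) \<Psi>" using assms by (simp add: C1c_def)
 obtain K where K: "compact K" "K \<subseteq> cylinder T" "\<And>z. z \<notin> K ==> \<Psi> z = 0" using assms by (auto simp: C1c_def)
 have "compact (snd ` K)" by (intro compact_continuous_image K(1) continuous_intros)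
 moreover have "snd ` K \<subseteq> unit_ball" using K(2) by (auto simp: cylinder_def)
 moreover have "\<Psi> (t, x) = 0" if "x \<notin> snd ` K" for x using K(3)[of "(t, x)"] that by force
 ultimately show "(%x. \<Psi> (t, x)) \<in> C1c unit_ball"
  unfolding C1c_def using Ck_on_slice(1)[OF \<Psi>, of t] by (auto simp del: Ck_on.simps)
 show "grad (%x. \<Psi> (t, x)) x $ i = pderiv_dir (0, axis i 1) \<Psi> (t, x)"
  unfolding grad_def using Ck_on_slice(2)[OF \<Psi>, of t] by simp
qed

text \<open>For \<open>q = y\<close> of norm 1 this is the projection of \<open>phi\<close> onto the
  tangent space of the sphere at \<open>y\<close>. Keeping \<open>q\<close> separate from
  \<open>y\<close> makes the field linear in \<open>y\<close>.\<close>

definition wedge :: "'b::euclidean_space => 'b => 'b => 'b" where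
 "wedge y q phi = (y \<bullet> q) *R phi - (y \<bullet> phi) *R q"

lemma wedge_self: "y \<bullet> wedge y q phi = 0"
 by (simp add: wedge_def inner_diff_right)

lemma wedge_norm: "norm (wedge y q phi) \<le> 2 * norm y * norm q * norm phi"
proof -
 have "norm (wedge y q phi) \<le> \<bar>y \<bullet> q\<bar> * norm phi + \<bar>y \<bullet> phi\<bar> * norm q"
  unfolding wedge_def using norm_triangle_ineq4[of "(y \<bullet> q) *R phi" "(y \<bullet> phi) *R q"] by simp
 also have "\<dots> \<le> (norm y * norm q) * norm phi + (norm y * norm phi) * norm q"
  by (intro add_mono mult_right_mono Cauchy_Schwarz_ineq2) auto
 finally show ?thesis by (simp add: ac_simps)
qed

lemma wedge_diff: "wedge (y - y') q phi = wedge y q phi - wedge y' q phi" "wedge y (q - q') phi = wedge y q phi - wedge y q' phi"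
 by (simp_all add: wedge_def algebra_simps inner_diff_left inner_diff_right)

lemma wedge_C1c:
 fixes u q phi :: "'a::euclidean_space => 'b::euclidean_space"
 assumes S: "open S" and u: "Ck_on (Suc 0) S u" and q: "Ck_on (Suc 0) S q" and phi: "phi \<in> C1c S"
 shows "(%z. wedge (u z) (q z) (phi z)) \<in> C1c S"
  and "z \<in> S ==> pderiv_dir v (%z. wedge (u z) (q z) (phi z)) z
   = wedge (pderiv_dir v u z) (q z) (phi z) + wedge (u z) (pderiv_dir v q z) (phi z) + wedge (u z) (q z) (pderiv_dir v phi z)"
proof -
 have uq: "Ck_on (Suc 0) S (%z. u z \<bullet> q z)" by (rule Ck_on_bilinear[OF bounded_bilinear_inner S u q])
 have uphi: "(%z. u z \<bullet> phi z) \<in> C1c S" by (rule C1c_bilinear[OF bounded_bilinear_inner S u phi])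
 have fl: "bounded_bilinear (%(y :: 'b) c. c *R y)" by (rule bounded_bilinear.flip[OF bounded_bilinear_scaleR])
 have A: "(%z. (u z \<bullet> q z) *R phi z) \<in> C1c S" by (rule C1c_bilinear[OF bounded_bilinear_scaleR S uq phi])
 have B: "(%z. (u z \<bullet> phi z) *R q z) \<in> C1c S" by (rule C1c_bilinear[OF fl S q uphi])
 show "(%z. wedge (u z) (q z) (phi z)) \<in> C1c S" unfolding wedge_def by (rule C1c_diff[OF A B])
 assume z: "z \<in> S"
 have du: "u differentiable (at z)" and dq: "q differentiable (at z)" and dphi: "phi differentiable (at z)"
  using u q z C1c_differentiable[OF phi] by auto
 note b1 = pderiv_dir_bilinear[OF bounded_bilinear_inner du dq] pderiv_dir_bilinear[OF bounded_bilinear_inner du dphi]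
 show "pderiv_dir v (%z. wedge (u z) (q z) (phi z)) z
   = wedge (pderiv_dir v u z) (q z) (phi z) + wedge (u z) (pderiv_dir v q z) (phi z) + wedge (u z) (q z) (pderiv_dir v phi z)"
  unfolding wedge_def
  by (subst pderiv_dir_diff[OF C1c_differentiable[OF A] C1c_differentiable[OF B]])
    (simp add: pderiv_dir_bilinear(2)[OF bounded_bilinear_scaleR b1(1) dphi] pderiv_dir_bilinear(2)[OF bounded_bilinear_scaleR b1(3) dq]
     b1 algebra_simps)
qed

context heat_flow begin

text \<open>The slicewise equation integrated in time; the pairing with \<open>p\<close> is
  integrable because \<open>p\<close> is square integrable by now.\<close>

lemma weak_Q:
 assumes \<Psi>: "\<Psi> \<in> C1c (cylinder T)"
 shows "(LBINT z. p z \<bullet> \<Psi> z + (\<Sum>i\<in>UNIV. g z $ i \<bullet> pderiv_dir (0, axis i 1) \<Psi> z) + f z \<bullet> \<Psi> z) = 0"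
proof -
 let ?F = "%z. p z \<bullet> \<Psi> z + (\<Sum>i\<in>UNIV. g z $ i \<bullet> pderiv_dir (0, axis i 1) \<Psi> z) + f z \<bullet> \<Psi> z"
 note [measurable] = meas C1c_measurable(1)[OF \<Psi>]
 have "intL (%z. Mf *R norm (\<Psi> z))" by (intro integrable_scaleR_right integrable_norm C1c_integrable(1)[OF \<Psi>])
 then have "intL (%z. f z \<bullet> \<Psi> z)"
  by (rule integrable_bound)
    (use order_trans[OF Cauchy_Schwarz_ineq2 mult_right_mono[OF f_bound norm_ge_zero]] Mf_nonneg in auto)
 then have "intL ?F"
  by (intro integrable_add integrable_sum sq_int_integrable_inner[OF sq_p C1c_sq_int(1)[OF \<Psi>]]
   sq_int_integrable_inner[OF sq_int_vec_nth[OF sq(2)] C1c_sq_int(2)[OF \<Psi>]])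
 then have "(LBINT z. ?F z) = (LBINT t. (LBINT x. ?F (t, x)))"
  by (rule fubini(5)[symmetric])
 also have "\<dots> = (\<integral>t. 0 \<partial>(lborel :: real measure))"
 proof (intro integral_cong refl)
  fix t :: real
  show "(LBINT x. ?F (t, x)) = 0"
  proof (cases "0 < t \<and> t < T")
   case True
   have "?F (t, x) = p (t, x) \<bullet> \<Psi> (t, x) + g (t, x) \<bullet> grad (%x. \<Psi> (t, x)) x + f (t, x) \<bullet> \<Psi> (t, x)" for x
    by (simp add: inner_vec_def C1c_slice(2)[OF \<Psi>])
   then show ?thesis using weak[OF _ _ C1c_slice(1)[OF \<Psi>, of t]] True by simp
  next
   case False
   then have "(t, x) \<notin> cylinder T" for x :: "real ^ 'd" by (auto simp: cyl_mem)
   then have "?F (t, x) = 0" for x using outside(2-4)[of "(t, x)"] by simp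
   then show ?thesis by simp
  qed
 qed
 finally show ?thesis by simp
qed

end

text \<open>As \<open>arctan\<close> stays below \<open>pi / 2\<close>, the exponent never falls
  below 1/2. A power of \<open>lambda\<close> is thus left at all times, which forces the limit onto
  the sphere.\<close>

lemma half_power_le:
 assumes "1 \<le> l" shows "sqrt l \<le> l powr (1 - kappa t)"
proof -
 have "kappa t \<le> 1 / 2" using arctan_ubound[of t] by (simp add: kappa_def divide_simps)
 then have "l powr (1 / 2) \<le> l powr (1 - kappa t)" using assms by (intro powr_mono) auto
 then show ?thesis using assms by (simp add: powr_half_sqrt)
qed

section \<open>A sequence of flows with common data: uniform bounds and the limit map\<close>

lemma Ck_on_pderiv_dir_continuous:
 assumes "Ck_on (Suc 0) S f" shows "continuous_on S (%z. pderiv_dir v f z)"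
proof -
 have "continuous_on S (%z. \<Sum>e\<in>Basis. (v \<bullet> e) *R pderiv_dir e f z)"
  by (intro continuous_intros) (use assms in auto)
 moreover have "pderiv_dir v f z = (\<Sum>e\<in>Basis. (v \<bullet> e) *R pderiv_dir e f z)" if "z \<in> S" for z
  by (rule pderiv_dir_linear) (use assms that in auto)
 ultimately show ?thesis by (simp cong: continuous_on_cong)
qed

lemma pderiv_dir_space_time:
 fixes f :: "real \<times> (real ^ 'd) => 'b::euclidean_space"
 assumes "f differentiable (at z)"
 shows "pderiv_dir (s, y) f z = s *R pderiv_dir (1, 0) f z + (\<Sum>i\<in>UNIV. (y $ i) *R pderiv_dir (0, axis i 1) f z)"
proof -
 interpret linear "%v. pderiv_dir v f z"
  using has_derivative_linear[OF pderiv_dir_has_derivative[OF assms]] .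
 have e: "(s, y) = s *R (1, 0) + (\<Sum>i\<in>UNIV. (y $ i) *R (0, axis i 1))"
  by (rule prod_eqI) (simp_all add: fst_sum snd_sum vec_eq_iff axis_def if_distrib cong: if_cong)
 show ?thesis by (subst e) (simp only: add scale sum)
qed

text \<open>The upper bound \<open>A\<close> of the coefficient is instantiated by
  \<open>lam k\<close>, since \<open>kappa\<close> is nonnegative at positive times. The bound
  \<open>Mf k\<close> of the nonlinearity may grow with \<open>k\<close>; the estimates below do not
  contain it.\<close>

locale gl_seq =
 fixes T :: real and v0 :: "real ^ 'd => 'b::euclidean_space" and g0 :: "real ^ 'd => 'b ^ 'd" and chi :: "real => real"
  and u p f :: "nat => real \<times> (real ^ 'd) => 'b" and g :: "nat => real \<times> (real ^ 'd) => 'b ^ 'd" and Mf lam :: "nat => real"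
 assumes gl: "gl_flow T (Mf k) (u k) (p k) (f k) (g k) v0 g0 chi (%t. lam k powr (1 - kappa t)) (lam k)"
  and lam: "filterlim lam at_top sequentially" "1 \<le> lam k"
  and C1: "Ck_on (Suc 0) (cylinder T) (u k)"
  and dt: "z \<in> cylinder T ==> p k z = pderiv_dir (1, 0) (u k) z"
  and dx: "z \<in> cylinder T ==> g k z $ i = pderiv_dir (0, axis i 1) (u k) z"
begin

abbreviation K0 :: real where "K0 \<equiv> (nrm g0)^2"

lemma hf: "heat_flow T (Mf k) (u k) (p k) (f k) (g k) v0 g0"
 by (rule gl_flow.axioms(1)[OF gl])

lemma T: "0 < T" by (rule heat_flow.T[OF hf])

lemmas u_le_1 = gl_flow.norm_u_le_1[OF gl]
lemmas meas = heat_flow.meas[OF hf]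
lemmas outside = heat_flow.outside[OF hf]
lemmas sq = heat_flow.sq[OF hf] heat_flow.sq_p[OF hf]

lemma Q_borel [measurable]: "cylinder T \<in> sets (borel :: 'd spacetime measure)"
 using cylinder_open by (rule borel_open)

lemma time_integral_le:
 fixes F :: "'d spacetime => real"
 assumes F: "intL F" and out: "\<And>z. z \<notin> cylinder T ==> F z = 0"
  and le: "\<And>t. 0 < t ==> t < T ==> (LBINT x. F (t, x)) \<le> c"
 shows "(LBINT z. F z) \<le> T * c"
proof -
 have i: "intL (ind {0<..<T} :: real => real)" by (rule integrable_real_indicator) (use T in auto)
 have "(LBINT z. F z) = (LBINT t. (LBINT x. F (t, x)))" by (rule fubini(5)[OF F, symmetric])
 also have "\<dots> \<le> (LBINT t. c * ind {0<..<T} t)"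
 proof (rule integral_mono[OF fubini(3)[OF F]])
  show "intL (%t. c * ind {0<..<T} t)" by (rule integrable_mult_right[OF i])
  fix t :: real
  show "(LBINT x. F (t, x)) \<le> c * ind {0<..<T} t"
   using le[of t] out by (cases "0 < t \<and> t < T") (auto simp: cylinder_def)
 qed
 also have "\<dots> = T * c" using T by simp
 finally show ?thesis .
qed

lemma p_le: "(LBINT z. (norm (p k z))^2) \<le> K0 / 2"
 by (rule gl_flow.p_bound[OF gl])

lemma g_le: "(LBINT z. (norm (g k z))^2) \<le> T * K0"
 by (rule time_integral_le[OF sq_int_integrable[OF sq(2)]]) (use outside(4) gl_flow.energy_parts(3)[OF gl] in auto)

lemma bounded_on_Q_integrable:
 fixes F :: "'d spacetime => real"
 assumes "F \<in> BM" "\<And>z. \<bar>F z\<bar> \<le> c * ind (cylinder T) z"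
 shows "intL F"
proof -
 have "intL (%z. c * ind (cylinder T :: 'd spacetime set) z)"
  by (rule integrable_mult_right, rule integrable_real_indicator) (use cylinder_finite in auto)
 then show ?thesis
  by (rule integrable_bound) (use assms order_trans[OF assms(2) abs_ge_self] in auto)
qed

lemma well_integrable: "intL (%z. ind (cylinder T) z * well (u k z))"
proof (rule bounded_on_Q_integrable[where c = 1])
 note [measurable] = meas(1)
 show "(%z. ind (cylinder T) z * well (u k z)) \<in> BM" unfolding well_def by measurable
 show "\<bar>ind (cylinder T) z * well (u k z)\<bar> \<le> 1 * ind (cylinder T) z" for z
  using well_le[OF u_le_1[of k z]] well_nonneg[of "u k z"] by (auto simp: indicator_def)
qed

text \<open>At each time the energy inequality bounds the integral of \<open>wd\<close> by
  \<open>K0 / 2\<close>, and the coefficient inside \<open>wd\<close> is at least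
  \<open>sqrt (lam k)\<close>.\<close>

lemma well_int_le: "(LBINT z. ind (cylinder T) z * well (u k z)) \<le> T * (K0 / 2 / sqrt (lam k))"
proof (rule time_integral_le[OF well_integrable])
 interpret gl_flow T "Mf k" "u k" "p k" "f k" "g k" v0 g0 chi "%t. lam k powr (1 - kappa t)" "lam k" by (rule gl)
 fix t assume t: "0 < t" "t < T"
 have s: "sqrt (lam k) > 0" using lam(2)[of k] by simp
 have "(LBINT x. ind (cylinder T) (t, x) * well (u k (t, x))) \<le> (LBINT x. wd (t, x) / sqrt (lam k))"
 proof (rule integral_mono_AE')
  show "intL (%x. wd (t, x) / sqrt (lam k))" using energy_parts(4)[OF t] by simp
  have "well (u k z) \<le> lam k powr (1 - kappa (fst z)) * well (u k z) / sqrt (lam k)" for z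
   using mult_right_mono[OF half_power_le[OF lam(2)[of k], of "fst z"] well_nonneg[of "u k z"]] s
   by (simp add: pos_le_divide_eq mult.commute)
  then show "AE x in lborel. ind (cylinder T) (t, x) * well (u k (t, x)) \<le> wd (t, x) / sqrt (lam k)"
   by (auto simp: wd_def indicator_def intro!: AE_I2)
 qed (use s wd_nonneg in auto)
 also have "\<dots> \<le> K0 / 2 / sqrt (lam k)" using divide_right_mono[OF energy_parts(5)[OF t], of "sqrt (lam k)"] s by simp
 finally show "(LBINT x. ind (cylinder T) (t, x) * well (u k (t, x))) \<le> K0 / 2 / sqrt (lam k)" .
qed auto

text \<open>The constant is twice the bound \<open>K0 / 2\<close> for \<open>p\<close> plus twice
  the bound \<open>T * K0\<close> for \<open>g\<close>, because the square of a sum is at most twice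
  the sum of the squares.\<close>

lemma equi_diff: "equi_diff (cylinder T) (u k) (%z v. pderiv_dir v (u k) z) (%z. norm (p k z) + norm (g k z)) (K0 + 2 * T * K0)"
proof
 show "convex (cylinder T :: 'd spacetime set)" unfolding cylinder_def by (intro convex_Times convex_ball) simp
 fix z :: "'d spacetime" and v
 note [measurable] = meas
 show "(u k has_derivative (%v. pderiv_dir v (u k) z)) (at z)" if "z \<in> cylinder T"
  by (rule pderiv_dir_has_derivative) (use C1[of k] that in auto)
 show "continuous_on (cylinder T) (pderiv_dir v (u k))" by (rule Ck_on_pderiv_dir_continuous[OF C1, unfolded eta_contract_eq])
 show "norm (pderiv_dir v (u k) z) \<le> (norm (p k z) + norm (g k z)) * norm v" if z: "z \<in> cylinder T"
 proof -
  obtain s y where v: "v = (s, y)" by (cases v)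
  have "u k differentiable (at z)" using C1[of k] z by auto
  note * = pderiv_dir_space_time[OF this, of s y]
  have "norm (\<Sum>i\<in>UNIV. (y $ i) *R (g k z $ i)) \<le> (\<Sum>i\<in>UNIV. \<bar>y $ i\<bar> * norm (g k z $ i))"
   by (rule order_trans[OF norm_sum]) simp
  also have "\<dots> \<le> norm y * norm (g k z)"
   unfolding norm_vec_def using L2_set_mult_ineq[of "%i. norm (y $ i)" "%i. norm (g k z $ i)" UNIV] by simp
  finally have "norm (pderiv_dir v (u k) z) \<le> \<bar>s\<bar> * norm (p k z) + norm y * norm (g k z)"
   unfolding v * dt[OF z, symmetric] dx[OF z, symmetric]
   by (intro norm_triangle_le) simp
  also have "\<dots> \<le> norm v * norm (p k z) + norm v * norm (g k z)"
   unfolding v using norm_fst_le[of s y] norm_snd_le[of y s] by (intro add_mono mult_right_mono) auto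
  finally show ?thesis by (simp add: algebra_simps)
 qed
 show "(%z. norm (p k z) + norm (g k z)) \<in> BM" by measurable
 have i: "intL (%z. 2 * (norm (p k z))^2 + 2 * (norm (g k z))^2)"
  using sq_int_integrable[OF sq(3)] sq_int_integrable[OF sq(2)] by simp
 have "(\<integral>\<^sup>+z. ennreal ((norm (p k z) + norm (g k z))^2) \<partial>lborel) \<le> (\<integral>\<^sup>+z. ennreal (2 * (norm (p k z))^2 + 2 * (norm (g k z))^2) \<partial>lborel)"
 proof (intro nn_integral_mono ennreal_leI)
  fix z
  show "(norm (p k z) + norm (g k z))^2 \<le> 2 * (norm (p k z))^2 + 2 * (norm (g k z))^2"
   using sum_squares_bound[of "norm (p k z)" "norm (g k z)"] by (simp add: power2_sum)
 qed
 also have "\<dots> = ennreal (LBINT z. 2 * (norm (p k z))^2 + 2 * (norm (g k z))^2)"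
  by (rule nn_integral_eq_integral[OF i]) auto
 also have "(LBINT z. 2 * (norm (p k z))^2 + 2 * (norm (g k z))^2) = 2 * (LBINT z. (norm (p k z))^2) + 2 * (LBINT z. (norm (g k z))^2)"
  using sq_int_integrable[OF sq(3)] sq_int_integrable[OF sq(2)] by simp
 also have "\<dots> \<le> K0 + 2 * T * K0" using p_le[of k] g_le[of k] by simp
 finally show "(\<integral>\<^sup>+z. ennreal ((norm (p k z) + norm (g k z))^2) \<partial>lborel) \<le> ennreal (K0 + 2 * T * K0)"
  by (simp add: ennreal_leI)
 show "0 \<le> K0 + 2 * T * K0" using T by simp
 show "u k \<in> BM" by (rule meas)
 show "norm (u k z) \<le> 1" by (rule u_le_1)
qed

text \<open>After Rellich, a further subsequence converges almost everywhere, and Fatou applied to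
  the potential, whose integral is of order \<open>1 / sqrt lambda\<close>, gives norm 1 almost
  everywhere in the cylinder. The limit is changed on a null set so that this holds everywhere, and
  likewise the vanishing outside.\<close>

lemma limit_exists:
 obtains r :: "nat => nat" and v where "strict_mono r" "v \<in> BM" "\<forall>z. z \<notin> cylinder T --> v z = 0"
  "\<forall>z. z \<in> cylinder T --> norm (v z) = 1" "(%k. nrm (%z. u (r k) z - v z)) ----> 0"
proof -
 have bQ: "bounded (cylinder T :: 'd spacetime set)"
  unfolding cylinder_def by (intro bounded_Times) auto
 obtain r :: "nat => nat" and v where r: "strict_mono r" and v: "sqL v"
  and l: "(%k. nrm (%z. u (r k) z - v z)) ----> 0"
  by (rule rellich[OF cylinder_open bQ equi_diff outside(1)])
 obtain s :: "nat => nat" where s: "strict_mono s" and ae: "AE z in lborel. (%k. u (r (s k)) z) ----> v z"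
  by (rule l2_tendsto_AE_subseq[OF sq(1) v l])
 have [measurable]: "v \<in> BM" using sq_int_measurable[OF v] by simp
 have lim0: "(%k. T * (K0 / 2 / sqrt (lam (r (s k))))) ----> T * (K0 / 2 * 0)"
 proof -
  have "filterlim (%k. lam (r (s k))) at_top sequentially"
   using filterlim_compose[OF lam(1) filterlim_subseq[OF strict_mono_o[OF r s]]] by (simp add: o_def)
  then have "filterlim (%k. sqrt (lam (r (s k)))) at_top sequentially" by (rule filterlim_compose[OF sqrt_at_top])
  then have "(%k. inverse (sqrt (lam (r (s k))))) ----> 0" by (rule tendsto_inverse_0_at_top)
  then show ?thesis unfolding divide_inverse by (intro tendsto_intros)
 qed
 let ?w = "%z. ind (cylinder T) z * well (v z)"
 have wm: "?w \<in> borel_measurable lborel" unfolding well_def by measurable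
 have wl: "AE z in lborel. (%k. ind (cylinder T) z * well (u (r (s k)) z)) ----> ?w z"
  using ae unfolding well_def by eventually_elim (auto intro!: tendsto_intros)
 have nn: "AE z in lborel. 0 \<le> ind (cylinder T) z * well (u k z)" for k
  by (simp add: well_nonneg)
 have wi: "intL ?w" "(LBINT z. ?w z) \<le> 0"
  using nonneg_fatou[OF well_integrable nn wm wl well_int_le lim0] by simp_all
 have w0: "0 \<le> ?w z" for z by (simp add: well_nonneg)
 have "(LBINT z. ?w z) = 0"
  by (rule antisym[OF wi(2)]) (rule integral_nonneg[OF w0])
 then have "AE z in lborel. ?w z = 0"
  using integral_nonneg_eq_0_iff_AE[OF wi(1)] w0 by simp
 then have ae1: "AE z in lborel. z \<in> cylinder T --> norm (v z) = 1"
 proof eventually_elim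
  case (elim z)
  show ?case
  proof
   assume "z \<in> cylinder T"
   then have "(norm (v z))^2 = 1^2" using elim by (simp add: well_def)
   then show "norm (v z) = 1" by (metis norm_ge_zero power2_eq_imp_eq zero_le_one)
  qed
 qed
 \<comment> \<open>An arbitrary unit vector, used as the value on the exceptional null set.\<close>
 obtain e :: 'b where e: "norm e = 1" using nonempty_Basis norm_Basis by blast
 define v' where "v' z = (if z \<in> cylinder T then if norm (v z) = 1 then v z else e else 0)" for z
 have v'm: "v' \<in> BM" unfolding v'_def[abs_def] by measurable
 have ae0: "AE z in lborel. z \<notin> cylinder T --> v z = 0"
  using ae
 proof eventually_elim
  case (elim z)
  then show ?case using outside(1)[of z] by (cases "z \<in> cylinder T") (simp_all add: LIMSEQ_const_iff)
 qed
 have ae2: "AE z in lborel. v z = v' z" using ae0 ae1 by eventually_elim (auto simp: v'_def)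
 show thesis
 proof (rule that[OF r v'm])
  have "nrm (%z. u (r k) z - v z) = nrm (%z. u (r k) z - v' z)" for k
   by (rule l2n_cong_AE) (use ae2 meas(1) v'm in auto)
  then show "(%k. nrm (%z. u (r k) z - v' z)) ----> 0" using l by simp
 qed (use e in "auto simp: v'_def")
qed

end

section \<open>Convex combinations of the flows and the weak derivatives of the limit\<close>

lemma convex_tail_tendsto:
 fixes a :: "nat => real"
 assumes a: "a ----> 0" and c: "\<And>n j. 0 \<le> c n j" "\<And>n. (\<Sum>j=n..<m n. c n j) = 1"
 shows "(%n. \<Sum>j=n..<m n. c n j * a j) ----> 0"
proof (rule LIMSEQ_I)
 fix e :: real assume e: "0 < e"
 then obtain N where N: "\<And>j. j \<ge> N ==> \<bar>a j\<bar> < e / 2" using LIMSEQ_D[OF a, of "e / 2"] by auto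
 have "norm ((\<Sum>j=n..<m n. c n j * a j) - 0) < e" if "n \<ge> N" for n
 proof -
  have "\<bar>\<Sum>j=n..<m n. c n j * a j\<bar> \<le> (\<Sum>j=n..<m n. c n j * (e / 2))"
  proof (intro order_trans[OF sum_abs] sum_mono)
   fix j assume "j \<in> {n..<m n}"
   then show "\<bar>c n j * a j\<bar> \<le> c n j * (e / 2)"
    using mult_left_mono[OF less_imp_le[OF N[of j]] c(1)[of n j]] that by (simp add: abs_mult c)
  qed
  also have "\<dots> = e / 2" by (subst sum_distrib_right[symmetric]) (simp add: c(2))
  finally show ?thesis using e by simp
 qed
 then show "\<exists>N. \<forall>n\<ge>N. norm ((\<Sum>j=n..<m n. c n j * a j) - 0) < e" by blast
qed

text \<open>The combination with index \<open>n\<close> uses only members from \<open>n\<close> on,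
  so it inherits a limit that the sequence already has. This keeps the combined maps convergent to
  \<open>v\<close> although the coefficients were chosen for the derivatives.\<close>

lemma l2_convex_tail_tendsto:
 assumes f: "\<And>k. sq_int M (f k)" "sq_int M f0" "(%k. l2n M (%x. f k x - f0 x)) ----> 0"
  and c: "\<And>n j. 0 \<le> c n j" "\<And>n. (\<Sum>j=n..<m n. c n j) = 1"
 shows "(%n. l2n M (%x. (\<Sum>j=n..<m n. c n j *R f j x) - f0 x)) ----> 0"
proof (rule Lim_null_comparison[OF always_eventually[OF allI] convex_tail_tendsto[OF f(3) c]])
 fix n
 have "(\<Sum>j=n..<m n. c n j *R f j x) - f0 x = (\<Sum>j=n..<m n. c n j *R (f j x - f0 x))" for x
  using c(2)[of n] by (simp add: scaleR_diff_right sum_subtractf flip: scaleR_left.sum)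
 then have "l2n M (%x. (\<Sum>j=n..<m n. c n j *R f j x) - f0 x) \<le> (\<Sum>j=n..<m n. l2n M (%x. c n j *R (f j x - f0 x)))"
  by (simp add: l2n_sum_le sq_int_scaleR sq_int_diff f)
 then show "norm (l2n M (%x. (\<Sum>j=n..<m n. c n j *R f j x) - f0 x)) \<le> (\<Sum>j=n..<m n. c n j * l2n M (%x. f j x - f0 x))"
  by (simp add: l2n_scaleR c)
qed

lemma l2_tendsto_dominated:
 assumes f: "\<And>n. sq_int M (f n)" "sq_int M f0" "(%n. l2n M (%x. f n x - f0 x)) ----> 0"
  and g: "\<And>n. g n \<in> borel_measurable M" "g0 \<in> borel_measurable M"
  and le: "\<And>n x. norm (g n x - g0 x) \<le> L * norm (f n x - f0 x)" and L: "0 \<le> L"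
 shows "(%n. l2n M (%x. g n x - g0 x)) ----> 0"
proof (rule Lim_null_comparison[OF always_eventually[OF allI]])
 show "norm (l2n M (%x. g n x - g0 x)) \<le> L * l2n M (%x. f n x - f0 x)" for n
  using l2n_mono_AE[OF sq_int_diff[OF f(1,2)], of "%x. g n x - g0 x" L] g le L by simp
 show "(%n. L * l2n M (%x. f n x - f0 x)) ----> 0" using tendsto_mult_right_zero[OF f(3)] by simp
qed

lemma has_weak_deriv_cong:
 assumes w: "has_weak_deriv S v f g" and eq: "\<And>x. x \<in> S ==> f x = f' x" "\<And>x. x \<in> S ==> g x = g' x"
 shows "has_weak_deriv S v f' g'"
proof -
 have l: "locally_integrable_on h' S" if "locally_integrable_on h S" "\<And>x. x \<in> S ==> h x = h' x" for h h' :: "'a => 'b"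
  unfolding locally_integrable_on_def
 proof (intro allI impI)
  fix K assume K: "compact K" "K \<subseteq> S"
  then have "integrable (lebesgue_on K) h" using that(1) by (auto simp: locally_integrable_on_def)
  then show "integrable (lebesgue_on K) h'"
   by (rule integrable_cong[THEN iffD1, rotated -1]) (use K that(2) in auto)
 qed
 have "integral\<^sup>L (lebesgue_on S) (%x. pderiv_dir v phi x *R f' x) = integral\<^sup>L (lebesgue_on S) (%x. pderiv_dir v phi x *R f x)"
  "integral\<^sup>L (lebesgue_on S) (%x. phi x *R g' x) = integral\<^sup>L (lebesgue_on S) (%x. phi x *R g x)" for phi :: "'a => real"
  by (intro integral_cong; simp add: eq)+
 moreover have "locally_integrable_on f' S" "locally_integrable_on g' S"
  using w l[of f f'] l[of g g'] eq by (auto simp: has_weak_deriv_def)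
 ultimately show ?thesis using w unfolding has_weak_deriv_def by simp
qed

lemma l2n_pair_sq:
 assumes "sq_int M f" "sq_int M g"
 shows "sq_int M (%x. (f x, g x))" "(l2n M (%x. (f x, g x)))^2 = (l2n M f)^2 + (l2n M g)^2"
proof -
 note [measurable] = sq_int_measurable[OF assms(1)] sq_int_measurable[OF assms(2)]
 have n: "(norm (a, b))^2 = (norm a)^2 + (norm b)^2" for a :: 'b and b :: 'c by (simp add: norm_Pair)
 show "sq_int M (%x. (f x, g x))"
  unfolding sq_int_def n using assms by (auto simp: sq_int_def intro: borel_measurable_Pair)
 show "(l2n M (%x. (f x, g x)))^2 = (l2n M f)^2 + (l2n M g)^2"
  unfolding l2n_sq n using assms by (simp add: sq_int_def)
qed

locale gl_limit = gl_seq T v0 g0 chi u p f g Mf lam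
 for T :: real and v0 :: "real ^ 'd => 'b::euclidean_space" and g0 :: "real ^ 'd => 'b ^ 'd" and chi :: "real => real"
  and u p f :: "nat => real \<times> (real ^ 'd) => 'b" and g :: "nat => real \<times> (real ^ 'd) => 'b ^ 'd" and Mf lam :: "nat => real" +
 fixes v :: "real \<times> (real ^ 'd) => 'b"
 assumes v: "v \<in> BM" "z \<notin> cylinder T ==> v z = 0" "z \<in> cylinder T ==> norm (v z) = 1"
  and u_v: "(%k. nrm (%z. u k z - v z)) ----> 0"
begin

lemma v_le_1: "norm (v z) \<le> 1"
 using v(2)[of z] v(3)[of z] by (cases "z \<in> cylinder T") auto

lemma sq_Q:
 fixes h :: "'d spacetime => 'c::euclidean_space"
 assumes "h \<in> BM" "\<And>z. norm (h z) \<le> 1" "\<And>z. z \<notin> cylinder T ==> h z = 0"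
 shows "sqL h"
 unfolding sq_int_def
proof
 note [measurable] = assms(1)
 show "intL (%z. (norm (h z))^2)"
  by (rule bounded_on_Q_integrable[where c = 1]) (use assms in "auto simp: indicator_def power_le_one")
qed (use assms in simp)

lemma sq_v: "sqL v"
 by (rule sq_Q[OF v(1) v_le_1 v(2)])

text \<open>Time derivative and gradient are treated as one function with values in a product, so
  that a single family of coefficients serves both; only then are they derivatives of the same
  combination of the flows.\<close>

lemma convex_combinations:
 obtains c :: "nat => nat => real" and m :: "nat => nat" and wt wx
 where "\<forall>n j. 0 \<le> c n j" "\<forall>n. (\<Sum>j=n..<m n. c n j) = 1" "sqL wt" "sqL wx"
  "\<forall>z. z \<notin> cylinder T --> wt z = 0" "\<forall>z. z \<notin> cylinder T --> wx z = 0"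
  "(%n. nrm (%z. (\<Sum>j=n..<m n. c n j *R p j z) - wt z)) ----> 0"
  "(%n. nrm (%z. (\<Sum>j=n..<m n. c n j *R g j z) - wx z)) ----> 0"
proof -
 let ?P = "%k z. (p k z, g k z)"
 have bd: "nrm (?P k) \<le> sqrt (K0 / 2 + T * K0)" for k
  using p_le[of k] g_le[of k] l2n_pair_sq(2)[OF sq(3)[of k] sq(2)[of k]] by (intro real_le_rsqrt) (simp add: l2n_sq)
 obtain c :: "nat => nat => real" and m :: "nat => nat" and w
  where c: "\<And>n j. 0 \<le> c n j" "\<And>n. (\<Sum>j=n..<m n. c n j) = 1" and w: "sqL w"
   and l: "(%n. nrm (%x. (\<Sum>j=n..<m n. c n j *R ?P j x) - w x)) ----> 0"
  by (rule l2_convex_tails_convergent[of lborel ?P, OF l2n_pair_sq(1)[OF sq(3) sq(2)] bd], rule that)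
 have wm: "w \<in> BM" using sq_int_measurable[OF w] by simp
 have w12: "(%z. fst (w z)) \<in> BM" "(%z. snd (w z)) \<in> BM"
  by (rule measurable_compose[OF wm], rule borel_measurable_continuous_onI, intro continuous_intros)+
 define wt where "wt z = ind (cylinder T) z *R fst (w z)" for z
 define wx where "wx z = ind (cylinder T) z *R snd (w z)" for z
 have wtm: "wt \<in> BM" "wx \<in> BM"
  unfolding wt_def[abs_def] wx_def[abs_def] using w12 by measurable
 have nfs: "norm (fst y) \<le> norm y" "norm (snd y) \<le> norm y" for y :: "'b \<times> ('b ^ 'd)"
  by (metis norm_fst_le prod.collapse, metis norm_snd_le prod.collapse)
 have sqw: "sqL wt" "sqL wx"
  by (rule sq_int_bound[OF w, where c = 1], use wtm nfs in "auto simp: wt_def wx_def indicator_def")+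
 have sqc: "sqL (%z. \<Sum>j=n..<m n. c n j *R ?P j z)" for n
  by (intro sq_int_sum sq_int_scaleR l2n_pair_sq(1) sq)
 have fs: "fst (\<Sum>j=n..<m n. c n j *R ?P j z) = (\<Sum>j=n..<m n. c n j *R p j z)"
  "snd (\<Sum>j=n..<m n. c n j *R ?P j z) = (\<Sum>j=n..<m n. c n j *R g j z)" for n z
  by (simp_all add: fst_sum snd_sum)
 note [measurable] = meas
 have d: "norm ((\<Sum>j=n..<m n. c n j *R p j z) - wt z) \<le> 1 * norm ((\<Sum>j=n..<m n. c n j *R ?P j z) - w z)"
  "norm ((\<Sum>j=n..<m n. c n j *R g j z) - wx z) \<le> 1 * norm ((\<Sum>j=n..<m n. c n j *R ?P j z) - w z)" for n z
  using nfs[of "(\<Sum>j=n..<m n. c n j *R ?P j z) - w z"]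
  by (cases "z \<in> cylinder T"; simp only: fst_diff snd_diff fs; simp add: wt_def wx_def outside)+
 show thesis
 proof (rule that[of c m wt wx])
  show "(%n. nrm (%z. (\<Sum>j=n..<m n. c n j *R p j z) - wt z)) ----> 0"
   by (rule l2_tendsto_dominated[OF sqc w l _ _ d(1)]) (use wtm in auto)
  show "(%n. nrm (%z. (\<Sum>j=n..<m n. c n j *R g j z) - wx z)) ----> 0"
   by (rule l2_tendsto_dominated[OF sqc w l _ _ d(2)]) (use wtm in auto)
 qed (use c sqw in "auto simp: wt_def wx_def")
qed

end

locale gl_combo = gl_limit T v0 g0 chi u p f g Mf lam v
 for T :: real and v0 :: "real ^ 'd => 'b::euclidean_space" and g0 :: "real ^ 'd => 'b ^ 'd" and chi :: "real => real"
  and u p f :: "nat => real \<times> (real ^ 'd) => 'b" and g :: "nat => real \<times> (real ^ 'd) => 'b ^ 'd" and Mf lam :: "nat => real"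
  and v :: "real \<times> (real ^ 'd) => 'b" +
 fixes c :: "nat => nat => real" and m :: "nat => nat" and wt :: "real \<times> (real ^ 'd) => 'b" and wx :: "real \<times> (real ^ 'd) => 'b ^ 'd"
 assumes c: "0 \<le> c n j" "(\<Sum>j=n..<m n. c n j) = 1" and w: "sqL wt" "sqL wx"
  and w_out: "z \<notin> cylinder T ==> wt z = 0" "z \<notin> cylinder T ==> wx z = 0"
  and cp: "(%n. nrm (%z. (\<Sum>j=n..<m n. c n j *R p j z) - wt z)) ----> 0"
  and cg: "(%n. nrm (%z. (\<Sum>j=n..<m n. c n j *R g j z) - wx z)) ----> 0"
begin

text \<open>These combinations are C1 and converge to \<open>v\<close> strongly together with their
  first derivatives, but they neither solve the flow equation nor take values in the sphere. They
  will play the role of \<open>q\<close> in the test field.\<close>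

definition U :: "nat => 'd spacetime => 'b" where "U n z = (\<Sum>j=n..<m n. c n j *R u j z)"
definition Up :: "nat => 'd spacetime => 'b" where "Up n z = (\<Sum>j=n..<m n. c n j *R p j z)"
definition Ug :: "nat => 'd spacetime => 'b ^ 'd" where "Ug n z = (\<Sum>j=n..<m n. c n j *R g j z)"

lemma U_meas: "U n \<in> BM" "Up n \<in> BM" "Ug n \<in> BM"
 unfolding U_def[abs_def] Up_def[abs_def] Ug_def[abs_def] using meas by measurable

lemma U_out: "z \<notin> cylinder T ==> U n z = 0" "z \<notin> cylinder T ==> Up n z = 0" "z \<notin> cylinder T ==> Ug n z = 0"
 by (simp_all add: U_def Up_def Ug_def outside)

lemma sq_U: "sqL (U n)" "sqL (Up n)" "sqL (Ug n)"
 unfolding U_def[abs_def] Up_def[abs_def] Ug_def[abs_def] by (intro sq_int_sum sq_int_scaleR sq)+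

lemma U_lim: "(%n. nrm (%z. U n z - v z)) ----> 0" "(%n. nrm (%z. Up n z - wt z)) ----> 0"
 "(%n. nrm (%z. Ug n z - wx z)) ----> 0"
 unfolding U_def Up_def Ug_def using l2_convex_tail_tendsto[OF sq(1) sq_v u_v c] cp cg by auto

lemma U_C1: "Ck_on (Suc 0) (cylinder T) (U n)"
 unfolding U_def[abs_def] by (intro Ck_on_sum Ck_on_cmult C1 cylinder_open)

lemma U_pderiv:
 assumes z: "z \<in> cylinder T"
 shows "pderiv_dir e (U n) z = (\<Sum>j=n..<m n. c n j *R pderiv_dir e (u j) z)"
proof -
 have "((%z. \<Sum>j=n..<m n. c n j *R u j z) has_derivative (%e. \<Sum>j=n..<m n. c n j *R pderiv_dir e (u j) z)) (at z)"
  by (intro has_derivative_sum has_derivative_scaleR_right pderiv_dir_has_derivative) (use C1 z in auto)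
 then show ?thesis unfolding U_def[abs_def] by (rule pderiv_dir_eq)
qed

lemma U_dt: "z \<in> cylinder T ==> pderiv_dir (1, 0) (U n) z = Up n z"
 by (simp add: U_pderiv Up_def dt)

lemma U_dx: "z \<in> cylinder T ==> pderiv_dir (0, axis i 1) (U n) z = Ug n z $ i"
 by (simp add: U_pderiv Ug_def dx)

lemma U_lim_nth: "(%n. nrm (%z. Ug n z $ i - wx z $ i)) ----> 0"
 by (rule l2_tendsto_dominated[OF sq_U(3) w(2) U_lim(3), where L = 1])
   (use sq_int_measurable[OF sq_int_vec_nth[OF sq_U(3)]] sq_int_measurable[OF sq_int_vec_nth[OF w(2)]] in
    \<open>auto simp flip: vector_minus_component intro: Finite_Cartesian_Product.norm_nth_le\<close>)

text \<open>On the cylinder \<open>U n\<close> has classical derivatives \<open>Up n\<close> and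
  \<open>Ug n\<close>; strong convergence of the maps and of these derivatives carries the weak
  derivative over to the limit.\<close>

lemma weak_deriv_v:
 "has_weak_deriv (cylinder T) (1, 0) v wt" "has_weak_deriv (cylinder T) (0, axis i 1) v (%z. wx z $ i)"
proof -
 have Q: "cylinder T \<in> sets (borel :: 'd spacetime measure)" by measurable
 have S: "sq_int (lebesgue_on (cylinder T)) h \<longleftrightarrow> sqL h" "l2n (lebesgue_on (cylinder T)) h = nrm h"
  if "h \<in> BM" "\<And>z. z \<notin> cylinder T ==> h z = 0" for h :: "'d spacetime => 'b"
  using sq_int_lebesgue_on_borel[OF Q that(1)] that(2) by auto
 have lim: "has_weak_deriv (cylinder T) e v w'" if e: "e \<in> Basis" and G: "\<And>n z. z \<in> cylinder T ==> pderiv_dir e (U n) z = G n z"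
  "\<And>n. sqL (G n)" "sqL w'" "\<And>n z. z \<notin> cylinder T ==> G n z = 0" "\<And>z. z \<notin> cylinder T ==> w' z = 0"
  "(%n. nrm (%z. G n z - w' z)) ----> 0" for e G w'
 proof -
  have m: "G n \<in> BM" "w' \<in> BM" for n
   using sq_int_measurable[OF G(2)] sq_int_measurable[OF G(3)] by auto
  show ?thesis
  proof (rule has_weak_deriv_limit[OF cylinder_open])
   show "has_weak_deriv (cylinder T) e (U n) (G n)" for n
    by (rule has_weak_deriv_cong[OF has_weak_deriv_Ck[OF cylinder_open U_C1 e]]) (use G(1) in auto)
   show "sq_int (lebesgue_on (cylinder T)) (U n)" "sq_int (lebesgue_on (cylinder T)) (G n)" for n
    using S(1)[OF U_meas(1) U_out(1)] S(1)[OF m(1) G(4)] sq_U(1) G(2) by auto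
   show "sq_int (lebesgue_on (cylinder T)) v" "sq_int (lebesgue_on (cylinder T)) w'"
    using S(1)[OF v(1,2)] S(1)[OF m(2) G(5)] sq_v G(3) by auto
   show "(%n. l2n (lebesgue_on (cylinder T)) (%z. U n z - v z)) ----> 0"
    by (subst S(2)) (use U_lim(1) U_meas v U_out in auto)
   show "(%n. l2n (lebesgue_on (cylinder T)) (%z. G n z - w' z)) ----> 0"
    by (subst S(2)) (use m G(4,5,6) in auto)
  qed
 qed
 show "has_weak_deriv (cylinder T) (1, 0) v wt"
  by (rule lim[OF _ U_dt sq_U(2) w(1) U_out(2) w_out(1) U_lim(2)]) (simp add: Basis_prod_def)
 show "has_weak_deriv (cylinder T) (0, axis i 1) v (%z. wx z $ i)"
  by (rule lim[OF _ U_dx sq_int_vec_nth[OF sq_U(3)] sq_int_vec_nth[OF w(2)] _ _ U_lim_nth])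
    (auto simp: U_out w_out intro!: Basis_snd axis_in_Basis_iff[THEN iffD2])
qed

section \<open>Passage to the limit in the equation\<close>

lemma Q_indicator_measurable:
 fixes h :: "'d spacetime => 'c::euclidean_space"
 assumes "continuous_on (cylinder T) h"
 shows "(%z. ind (cylinder T) z *R h z) \<in> BM"
 by (rule borel_measurable_continuous_on_indicator[OF _ assms]) simp

lemma wedge_dominated:
 fixes q phi :: "'d spacetime => 'b"
 assumes q: "continuous_on (cylinder T) q" and phi: "continuous_on UNIV phi" "compact K" "K \<subseteq> cylinder T" "\<And>z. z \<notin> K ==> phi z = 0"
 shows "(%n. nrm (%z. wedge (u n z) (q z) (phi z) - wedge (v z) (q z) (phi z))) ----> 0"
  and "sqL (%z. wedge (u n z) (q z) (phi z))" "sqL (%z. wedge (v z) (q z) (phi z))"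
proof -
 obtain A where A: "A \<ge> 0" "\<And>z. norm (phi z) \<le> A"
  using bounded_of_compact_support[OF phi(1,2,4)] by blast
 have "bounded (q ` K)" by (rule compact_imp_bounded[OF compact_continuous_image[OF continuous_on_subset[OF q phi(3)] phi(2)]])
 then obtain B where B: "\<And>z. z \<in> K ==> norm (q z) \<le> B" "B > 0" unfolding bounded_pos by blast
 have le: "norm (wedge y (q z) (phi z)) \<le> (2 * B * A) * norm y" for y z
 proof (cases "z \<in> K")
  case True
  have "norm (wedge y (q z) (phi z)) \<le> 2 * norm y * (norm (q z) * norm (phi z))"
   using wedge_norm[of y "q z" "phi z"] by (simp add: mult.assoc)
  also have "\<dots> \<le> 2 * norm y * (B * A)" by (intro mult_left_mono mult_mono B A True) (use B in auto)
  finally show ?thesis by (simp add: mult_ac)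
 next
  case False
  then show ?thesis using phi(4) A B by (simp add: wedge_def)
 qed
 have m: "(%z. wedge (h z) (q z) (phi z)) \<in> BM"
  if [measurable]: "h \<in> BM" and out: "\<And>z. z \<notin> cylinder T ==> h z = 0" for h
 proof -
  note [measurable] = Q_indicator_measurable[OF q] borel_measurable_continuous_onI[OF phi(1)]
  have "wedge (h z) (q z) (phi z) = wedge (h z) (ind (cylinder T) z *R q z) (phi z)" for z
   using out[of z] by (cases "z \<in> cylinder T") (auto simp: wedge_def)
  then have *: "(%z. wedge (h z) (q z) (phi z)) = (%z. wedge (h z) (ind (cylinder T) z *R q z) (phi z))" by blast
  show ?thesis unfolding * unfolding wedge_def by measurable
 qed
 have mu: "(%z. wedge (u n z) (q z) (phi z)) \<in> BM" for n by (rule m[OF meas(1) outside(1)])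
 have mv: "(%z. wedge (v z) (q z) (phi z)) \<in> BM" by (rule m[OF v(1,2)])
 show "(%n. nrm (%z. wedge (u n z) (q z) (phi z) - wedge (v z) (q z) (phi z))) ----> 0"
  by (rule l2_tendsto_dominated[OF sq(1) sq_v u_v, where L = "2 * B * A"])
    (use mu mv le A B in "auto simp flip: wedge_diff(1)")
 show "sqL (%z. wedge (u n z) (q z) (phi z))"
  by (rule sq_int_bound[OF sq(1)[of n], where c = "2 * B * A"]) (use mu le in auto)
 show "sqL (%z. wedge (v z) (q z) (phi z))"
  by (rule sq_int_bound[OF sq_v, where c = "2 * B * A"]) (use mv le in auto)
qed

end

text \<open>The penalty term of the flow is parallel to \<open>u\<close>, so it drops out when the equation is tested with a field
 orthogonal to \<open>u\<close>; the resulting identity is linear in the derivatives and survives weak limits.\<close>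

context gl_combo begin

lemma wedge_equation:
 fixes q phi :: "'d spacetime => 'b"
 assumes q: "Ck_on (Suc 0) (cylinder T) q" and phi: "phi \<in> C1c (cylinder T)"
 defines "dd i \<equiv> pderiv_dir (0, axis i 1)"
 shows "(LBINT z. wt z \<bullet> wedge (v z) (q z) (phi z))
  + (\<Sum>i\<in>UNIV. (LBINT z. wx z $ i \<bullet> (wedge (v z) (dd i q z) (phi z) + wedge (v z) (q z) (dd i phi z)))) = 0"
proof -
 obtain K where K: "compact K" "K \<subseteq> cylinder T" "\<And>z. z \<notin> K ==> phi z = 0" "\<And>z v. z \<notin> K ==> pderiv_dir v phi z = 0"
  by (rule C1c_support[OF phi], rule that)
 have qc: "continuous_on (cylinder T) q" "continuous_on (cylinder T) (dd i q)" for i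
  using Ck_on_SucD[OF q] Ck_on_pderiv_dir_continuous[OF q] unfolding dd_def by auto
 have phic: "continuous_on UNIV phi" "continuous_on UNIV (dd i phi)" for i
  using C1c_continuous[OF phi] C1c_continuous_pderiv[OF phi] unfolding dd_def by auto
 have ddK: "dd i phi z = 0" if "z \<notin> K" for i z using K(4)[OF that] by (simp add: dd_def)
 note D1 = wedge_dominated[OF qc(1) phic(1) K(1-3)]
 note D2 = wedge_dominated[OF qc(2) phic(1) K(1-3)]
 note D3 = wedge_dominated[OF qc(1) phic(2) K(1,2) ddK]
 \<comment> \<open>The derivative of the test field has a third term in which \<open>u\<close>
   itself is differentiated. It is orthogonal to that very derivative by \<open>wedge_self\<close>,
   hence it disappears when paired with the gradient and is left out here.\<close>
 define hx where "hx y i z = wedge (y z) (dd i q z) (phi z) + wedge (y z) (q z) (dd i phi z)" for y i z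
 have "sqL (hx (u k) i)" for k i
  unfolding hx_def[abs_def] by (rule sq_int_add[OF D2(2) D3(2)])
 moreover have "sqL (hx v i)" for i
  unfolding hx_def[abs_def] by (rule sq_int_add[OF D2(3) D3(3)])
 ultimately have hxs: "sqL (hx (u k) i)" "sqL (hx v i)" for k i by auto
 have hxl: "(%k. nrm (%z. hx (u k) i z - hx v i z)) ----> 0" for i
 proof (rule Lim_null_comparison[OF always_eventually[OF allI]])
  show "norm (nrm (%z. hx (u k) i z - hx v i z))
   \<le> nrm (%z. wedge (u k z) (dd i q z) (phi z) - wedge (v z) (dd i q z) (phi z))
    + nrm (%z. wedge (u k z) (q z) (dd i phi z) - wedge (v z) (q z) (dd i phi z))" for k
   unfolding hx_def real_norm_def abs_of_nonneg[OF l2n_nonneg] add_diff_add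
   by (rule l2n_triangle[OF sq_int_diff[OF D2(2) D2(3)] sq_int_diff[OF D3(2) D3(3)]])
  show "(%k. nrm (%z. wedge (u k z) (dd i q z) (phi z) - wedge (v z) (dd i q z) (phi z))
    + nrm (%z. wedge (u k z) (q z) (dd i phi z) - wedge (v z) (q z) (dd i phi z))) ----> 0"
   by (intro tendsto_add_zero D2 D3)
 qed
 \<comment> \<open>The tested equation as a functional of time derivative, gradient and base map.
   For a fixed base map it is linear in the derivatives, which is what allows convex
   combinations.\<close>
 define J where "J P G y = (LBINT z. P z \<bullet> wedge (y z) (q z) (phi z)) + (\<Sum>i\<in>UNIV. (LBINT z. G z $ i \<bullet> hx y i z))"
  for P :: "'d spacetime => 'b" and G :: "'d spacetime => 'b ^ 'd" and y
 have J0: "J (p k) (g k) (u k) = 0" for k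
 proof -
  let ?W = "%z. wedge (u k z) (q z) (phi z)"
  have W: "?W \<in> C1c (cylinder T)" by (rule wedge_C1c(1)[OF cylinder_open C1 q phi])
  have e: "p k z \<bullet> ?W z + (\<Sum>i\<in>UNIV. g k z $ i \<bullet> pderiv_dir (0, axis i 1) ?W z) + f k z \<bullet> ?W z
   = p k z \<bullet> ?W z + (\<Sum>i\<in>UNIV. g k z $ i \<bullet> hx (u k) i z)" for z
  proof (cases "z \<in> cylinder T")
   case True
   have "f k z \<bullet> ?W z = 0" unfolding gl_flow.f_eq[OF gl True] inner_scaleR_left wedge_self by simp
   moreover have "g k z $ i \<bullet> pderiv_dir (0, axis i 1) ?W z = g k z $ i \<bullet> hx (u k) i z" for i
    unfolding wedge_C1c(2)[OF cylinder_open C1 q phi True] dx[OF True, symmetric] hx_def dd_def inner_add_right wedge_self by simp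
   ultimately show ?thesis by simp
  qed (use outside in simp)
  have "(LBINT z. p k z \<bullet> ?W z + (\<Sum>i\<in>UNIV. g k z $ i \<bullet> hx (u k) i z)) = 0"
   using heat_flow.weak_Q[OF hf[of k] W] unfolding e .
  moreover have "(LBINT z. p k z \<bullet> ?W z + (\<Sum>i\<in>UNIV. g k z $ i \<bullet> hx (u k) i z)) = J (p k) (g k) (u k)"
   unfolding J_def using sq_int_integrable_inner[OF sq(3) D1(2)] sq_int_integrable_inner[OF sq_int_vec_nth[OF sq(2)] hxs(1)]
   by (subst integral_add) (auto intro!: integrable_sum simp: integral_sum)
  ultimately show ?thesis by simp
 qed
 have CS: "\<bar>LBINT z. P z \<bullet> h z\<bar> \<le> nrm P * nrm h" if "sqL P" "sqL h"
  for P h :: "'d spacetime => 'b" using l2n_Cauchy_Schwarz[OF that] .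
 \<comment> \<open>In the base slot \<open>u k\<close> may be replaced by \<open>v\<close> with a
   vanishing error: the test fields converge strongly while the derivatives are bounded in
   \<open>L2\<close> uniformly in \<open>k\<close>.\<close>
 have Jl: "(%k. J (p k) (g k) v) ----> 0"
 proof (rule Lim_null_comparison[OF always_eventually[OF allI]])
  fix k
  have e1: "(LBINT z. p k z \<bullet> (wedge (u k z) (q z) (phi z) - wedge (v z) (q z) (phi z)))
   = (LBINT z. p k z \<bullet> wedge (u k z) (q z) (phi z)) - (LBINT z. p k z \<bullet> wedge (v z) (q z) (phi z))"
   unfolding inner_diff_right by (intro integral_diff sq_int_integrable_inner sq D1)
  have e2: "(LBINT z. g k z $ i \<bullet> (hx (u k) i z - hx v i z)) = (LBINT z. g k z $ i \<bullet> hx (u k) i z) - (LBINT z. g k z $ i \<bullet> hx v i z)" for i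
   unfolding inner_diff_right by (intro integral_diff sq_int_integrable_inner sq_int_vec_nth sq hxs)
  have "J (p k) (g k) v = - (LBINT z. p k z \<bullet> (wedge (u k z) (q z) (phi z) - wedge (v z) (q z) (phi z)))
   - (\<Sum>i\<in>UNIV. (LBINT z. g k z $ i \<bullet> (hx (u k) i z - hx v i z)))"
   using J0[of k] unfolding J_def e1 e2 sum_subtractf by linarith
  then have "\<bar>J (p k) (g k) v\<bar> \<le> \<bar>LBINT z. p k z \<bullet> (wedge (u k z) (q z) (phi z) - wedge (v z) (q z) (phi z))\<bar>
   + (\<Sum>i\<in>UNIV. \<bar>LBINT z. g k z $ i \<bullet> (hx (u k) i z - hx v i z)\<bar>)"
   using sum_abs[of "%i. LBINT z. g k z $ i \<bullet> (hx (u k) i z - hx v i z)" UNIV] by linarith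
  also have "\<dots> \<le> sqrt (K0 / 2) * nrm (%z. wedge (u k z) (q z) (phi z) - wedge (v z) (q z) (phi z))
   + (\<Sum>i\<in>UNIV. sqrt (T * K0) * nrm (%z. hx (u k) i z - hx v i z))"
  proof (intro add_mono sum_mono)
   have "nrm (p k) \<le> sqrt (K0 / 2)" unfolding l2n_def[of _ "p k"] by (rule real_sqrt_le_mono[OF p_le])
   then show "\<bar>LBINT z. p k z \<bullet> (wedge (u k z) (q z) (phi z) - wedge (v z) (q z) (phi z))\<bar>
    \<le> sqrt (K0 / 2) * nrm (%z. wedge (u k z) (q z) (phi z) - wedge (v z) (q z) (phi z))"
    by (intro order_trans[OF CS[OF sq(3) sq_int_diff[OF D1(2,3)]]] mult_right_mono) auto
   fix i
   have "nrm (%z. g k z $ i) \<le> 1 * nrm (g k)"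
    by (rule l2n_mono_AE[OF sq(2)]) (use sq_int_measurable[OF sq_int_vec_nth[OF sq(2)]] in "auto intro: Finite_Cartesian_Product.norm_nth_le")
   also have "\<dots> \<le> sqrt (T * K0)" unfolding l2n_def[of _ "g k"] using real_sqrt_le_mono[OF g_le] by simp
   finally show "\<bar>LBINT z. g k z $ i \<bullet> (hx (u k) i z - hx v i z)\<bar> \<le> sqrt (T * K0) * nrm (%z. hx (u k) i z - hx v i z)"
    by (intro order_trans[OF CS[OF sq_int_vec_nth[OF sq(2)] sq_int_diff[OF hxs]]] mult_right_mono) auto
  qed
  finally show "norm (J (p k) (g k) v) \<le> sqrt (K0 / 2) * nrm (%z. wedge (u k z) (q z) (phi z) - wedge (v z) (q z) (phi z))
   + (\<Sum>i\<in>UNIV. sqrt (T * K0) * nrm (%z. hx (u k) i z - hx v i z))" by simp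
 next
  show "(%k. sqrt (K0 / 2) * nrm (%z. wedge (u k z) (q z) (phi z) - wedge (v z) (q z) (phi z))
   + (\<Sum>i\<in>UNIV. sqrt (T * K0) * nrm (%z. hx (u k) i z - hx v i z))) ----> 0"
   by (intro tendsto_add_zero tendsto_null_sum tendsto_mult_right_zero D1(1) hxl)
 qed
 \<comment> \<open>Only after the base map has become the common \<open>v\<close> can the
   functionals for different indices be combined.\<close>
 have lin: "J (Up n) (Ug n) v = (\<Sum>j=n..<m n. c n j * J (p j) (g j) v)" for n
 proof -
  have a: "(LBINT z. Up n z \<bullet> wedge (v z) (q z) (phi z)) = (\<Sum>j=n..<m n. c n j * (LBINT z. p j z \<bullet> wedge (v z) (q z) (phi z)))"
   unfolding Up_def inner_sum_left inner_scaleR_left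
   by (subst integral_sum) (auto intro: sq_int_integrable_inner[OF sq(3) D1(3)])
  have b: "(LBINT z. Ug n z $ i \<bullet> hx v i z) = (\<Sum>j=n..<m n. c n j * (LBINT z. g j z $ i \<bullet> hx v i z))" for i
   unfolding Ug_def sum_component vector_scaleR_component inner_sum_left inner_scaleR_left
   by (subst integral_sum) (auto intro: sq_int_integrable_inner[OF sq_int_vec_nth[OF sq(2)] hxs(2)])
  show ?thesis unfolding J_def a b distrib_left sum.distrib sum_distrib_left by (subst sum.swap) simp
 qed
 have "(%n. J (Up n) (Ug n) v) ----> 0" unfolding lin by (rule convex_tail_tendsto[OF Jl c])
 moreover have "(%n. J (Up n) (Ug n) v) ----> J wt wx v"
  unfolding J_def
  by (intro tendsto_add tendsto_sum l2_inner_tendsto[OF sq_U(2) w(1) U_lim(2) D1(3) D1(3)]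
   l2_inner_tendsto[OF sq_int_vec_nth[OF sq_U(3)] sq_int_vec_nth[OF w(2)] U_lim_nth hxs(2) hxs(2)]) (simp_all add: l2n_def)
 ultimately have "J wt wx v = 0" using LIMSEQ_unique by blast
 then show ?thesis by (simp add: J_def hx_def)
qed

lemma bounded_mult_tendsto:
 fixes eta :: "'d spacetime => real"
 assumes eta: "continuous_on UNIV eta" "compact K" "\<And>z. z \<notin> K ==> eta z = 0"
 shows "(%n. nrm (%z. eta z *R U n z - eta z *R v z)) ----> 0"
  "sqL (%z. eta z *R U n z)" "sqL (%z. eta z *R v z)"
proof -
 obtain L where L: "L \<ge> 0" "\<And>z. norm (eta z) \<le> L" using bounded_of_compact_support[OF eta] by blast
 note [measurable] = borel_measurable_continuous_onI[OF eta(1)] U_meas v(1)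
 have b: "norm (eta z *R y) \<le> L * norm y" for z and y :: 'b using L(2)[of z] by (simp add: mult_right_mono)
 show "(%n. nrm (%z. eta z *R U n z - eta z *R v z)) ----> 0"
  by (rule l2_tendsto_dominated[OF sq_U(1) sq_v U_lim(1) _ _ _ L(1)])
    (use b in "auto simp flip: scaleR_diff_right simp del: norm_scaleR")
 show "sqL (%z. eta z *R U n z)" by (rule sq_int_bound[OF sq_U(1)[of n], where c = L]) (use b in auto)
 show "sqL (%z. eta z *R v z)" by (rule sq_int_bound[OF sq_v, where c = L]) (use b in auto)
qed

text \<open>The product rule for \<open>norm (U n)^2\<close>, multiplied by a test function and
  integrated, passes to the limit since \<open>U n\<close> and its derivative converge strongly.
  There \<open>norm v = 1\<close>, so the term with the derivative of the test function integrates
  to 0, and the other term is twice the pairing of \<open>v\<close> with its derivative.\<close>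

lemma orthogonal:
 assumes G: "\<And>n z. z \<in> cylinder T ==> pderiv_dir e (U n) z = G n z"
  and sG: "\<And>n. sqL (G n)" "sqL w'" and out: "\<And>z. z \<notin> cylinder T ==> w' z = 0"
  and lG: "(%n. nrm (%z. G n z - w' z)) ----> 0"
 shows "AE z in lborel. v z \<bullet> w' z = 0"
proof -
 have Q: "cylinder T \<in> sets (borel :: 'd spacetime measure)" by measurable
 have wm [measurable]: "w' \<in> BM" using sq_int_measurable[OF sG(2)] by simp
 note [measurable] = v(1)
 have z: "(LBINT z. eta z * (v z \<bullet> w' z)) = 0" if eta: "eta \<in> C1c (cylinder T)" for eta
 proof -
  obtain K where K: "compact K" "K \<subseteq> cylinder T" "\<And>z. z \<notin> K ==> eta z = 0" "\<And>z v. z \<notin> K ==> pderiv_dir v eta z = 0"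
   by (rule C1c_support[OF eta], rule that)
  note M = bounded_mult_tendsto[OF C1c_continuous[OF eta] K(1,3)]
  note M' = bounded_mult_tendsto[OF C1c_continuous_pderiv[OF eta, of e] K(1) K(4)]
  have "(LBINT z. (pderiv_dir e eta z *R U n z) \<bullet> U n z) + 2 * (LBINT z. (eta z *R U n z) \<bullet> G n z) = 0" for n
  proof -
   have UU: "Ck_on (Suc 0) (cylinder T) (%z. U n z \<bullet> U n z)"
    by (rule Ck_on_bilinear[OF bounded_bilinear_inner cylinder_open U_C1 U_C1])
   have h: "(%z. (U n z \<bullet> U n z) * eta z) \<in> C1c (cylinder T)"
    by (rule C1c_bilinear[OF bounded_bilinear_mult cylinder_open UU eta])
   have "pderiv_dir e (%z. (U n z \<bullet> U n z) * eta z) z = (pderiv_dir e eta z *R U n z) \<bullet> U n z + 2 * ((eta z *R U n z) \<bullet> G n z)" for z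
   proof (cases "z \<in> cylinder T")
    case True
    have d: "U n differentiable (at z)" "(%z. U n z \<bullet> U n z) differentiable (at z)" using U_C1[of n] UU True by auto
    show ?thesis
     unfolding pderiv_dir_bilinear(2)[OF bounded_bilinear_mult d(2) C1c_differentiable[OF eta]]
      pderiv_dir_bilinear(2)[OF bounded_bilinear_inner d(1) d(1)] G[OF True]
     by (simp add: inner_commute algebra_simps)
   next
    case False
    obtain K' where K': "K' \<subseteq> cylinder T" "\<And>z v. z \<notin> K' ==> pderiv_dir v (%z. (U n z \<bullet> U n z) * eta z) z = 0"
     by (rule C1c_support[OF h], rule that)
    have "z \<notin> K'" using K'(1) False by blast
    then show ?thesis using K'(2)[of z e] U_out(1)[OF False, of n] by simp
   qed
   then have "(LBINT z. (pderiv_dir e eta z *R U n z) \<bullet> U n z + 2 * ((eta z *R U n z) \<bullet> G n z)) = 0"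
    using integral_pderiv_dir_C1c[OF h, of e] by simp
   then show ?thesis
    using sq_int_integrable_inner[OF M'(2) sq_U(1)] sq_int_integrable_inner[OF M(2) sG(1)]
    by (subst (asm) integral_add) auto
  qed
  moreover have "(%n. (LBINT z. (pderiv_dir e eta z *R U n z) \<bullet> U n z) + 2 * (LBINT z. (eta z *R U n z) \<bullet> G n z))
    ----> (LBINT z. (pderiv_dir e eta z *R v z) \<bullet> v z) + 2 * (LBINT z. (eta z *R v z) \<bullet> w' z)"
   by (intro tendsto_add tendsto_mult tendsto_const l2_inner_tendsto[OF M'(2,3,1) sq_U(1) sq_v U_lim(1)] l2_inner_tendsto[OF M(2,3,1) sG lG])
  ultimately have l: "(LBINT z. (pderiv_dir e eta z *R v z) \<bullet> v z) + 2 * (LBINT z. (eta z *R v z) \<bullet> w' z) = 0"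
   by (simp add: LIMSEQ_const_iff)
  have "(pderiv_dir e eta z *R v z) \<bullet> v z = pderiv_dir e eta z" for z
   using v(3)[of z] K(2) K(4)[of z e] by (cases "z \<in> cylinder T") (auto simp: dot_square_norm)
  then have "2 * (LBINT z. (eta z *R v z) \<bullet> w' z) = 0"
   using l unfolding integral_pderiv_dir_C1c[OF eta, of e] by (simp only: integral_pderiv_dir_C1c[OF eta, of e] add_0)
  then show ?thesis by simp
 qed
 have sq: "sqL (%z. v z \<bullet> w' z)"
  by (rule sq_int_bound[OF sG(2), where c = 1])
    (use order_trans[OF Cauchy_Schwarz_ineq2 mult_right_mono[OF v_le_1 norm_ge_zero]] in auto)
 have "AE z in lebesgue_on (cylinder T). v z \<bullet> w' z = 0"
 proof (rule fundamental_lemma[OF cylinder_open])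
  show "locally_integrable_on (%z. v z \<bullet> w' z) (cylinder T)"
   by (rule sq_int_locally_integrable[OF Q], subst sq_int_lebesgue_on_borel(1)[OF Q]) (use sq v(2) in auto)
  show "(\<integral>z. eta z *R (v z \<bullet> w' z) \<partial>lebesgue_on (cylinder T)) = 0" if "eta \<in> test_functions (cylinder T)" for eta
  proof -
   note [measurable] = C1c_measurable(1)[OF test_functions_C1c[OF that]]
   show ?thesis by (subst lebesgue_on_borel(3)[OF Q]) (use z[OF test_functions_C1c[OF that]] v(2) in auto)
  qed
 qed
 then have "AE z in lborel. z \<in> cylinder T --> v z \<bullet> w' z = 0" by (subst (asm) AE_lebesgue_on_iff[OF Q])
 then show ?thesis by eventually_elim (use out in force)
qed

lemma orthogonal_v: "AE z in lborel. v z \<bullet> wt z = 0" "AE z in lborel. \<forall>i. v z \<bullet> (wx z $ i) = 0"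
proof -
 show "AE z in lborel. v z \<bullet> wt z = 0"
  by (rule orthogonal[OF U_dt sq_U(2) w(1) w_out(1) U_lim(2)])
 have o: "wx z $ i = 0" if "z \<notin> cylinder T" for z i using w_out(2)[OF that] by simp
 have "AE z in lborel. v z \<bullet> (wx z $ i) = 0" for i
  by (rule orthogonal[OF U_dx sq_int_vec_nth[OF sq_U(3)] sq_int_vec_nth[OF w(2)] o U_lim_nth])
 then show "AE z in lborel. \<forall>i. v z \<bullet> (wx z $ i) = 0" by (simp add: AE_all_countable)
qed

lemma wedge_v_tendsto:
 fixes phi :: "'d spacetime => 'b"
 assumes phi: "continuous_on UNIV phi" "compact K" "\<And>z. z \<notin> K ==> phi z = 0"
  and h: "\<And>n. sqL (h n)" "sqL h0" "(%n. nrm (%z. h n z - h0 z)) ----> 0"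
 shows "(%n. nrm (%z. wedge (v z) (h n z) (phi z) - wedge (v z) (h0 z) (phi z))) ----> 0"
  "sqL (%z. wedge (v z) (h n z) (phi z))" "sqL (%z. wedge (v z) (h0 z) (phi z))"
proof -
 obtain A where A: "A \<ge> 0" "\<And>z. norm (phi z) \<le> A" using bounded_of_compact_support[OF phi] by blast
 have b: "norm (wedge (v z) y (phi z)) \<le> 2 * A * norm y" for y z
 proof -
  have "norm (wedge (v z) y (phi z)) \<le> 2 * (norm (v z) * norm y * norm (phi z))" using wedge_norm[of "v z" y "phi z"] by (simp add: mult.assoc)
  also have "norm (v z) * norm y * norm (phi z) \<le> 1 * norm y * A" by (intro mult_mono v_le_1 A order_refl) (auto simp: A)
  finally show ?thesis by (simp add: mult_ac)
 qed
 have hm: "h n \<in> BM" "h0 \<in> BM" for n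
  using sq_int_measurable[OF h(1)] sq_int_measurable[OF h(2)] by auto
 note [measurable] = borel_measurable_continuous_onI[OF phi(1)] v(1) hm
 have m: "(%z. wedge (v z) (h n z) (phi z)) \<in> borel_measurable lborel" "(%z. wedge (v z) (h0 z) (phi z)) \<in> borel_measurable lborel" for n
  unfolding wedge_def by measurable
 show "(%n. nrm (%z. wedge (v z) (h n z) (phi z) - wedge (v z) (h0 z) (phi z))) ----> 0"
  by (rule l2_tendsto_dominated[OF h m, where L = "2 * A"]) (use b A in "auto simp flip: wedge_diff(2)")
 show "sqL (%z. wedge (v z) (h n z) (phi z))" by (rule sq_int_bound[OF h(1)[of n] m(1), where c = "2 * A"]) (use b in auto)
 show "sqL (%z. wedge (v z) (h0 z) (phi z))" by (rule sq_int_bound[OF h(2) m(2), where c = "2 * A"]) (use b in auto)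
qed

text \<open>\<open>wedge_equation\<close> with \<open>q = U n\<close>, and \<open>n\<close> to
  infinity. Since \<open>v\<close> is orthogonal to its derivatives, the field with
  \<open>q = v\<close> acts on them like \<open>phi\<close> itself. The quadratic term comes from
  the derivative of \<open>q\<close>: it is the limit of the pairing of the fixed \<open>wx\<close>
  with the strongly convergent \<open>Ug n\<close>.\<close>

lemma limit_equation:
 fixes phi :: "'d spacetime => 'b"
 assumes phi: "phi \<in> C1c (cylinder T)"
 defines "dd i \<equiv> pderiv_dir (0, axis i 1)"
 shows "(LBINT z. wt z \<bullet> phi z + (\<Sum>i\<in>UNIV. wx z $ i \<bullet> dd i phi z) - (v z \<bullet> phi z) * (\<Sum>i\<in>UNIV. (norm (wx z $ i))^2)) = 0"
proof -
 obtain K where K: "compact K" "K \<subseteq> cylinder T" "\<And>z. z \<notin> K ==> phi z = 0" "\<And>z v. z \<notin> K ==> pderiv_dir v phi z = 0"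
  by (rule C1c_support[OF phi], rule that)
 have ddK: "dd i phi z = 0" if "z \<notin> K" for i z using K(4)[OF that] by (simp add: dd_def)
 have phic: "continuous_on UNIV phi" "continuous_on UNIV (dd i phi)" for i
  using C1c_continuous[OF phi] C1c_continuous_pderiv[OF phi] unfolding dd_def by auto
 note D1 = wedge_v_tendsto[OF phic(1) K(1,3) sq_U(1) sq_v U_lim(1)]
 note D2 = wedge_v_tendsto[OF phic(1) K(1,3) sq_int_vec_nth[OF sq_U(3)] sq_int_vec_nth[OF w(2)] U_lim_nth]
 note D3 = wedge_v_tendsto[OF phic(2) K(1) ddK sq_U(1) sq_v U_lim(1)]
 note wi = sq_int_vec_nth[OF w(2)]
 define R where "R n = (LBINT z. wt z \<bullet> wedge (v z) (U n z) (phi z))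
  + (\<Sum>i\<in>UNIV. (LBINT z. wx z $ i \<bullet> wedge (v z) (Ug n z $ i) (phi z)) + (LBINT z. wx z $ i \<bullet> wedge (v z) (U n z) (dd i phi z)))" for n
 define R0 where "R0 = (LBINT z. wt z \<bullet> wedge (v z) (v z) (phi z))
  + (\<Sum>i\<in>UNIV. (LBINT z. wx z $ i \<bullet> wedge (v z) (wx z $ i) (phi z)) + (LBINT z. wx z $ i \<bullet> wedge (v z) (v z) (dd i phi z)))"
 have R: "R n = 0" for n
 proof -
  have "wedge (v z) (dd i (U n) z) y = wedge (v z) (Ug n z $ i) y" for z i y
   by (cases "z \<in> cylinder T") (auto simp: dd_def U_dx v(2) wedge_def)
  then have "(LBINT z. wx z $ i \<bullet> (wedge (v z) (dd i (U n) z) (phi z) + wedge (v z) (U n z) (dd i phi z)))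
   = (LBINT z. wx z $ i \<bullet> wedge (v z) (Ug n z $ i) (phi z)) + (LBINT z. wx z $ i \<bullet> wedge (v z) (U n z) (dd i phi z))" for i
   unfolding inner_add_right
   using integral_add[OF sq_int_integrable_inner[OF wi D2(2)] sq_int_integrable_inner[OF wi D3(2)]] by simp
  then show ?thesis using wedge_equation[OF U_C1 phi, of n] unfolding R_def dd_def by simp
 qed
 have "(%n. R n) ----> R0" unfolding R_def R0_def
  by (intro tendsto_add tendsto_sum l2_inner_tendsto[OF w(1) w(1) _ D1(2,3,1)] l2_inner_tendsto[OF wi wi _ D2(2,3,1)]
   l2_inner_tendsto[OF wi wi _ D3(2,3,1)]) (simp_all add: l2n_def)
 then have "R0 = 0" unfolding R by (simp add: LIMSEQ_const_iff)
 note F = sq_int_integrable_inner[OF w(1) D1(3)] sq_int_integrable_inner[OF wi D2(3)] sq_int_integrable_inner[OF wi D3(3)]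
 let ?F = "%z. wt z \<bullet> wedge (v z) (v z) (phi z) + (\<Sum>i\<in>UNIV. wx z $ i \<bullet> wedge (v z) (wx z $ i) (phi z) + wx z $ i \<bullet> wedge (v z) (v z) (dd i phi z))"
 have iF: "intL ?F" by (intro integrable_add integrable_sum F)
 have "(LBINT z. ?F z) = R0"
  unfolding R0_def using F by (simp add: integral_add integrable_sum integral_sum)
 moreover have "(LBINT z. wt z \<bullet> phi z + (\<Sum>i\<in>UNIV. wx z $ i \<bullet> dd i phi z) - (v z \<bullet> phi z) * (\<Sum>i\<in>UNIV. (norm (wx z $ i))^2)) = (LBINT z. ?F z)"
 proof (rule integral_cong_AE)
  note [measurable] = sq_int_measurable[OF w(1)] sq_int_measurable[OF wi] v(1) borel_measurable_continuous_onI[OF phic(1)] borel_measurable_continuous_onI[OF phic(2)]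
  show "(%z. wt z \<bullet> phi z + (\<Sum>i\<in>UNIV. wx z $ i \<bullet> dd i phi z) - (v z \<bullet> phi z) * (\<Sum>i\<in>UNIV. (norm (wx z $ i))^2)) \<in> borel_measurable lborel"
   by measurable
  show "?F \<in> borel_measurable lborel" using iF by (rule borel_measurable_integrable)
  show "AE z in lborel. wt z \<bullet> phi z + (\<Sum>i\<in>UNIV. wx z $ i \<bullet> dd i phi z) - (v z \<bullet> phi z) * (\<Sum>i\<in>UNIV. (norm (wx z $ i))^2) = ?F z"
   using orthogonal_v
  proof eventually_elim
   case (elim z)
   show ?case
   proof (cases "z \<in> cylinder T")
    case True
    have vv: "v z \<bullet> v z = 1" using v(3)[OF True] by (simp add: dot_square_norm)
    have "wt z \<bullet> wedge (v z) (v z) (phi z) = wt z \<bullet> phi z"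
     using elim(1) vv by (simp add: wedge_def inner_diff_right inner_commute)
    moreover have "wx z $ i \<bullet> wedge (v z) (v z) (dd i phi z) = wx z $ i \<bullet> dd i phi z" for i
     using elim(2) vv by (simp add: wedge_def inner_diff_right inner_commute)
    \<comment> \<open>The first half of the field is multiplied by \<open>v \<bullet> wx\<close>,
      which is 0; the second half gives the squared norm with a minus sign, the nonlinearity of the
      harmonic map heat flow.\<close>
    moreover have "wx z $ i \<bullet> wedge (v z) (wx z $ i) (phi z) = - ((v z \<bullet> phi z) * (norm (wx z $ i))^2)" for i
     using elim(2) by (simp add: wedge_def inner_diff_right inner_commute power2_norm_eq_inner)
    ultimately show ?thesis by (simp add: sum_subtractf sum_distrib_left)
   qed (simp add: w_out v(2))
  qed
 qed
 ultimately show ?thesis using \<open>R0 = 0\<close> by simp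
qed

end

section \<open>Slices of the limit: boundary values, energy bound and the rate at time 0\<close>

lemma test_functions_sum:
 assumes "finite I" "\<And>i. i \<in> I ==> phi i \<in> test_functions S"
 shows "(%x. \<Sum>i\<in>I. a i *R phi i x) \<in> test_functions S"
proof -
 have "\<forall>i\<in>I. \<exists>K. compact K \<and> K \<subseteq> S \<and> (\<forall>x. x \<notin> K --> phi i x = 0)" using assms(2) by (auto simp: test_functions_def)
 then obtain K where K: "\<And>i. i \<in> I ==> compact (K i) \<and> K i \<subseteq> S \<and> (\<forall>x. x \<notin> K i --> phi i x = 0)" by metis
 have "compact (\<Union>i\<in>I. K i)" using assms(1) K by auto
 moreover have "(\<Union>i\<in>I. K i) \<subseteq> S" using K by auto
 moreover have "(\<Sum>i\<in>I. a i *R phi i x) = 0" if "x \<notin> (\<Union>i\<in>I. K i)" for x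
  by (rule sum.neutral) (use K that in auto)
 moreover have "Ck_on k UNIV (%x. \<Sum>i\<in>I. a i *R phi i x)" for k
  by (intro Ck_on_sum Ck_on_cmult test_functions_Ck[OF assms(2)]) auto
 ultimately show ?thesis unfolding test_functions_def smooth_on_def by blast
qed

text \<open>Like \<open>H10\<close>, but with smooth test functions, as \<open>sobolev1_0\<close>
  demands, and in epsilon form, which makes stability under convex combinations and under limits
  immediate.\<close>

definition H1_closure :: "(real ^ 'd => 'b::euclidean_space) => (real ^ 'd => 'b ^ 'd) => bool" where
 "H1_closure f g \<longleftrightarrow> sqL f \<and> sqL g \<and>
  (\<forall>eps>0. \<exists>phi\<in>test_functions unit_ball. nrm (%x. phi x - f x) \<le> eps \<and> nrm (%x. grad phi x - g x) \<le> eps)"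

lemma l2n_convex_combination:
 assumes f: "\<And>j. j \<in> I ==> sq_int M (f j)" and le: "\<And>j. j \<in> I ==> l2n M (f j) \<le> B"
  and a: "finite I" "\<And>j. j \<in> I ==> 0 \<le> a j" "(\<Sum>j\<in>I. a j) = 1"
 shows "l2n M (%x. \<Sum>j\<in>I. a j *R f j x) \<le> B"
proof -
 have "l2n M (%x. \<Sum>j\<in>I. a j *R f j x) \<le> (\<Sum>j\<in>I. a j * l2n M (f j))"
  using l2n_sum_le[OF a(1), of M "%j x. a j *R f j x"] f a(2) by (simp add: sq_int_scaleR l2n_scaleR)
 also have "\<dots> \<le> (\<Sum>j\<in>I. a j * B)" by (intro sum_mono mult_left_mono le a)
 finally show ?thesis by (simp add: a(3) flip: sum_distrib_right)
qed

lemma H1_closure_convex: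
 assumes a: "finite I" "\<And>j. j \<in> I ==> 0 \<le> a j" "(\<Sum>j\<in>I. a j) = 1"
  and h: "\<And>j. j \<in> I ==> H1_closure (f j) (g j)"
 shows "H1_closure (%x. \<Sum>j\<in>I. a j *R f j x) (%x. \<Sum>j\<in>I. a j *R g j x)"
 unfolding H1_closure_def
proof (intro conjI allI impI)
 have s: "sqL (f j)" "sqL (g j)" if "j \<in> I" for j using h[OF that] by (auto simp: H1_closure_def)
 show "sqL (%x. \<Sum>j\<in>I. a j *R f j x)" by (rule sq_int_sum, rule sq_int_scaleR, rule s(1))
 show "sqL (%x. \<Sum>j\<in>I. a j *R g j x)" by (rule sq_int_sum, rule sq_int_scaleR, rule s(2))
 fix eps :: real assume "eps > 0"
 then have "\<forall>j\<in>I. \<exists>phi. phi \<in> test_functions unit_ball \<and> nrm (%x. phi x - f j x) \<le> eps \<and> nrm (%x. grad phi x - g j x) \<le> eps"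
  using h unfolding H1_closure_def by blast
 from bchoice[OF this] obtain phi where phi: "\<And>j. j \<in> I ==> phi j \<in> test_functions unit_ball"
  "\<And>j. j \<in> I ==> nrm (%x. phi j x - f j x) \<le> eps" "\<And>j. j \<in> I ==> nrm (%x. grad (phi j) x - g j x) \<le> eps"
  by blast
 let ?phi = "%x. \<Sum>j\<in>I. a j *R phi j x"
 have d: "(?phi has_derivative (%v. \<Sum>j\<in>I. a j *R pderiv_dir v (phi j) x)) (at x)" for x
  by (intro has_derivative_sum has_derivative_scaleR_right pderiv_dir_has_derivative C1c_differentiable[OF test_functions_C1c[OF phi(1)]])
 have gr: "grad ?phi x = (\<Sum>j\<in>I. a j *R grad (phi j) x)" for x
  by (simp add: grad_def pderiv_dir_eq[OF d] vec_eq_iff)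
 have "nrm (%x. \<Sum>j\<in>I. a j *R (phi j x - f j x)) \<le> eps"
  by (rule l2n_convex_combination[OF sq_int_diff[OF C1c_sq_int(1)[OF test_functions_C1c[OF phi(1)]] s(1)] phi(2) a])
 moreover have "nrm (%x. \<Sum>j\<in>I. a j *R (grad (phi j) x - g j x)) \<le> eps"
  by (rule l2n_convex_combination[OF sq_int_diff[OF C1c_grad_sq_int[OF test_functions_C1c[OF phi(1)]] s(2)] phi(3) a])
 ultimately have "nrm (%x. ?phi x - (\<Sum>j\<in>I. a j *R f j x)) \<le> eps \<and> nrm (%x. grad ?phi x - (\<Sum>j\<in>I. a j *R g j x)) \<le> eps"
  unfolding gr by (simp add: scaleR_diff_right sum_subtractf)
 then show "\<exists>phi\<in>test_functions unit_ball. nrm (%x. phi x - (\<Sum>j\<in>I. a j *R f j x)) \<le> eps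
   \<and> nrm (%x. grad phi x - (\<Sum>j\<in>I. a j *R g j x)) \<le> eps"
  by (rule bexI[OF _ test_functions_sum[OF a(1) phi(1)]])
qed

lemma H1_closure_limit:
 assumes h: "\<And>n::nat. H1_closure (f n) (g n)" and s: "sqL f0" "sqL g0"
  and l: "(%n. nrm (%x. f n x - f0 x)) ----> 0" "(%n. nrm (%x. g n x - g0 x)) ----> 0"
 shows "H1_closure f0 g0"
 unfolding H1_closure_def
proof (intro conjI allI impI s)
 fix eps :: real assume e: "eps > 0"
 have sn: "sqL (f n)" "sqL (g n)" for n using h[of n] by (auto simp: H1_closure_def)
 have "\<forall>\<^sub>F n in sequentially. nrm (%x. f n x - f0 x) < eps / 2 \<and> nrm (%x. g n x - g0 x) < eps / 2"
  by (rule eventually_conj) (use order_tendstoD(2)[OF l(1), of "eps / 2"] order_tendstoD(2)[OF l(2), of "eps / 2"] e in auto)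
 then obtain n where n: "nrm (%x. f n x - f0 x) < eps / 2" "nrm (%x. g n x - g0 x) < eps / 2"
  using eventually_happens'[OF sequentially_bot] by blast
 obtain phi where phi: "phi \<in> test_functions unit_ball" "nrm (%x. phi x - f n x) \<le> eps / 2" "nrm (%x. grad phi x - g n x) \<le> eps / 2"
  using h[of n] half_gt_zero[OF e] unfolding H1_closure_def by blast
 note c = test_functions_C1c[OF phi(1)]
 show "\<exists>phi\<in>test_functions unit_ball. nrm (%x. phi x - f0 x) \<le> eps \<and> nrm (%x. grad phi x - g0 x) \<le> eps"
  using l2n_triangle3[OF C1c_sq_int(1)[OF c] sn(1) s(1), of n] l2n_triangle3[OF C1c_grad_sq_int[OF c] sn(2) s(2), of n] n phi
  by (intro bexI[OF _ phi(1)] conjI) linarith+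
qed

text \<open>Convergence in \<open>L2\<close> on space-time is convergence in \<open>L1\<close> in
  time of the squared slice norms, so a subsequence of these converges to 0 for almost every
  time.\<close>

lemma slices_convergent_subsequence:
 fixes h :: "nat => real \<times> 'a::euclidean_space => 'b::euclidean_space"
 assumes h: "\<And>n. sqL (h n)" "sqL h0" "(%n. nrm (%z. h n z - h0 z)) ----> 0"
 obtains r :: "nat => nat" where "strict_mono r"
  "AE t in lborel. (%n. nrm (%x. h (r n) (t, x) - h0 (t, x))) ----> 0"
proof -
 let ?F = "%n z. (norm (h n z - h0 z))^2"
 have i: "intL (?F n)" for n by (rule sq_int_integrable[OF sq_int_diff[OF h(1,2)]])
 have nn: "norm (LBINT x. ?F n (t, x)) = (LBINT x. ?F n (t, x))" for n t by simp
 have "(%n. (nrm (%z. h n z - h0 z))^2) ----> 0^2" by (intro tendsto_intros h)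
 then have "(%n. LBINT t. norm (LBINT x. ?F n (t, x))) ----> 0"
  unfolding nn fubini(5)[OF i] by (simp add: l2n_sq)
 then obtain r :: "nat => nat" where r: "strict_mono r" "AE t in lborel. (%n. LBINT x. ?F (r n) (t, x)) ----> 0"
  using tendsto_L1_AE_subseq[of lborel "%n t. LBINT x. ?F n (t, x)"] fubini(3)[OF i] by blast
 have "AE t in lborel. (%n. nrm (%x. h (r n) (t, x) - h0 (t, x))) ----> 0"
  using r(2) by eventually_elim (unfold l2n_def, use tendsto_real_sqrt in fastforce)
 then show thesis by (rule that[OF r(1)])
qed

lemma AE_fst_lborel:
 assumes "AE t in (lborel :: real measure). Q t"
 shows "AE z in (lborel :: (real \<times> 'a::euclidean_space) measure). Q (fst z)"
proof -
 obtain N where N: "N \<in> null_sets lborel" "{t. \<not> Q t} \<subseteq> N" using assms by (auto simp: eventually_ae_filter)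
 have "N \<times> (UNIV :: 'a set) \<in> null_sets (lborel \<Otimes>\<^sub>M lborel)" by (rule lborel.times_in_null_sets1) (use N in auto)
 then have "N \<times> (UNIV :: 'a set) \<in> null_sets lborel" by (simp add: lborel_prod)
 then show ?thesis by (rule AE_I') (use N in "auto simp: mem_Times_iff")
qed

context gl_combo begin

text \<open>Everything asked of almost every slice of \<open>v\<close> holds for the combinations,
  because the bounds and the boundary class are convex, and it passes to the limit along a
  subsequence whose slices, with their gradients, converge. The passage is needed slice by slice
  because the final definition bounds norms of time slices.\<close>

lemma slice_properties:
 assumes b: "\<And>k. AE t in lborel. 0 < t --> t < T --> H1_closure (%x. u k (t, x) - v0 x) (%x. g k (t, x) - g0 x)"
 shows "AE t in lborel. 0 < t --> t < T --> sqL (%x. v (t, x)) \<and> sqL (%x. wx (t, x))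
  \<and> (\<forall>i. has_weak_deriv unit_ball (axis i 1) (%x. v (t, x)) (%x. wx (t, x) $ i))
  \<and> nrm (%x. wx (t, x)) \<le> sqrt K0 \<and> nrm (%x. v (t, x) - v0 x) \<le> sqrt (t * K0)
  \<and> H1_closure (%x. v (t, x) - v0 x) (%x. wx (t, x) - g0 x)"
proof -
 obtain r1 :: "nat => nat" where r1: "strict_mono r1" "AE t in lborel. (%n. nrm (%x. U (r1 n) (t, x) - v (t, x))) ----> 0"
  by (rule slices_convergent_subsequence[OF sq_U(1) sq_v U_lim(1)])
 obtain r2 :: "nat => nat" where r2: "strict_mono r2"
  "AE t in lborel. (%n. nrm (%x. Ug (r1 (r2 n)) (t, x) - wx (t, x))) ----> 0"
  by (rule slices_convergent_subsequence[OF sq_U(3) w(2) LIMSEQ_subseq_LIMSEQ[OF U_lim(3) r1(1), unfolded o_def]])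
 define r where "r n = r1 (r2 n)" for n
 have "AE t in lborel. \<forall>k. 0 < t --> t < T --> H1_closure (%x. u k (t, x) - v0 x) (%x. g k (t, x) - g0 x)"
  unfolding AE_all_countable using b by blast
 then show ?thesis using r1(2) r2(2) sq_int_slices(1)[OF sq_v] sq_int_slices(1)[OF w(2)]
 proof eventually_elim
  case (elim t)
  show ?case
  proof (intro impI)
   assume t: "0 < t" "t < T"
   have B: "unit_ball \<in> sets (borel :: (real ^ 'd) measure)" by simp
   have lU: "(%n. nrm (%x. U (r n) (t, x) - v (t, x))) ----> 0"
    using LIMSEQ_subseq_LIMSEQ[OF elim(2) r2(1)] by (simp add: r_def o_def)
   have lG: "(%n. nrm (%x. Ug (r n) (t, x) - wx (t, x))) ----> 0" using elim(3) by (simp add: r_def)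
   have su: "sqL (%x. u j (t, x))" for j by (rule gl_flow.sq_u_slice[OF gl])
   have sg: "sqL (%x. g j (t, x))" for j by (rule gl_flow.energy_parts(2)[OF gl t])
   have sU: "sqL (%x. U n (t, x))" "sqL (%x. Ug n (t, x))" for n
    unfolding U_def Ug_def by (intro sq_int_sum sq_int_scaleR su sg)+
   have v0: "sqL v0" "sqL g0" using heat_flow.v0[OF hf] by auto
   have gE: "nrm (%x. Ug n (t, x)) \<le> sqrt K0" for n
    unfolding Ug_def
   proof (rule l2n_convex_combination[OF sg])
    show "nrm (%x. g j (t, x)) \<le> sqrt K0" for j
     unfolding l2n_def[of _ "%x. g j (t, x)"] by (rule real_sqrt_le_mono[OF gl_flow.energy_parts(3)[OF gl t]])
   qed (use c in auto)
   have cd: "(\<Sum>j=n..<m n. c n j *R (a j - y)) = (\<Sum>j=n..<m n. c n j *R a j) - y" for a :: "nat => 'z::euclidean_space" and y n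
    using c(2)[of n] by (simp add: scaleR_diff_right sum_subtractf flip: scaleR_left.sum)
   have uE: "nrm (%x. U n (t, x) - v0 x) \<le> sqrt (t * K0)" for n
   proof -
    have "nrm (%x. \<Sum>j=n..<m n. c n j *R (u j (t, x) - v0 x)) \<le> sqrt (t * K0)"
     by (rule l2n_convex_combination[OF sq_int_diff[OF su v0(1)] gl_flow.u_initial_bound[OF gl t]]) (use c in auto)
    then show ?thesis unfolding cd U_def .
   qed
   have "nrm (%x. wx (t, x)) \<le> sqrt K0 + 0"
   proof (rule LIMSEQ_le_const[OF tendsto_add[OF tendsto_const lG]], intro exI allI impI)
    show "nrm (%x. wx (t, x)) \<le> sqrt K0 + nrm (%x. Ug (r n) (t, x) - wx (t, x))" for n
     using l2n_le_add_diff[OF elim(5) sU(2)[of "r n"]] gE[of "r n"] l2n_diff_commute[of lborel "%x. wx (t, x)" "%x. Ug (r n) (t, x)"] by linarith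
   qed
   moreover have "nrm (%x. v (t, x) - v0 x) \<le> sqrt (t * K0) + 0"
   proof (rule LIMSEQ_le_const[OF tendsto_add[OF tendsto_const lU]], intro exI allI impI)
    show "nrm (%x. v (t, x) - v0 x) \<le> sqrt (t * K0) + nrm (%x. U (r n) (t, x) - v (t, x))" for n
     using l2n_triangle3[OF elim(4) sU(1)[of "r n"] v0(1)] uE[of "r n"] l2n_diff_commute[of lborel "%x. v (t, x)" "%x. U (r n) (t, x)"] by linarith
   qed
   moreover have "H1_closure (%x. v (t, x) - v0 x) (%x. wx (t, x) - g0 x)"
   proof (rule H1_closure_limit)
    show "H1_closure (%x. U (r n) (t, x) - v0 x) (%x. Ug (r n) (t, x) - g0 x)" for n
     using H1_closure_convex[of "{r n..<m (r n)}" "c (r n)" "%j x. u j (t, x) - v0 x" "%j x. g j (t, x) - g0 x"] c elim(1) t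
     unfolding cd U_def Ug_def by simp
   qed (use lU lG in "simp_all add: sq_int_diff elim v0")
   moreover have "has_weak_deriv unit_ball (axis i 1) (%x. v (t, x)) (%x. wx (t, x) $ i)" for i
   proof -
    note nth = sq_int_vec_nth[of lborel, where i = i]
    have on: "sq_int (lebesgue_on unit_ball) h" "l2n (lebesgue_on unit_ball) h = nrm h"
     if "sqL h" "\<And>x. x \<notin> unit_ball ==> h x = 0" for h :: "real ^ 'd => 'b"
     using sq_int_lebesgue_on_borel[OF B, of h] sq_int_measurable[OF that(1)] that by auto
    have nQ: "(t, x) \<notin> cylinder T" if "x \<notin> unit_ball" for x :: "real ^ 'd" using that by (simp add: cylinder_def)
    show ?thesis
    proof (rule has_weak_deriv_limit[OF open_ball])
     show "has_weak_deriv unit_ball (axis i 1) (%x. U (r n) (t, x)) (%x. Ug (r n) (t, x) $ i)" for n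
     proof (rule has_weak_deriv_cong[OF has_weak_deriv_Ck[OF open_ball, where f = "%x. U (r n) (t, x)"]])
      have C: "Ck_on (Suc 0) ({0<..<T} \<times> unit_ball) (U (r n))" using U_C1 by (simp add: cylinder_def del: Ck_on.simps)
      show "Ck_on (Suc 0) unit_ball (%x. U (r n) (t, x))" by (rule Ck_on_slice(1)[OF C]) (use t in auto)
      show "axis i (1 :: real) \<in> Basis" by (simp add: axis_in_Basis_iff)
      show "pderiv_dir (axis i 1) (%x. U (r n) (t, x)) x = Ug (r n) (t, x) $ i" if x: "x \<in> unit_ball" for x
       by (subst Ck_on_slice(2)[OF C _ _ x]) (use t x U_dx in "auto simp: cylinder_def")
     qed simp
     show "(%n. l2n (lebesgue_on unit_ball) (%x. U (r n) (t, x) - v (t, x))) ----> 0"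
      by (subst on(2)) (use lU in "simp_all add: sq_int_diff sU elim U_out v(2) nQ")
     have "(%n. nrm (%x. Ug (r n) (t, x) $ i - wx (t, x) $ i)) ----> 0"
      by (rule l2_tendsto_dominated[OF sU(2) elim(5) lG, where L = 1])
        (use sq_int_measurable[OF nth[OF sU(2)]] sq_int_measurable[OF nth[OF elim(5)]] in
         \<open>auto simp flip: vector_minus_component intro: Finite_Cartesian_Product.norm_nth_le\<close>)
     then show "(%n. l2n (lebesgue_on unit_ball) (%x. Ug (r n) (t, x) $ i - wx (t, x) $ i)) ----> 0"
      by (subst on(2)) (simp_all add: sq_int_diff nth sU elim U_out w_out(2) nQ)
    qed (rule on(1); simp add: sU elim U_out v(2) w_out(2) nQ nth)+
   qed
   ultimately show "sqL (%x. v (t, x)) \<and> sqL (%x. wx (t, x))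
    \<and> (\<forall>i. has_weak_deriv unit_ball (axis i 1) (%x. v (t, x)) (%x. wx (t, x) $ i))
    \<and> nrm (%x. wx (t, x)) \<le> sqrt K0 \<and> nrm (%x. v (t, x) - v0 x) \<le> sqrt (t * K0)
    \<and> H1_closure (%x. v (t, x) - v0 x) (%x. wx (t, x) - g0 x)"
    using elim(4,5) by simp
  qed
 qed
qed

end

section \<open>From the flow as defined to the analytic setting\<close>

lemma Basis_axis: "(Basis :: (real ^ 'd) set) = range (%i. axis i 1)"
 by (auto simp: Basis_vec_def)

lemma sum_Basis_axis: "(\<Sum>e\<in>Basis. h e) = (\<Sum>i\<in>UNIV. h (axis i 1 :: real ^ 'd))"
 unfolding Basis_axis by (subst sum.reindex) (auto simp: inj_on_def axis_eq_axis)

text \<open>Constant sequences in \<open>has_weak_deriv_limit\<close>: functions that agree almost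
  everywhere have distance 0.\<close>

lemma has_weak_deriv_AE:
 fixes f :: "'a::euclidean_space => 'b::euclidean_space"
 assumes S: "open S" and w: "has_weak_deriv S v f g" and s: "sq_int (lebesgue_on S) f" "sq_int (lebesgue_on S) g"
  and s': "sq_int (lebesgue_on S) f'" "sq_int (lebesgue_on S) g'"
  and ae: "AE x in lebesgue_on S. f x = f' x" "AE x in lebesgue_on S. g x = g' x"
 shows "has_weak_deriv S v f' g'"
proof -
 have z: "(%n::nat. l2n (lebesgue_on S) (%x. h x - h' x)) ----> 0"
  if "sq_int (lebesgue_on S) h" "sq_int (lebesgue_on S) h'" and e: "AE x in lebesgue_on S. h x = h' x" for h h' :: "'a => 'b"
 proof -
  have "l2n (lebesgue_on S) (%x. h x - h' x) = l2n (lebesgue_on S) (%x. 0 :: 'b)"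
  proof (rule l2n_cong_AE)
   show "AE x in lebesgue_on S. h x - h' x = 0" using e by eventually_elim simp
  qed (use sq_int_measurable[OF sq_int_diff[OF that(1,2)]] in auto)
  then show ?thesis by (simp add: l2n_def)
 qed
 show ?thesis by (rule has_weak_deriv_limit[OF S w s(1) s'(1) z[OF s(1) s'(1) ae(1)] s(2) s'(2) z[OF s(2) s'(2) ae(2)]])
qed

text \<open>The data and their weak gradient are replaced by Borel functions that vanish off the
  ball. The weak derivative is recorded for \<open>u0\<close> itself, so that it can be subtracted
  from that of the flow.\<close>

lemma initial_data_representative:
 fixes u0 :: "real ^ 'd => 'b::euclidean_space"
 assumes u0: "u0 \<in> sobolev 1 unit_ball"
 obtains v0 :: "real ^ 'd => 'b" and g0 :: "real ^ 'd => 'b ^ 'd"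
 where "sqL v0" "sqL g0" "\<forall>x. x \<notin> unit_ball --> v0 x = 0" "\<forall>x. x \<notin> unit_ball --> g0 x = 0"
  "AE x in lebesgue_on unit_ball. u0 x = v0 x" "\<forall>i. has_weak_deriv unit_ball (axis i 1) u0 (%x. g0 x $ i)"
proof -
 have B: "unit_ball \<in> sets (borel :: (real ^ 'd) measure)" by simp
 let ?B = "lebesgue_on (unit_ball :: (real ^ 'd) set)"
 have su: "sq_int ?B u0" using u0 by (simp add: L2_iff One_nat_def)
 have "\<exists>v. sqL v \<and> (\<forall>x. x \<notin> unit_ball --> v x = 0) \<and> (AE x in ?B. h x = v x)" if h: "sq_int ?B h" for h :: "real ^ 'd => 'b"
 proof -
  obtain v where v: "v \<in> BM" "\<forall>x. x \<notin> unit_ball --> v x = 0" "AE x in ?B. h x = v x"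
   by (rule lebesgue_on_borel_rep[OF B sq_int_measurable[OF h]])
  have "sq_int ?B v" using v(3) by (intro sq_int_cong_AE[OF h lebesgue_on_borel(1)[OF B v(1,2)]])
  then show ?thesis using sq_int_lebesgue_on_borel(1)[OF B v(1,2)] v by auto
 qed
 note rep = this
 have "\<exists>G. has_weak_deriv unit_ball (axis i 1) u0 G \<and> sqL G \<and> (\<forall>x. x \<notin> unit_ball --> G x = 0)" for i
 proof -
  obtain G where G: "has_weak_deriv unit_ball (axis i 1) u0 G" "sq_int ?B G"
   using u0 by (auto simp: L2_iff One_nat_def Basis_axis)
  obtain G' where G': "sqL G'" "\<forall>x. x \<notin> unit_ball --> G' x = 0" "AE x in ?B. G x = G' x" using rep[OF G(2)] by blast
  have "sq_int ?B G'" using sq_int_lebesgue_on_borel(1)[OF B _ G'(2)] sq_int_measurable[OF G'(1)] G'(1) by simp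
  then have "has_weak_deriv unit_ball (axis i 1) u0 G'"
   by (intro has_weak_deriv_AE[OF open_ball G(1) su G(2) su _ _ G'(3)]) auto
  then show ?thesis using G' by blast
 qed
 then obtain G where G: "\<And>i. has_weak_deriv unit_ball (axis i 1) u0 (G i)" "\<And>i. sqL (G i)"
  "\<And>i. \<forall>x. x \<notin> unit_ball --> G i x = 0" by metis
 obtain v where v: "sqL v" "\<forall>x. x \<notin> unit_ball --> v x = 0" "AE x in ?B. u0 x = v x" using rep[OF su] by blast
 show thesis
  by (rule that[of v "%x. \<chi> i. G i x"]) (use v G in "auto intro!: sq_int_vec simp: vec_eq_iff")
qed

lemma l2n_vec_tendsto:
 fixes h :: "nat => 'a => 'b::euclidean_space ^ 'i::finite"
 assumes s: "\<And>n. sq_int M (h n)" and l: "\<And>i. (%n. l2n M (%x. h n x $ i)) ----> 0"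
 shows "(%n. l2n M (h n)) ----> 0"
proof -
 have "(l2n M (h n))^2 = (\<Sum>i\<in>UNIV. (l2n M (%x. h n x $ i))^2)" for n
  unfolding l2n_sq norm_vec_sq by (rule integral_sum) (rule sq_int_integrable[OF sq_int_vec_nth[OF s]])
 then have e: "l2n M (h n) = sqrt (\<Sum>i\<in>UNIV. (l2n M (%x. h n x $ i))^2)" for n
  by (metis l2n_nonneg real_sqrt_unique)
 have "(%n. sqrt (\<Sum>i\<in>UNIV. (l2n M (%x. h n x $ i))^2)) ----> sqrt (\<Sum>i\<in>(UNIV :: 'i set). 0^2)"
  by (intro tendsto_intros l)
 then show ?thesis unfolding e by simp
qed

lemma kappa_mono: "s \<le> t ==> kappa s \<le> kappa t"
 by (simp add: kappa_def divide_right_mono arctan_le_iff)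

lemma lebesgue_on_transfer:
 fixes h :: "'a::euclidean_space => 'b::euclidean_space"
 assumes S: "S \<in> sets borel" and h: "h \<in> BM" "\<And>x. x \<notin> S ==> h x = 0"
  and ae: "AE x in lebesgue_on S. k x = h x"
 shows "k \<in> borel_measurable (lebesgue_on S)" "sq_int (lebesgue_on S) k \<longleftrightarrow> sqL h"
  "l2n (lebesgue_on S) k = nrm h"
proof -
 have o: "\<forall>x. x \<notin> S --> h x = 0" using h(2) by blast
 note m = lebesgue_on_borel(1)[OF S h(1) o] and s = sq_int_lebesgue_on_borel[OF S h(1) o]
 show k: "k \<in> borel_measurable (lebesgue_on S)" by (rule lebesgue_on_measurable_AE[OF S m ae])
 have ae': "AE x in lebesgue_on S. h x = k x" using ae by eventually_elim simp
 show "sq_int (lebesgue_on S) k \<longleftrightarrow> sqL h" using sq_int_cong_AE[OF _ m ae] sq_int_cong_AE[OF _ k ae'] s(1) by blast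
 show "l2n (lebesgue_on S) k = nrm h" using l2n_cong_AE[OF k m ae] s(2) by simp
qed

text \<open>\<open>uu\<close>, \<open>pp\<close>, \<open>gg\<close> and \<open>ff\<close> below are
  the extensions by 0 of the flow, its time derivative, its gradient and its nonlinear term. The
  condition \<open>1 <= lam\<close> makes powers of \<open>lam\<close> monotone in the
  exponent.\<close>

locale GLHF_flow =
 fixes T lam :: real and chi :: "real => real" and u0 :: "real ^ 'd => 'b::euclidean_space" and u :: "real \<times> (real ^ 'd) => 'b"
  and v0 :: "real ^ 'd => 'b" and g0 :: "real ^ 'd => 'b ^ 'd"
 assumes T: "0 < T" and lam_ge: "1 \<le> lam" and chi: "cutoff chi" and sphere: "sphere_valued unit_ball u0"
  and GL: "GLHF chi T u0 lam u"
  and v0: "sqL v0" "sqL g0" "x \<notin> unit_ball ==> v0 x = 0" "x \<notin> unit_ball ==> g0 x = 0"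
   "AE x in lebesgue_on unit_ball. u0 x = v0 x" "has_weak_deriv unit_ball (axis i 1) u0 (%x. g0 x $ i)"
begin

abbreviation Q :: "'d spacetime set" where "Q \<equiv> cylinder T"

definition uu :: "'d spacetime => 'b" where "uu z = ind Q z *R u z"
definition pp :: "'d spacetime => 'b" where "pp z = ind Q z *R pderiv_dir (1, 0) u z"
definition gg :: "'d spacetime => 'b ^ 'd" where "gg z = ind Q z *R (\<chi> i. pderiv_dir (0, axis i 1) u z)"
definition ff :: "'d spacetime => 'b" where
 "ff z = ind Q z *R ((lam powr (1 - kappa (fst z)) * deriv chi (((norm (u z))^2 - 1)^2) * ((norm (u z))^2 - 1)) *R u z)"

lemma Ck_u: "Ck_on k Q u" using GL by (simp add: GLHF_def smooth_on_def)

lemma Ck_dx: "Ck_on k Q (pderiv_dir (0, axis i 1) u)"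
 using Ck_u[of "Suc k"] Basis_snd[of "axis i (1 :: real)"] unfolding Ck_on.simps by (auto simp: axis_in_Basis_iff)

lemma dt_continuous: "continuous_on Q (pderiv_dir (1, 0) u)"
 using Ck_on_pderiv_dir_continuous[OF Ck_u] by simp

lemma zero_ext_measurable:
 fixes h :: "'d spacetime => 'c::euclidean_space"
 assumes "continuous_on Q h"
 shows "(%z. ind Q z *R h z) \<in> BM" "continuous_on Q (%z. ind Q z *R h z)"
proof -
 show "(%z. ind Q z *R h z) \<in> BM"
  by (rule borel_measurable_continuous_on_indicator[OF _ assms]) (rule borel_open[OF cylinder_open])
 show "continuous_on Q (%z. ind Q z *R h z)"
  using assms by (simp cong: continuous_on_cong)
qed

lemma pde: "z \<in> Q ==> ff z = (\<Sum>i\<in>UNIV. pderiv_dir (0, axis i 1) (pderiv_dir (0, axis i 1) u) z) - pderiv_dir (1, 0) u z"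
proof -
 assume z: "z \<in> Q"
 obtain t x where tx: "z = (t, x)" by (cases z)
 have "pderiv_dir (1, 0) u (t, x) - laplacian_x u (t, x)
    + (lam powr (1 - kappa t) * deriv chi (((norm (u (t, x)))^2 - 1)^2) * ((norm (u (t, x)))^2 - 1)) *R u (t, x) = 0"
  using GL z unfolding GLHF_def tx by blast
 then show ?thesis using z by (simp add: ff_def tx laplacian_x_def sum_Basis_axis algebra_simps eq_neg_iff_add_eq_0)
qed

text \<open>The equation expresses the nonlinear term by derivatives of the smooth map
  \<open>u\<close>; measurability and continuity follow from this form without a study of
  \<open>deriv chi\<close>.\<close>

lemma ff_zero_ext: "ff = (%z. ind Q z *R ((\<Sum>i\<in>UNIV. pderiv_dir (0, axis i 1) (pderiv_dir (0, axis i 1) u) z) - pderiv_dir (1, 0) u z))"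
proof
 fix z show "ff z = ind Q z *R ((\<Sum>i\<in>UNIV. pderiv_dir (0, axis i 1) (pderiv_dir (0, axis i 1) u) z) - pderiv_dir (1, 0) u z)"
  using pde[of z] by (cases "z \<in> Q") (auto simp: ff_def)
qed

lemma continuous_parts:
 "continuous_on Q u" "continuous_on Q (%z. \<chi> i. pderiv_dir (0, axis i 1) u z)"
 "continuous_on Q (%z. (\<Sum>i\<in>UNIV. pderiv_dir (0, axis i 1) (pderiv_dir (0, axis i 1) u) z) - pderiv_dir (1, 0) u z)"
 using Ck_u[of 0] Ck_dx[of 0] Ck_on_pderiv_dir_continuous[OF Ck_dx] dt_continuous
 by (auto intro!: continuous_intros)

lemma slice_C1: "0 < t ==> t < T ==> Ck_on (Suc 0) unit_ball (%x. u (t, x))"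
 "0 < t ==> t < T ==> x \<in> unit_ball ==> pderiv_dir (axis i 1) (%x. u (t, x)) x = gg (t, x) $ i"
proof -
 have C: "Ck_on (Suc 0) ({0<..<T} \<times> unit_ball) u" using Ck_u[of "Suc 0"] by (simp add: cylinder_def del: Ck_on.simps)
 show "0 < t ==> t < T ==> Ck_on (Suc 0) unit_ball (%x. u (t, x))"
  by (rule Ck_on_slice(1)[OF C]) auto
 show "pderiv_dir (axis i 1) (%x. u (t, x)) x = gg (t, x) $ i" if "0 < t" "t < T" "x \<in> unit_ball"
  using Ck_on_slice(2)[OF C, of t x "axis i 1"] that by (simp add: gg_def cylinder_def)
qed

text \<open>This precedes any bound on \<open>u\<close> and rests on the cutoff. With
  \<open>S = (norm u)^2\<close>, the derivative of \<open>chi\<close> is 0 when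
  \<open>(S - 1)^2 > 4\<close>; otherwise \<open>S <= 3\<close>, so \<open>norm u <= 2\<close>. The
  numbers 3 and 2 are crude bounds for \<open>abs (S - 1)\<close> and \<open>norm u\<close>.\<close>

lemma ff_bounded: "\<exists>M. \<forall>z. norm (ff z) \<le> M"
proof -
 obtain K where K: "0 \<le> K" "\<And>s. 0 \<le> s ==> \<bar>deriv chi s\<bar> \<le> K" by (rule cutoff_deriv_bound[OF chi], rule that)
 have "norm (ff z) \<le> lam * K * 3 * 2" for z
 proof (cases "z \<in> Q")
  case True
  define S where "S = (norm (u z))^2"
  have k: "0 \<le> kappa (fst z)" using True kappa_mono[of 0 "fst z"] by (auto simp: cylinder_def kappa_def)
  have a: "lam powr (1 - kappa (fst z)) \<le> lam" using powr_mono[of "1 - kappa (fst z)" 1 lam] lam_ge k by simp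
  show ?thesis
  proof (cases "4 < (S - 1)^2")
   case True
   then show ?thesis using K lam_ge by (simp add: ff_def S_def cutoff_deriv_large[OF chi])
  next
   case False
   then have "\<bar>S - 1\<bar> \<le> 2" using abs_le_square_iff[of "S - 1" 2] by simp
   then have s: "\<bar>S - 1\<bar> \<le> 3" "S \<le> 2^2" by auto
   then have n: "norm (u z) \<le> 2" unfolding S_def by (rule_tac power2_le_imp_le) auto
   have "lam powr (1 - kappa (fst z)) * \<bar>deriv chi ((S - 1)^2)\<bar> * \<bar>S - 1\<bar> * norm (u z) \<le> lam * K * 3 * 2"
    by (intro mult_mono a K s n mult_nonneg_nonneg) (use K lam_ge in auto)
   then show ?thesis using True by (simp add: ff_def S_def abs_mult)
  qed
 qed (use K lam_ge in "simp add: ff_def")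
 then show ?thesis by blast
qed

text \<open>By the equation the integrand is the divergence of the compactly supported fields formed
  by \<open>psi\<close> and the partial derivatives of \<open>u\<close>, and the integral of each of
  its terms is 0.\<close>

lemma weak_form:
 assumes t: "0 < t" "t < T" and psi: "psi \<in> C1c unit_ball"
 shows "(LBINT x. pp (t, x) \<bullet> psi x + gg (t, x) \<bullet> grad psi x + ff (t, x) \<bullet> psi x) = 0"
proof -
 let ?d = "%i x. pderiv_dir (0, axis i 1) u (t, x)"
 have C: "Ck_on (Suc 0) ({0<..<T} \<times> unit_ball) (pderiv_dir (0, axis i 1) u)" for i
  using Ck_dx[of "Suc 0"] by (simp add: cylinder_def del: Ck_on.simps)
 have Cd: "Ck_on (Suc 0) unit_ball (?d i)" for i by (rule Ck_on_slice(1)[OF C]) (use t in auto)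
 have h: "(%x. ?d i x \<bullet> psi x) \<in> C1c unit_ball" for i by (rule C1c_bilinear[OF bounded_bilinear_inner open_ball Cd psi])
 have "pp (t, x) \<bullet> psi x + gg (t, x) \<bullet> grad psi x + ff (t, x) \<bullet> psi x = (\<Sum>i\<in>UNIV. pderiv_dir (axis i 1) (%x. ?d i x \<bullet> psi x) x)" for x
 proof (cases "x \<in> unit_ball")
  case True
  then have z: "(t, x) \<in> Q" using t by (simp add: cylinder_def)
  have "pderiv_dir (axis i 1) (%x. ?d i x \<bullet> psi x) x
   = ?d i x \<bullet> pderiv_dir (axis i 1) psi x + pderiv_dir (0, axis i 1) (pderiv_dir (0, axis i 1) u) (t, x) \<bullet> psi x" for i
  proof -
   have "?d i differentiable (at x)" using Cd[of i] True by auto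
   from pderiv_dir_bilinear(2)[OF bounded_bilinear_inner this C1c_differentiable[OF psi]]
   show ?thesis using Ck_on_slice(2)[OF C _ open_ball True, of t] t by simp
  qed
  then show ?thesis unfolding pde[OF z]
   using z by (simp add: pp_def gg_def inner_vec_def grad_def inner_diff_left inner_sum_left sum.distrib)
 next
  case False
  have "pderiv_dir (axis i 1) (%x. ?d i x \<bullet> psi x) x = 0" for i
  proof -
   obtain K where K: "K \<subseteq> unit_ball" "\<And>x v. x \<notin> K ==> pderiv_dir v (%x. ?d i x \<bullet> psi x) x = 0"
    by (rule C1c_support[OF h[of i]], rule that)
   then show ?thesis using False by blast
  qed
  then show ?thesis using False by (simp add: pp_def gg_def ff_def cylinder_def)
 qed
 then show ?thesis
  by (simp add: integral_sum[OF C1c_integrable(2)[OF h]] integral_pderiv_dir_C1c[OF h])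
qed

text \<open>One approximating sequence yields both closures: \<open>H10\<close> for testing the
  equation, and \<open>H1_closure\<close> for the boundary values of the limit.\<close>

lemma boundary:
 "AE t in lborel. 0 < t --> t < T --> H10 (%x. uu (t, x) - v0 x) (%x. gg (t, x) - g0 x)
  \<and> H1_closure (%x. uu (t, x) - v0 x) (%x. gg (t, x) - g0 x)"
proof -
 have "AE t in lebesgue_on {0<..<T}. (%x. u (t, x) - u0 x) \<in> sobolev1_0 unit_ball"
  using GL by (simp add: GLHF_def attains_data_def)
 then have "AE t in lborel. t \<in> {0<..<T} --> (%x. u (t, x) - u0 x) \<in> sobolev1_0 unit_ball"
  by (subst (asm) AE_lebesgue_on_iff) auto
 then show ?thesis
 proof eventually_elim
  case (elim t)
  show ?case
  proof (intro impI)
   assume t: "0 < t" "t < T"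
   let ?B = "lebesgue_on (unit_ball :: (real ^ 'd) set)"
   let ?f = "%x. uu (t, x) - v0 x" and ?g = "%x. gg (t, x) - g0 x"
   have uw: "has_weak_deriv unit_ball (axis i 1) (%x. u (t, x) - u0 x) (%x. ?g x $ i)" for i
   proof -
    have "has_weak_deriv unit_ball (axis i 1) (%x. u (t, x)) (%x. gg (t, x) $ i)"
     by (rule has_weak_deriv_cong[OF has_weak_deriv_Ck[OF open_ball slice_C1(1)[OF t]]])
       (auto simp: axis_in_Basis_iff slice_C1(2)[OF t])
    from has_weak_deriv_diff[OF open_ball this v0(6)] show ?thesis by simp
   qed
   \<comment> \<open>\<open>sobolev1_0_D\<close> indexes derivatives by basis vectors, whereas
     gradients are indexed by coordinates; \<open>THE\<close> translates, by injectivity of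
     \<open>axis\<close>.\<close>
   define G where "G e x = ?g x $ (THE i. e = axis i 1)" for e :: "real ^ 'd" and x
   have Ga: "G (axis i 1) = (%x. ?g x $ i)" for i by (simp add: G_def fun_eq_iff axis_eq_axis)
   have wG: "has_weak_deriv unit_ball e (%x. u (t, x) - u0 x) (G e)" if "e \<in> Basis" for e
    using uw that by (auto simp: Basis_axis Ga)
   from elim t have "(%x. u (t, x) - u0 x) \<in> sobolev1_0 unit_ball" by simp
   note D = sobolev1_0_D[OF open_ball this wG]
   obtain phi where phi: "\<And>n. phi n \<in> test_functions unit_ball" "(%n. l2n ?B (%x. phi n x - (u (t, x) - u0 x))) ----> 0"
    "\<And>e. e \<in> Basis ==> (%n. l2n ?B (%x. pderiv_dir e (phi n) x - G e x)) ----> 0"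
    using D(3) by blast
   note c = test_functions_C1c[OF phi(1)]
   have um: "uu \<in> BM" "gg \<in> BM"
    unfolding uu_def[abs_def] gg_def[abs_def] using zero_ext_measurable(1) continuous_parts by auto
   have vm: "v0 \<in> BM" "g0 \<in> BM" using sq_int_measurable[OF v0(1)] sq_int_measurable[OF v0(2)] by auto
   have fm: "?f \<in> BM" "?g \<in> BM"
    using borel_measurable_pairI[OF um(1), of "%x. t" borel "%x. x"] borel_measurable_pairI[OF um(2), of "%x. t" borel "%x. x"] vm by auto
   have nth: "(%y :: 'b ^ 'd. y $ i) \<in> BM" for i
    by (intro borel_measurable_continuous_onI continuous_intros)
   have gm: "(%x. ?g x $ i) \<in> BM" for i by (rule measurable_compose[OF fm(2) nth])
   have out: "?f x = 0" "?g x = 0" if "x \<notin> unit_ball" for x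
    using that v0(3,4) by (auto simp: uu_def gg_def cylinder_def)
   have B: "unit_ball \<in> sets (borel :: (real ^ 'd) measure)" by simp
   have ae: "AE x in ?B. u (t, x) - u0 x = ?f x"
    using v0(5) AE_space[of ?B] by eventually_elim (use t in "auto simp: uu_def cylinder_def")
   have sf: "sqL ?f" using lebesgue_on_transfer(2)[OF B fm(1) out(1) ae] D(1) by blast
   have sgi: "sqL (%x. ?g x $ i)" for i
    using lebesgue_on_transfer(2)[OF B gm, of i "%x. ?g x $ i"] out(2) D(2)[of "axis i 1"] by (auto simp: Ga axis_in_Basis_iff)
   have sg: "sqL ?g" using sq_int_vec[where f = "%i x. ?g x $ i", OF sgi] unfolding vec_lambda_eta .
   have pz: "phi n x = 0" "pderiv_dir v (phi n) x = 0" if "x \<notin> unit_ball" for n x v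
   proof -
    obtain K where "K \<subseteq> unit_ball" "\<And>x. x \<notin> K ==> phi n x = 0" "\<And>x v. x \<notin> K ==> pderiv_dir v (phi n) x = 0"
     by (rule C1c_support[OF c[of n]], rule that)
    then show "phi n x = 0" "pderiv_dir v (phi n) x = 0" using that by blast+
   qed
   have l1: "(%n. nrm (%x. phi n x - ?f x)) ----> 0"
   proof -
    have "l2n ?B (%x. phi n x - (u (t, x) - u0 x)) = nrm (%x. phi n x - ?f x)" for n
    proof (rule lebesgue_on_transfer(3)[OF B])
     show "(%x. phi n x - ?f x) \<in> BM" using C1c_measurable(1)[OF c] fm(1) by measurable
     show "AE x in ?B. phi n x - (u (t, x) - u0 x) = phi n x - ?f x" using ae by eventually_elim simp
    qed (simp add: pz out)
    then show ?thesis using phi(2) by simp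
   qed
   have l2: "(%n. nrm (%x. grad (phi n) x - ?g x)) ----> 0"
   proof (rule l2n_vec_tendsto)
    show "sqL (%x. grad (phi n) x - ?g x)" for n by (rule sq_int_diff[OF C1c_grad_sq_int[OF c] sg])
    fix i
    have "l2n ?B (%x. pderiv_dir (axis i 1) (phi n) x - ?g x $ i) = nrm (%x. (grad (phi n) x - ?g x) $ i)" for n
    proof (rule lebesgue_on_transfer(3)[OF B])
     show "(%x. (grad (phi n) x - ?g x) $ i) \<in> BM"
      using C1c_measurable(2)[OF c] gm by (simp add: grad_def)
    qed (use out(2) in "auto simp: pz grad_def")
    then show "(%n. nrm (%x. (grad (phi n) x - ?g x) $ i)) ----> 0"
     using phi(3)[of "axis i 1"] by (simp add: Ga axis_in_Basis_iff)
   qed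
   have "H1_closure ?f ?g" unfolding H1_closure_def
   proof (intro conjI allI impI sf sg)
    fix eps :: real assume "eps > 0"
    then have "\<forall>\<^sub>F n in sequentially. nrm (%x. phi n x - ?f x) < eps \<and> nrm (%x. grad (phi n) x - ?g x) < eps"
     using order_tendstoD(2)[OF l1] order_tendstoD(2)[OF l2] by (intro eventually_conj) auto
    then obtain n where "nrm (%x. phi n x - ?f x) < eps \<and> nrm (%x. grad (phi n) x - ?g x) < eps"
     using eventually_happens'[OF sequentially_bot] by blast
    then show "\<exists>phi\<in>test_functions unit_ball. nrm (%x. phi x - ?f x) \<le> eps \<and> nrm (%x. grad phi x - ?g x) \<le> eps"
     using phi(1) less_imp_le by blast
   qed
   moreover have "H10 ?f ?g" unfolding H10_def using sf sg c l1 l2 by blast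
   ultimately show "H10 ?f ?g \<and> H1_closure ?f ?g" by blast
  qed
 qed
qed

lemma initial_condition:
 "((%t. nrm (%x. uu (t, x) - v0 x)) \<longlongrightarrow> 0) (at_right 0)"
 "\<forall>\<^sub>F t in at_right 0. sqL (%x. uu (t, x) - v0 x)"
proof -
 let ?B = "lebesgue_on (unit_ball :: (real ^ 'd) set)"
 have A: "\<forall>\<^sub>F t in at_right 0. sq_int ?B (%x. u (t, x) - u0 x)" "((%t. l2n ?B (%x. u (t, x) - u0 x)) \<longlongrightarrow> 0) (at_right 0)"
  using GL by (auto simp: GLHF_def attains_data_def tendsto_L2_def L2_iff L2_norm_eq)
 have ev: "\<forall>\<^sub>F t in at_right 0. 0 < t \<and> t < T" unfolding eventually_at_right_field using T by auto
 have um: "uu \<in> BM"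
  unfolding uu_def[abs_def] by (rule zero_ext_measurable(1)[OF continuous_parts(1)])
 have vm: "v0 \<in> BM" using sq_int_measurable[OF v0(1)] by simp
 have fm: "(%x. uu (t, x) - v0 x) \<in> BM" for t
  using borel_measurable_pairI[OF um, of "%x. t" borel "%x. x"] vm by simp
 have out: "uu (t, x) - v0 x = 0" if "x \<notin> unit_ball" for t x using that v0(3) by (auto simp: uu_def cylinder_def)
 have ae: "AE x in ?B. u (t, x) - u0 x = uu (t, x) - v0 x" if "0 < t" "t < T" for t
  using v0(5) AE_space[of ?B] by eventually_elim (use that in "auto simp: uu_def cylinder_def")
 have e: "\<forall>\<^sub>F t in at_right 0. sqL (%x. uu (t, x) - v0 x)
  \<and> l2n ?B (%x. u (t, x) - u0 x) = nrm (%x. uu (t, x) - v0 x)"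
  using A(1) ev
 proof eventually_elim
  case (elim t)
  have B: "unit_ball \<in> sets (borel :: (real ^ 'd) measure)" by simp
  show ?case using lebesgue_on_transfer(2,3)[OF B fm out ae] elim by blast
 qed
 show "\<forall>\<^sub>F t in at_right 0. sqL (%x. uu (t, x) - v0 x)" using e by eventually_elim simp
 show "((%t. nrm (%x. uu (t, x) - v0 x)) \<longlongrightarrow> 0) (at_right 0)"
  by (rule Lim_transform_eventually[OF A(2)]) (use e in eventually_elim, simp)
qed

lemma pp_eq: "z \<in> Q ==> pp z = pderiv_dir (1, 0) uu z" and gg_eq: "z \<in> Q ==> gg z $ i = pderiv_dir (0, axis i 1) uu z"
 using pderiv_dir_cong_open(1)[OF cylinder_open, of z T uu u] by (auto simp: uu_def pp_def gg_def)

lemma uu_C1: "Ck_on k Q uu"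
 by (subst Ck_on_cong[OF cylinder_open, of T uu u]) (auto simp: uu_def Ck_u)

text \<open>The hypotheses on the coefficient hold because \<open>kappa\<close> is nonnegative at
  positive times and increasing in time, and \<open>lam >= 1\<close>. The bound \<open>Mf\<close>
  remains existential, since nothing later depends on its value.\<close>

lemma gl_flow: "\<exists>Mf. gl_flow T Mf uu pp ff gg v0 g0 chi (%t. lam powr (1 - kappa t)) lam"
proof -
 obtain M where M: "\<And>z. norm (ff z) \<le> M" using ff_bounded by blast
 have QB: "Q \<in> sets borel" by (rule borel_open[OF cylinder_open])
 have sq: "sqL (%z. ind Q z *R h z)" if "h \<in> L2 Q" "continuous_on Q h" for h :: "'d spacetime => 'b"
 proof -
  note m = zero_ext_measurable(1)[OF that(2)]
  have "\<forall>z. z \<notin> Q --> ind Q z *R h z = 0" by simp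
  note o = lebesgue_on_borel(1)[OF QB m this] sq_int_lebesgue_on_borel(1)[OF QB m this]
  have "sq_int (lebesgue_on Q) (%z. ind Q z *R h z)"
   by (rule sq_int_cong_AE[OF that(1)[unfolded L2_iff] o(1)]) (auto intro!: AE_I2)
  then show ?thesis using o(2) by simp
 qed
 show ?thesis
 proof (intro exI[of _ M] gl_flow.intro heat_flow.intro gl_flow_axioms.intro)
  show "uu \<in> BM" "pp \<in> BM" "gg \<in> BM" "ff \<in> BM"
   unfolding uu_def[abs_def] pp_def[abs_def] gg_def[abs_def] ff_zero_ext using zero_ext_measurable(1) continuous_parts dt_continuous by blast+
  show "continuous_on Q uu" "continuous_on Q pp" "continuous_on Q gg" "continuous_on Q ff"
   unfolding uu_def[abs_def] pp_def[abs_def] gg_def[abs_def] ff_zero_ext using zero_ext_measurable(2) continuous_parts dt_continuous by blast+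
  show "((%s. uu (s, x)) has_vector_derivative pp (t, x)) (at t)" if z: "(t, x) \<in> Q" for t x
  proof -
   have d: "(uu has_derivative (%v. pderiv_dir v uu (t, x))) (at (t, x))"
    by (rule pderiv_dir_has_derivative) (use uu_C1[of "Suc 0"] z in auto)
   have "((%s. (s, x)) has_derivative (%h. (h, 0))) (at t)" by (auto intro!: derivative_eq_intros)
   then have "((%s. uu (s, x)) has_derivative (%h. pderiv_dir (h, 0) uu (t, x))) (at t)"
    by (rule has_derivative_compose) (rule d)
   moreover have "pderiv_dir (h, 0) uu (t, x) = h *R pp (t, x)" for h
    using linear_cmul[OF has_derivative_linear[OF d], of h "(1, 0)"] by (simp add: pp_eq[OF z])
   ultimately show ?thesis by (simp add: has_vector_derivative_def)
  qed
  show "(LBINT x. pp (t, x) \<bullet> psi x + gg (t, x) \<bullet> grad psi x + ff (t, x) \<bullet> psi x) = 0"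
   if "0 < t" "t < T" "psi \<in> C1c unit_ball" for t psi by (rule weak_form[OF that])
  show "sqL uu" unfolding uu_def[abs_def] by (rule sq) (use GL continuous_parts in "auto simp: GLHF_def")
  have "pderiv_dir (0, axis i 1) u \<in> L2 Q" for i using GL by (simp add: GLHF_def Basis_axis)
  then have "sqL (%z. \<chi> i. ind Q z *R pderiv_dir (0, axis i 1) u z)"
   by (intro sq_int_vec sq Ck_dx[of 0, unfolded Ck_on.simps])
  moreover have "gg = (%z. \<chi> i. ind Q z *R pderiv_dir (0, axis i 1) u z)" by (auto simp: gg_def vec_eq_iff)
  ultimately show "sqL gg" by simp
  show "AE t in lborel. 0 < t --> t < T --> H10 (%x. uu (t, x) - v0 x) (%x. gg (t, x) - g0 x)"
   using boundary by eventually_elim blast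
  show "continuous_on {0<..<T} (%t. lam powr (1 - kappa t))"
   unfolding kappa_def using lam_ge by (intro continuous_intros) auto
  show "lam powr (1 - kappa t) \<le> lam" if "0 < t" for t
   using powr_mono[of "1 - kappa t" 1 lam] kappa_mono[of 0 t] that lam_ge by (simp add: kappa_def)
  show "lam powr (1 - kappa t) \<le> lam powr (1 - kappa s)" if "s \<le> t" for s t
   using powr_mono[of "1 - kappa t" "1 - kappa s" lam] kappa_mono[OF that] lam_ge by simp
  show "AE x in lborel. x \<in> unit_ball --> norm (v0 x) = 1"
  proof -
   have "AE x in lebesgue_on unit_ball. norm (v0 x) = 1"
    using v0(5) sphere[unfolded sphere_valued_def] by eventually_elim simp
   then show ?thesis by (subst (asm) AE_lebesgue_on_iff) auto
  qed
  show "Ck_on (Suc 0) unit_ball (%x. uu (t, x))" if "0 < t" "t < T" for t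
   by (subst Ck_on_cong[OF open_ball, of 0 1 _ "%x. u (t, x)"]) (use slice_C1(1)[OF that] that in "auto simp: uu_def cylinder_def simp del: Ck_on.simps")
  show "grad (%x. uu (t, x)) x = gg (t, x)" if "0 < t" "t < T" "x \<in> unit_ball" for t x
   using pderiv_dir_cong_open(1)[OF open_ball that(3), of "%x. uu (t, x)" "%x. u (t, x)"] slice_C1(2)[OF that] that
   by (simp add: grad_def vec_eq_iff uu_def cylinder_def)
  show "ff z = (lam powr (1 - kappa (fst z)) * deriv chi (((norm (uu z))^2 - 1)^2) * ((norm (uu z))^2 - 1)) *R uu z" if "z \<in> Q" for z
   using that by (simp add: ff_def uu_def)
 qed (use T M chi v0(1-3) initial_condition in "auto simp: uu_def pp_def gg_def ff_def")
qed

end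

section \<open>The limit is a weakly harmonic heat flow with the given data\<close>

context gl_combo begin

text \<open>The initial condition is a limit over all small times, whereas the slices of
  \<open>v\<close> are controlled only for almost every time. So \<open>v\<close> is replaced by a
  map \<open>v'\<close> that agrees with it almost everywhere; weak derivatives and integrals on the
  cylinder do not notice the change.\<close>

lemma WHHF_exists:
 assumes b: "\<And>k. AE t in lborel. 0 < t --> t < T --> H1_closure (%x. u k (t, x) - v0 x) (%x. g k (t, x) - g0 x)"
  and u0: "AE x in lebesgue_on unit_ball. u0 x = v0 x" "\<And>i. has_weak_deriv unit_ball (axis i 1) u0 (%x. g0 x $ i)"
   "\<And>x. x \<notin> unit_ball ==> g0 x = 0"
 shows "\<exists>v'. WHHF T u0 v' \<and> (AE z in lebesgue_on (cylinder T). v' z = v z)"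
proof -
 let ?Q = "cylinder T :: 'd spacetime set" and ?B = "unit_ball :: (real ^ 'd) set"
 have B: "?B \<in> sets borel" by simp
 define G where "G t \<longleftrightarrow> sqL (%x. v (t, x)) \<and> sqL (%x. wx (t, x))
  \<and> (\<forall>i. has_weak_deriv unit_ball (axis i 1) (%x. v (t, x)) (%x. wx (t, x) $ i))
  \<and> nrm (%x. wx (t, x)) \<le> sqrt K0 \<and> nrm (%x. v (t, x) - v0 x) \<le> sqrt (t * K0)
  \<and> H1_closure (%x. v (t, x) - v0 x) (%x. wx (t, x) - g0 x)" for t
 have G: "AE t in lborel. 0 < t --> t < T --> G t" unfolding G_def by (rule slice_properties[OF b])
 have Gl: "AE t in lebesgue_on {0<..<T}. 0 < t \<and> t < T \<and> G t"
  by (subst AE_lebesgue_on_iff, simp) (use G in eventually_elim, auto)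
 \<comment> \<open>At the exceptional times the slice is set to the data, so that its distance from
   the data is 0.\<close>
 define v' where "v' z = (if G (fst z) then v z else u0 (snd z))" for z
 have ae: "AE z in lebesgue_on ?Q. v' z = v z"
  by (subst AE_lebesgue_on_iff[OF Q_borel]) (use AE_fst_lborel[OF G] in eventually_elim, auto simp: v'_def cylinder_def)
 have vQ: "v z = 0" "wt z = 0" "wx z = 0" if "z \<notin> ?Q" for z using that v(2) w_out by auto
 note vm = lebesgue_on_transfer[OF Q_borel v(1) vQ(1) ae]
 have wm: "wt \<in> BM" "wx \<in> BM"
  using sq_int_measurable[OF w(1)] sq_int_measurable[OF w(2)] by auto
 have wxm: "(%z. wx z $ i) \<in> BM" for i using sq_int_measurable[OF sq_int_vec_nth[OF w(2), of i]] by simp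
 have on: "sq_int (lebesgue_on ?Q) h" if "sqL h" "\<And>z. z \<notin> ?Q ==> h z = 0" for h :: "'d spacetime => 'b"
  using lebesgue_on_transfer(2)[OF Q_borel _ that(2), where k = h] sq_int_measurable[OF that(1)] that(1) by auto
 have onv: "sq_int (lebesgue_on ?Q) v" "sq_int (lebesgue_on ?Q) wt" "sq_int (lebesgue_on ?Q) (%z. wx z $ i)" for i
  using on[OF sq_v vQ(1)] on[OF w(1) vQ(2)] on[OF sq_int_vec_nth[OF w(2), of i]] vQ(3) by auto
 have v'2: "sq_int (lebesgue_on ?Q) v'" using vm(2) sq_v by blast
 have ae': "AE z in lebesgue_on ?Q. v z = v' z" using ae by eventually_elim simp
 have wd': "has_weak_deriv ?Q (1, 0) v' wt" "has_weak_deriv ?Q (0, axis i 1) v' (%z. wx z $ i)" for i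
  by (rule has_weak_deriv_AE[OF cylinder_open weak_deriv_v(1) onv(1,2) v'2 onv(2) ae'], simp)
    (rule has_weak_deriv_AE[OF cylinder_open weak_deriv_v(2) onv(1,3) v'2 onv(3) ae'], simp)
 have E: "K0 \<ge> 0" by simp
 have vB: "v (t, x) = 0" "wx (t, x) = 0" if "x \<notin> ?B" for t x using that vQ[of "(t, x)"] by (auto simp: cylinder_def)
 have v0: "sqL v0" "sqL g0" "\<And>x. x \<notin> ?B ==> v0 x = 0" using heat_flow.v0[OF hf] by auto
 have onB: "sq_int (lebesgue_on ?B) h" "l2n (lebesgue_on ?B) h = nrm h"
  if "sqL h" "\<And>x. x \<notin> ?B ==> h x = 0" for h :: "real ^ 'd => 'b"
 proof -
  have hm: "h \<in> BM" using sq_int_measurable[OF that(1)] by simp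
  have "AE x in lebesgue_on ?B. h x = h x" by simp
  note L = lebesgue_on_transfer[OF B hm that(2) this]
  show "sq_int (lebesgue_on ?B) h" using L(2) that(1) by blast
  show "l2n (lebesgue_on ?B) h = nrm h" by (rule L(3))
 qed
 have aeB: "AE x in lebesgue_on ?B. v (t, x) - u0 x = v (t, x) - v0 x" for t using u0(1) by eventually_elim simp
 have vt: "(%x. v (t, x)) \<in> BM" for t using borel_measurable_pairI[OF v(1), of "%x. t" borel "%x. x"] by simp
 have vtm: "(%x. v (t, x) - v0 x) \<in> BM" for t
  using vt[of t] sq_int_measurable[OF v0(1)] by simp
 have vto: "v (t, x) - v0 x = 0" if "x \<notin> ?B" for t x using that vB v0(3) by simp
 note vu = lebesgue_on_transfer[OF B vtm vto aeB]
 have slice: "v' (t, x) = v (t, x)" if "G t" for t x using that by (simp add: v'_def)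
 have V: "v' \<in> V_sphere T"
  unfolding V_sphere_def
 proof (intro CollectI conjI exI)
  show "v' \<in> borel_measurable (lebesgue_on ?Q)" by (rule vm(1))
  show "v' \<in> L2 ?Q" using v'2 by (simp add: L2_iff)
  show "has_weak_deriv ?Q (1, 0) v' wt" by (rule wd')
  show "wt \<in> L2 ?Q" using onv(2) by (simp add: L2_iff)
  show "AE t in lebesgue_on {0<..<T}. (%x. v' (t, x)) \<in> sobolev 1 ?B \<and> sphere_valued ?B (%x. v' (t, x))
   \<and> H1_norm ?B (%x. v' (t, x)) \<le> sqrt (measure lborel ?B + K0)"
   using Gl
  proof eventually_elim
   case (elim t)
   then have g: "sqL (%x. v (t, x))" "sqL (%x. wx (t, x))" "nrm (%x. wx (t, x)) \<le> sqrt K0"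
    "\<And>i. has_weak_deriv ?B (axis i 1) (%x. v (t, x)) (%x. wx (t, x) $ i)" by (auto simp: G_def)
   have gi: "sqL (%x. wx (t, x) $ i)" for i by (rule sq_int_vec_nth[OF g(2)])
   have n1: "norm (v (t, x)) = 1" if "x \<in> ?B" for x using v(3)[of "(t, x)"] elim that by (simp add: cylinder_def)
   have b1: "sq_int (lebesgue_on ?B) (%x. v (t, x))" "l2n (lebesgue_on ?B) (%x. v (t, x)) = nrm (%x. v (t, x))"
    using onB[OF g(1)] vB by auto
   have b2: "sq_int (lebesgue_on ?B) (%x. wx (t, x) $ i)" "l2n (lebesgue_on ?B) (%x. wx (t, x) $ i) = nrm (%x. wx (t, x) $ i)" for i
    using onB[OF gi] vB by auto
   have wG: "has_weak_deriv ?B e (%x. v (t, x)) (%x. wx (t, x) $ (THE i. e = axis i 1))"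
    "sq_int (lebesgue_on ?B) (%x. wx (t, x) $ (THE i. e = axis i 1))" if "e \<in> Basis" for e
    using g(4) b2(1) that by (auto simp: Basis_axis axis_eq_axis)
   have "(norm (v (t, x)))^2 = ind ?B x" for x using n1[of x] vB(1)[of x t] by (auto simp: indicator_def)
   then have l1: "(nrm (%x. v (t, x)))^2 = measure lborel ?B" unfolding l2n_sq by simp
   have l2: "(\<Sum>i\<in>UNIV. (nrm (%x. wx (t, x) $ i))^2) = (nrm (%x. wx (t, x)))^2"
    unfolding l2n_sq norm_vec_sq by (rule integral_sum[symmetric]) (rule sq_int_integrable[OF gi])
   also have "\<dots> \<le> K0" using power_mono[OF g(3), of 2] by simp
   finally have "H1_norm ?B (%x. v (t, x)) \<le> sqrt (measure lborel ?B + K0)"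
    by (subst H1_norm_eq[OF open_ball wG]) (auto simp: sum_Basis_axis axis_eq_axis b1 b2 l1)
   moreover have "sphere_valued ?B (%x. v (t, x))" unfolding sphere_valued_def using n1 by (intro AE_I2) simp
   moreover have "(%x. v (t, x)) \<in> sobolev 1 ?B" using b1(1) wG by (auto simp: L2_iff One_nat_def)
   ultimately show ?case using slice elim by simp
  qed
 qed
 have D: "attains_data T u0 v'"
  unfolding attains_data_def
 proof
  show "AE t in lebesgue_on {0<..<T}. (%x. v' (t, x) - u0 x) \<in> sobolev1_0 ?B"
   using Gl
  proof eventually_elim
   case (elim t)
   then have g: "\<And>i. has_weak_deriv ?B (axis i 1) (%x. v (t, x)) (%x. wx (t, x) $ i)"
    and H: "H1_closure (%x. v (t, x) - v0 x) (%x. wx (t, x) - g0 x)" by (auto simp: G_def)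
   have s: "sqL (%x. v (t, x) - v0 x)" "sqL (%x. wx (t, x) - g0 x)" using H by (auto simp: H1_closure_def)
   have "\<forall>n. \<exists>phi. phi \<in> test_functions ?B \<and> nrm (%x. phi x - (v (t, x) - v0 x)) \<le> 1 / real (Suc n)
    \<and> nrm (%x. grad phi x - (wx (t, x) - g0 x)) \<le> 1 / real (Suc n)"
    using H unfolding H1_closure_def by (auto simp: Bex_def)
   from choice[OF this] obtain phi where phi: "\<And>n. phi n \<in> test_functions ?B"
    "\<And>n. nrm (%x. phi n x - (v (t, x) - v0 x)) \<le> 1 / real (Suc n)"
    "\<And>n. nrm (%x. grad (phi n) x - (wx (t, x) - g0 x)) \<le> 1 / real (Suc n)" by blast
   note c = test_functions_C1c[OF phi(1)]
   have inv: "(%n. 1 / real (Suc n)) ----> 0" using LIMSEQ_inverse_real_of_nat by (simp add: inverse_eq_divide)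
   have pz: "phi n x = 0" "pderiv_dir v (phi n) x = 0" if "x \<notin> ?B" for n x v
   proof -
    obtain K where "K \<subseteq> ?B" "\<And>x. x \<notin> K ==> phi n x = 0" "\<And>x v. x \<notin> K ==> pderiv_dir v (phi n) x = 0"
     by (rule C1c_support[OF c[of n]], rule that)
    then show "phi n x = 0" "pderiv_dir v (phi n) x = 0" using that by blast+
   qed
   define F where "F e x = (wx (t, x) - g0 x) $ (THE i. e = axis i 1)" for e :: "real ^ 'd" and x
   have Fa: "F (axis i 1) = (%x. wx (t, x) $ i - g0 x $ i)" for i by (simp add: F_def fun_eq_iff axis_eq_axis)
   have si: "sqL (%x. wx (t, x) $ i - g0 x $ i)" for i using sq_int_vec_nth[OF s(2), of i] by simp
   have "(%x. v (t, x) - u0 x) \<in> sobolev1_0 ?B"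
   proof (rule sobolev1_0_I[OF open_ball, where g = F])
    show "has_weak_deriv ?B e (%x. v (t, x) - u0 x) (F e)" if "e \<in> Basis" for e
     using has_weak_deriv_diff[OF open_ball g u0(2)] that by (auto simp: Basis_axis Fa)
    show "sq_int (lebesgue_on ?B) (%x. v (t, x) - u0 x)" using vu(2) s(1) by blast
    show "sq_int (lebesgue_on ?B) (F e)" if "e \<in> Basis" for e
     using that onB(1)[OF si] vB(2) u0(3) by (auto simp: Basis_axis Fa)
    show "phi n \<in> test_functions ?B" for n by (rule phi)
    show "(%n. l2n (lebesgue_on ?B) (%x. phi n x - (v (t, x) - u0 x))) ----> 0"
    proof (rule Lim_null_comparison[OF always_eventually[OF allI] inv])
     fix n
     have "l2n (lebesgue_on ?B) (%x. phi n x - (v (t, x) - u0 x)) = nrm (%x. phi n x - (v (t, x) - v0 x))"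
     proof (rule lebesgue_on_transfer(3)[OF B])
      show "(%x. phi n x - (v (t, x) - v0 x)) \<in> BM" using C1c_measurable(1)[OF c] vtm by measurable
      show "AE x in lebesgue_on ?B. phi n x - (v (t, x) - u0 x) = phi n x - (v (t, x) - v0 x)" using aeB by eventually_elim simp
     qed (simp add: pz vto)
     then show "norm (l2n (lebesgue_on ?B) (%x. phi n x - (v (t, x) - u0 x))) \<le> 1 / real (Suc n)" using phi(2)[of n] by simp
    qed
    show "(%n. l2n (lebesgue_on ?B) (%x. pderiv_dir e (phi n) x - F e x)) ----> 0" if "e \<in> Basis" for e
    proof (rule Lim_null_comparison[OF always_eventually[OF allI] inv])
     fix n
     obtain i where e: "e = axis i 1" using \<open>e \<in> Basis\<close> by (auto simp: Basis_axis)
     have gs: "sqL (%x. grad (phi n) x - (wx (t, x) - g0 x))" by (rule sq_int_diff[OF C1c_grad_sq_int[OF c] s(2)])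
     have "l2n (lebesgue_on ?B) (%x. pderiv_dir e (phi n) x - F e x) = nrm (%x. (grad (phi n) x - (wx (t, x) - g0 x)) $ i)"
      by (rule lebesgue_on_transfer(3)[OF B]) (use sq_int_measurable[OF sq_int_vec_nth[OF gs, of i]] vB(2) u0(3) pz in "auto simp: e Fa grad_def")
     also have "\<dots> \<le> 1 * nrm (%x. grad (phi n) x - (wx (t, x) - g0 x))"
      by (rule l2n_mono_AE[OF gs]) (use sq_int_measurable[OF sq_int_vec_nth[OF gs, of i]] in "auto intro!: AE_I2 Finite_Cartesian_Product.norm_nth_le simp del: vector_minus_component")
     finally show "norm (l2n (lebesgue_on ?B) (%x. pderiv_dir e (phi n) x - F e x)) \<le> 1 / real (Suc n)" using phi(3)[of n] by simp
    qed
   qed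
   then show ?case using slice elim by simp
  qed
  \<comment> \<open>Now for every positive time: by the uniform rate where \<open>G\<close> holds,
    and trivially at the other times.\<close>
  have st: "sq_int (lebesgue_on ?B) (%x. v' (t, x) - u0 x) \<and> l2n (lebesgue_on ?B) (%x. v' (t, x) - u0 x) \<le> sqrt (t * K0)" if t: "0 < t" for t
  proof (cases "G t")
   case True
   then have "sqL (%x. v (t, x) - v0 x)" "nrm (%x. v (t, x) - v0 x) \<le> sqrt (t * K0)"
    by (auto simp: G_def H1_closure_def)
   then show ?thesis using vu(2,3) slice[OF True] by simp
  qed (use t in "simp add: v'_def l2n_def")
  have t0: "\<forall>\<^sub>F t in at_right (0 :: real). 0 < t" by (simp add: eventually_at_filter)
  show "tendsto_L2 ?B (%t x. v' (t, x)) u0 (at_right 0)"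
   unfolding tendsto_L2_def L2_iff L2_norm_eq
  proof
   show "\<forall>\<^sub>F t in at_right 0. sq_int (lebesgue_on ?B) (%x. v' (t, x) - u0 x)" using t0 by eventually_elim (use st in blast)
   show "((%t. l2n (lebesgue_on ?B) (%x. v' (t, x) - u0 x)) \<longlongrightarrow> 0) (at_right 0)"
   proof (rule Lim_null_comparison)
    show "\<forall>\<^sub>F t in at_right 0. norm (l2n (lebesgue_on ?B) (%x. v' (t, x) - u0 x)) \<le> sqrt (t * K0)"
     using t0 by eventually_elim (use st in simp)
    have "((%t. sqrt (t * K0)) \<longlongrightarrow> sqrt (0 * K0)) (at_right 0)" by (intro tendsto_intros)
    then show "((%t. sqrt (t * K0)) \<longlongrightarrow> 0) (at_right 0)" by simp
   qed
  qed
 qed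
 have Eq: "integral\<^sup>L (lebesgue_on ?Q) (%z. weak_deriv ?Q (1, 0) v' z \<bullet> phi z
   + (\<Sum>e\<in>Basis. weak_deriv ?Q (0, e) v' z \<bullet> pderiv_dir (0, e) phi z)
   - (v' z \<bullet> phi z) * (\<Sum>e\<in>Basis. (norm (weak_deriv ?Q (0, e) v' z))^2)) = 0" (is "integral\<^sup>L _ ?I = 0")
  if phi: "phi \<in> test_functions ?Q" for phi :: "'d spacetime => 'b"
 proof -
  note c = test_functions_C1c[OF phi]
  let ?F = "%z. wt z \<bullet> phi z + (\<Sum>i\<in>UNIV. wx z $ i \<bullet> pderiv_dir (0, axis i 1) phi z) - (v z \<bullet> phi z) * (\<Sum>i\<in>UNIV. (norm (wx z $ i))^2)"
  have Fm: "?F \<in> BM"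
  proof -
   note [measurable] = wm(1) wxm v(1) C1c_measurable[OF c]
   show ?thesis by measurable
  qed
  have Fo: "?F z = 0" if "z \<notin> ?Q" for z using vQ[OF that] by simp
  have "AE z in lebesgue_on ?Q. \<forall>i. weak_deriv ?Q (0, axis i 1) v' z = wx z $ i"
   unfolding AE_all_countable using weak_deriv_eq_AE(2)[OF cylinder_open wd'(2)] by blast
  then have aeI: "AE z in lebesgue_on ?Q. ?I z = ?F z"
   using weak_deriv_eq_AE(2)[OF cylinder_open wd'(1)] ae by eventually_elim (simp add: sum_Basis_axis)
  have "integral\<^sup>L (lebesgue_on ?Q) ?I = integral\<^sup>L (lebesgue_on ?Q) ?F"
  proof (rule integral_cong_AE)
   show Fl: "?F \<in> borel_measurable (lebesgue_on ?Q)" by (rule borel_measurable_lebesgue_on[OF Fm])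
   show "?I \<in> borel_measurable (lebesgue_on ?Q)" by (rule lebesgue_on_measurable_AE[OF Q_borel Fl aeI])
  qed (rule aeI)
  also have "\<dots> = integral\<^sup>L lborel ?F" by (rule lebesgue_on_borel(3)[OF Q_borel Fm]) (use Fo in blast)
  also have "\<dots> = 0" by (rule limit_equation[OF c])
  finally show ?thesis .
 qed
 have "WHHF T u0 v'" unfolding WHHF_def using V D Eq by blast
 then show ?thesis using ae by blast
qed

end

theorem theorem3p2:
  fixes d D :: nat and T \<delta>\<^sub>0 :: real and chi :: "real \<Rightarrow> real"
    and u\<^sub>0 :: "real ^ 'd \<Rightarrow> real ^ 'm"
    and u :: "real \<Rightarrow> real \<times> (real ^ 'd) \<Rightarrow> real ^ 'm"
    and \<Lambda> :: "nat \<Rightarrow> real"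
  assumes "d \<ge> 2" and "CARD('d) = d"
    and "D \<ge> 2" and "CARD('m) = D + 1"
    and "T > 0"
    and "cutoff chi"
    and "0 < \<delta>\<^sub>0" and "\<delta>\<^sub>0 < 1"
    and "u\<^sub>0 \<in> sobolev 1 unit_ball" and "sphere_valued unit_ball u\<^sub>0"
    and "u\<^sub>0 \<in> sobolev 2 (unit_ball - cball 0 (1 - \<delta>\<^sub>0))"
    and "\<And>lam. lam > 0 \<Longrightarrow> GLHF chi T u\<^sub>0 lam (u lam)"
    and "\<And>k. \<Lambda> k > 0" and "filterlim \<Lambda> at_top sequentially"
  shows "\<exists>r v. strict_mono r \<and> WHHF T u\<^sub>0 v \<and>
           tendsto_L2 (cylinder T) (\<lambda>k. u (\<Lambda> (r k))) v sequentially"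
proof -
 have T: "T > 0" and chi: "cutoff chi" and sph: "sphere_valued unit_ball u\<^sub>0" by fact+
 obtain v0 :: "real ^ 'd => real ^ 'm" and g0 where v0: "sqL v0" "sqL g0"
  "\<forall>x. x \<notin> unit_ball --> v0 x = 0" "\<forall>x. x \<notin> unit_ball --> g0 x = 0"
  "AE x in lebesgue_on unit_ball. u\<^sub>0 x = v0 x" "\<forall>i. has_weak_deriv unit_ball (axis i 1) u\<^sub>0 (%x. g0 x $ i)"
  by (rule initial_data_representative[OF \<open>u\<^sub>0 \<in> sobolev 1 unit_ball\<close>])
 \<comment> \<open>The first indices are skipped so that \<open>lambda >= 1\<close>, on which the
   monotonicity of powers and the lower bound \<open>sqrt lambda\<close> depend. The shift by
   \<open>N\<close> reappears in the subsequence of the conclusion.\<close>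
 obtain N where N: "\<And>k. k \<ge> N ==> 1 \<le> \<Lambda> k"
  using \<open>filterlim \<Lambda> at_top sequentially\<close> unfolding filterlim_at_top eventually_sequentially by blast
 define L where "L k = \<Lambda> (k + N)" for k
 have L1: "1 \<le> L k" for k using N by (simp add: L_def)
 have Ll: "filterlim L at_top sequentially"
  unfolding L_def by (rule filterlim_compose[OF \<open>filterlim \<Lambda> at_top sequentially\<close>]) (simp add: filterlim_add_const_nat_at_top)
 have GL: "GLHF_flow T (L k) chi u\<^sub>0 (u (L k)) v0 g0" for k
  by unfold_locales (use T L1 chi sph v0 assms(12)[of "L k"] less_le_trans[OF zero_less_one L1[of k]] in auto)
 define uk where "uk k = GLHF_flow.uu T (u (L k))" for k
 define pk where "pk k = GLHF_flow.pp T (u (L k))" for k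
 define gk where "gk k = GLHF_flow.gg T (u (L k))" for k
 have uk: "uk k z = ind (cylinder T) z *R u (L k) z" for k z unfolding uk_def by (rule GLHF_flow.uu_def[OF GL])
 have "\<forall>k. \<exists>fk Mf. gl_flow T Mf (uk k) (pk k) fk (gk k) v0 g0 chi (%t. L k powr (1 - kappa t)) (L k)"
  unfolding uk_def pk_def gk_def using GLHF_flow.gl_flow[OF GL] by blast
 then obtain fk Mf where gl: "\<And>k. gl_flow T (Mf k) (uk k) (pk k) (fk k) (gk k) v0 g0 chi (%t. L k powr (1 - kappa t)) (L k)"
  by metis
 have C1: "Ck_on (Suc 0) (cylinder T) (uk k)" for k unfolding uk_def by (rule GLHF_flow.uu_C1[OF GL])
 have dt: "pk k z = pderiv_dir (1, 0) (uk k) z" and dx: "gk k z $ i = pderiv_dir (0, axis i 1) (uk k) z" if "z \<in> cylinder T" for k z i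
  unfolding uk_def pk_def gk_def by (rule GLHF_flow.pp_eq[OF GL that], rule GLHF_flow.gg_eq[OF GL that])
 have bd: "AE t in lborel. 0 < t --> t < T --> H1_closure (%x. uk k (t, x) - v0 x) (%x. gk k (t, x) - g0 x)" for k
  using GLHF_flow.boundary[OF GL[of k]] unfolding uk_def gk_def by eventually_elim blast
 interpret S: gl_seq T v0 g0 chi uk pk fk gk Mf L
  by (rule gl_seq.intro[OF gl Ll L1 C1 dt dx])
 obtain r :: "nat => nat" and v where r: "strict_mono r" and v: "v \<in> BM" "\<forall>z. z \<notin> cylinder T --> v z = 0"
  "\<forall>z. z \<in> cylinder T --> norm (v z) = 1" and lim: "(%k. nrm (%z. uk (r k) z - v z)) ----> 0"
  by (rule S.limit_exists)
 have Lr: "filterlim (%k. L (r k)) at_top sequentially" by (rule filterlim_compose[OF Ll filterlim_subseq[OF r]])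
 interpret R: gl_limit T v0 g0 chi "%k. uk (r k)" "%k. pk (r k)" "%k. fk (r k)" "%k. gk (r k)" "%k. Mf (r k)" "%k. L (r k)" v
  by (intro gl_limit.intro gl_seq.intro[OF gl Lr L1 C1 dt dx] gl_limit_axioms.intro) (use v lim in auto)
 obtain c :: "nat => nat => real" and m :: "nat => nat" and wt wx
  where c: "\<forall>n j. 0 \<le> c n j" "\<forall>n. (\<Sum>j=n..<m n. c n j) = 1" and w: "sqL wt" "sqL wx"
  "\<forall>z. z \<notin> cylinder T --> wt z = 0" "\<forall>z. z \<notin> cylinder T --> wx z = 0"
  "(%n. nrm (%z. (\<Sum>j=n..<m n. c n j *R pk (r j) z) - wt z)) ----> 0"
  "(%n. nrm (%z. (\<Sum>j=n..<m n. c n j *R gk (r j) z) - wx z)) ----> 0"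
  by (rule R.convex_combinations)
 interpret C: gl_combo T v0 g0 chi "%k. uk (r k)" "%k. pk (r k)" "%k. fk (r k)" "%k. gk (r k)" "%k. Mf (r k)" "%k. L (r k)" v c m wt wx
  by (intro gl_combo.intro R.gl_limit_axioms gl_combo_axioms.intro) (use c w in auto)
 obtain v' where W: "WHHF T u\<^sub>0 v'" and ae: "AE z in lebesgue_on (cylinder T). v' z = v z"
  using C.WHHF_exists[OF bd v0(5)] v0(4,6) by blast
 have Q: "cylinder T \<in> sets (borel :: (real \<times> (real ^ 'd)) measure)" by (rule borel_open[OF cylinder_open])
 have t: "sq_int (lebesgue_on (cylinder T)) (%z. u (L (r k)) z - v' z)"
  "l2n (lebesgue_on (cylinder T)) (%z. u (L (r k)) z - v' z) = nrm (%z. uk (r k) z - v z)" for k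
 proof -
  have m: "(%z. uk (r k) z - v z) \<in> BM" using S.meas(1)[of "r k"] v(1) by simp
  have o: "uk (r k) z - v z = 0" if "z \<notin> cylinder T" for z using that v(2)[rule_format, OF that] by (simp add: uk)
  have a: "AE z in lebesgue_on (cylinder T). u (L (r k)) z - v' z = uk (r k) z - v z"
   using ae AE_space[of "lebesgue_on (cylinder T)"] by eventually_elim (simp add: uk)
  show "sq_int (lebesgue_on (cylinder T)) (%z. u (L (r k)) z - v' z)"
   "l2n (lebesgue_on (cylinder T)) (%z. u (L (r k)) z - v' z) = nrm (%z. uk (r k) z - v z)"
   using lebesgue_on_transfer[OF Q m o a] sq_int_diff[OF S.sq(1) R.sq_v] by auto
 qed
 have "tendsto_L2 (cylinder T) (%k. u (\<Lambda> (r k + N))) v' sequentially"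
  unfolding tendsto_L2_def L2_iff L2_norm_eq using t lim by (simp add: L_def)
 moreover have "strict_mono (%k. r k + N)" using r by (simp add: strict_mono_def)
 ultimately show ?thesis using W by blast
qed

end
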